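(* Let $\mathcal C$ be a $BTC^*$ and $\mathcal S\subset\mathcal C$ an even symmetric subcategory all of whose irreducible objects have dimension one; let $K$ be the discrete abelian group of isomorphism classes of irreducible objects of $\mathcal S$ and $G=\hat K=\mathrm{Gal}(\mathcal S)$. Let $\rho\in\mathcal C$ be irreducible, with associated finite groups $L_\rho\subset K_\rho\subset K$. In $\mathcal C\rtimes\mathcal S$ the object $\rho$ decomposes according to $$\rho\cong N_\rho\bigoplus_{\chi\in\widehat{L_\rho}}\rho^\chi,$$ where the $\rho^\chi$, $\chi\in\widehat{L_\rho}$, are irreducible, mutually inequivalent and all occur with the same multiplicity $N_\rho=\sqrt{|K_\rho|/|L_\rho|}$. The automorphism group $G$ of $\mathcal C\rtimes\mathcal S$ permutes the subsectors according to $\alpha_g(\rho^\chi)\cong\rho^{\bar g\chi}$, where $\bar g\in\widehat{L_\rho}$ is the restriction of $g\in G=\hat K$, considered as a character on $K$, to the subgroup $L_\rho\subset K_\rho\subset K$.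
   Context: Tensor categories. All are small and strict; $\rho\sigma$ is the tensor product of objects, $\times$ that of arrows, $\circ$ is composition, $\iota$ the unit. A tensor $*$-category has complex vector spaces as Hom-sets, bilinear $\circ,\times$, and a positive $*$-operation (antilinear, involutive, contravariant, monoidal, and $X^*\circ X=0\Rightarrow X=0$). $\rho$ is irreducible if $\mathrm{Hom}(\rho,\rho)=\mathbb C\,\mathrm{id}_\rho$. Subobjects (for every projection $E=E^*=E^2\in\mathrm{Hom}(\rho,\rho)$ an isometry $V$ with $VV^*=E$), direct sums (isometries $V_i\in\mathrm{Hom}(\rho_i,\tau)$ with $V_1V_1^*+V_2V_2^*=\mathrm{id}_\tau$) and conjugates ($R\in\mathrm{Hom}(\iota,\bar\rho\rho)$, $\bar R\in\mathrm{Hom}(\iota,\rho\bar\rho)$ with $(\bar R^*\times\mathrm{id}_\rho)\circ(\mathrm{id}_\rho\times R)=\mathrm{id}_\rho$, $(R^*\times\mathrm{id}_{\bar\rho})\circ(\mathrm{id}_{\bar\rho}\times\bar R)=\mathrm{id}_{\bar\rho}$, normalized by $R^*R=\bar R^*\bar R=d(\rho)\mathrm{id}_\iota$ for $\rho$ irreducible; $d(\rho)$ is the dimension) are meant in the $*$-sense. For reducible $\rho$ only standard solutions $R_\rho=\sum_i(\bar W_i\times W_i)\circ R_i$, built from a decomposition into irreducibles, are used. A $TC^*$ is a tensor $*$-category with conjugates, direct sums, subobjects, finite dimensional Hom-spaces and irreducible unit; a $BTC^*$ is a $TC^*$ with unitary braiding $\varepsilon$. The twist is $\kappa(\rho)=(R_\rho^*\times\mathrm{id}_\rho)\circ(\mathrm{id}_{\bar\rho}\times\varepsilon(\rho,\rho))\circ(R_\rho\times\mathrm{id}_\rho)$.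 Even symmetric subcategory $\mathcal S\subset\mathcal C$: a replete full tensor subcategory on which $\varepsilon$ is symmetric, closed under conjugates, direct sums and subobjects, with all twists $\kappa(\rho)=\mathrm{id}_\rho$, $\rho\in\mathcal S$. By Doplicher–Roberts there are a compact group $G=\mathrm{Gal}(\mathcal S)$, unique up to isomorphism, and an isomorphism $F:\mathcal S\to U(G)$ of symmetric tensor $*$-categories onto a category $U(G)$ of finite dimensional continuous unitary representations of $G$ closed under direct sums and subrepresentations and containing members of all classes of irreducibles. Tensor product in $U(G)$ is $\boxtimes$; $F(\iota)=\mathbb C$ contains a unit vector $\Omega$ with $\Omega\boxtimes\psi=\psi\boxtimes\Omega=\psi$. If all irreducibles of $\mathcal S$ have dimension one, their classes form a discrete abelian group $K$ under tensor product, $G$ is its Pontrjagin dual $\hat K$, and $g\in G$ acts on $\mathcal H_k$ below by the scalar $g(k)$. Crossed product: let $\gamma_k$ be representatives of the isomorphism classes $k$ of irreducible objects of $\mathcal S$ (here $k\in K$), $\gamma_0=\iota$ the one of the unit class (also written $e$), $\mathcal H_k=F(\gamma_k)$; choose orthonormal bases $\{V_{k,l}^{m,\alpha}\}$ of $\mathrm{Hom}(\gamma_m,\gamma_k\gamma_l)$ ($V^*\circ W=\langle V,W\rangle\mathrm{id}$), and normalized solutions $R_k\in\mathrm{Hom}(\iota,\gamma_{\bar k}\gamma_k)$, $\bar R_k\in\mathrm{Hom}(\iota,\gamma_k\gamma_{\bar k})$ of the conjugate equations with $R_{\bar k}=\bar R_k$, $\bar R_{\bar k}=R_k$ if $\bar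 k\neq k$ and $\bar R_k=\pm R_k$ if $\bar k=k$. $\mathcal C\rtimes_0\mathcal S$ has the objects and tensor product of objects of $\mathcal C$, and $\mathrm{Hom}_{\mathcal C\rtimes_0\mathcal S}(\rho,\sigma)=\bigoplus_k\mathrm{Hom}_{\mathcal C}(\gamma_k\rho,\sigma)\otimes\mathcal H_k$. For $S\in\mathrm{Hom}(\gamma_k\sigma,\delta)$, $T\in\mathrm{Hom}(\gamma_l\rho,\sigma)$, $\psi_k\in\mathcal H_k,\psi_l\in\mathcal H_l$, $$(S\otimes\psi_k)\circ(T\otimes\psi_l)=\bigoplus_{m}\sum_\alpha\big[S\circ(\mathrm{id}_{\gamma_k}\times T)\circ(V_{k,l}^{m,\alpha}\times\mathrm{id}_\rho)\big]\otimes F(V_{k,l}^{m,\alpha})^*(\psi_k\boxtimes\psi_l);$$ for $S\in\mathrm{Hom}(\gamma_k\rho_1,\sigma_1)$, $T\in\mathrm{Hom}(\gamma_l\rho_2,\sigma_2)$, $$(S\otimes\psi_k)\times(T\otimes\psi_l)=\bigoplus_{m}\sum_\alpha\big[(S\times T)\circ(\mathrm{id}_{\gamma_k}\times\varepsilon(\gamma_l,\rho_1)\times\mathrm{id}_{\rho_2})\circ(V_{k,l}^{m,\alpha}\times\mathrm{id}_{\rho_1\rho_2})\big]\otimes F(V_{k,l}^{m,\alpha})^*(\psi_k\boxtimes\psi_l);$$ for $S\in\mathrm{Hom}(\gamma_k\rho,\sigma)$, $(S\otimes\psi_k)^*=\big[(R_k^*\times\mathrm{id}_\rho)\circ(\mathrm{id}_{\gamma_{\bar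 k}}\times S^* )\big]\otimes\bar\psi$, where $\bar\psi\in\mathcal H_{\bar k}$ is defined by $\langle a,\bar\psi\rangle=\langle\psi_k\boxtimes a,F(\bar R_k)\Omega\rangle$ for all $a\in\mathcal H_{\bar k}$ (inner products antilinear in the first variable). $\mathcal C\rtimes\mathcal S$ is the closure of $\mathcal C\rtimes_0\mathcal S$ under subobjects: objects are pairs $(\rho,E)$ with $E=E^2=E^*\in\mathrm{Hom}_{\mathcal C\rtimes_0\mathcal S}(\rho,\rho)$, $\mathrm{Hom}((\rho,E),(\sigma,E'))=E'\circ\mathrm{Hom}_{\mathcal C\rtimes_0\mathcal S}(\rho,\sigma)\circ E$, $\mathrm{id}_{(\rho,E)}=E$, $(\rho,E)(\sigma,E')=(\rho\sigma,E\times E')$, arrows as in $\mathcal C\rtimes_0\mathcal S$; $\rho\in\mathcal C$ is identified with $(\rho,\mathrm{id}_\rho)$. $G$ acts on $\mathcal C\rtimes\mathcal S$ by $\alpha_g(S\otimes\psi_k)=S\otimes g(k)\psi_k$ and $\alpha_g((\rho,E))=(\rho,\alpha_g(E))$. The groups $K_\rho,L_\rho$ for irreducible $\rho\in\mathcal C$: $K_\rho=\{k\in K:\gamma_k\rho\cong\rho\}$, a finite subgroup of $K$. Choose unitaries $T_k\in\mathrm{Hom}_{\mathcal C}(\gamma_k\rho,\rho)$ (with $T_e=\mathrm{id}_\rho$) and unit vectors $\psi_k\in\mathcal H_k$, $k\in K_\rho$, and put $U_k=T_k\otimes\psi_k\in\mathrm{Hom}_{\mathcal C\rtimes\mathcal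 S}(\rho,\rho)$. Then $U_k\circ U_l=c(k,l)U_{kl}$ with a 2-cocycle $c\in Z^2(K_\rho,\mathbb T)$, and $L_\rho=\{k\in K_\rho: c(k,l)=c(l,k)\ \forall l\in K_\rho\}$, which is a subgroup independent of the choices. $\widehat{L_\rho}$ is the character group. A (sub)sector is an isomorphism class of (sub)objects. *)

theory Defs
  imports "HOL-Analysis.Analysis" "HOL-Algebra.Group" "HOL-Library.Function_Algebras"
begin

section \<open>Complex vector spaces\<close>

class complex_vector = ab_group_add +
  fixes scaleC :: "complex \<Rightarrow> 'a \<Rightarrow> 'a" (infixr "*\<^sub>C" 75)
  assumes scaleC_add_right: "c *\<^sub>C (x + y) = c *\<^sub>C x + c *\<^sub>C y"
    and scaleC_add_left: "(c + d) *\<^sub>C x = c *\<^sub>C x + d *\<^sub>C x"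
    and scaleC_scaleC: "c *\<^sub>C d *\<^sub>C x = (c * d) *\<^sub>C x"
    and scaleC_one: "1 *\<^sub>C x = x"

global_interpretation complex_vector:
  vector_space "scaleC :: complex \<Rightarrow> 'a \<Rightarrow> 'a::complex_vector"
  by unfold_locales
    (simp_all add: scaleC_add_right scaleC_add_left scaleC_scaleC scaleC_one)

abbreviation csubspace :: "'a::complex_vector set \<Rightarrow> bool" where
  "csubspace \<equiv> module.subspace scaleC"

abbreviation cspan :: "'a::complex_vector set \<Rightarrow> 'a set" where
  "cspan \<equiv> module.span scaleC"

instantiation "fun" :: (type, complex_vector) complex_vector
begin

definition scaleC_fun :: "complex \<Rightarrow> ('a \<Rightarrow> 'b) \<Rightarrow> 'a \<Rightarrow> 'b" where
  "scaleC_fun c f = (\<lambda>x. c *\<^sub>C f x)"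

instance
  by standard
    (simp_all add: scaleC_fun_def fun_eq_iff scaleC_add_right scaleC_add_left scaleC_scaleC
      scaleC_one)

end

definition clinear_on :: "'a::complex_vector set \<Rightarrow> ('a \<Rightarrow> 'b::complex_vector) \<Rightarrow> bool" where
  "clinear_on A f \<longleftrightarrow>
    (\<forall>x\<in>A. \<forall>y\<in>A. f (x + y) = f x + f y) \<and> (\<forall>c. \<forall>x\<in>A. f (c *\<^sub>C x) = c *\<^sub>C f x)"

definition cfinite_dim :: "'a::complex_vector set \<Rightarrow> bool" where
  "cfinite_dim A \<longleftrightarrow> (\<exists>B. finite B \<and> A = cspan B)"


section \<open>Strict tensor *-categories\<close>

text \<open>
  All Hom-spaces of a category are subspaces of one ambient complex vector space, the arrow
  type. This loses no generality (take the direct sum of all Hom-spaces), gives finite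
  sums of arrows their usual notation, and lets the zero arrows of all Hom-spaces be \<^term>\<open>0\<close>.
  The Hom-spaces are not required to be independent.
\<close>

record ('o, 'm) scat =
  ob :: "'o set"
  Hom :: "'o \<Rightarrow> 'o \<Rightarrow> 'm set"
  idt :: "'o \<Rightarrow> 'm"
  cmp :: "'m \<Rightarrow> 'm \<Rightarrow> 'm" (infixl "\<cdot>\<index>" 72)
  str :: "'m \<Rightarrow> 'm"

record ('o, 'm) tcat = "('o, 'm) scat" +
  tob :: "'o \<Rightarrow> 'o \<Rightarrow> 'o" (infixl "\<odot>\<index>" 74)
  tar :: "'m \<Rightarrow> 'm \<Rightarrow> 'm" (infixl "\<boxtimes>\<index>" 74)
  unt :: 'o

record ('o, 'm) btcat = "('o, 'm) tcat" +
  brd :: "'o \<Rightarrow> 'o \<Rightarrow> 'm"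

locale star_category =
  fixes C :: "('o, 'm::complex_vector, 'x) scat_scheme" (structure)
  assumes Hom_subspace: "\<lbrakk>a \<in> ob C; b \<in> ob C\<rbrakk> \<Longrightarrow> csubspace (Hom C a b)"
    and idt_in: "a \<in> ob C \<Longrightarrow> idt C a \<in> Hom C a a"
    and cmp_in: "\<lbrakk>a \<in> ob C; b \<in> ob C; c \<in> ob C; g \<in> Hom C b c; f \<in> Hom C a b\<rbrakk>
      \<Longrightarrow> g \<cdot> f \<in> Hom C a c"
    and cmp_assoc: "\<lbrakk>a \<in> ob C; b \<in> ob C; c \<in> ob C; d \<in> ob C;
        h \<in> Hom C c d; g \<in> Hom C b c; f \<in> Hom C a b\<rbrakk> \<Longrightarrow> h \<cdot> (g \<cdot> f) = (h \<cdot> g) \<cdot> f"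
    and cmp_idt_right: "\<lbrakk>a \<in> ob C; b \<in> ob C; f \<in> Hom C a b\<rbrakk> \<Longrightarrow> f \<cdot> idt C a = f"
    and cmp_idt_left: "\<lbrakk>a \<in> ob C; b \<in> ob C; f \<in> Hom C a b\<rbrakk> \<Longrightarrow> idt C b \<cdot> f = f"
    and cmp_linear_right: "\<lbrakk>a \<in> ob C; b \<in> ob C; c \<in> ob C; g \<in> Hom C b c\<rbrakk>
      \<Longrightarrow> clinear_on (Hom C a b) (\<lambda>f. g \<cdot> f)"
    and cmp_linear_left: "\<lbrakk>a \<in> ob C; b \<in> ob C; c \<in> ob C; f \<in> Hom C a b\<rbrakk>
      \<Longrightarrow> clinear_on (Hom C b c) (\<lambda>g. g \<cdot> f)"
    and str_in: "\<lbrakk>a \<in> ob C; b \<in> ob C; f \<in> Hom C a b\<rbrakk> \<Longrightarrow> str C f \<in> Hom C b a"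
    and str_str: "\<lbrakk>a \<in> ob C; b \<in> ob C; f \<in> Hom C a b\<rbrakk> \<Longrightarrow> str C (str C f) = f"
    and str_add: "\<lbrakk>a \<in> ob C; b \<in> ob C; f \<in> Hom C a b; g \<in> Hom C a b\<rbrakk>
      \<Longrightarrow> str C (f + g) = str C f + str C g"
    and str_scaleC: "\<lbrakk>a \<in> ob C; b \<in> ob C; f \<in> Hom C a b\<rbrakk>
      \<Longrightarrow> str C (z *\<^sub>C f) = cnj z *\<^sub>C str C f"
    and str_cmp: "\<lbrakk>a \<in> ob C; b \<in> ob C; c \<in> ob C; g \<in> Hom C b c; f \<in> Hom C a b\<rbrakk>
      \<Longrightarrow> str C (g \<cdot> f) = str C f \<cdot> str C g"
    and str_positive: "\<lbrakk>a \<in> ob C; b \<in> ob C; f \<in> Hom C a b; str C f \<cdot> f = 0\<rbrakk> \<Longrightarrow> f = 0"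

locale tensor_star_category = star_category C
  for C :: "('o, 'm::complex_vector, 'x) tcat_scheme" (structure) +
  assumes unt_in: "unt C \<in> ob C"
    and tob_in: "\<lbrakk>a \<in> ob C; b \<in> ob C\<rbrakk> \<Longrightarrow> a \<odot> b \<in> ob C"
    and tob_assoc: "\<lbrakk>a \<in> ob C; b \<in> ob C; c \<in> ob C\<rbrakk> \<Longrightarrow> (a \<odot> b) \<odot> c = a \<odot> (b \<odot> c)"
    and tob_unt_left: "a \<in> ob C \<Longrightarrow> unt C \<odot> a = a"
    and tob_unt_right: "a \<in> ob C \<Longrightarrow> a \<odot> unt C = a"
    and tar_in: "\<lbrakk>a \<in> ob C; b \<in> ob C; c \<in> ob C; d \<in> ob C; f \<in> Hom C a b; g \<in> Hom C c d\<rbrakk>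
      \<Longrightarrow> f \<boxtimes> g \<in> Hom C (a \<odot> c) (b \<odot> d)"
    and tar_idt: "\<lbrakk>a \<in> ob C; b \<in> ob C\<rbrakk> \<Longrightarrow> idt C a \<boxtimes> idt C b = idt C (a \<odot> b)"
    and tar_cmp: "\<lbrakk>a \<in> ob C; b \<in> ob C; c \<in> ob C; a' \<in> ob C; b' \<in> ob C; c' \<in> ob C;
        g \<in> Hom C b c; f \<in> Hom C a b; g' \<in> Hom C b' c'; f' \<in> Hom C a' b'\<rbrakk>
      \<Longrightarrow> (g \<cdot> f) \<boxtimes> (g' \<cdot> f') = (g \<boxtimes> g') \<cdot> (f \<boxtimes> f')"
    and tar_assoc: "\<lbrakk>a \<in> ob C; b \<in> ob C; a' \<in> ob C; b' \<in> ob C; a'' \<in> ob C; b'' \<in> ob C;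
        f \<in> Hom C a b; g \<in> Hom C a' b'; h \<in> Hom C a'' b''\<rbrakk>
      \<Longrightarrow> (f \<boxtimes> g) \<boxtimes> h = f \<boxtimes> (g \<boxtimes> h)"
    and tar_unt_left: "\<lbrakk>a \<in> ob C; b \<in> ob C; f \<in> Hom C a b\<rbrakk> \<Longrightarrow> idt C (unt C) \<boxtimes> f = f"
    and tar_unt_right: "\<lbrakk>a \<in> ob C; b \<in> ob C; f \<in> Hom C a b\<rbrakk> \<Longrightarrow> f \<boxtimes> idt C (unt C) = f"
    and tar_linear_right: "\<lbrakk>a \<in> ob C; b \<in> ob C; c \<in> ob C; d \<in> ob C; f \<in> Hom C a b\<rbrakk>
      \<Longrightarrow> clinear_on (Hom C c d) (\<lambda>g. f \<boxtimes> g)"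
    and tar_linear_left: "\<lbrakk>a \<in> ob C; b \<in> ob C; c \<in> ob C; d \<in> ob C; g \<in> Hom C c d\<rbrakk>
      \<Longrightarrow> clinear_on (Hom C a b) (\<lambda>f. f \<boxtimes> g)"
    and str_tar: "\<lbrakk>a \<in> ob C; b \<in> ob C; c \<in> ob C; d \<in> ob C; f \<in> Hom C a b; g \<in> Hom C c d\<rbrakk>
      \<Longrightarrow> str C (f \<boxtimes> g) = str C f \<boxtimes> str C g"

context
  fixes C :: "('o, 'm::complex_vector, 'x) scat_scheme" (structure)
begin

definition iso_obj :: "'o \<Rightarrow> 'o \<Rightarrow> bool" where
  "iso_obj a b \<longleftrightarrow> (\<exists>f\<in>Hom C a b. \<exists>g\<in>Hom C b a. g \<cdot> f = idt C a \<and> f \<cdot> g = idt C b)"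

definition iso_class :: "'o \<Rightarrow> 'o set" where
  "iso_class a = {b \<in> ob C. iso_obj a b}"

text \<open>\<^term>\<open>idt C a \<noteq> 0\<close> keeps zero objects (which exist, being images of the projection
  \<^term>\<open>0\<close>) from counting as irreducible.\<close>

definition irred_obj :: "'o \<Rightarrow> bool" where
  "irred_obj a \<longleftrightarrow> idt C a \<noteq> 0 \<and> Hom C a a = range (\<lambda>z. z *\<^sub>C idt C a)"

definition is_isometry :: "'o \<Rightarrow> 'o \<Rightarrow> 'm \<Rightarrow> bool" where
  "is_isometry a b v \<longleftrightarrow> v \<in> Hom C a b \<and> str C v \<cdot> v = idt C a"

definition is_unitary :: "'o \<Rightarrow> 'o \<Rightarrow> 'm \<Rightarrow> bool" where
  "is_unitary a b u \<longleftrightarrow> is_isometry a b u \<and> u \<cdot> str C u = idt C b"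

definition is_projection :: "'o \<Rightarrow> 'm \<Rightarrow> bool" where
  "is_projection a e \<longleftrightarrow> e \<in> Hom C a a \<and> e \<cdot> e = e \<and> str C e = e"

definition direct_sum :: "'i set \<Rightarrow> ('i \<Rightarrow> 'o) \<Rightarrow> ('i \<Rightarrow> 'm) \<Rightarrow> 'o \<Rightarrow> bool" where
  "direct_sum I r w a \<longleftrightarrow> finite I \<and> (\<forall>i\<in>I. r i \<in> ob C \<and> is_isometry (r i) a (w i)) \<and>
    (\<forall>i\<in>I. \<forall>j\<in>I. i \<noteq> j \<longrightarrow> str C (w i) \<cdot> w j = 0) \<and>
    (\<Sum>i\<in>I. w i \<cdot> str C (w i)) = idt C a"

definition binary_sum :: "'o \<Rightarrow> 'o \<Rightarrow> 'o \<Rightarrow> bool" where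
  "binary_sum a b c \<longleftrightarrow> (\<exists>v w. is_isometry a c v \<and> is_isometry b c w \<and>
    v \<cdot> str C v + w \<cdot> str C w = idt C c)"

end

context
  fixes C :: "('o, 'm::complex_vector, 'x) tcat_scheme" (structure)
begin

definition conj_eqs :: "'o \<Rightarrow> 'o \<Rightarrow> 'm \<Rightarrow> 'm \<Rightarrow> bool" where
  "conj_eqs a b R R' \<longleftrightarrow> a \<in> ob C \<and> b \<in> ob C \<and>
    R \<in> Hom C (unt C) (b \<odot> a) \<and> R' \<in> Hom C (unt C) (a \<odot> b) \<and>
    (str C R' \<boxtimes> idt C a) \<cdot> (idt C a \<boxtimes> R) = idt C a \<and>
    (str C R \<boxtimes> idt C b) \<cdot> (idt C b \<boxtimes> R') = idt C b"

definition normalized_conj :: "'o \<Rightarrow> 'o \<Rightarrow> 'm \<Rightarrow> 'm \<Rightarrow> real \<Rightarrow> bool" where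
  "normalized_conj a b R R' d \<longleftrightarrow> conj_eqs a b R R' \<and>
    str C R \<cdot> R = complex_of_real d *\<^sub>C idt C (unt C) \<and>
    str C R' \<cdot> R' = complex_of_real d *\<^sub>C idt C (unt C)"

definition has_dimension :: "'o \<Rightarrow> real \<Rightarrow> bool" where
  "has_dimension a d \<longleftrightarrow> (\<exists>b R R'. normalized_conj a b R R' d)"

definition standard_solution :: "'o \<Rightarrow> 'o \<Rightarrow> 'm \<Rightarrow> 'm \<Rightarrow> bool" where
  "standard_solution a b R R' \<longleftrightarrow> a \<in> ob C \<and> b \<in> ob C \<and>
    (\<exists>(n::nat) r s w w' Q Q' d.
      direct_sum C {..<n} r w a \<and> direct_sum C {..<n} s w' b \<and>
      (\<forall>i<n. irred_obj C (r i) \<and> normalized_conj (r i) (s i) (Q i) (Q' i) (d i)) \<and>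
      R = (\<Sum>i<n. (w' i \<boxtimes> w i) \<cdot> Q i) \<and> R' = (\<Sum>i<n. (w i \<boxtimes> w' i) \<cdot> Q' i))"

end

text \<open>The twist of \<open>a\<close> computed from a standard solution \<open>R\<close> with conjugate \<open>b\<close>; its value
  does not depend on the solution.\<close>

definition twist :: "('o, 'm::complex_vector, 'x) btcat_scheme \<Rightarrow> 'o \<Rightarrow> 'o \<Rightarrow> 'm \<Rightarrow> 'm" where
  "twist C a b R = (str C R \<boxtimes>\<^bsub>C\<^esub> idt C a) \<cdot>\<^bsub>C\<^esub> (idt C b \<boxtimes>\<^bsub>C\<^esub> brd C a a) \<cdot>\<^bsub>C\<^esub> (R \<boxtimes>\<^bsub>C\<^esub> idt C a)"

locale TC_star = tensor_star_category C
  for C :: "('o, 'm::complex_vector, 'x) tcat_scheme" (structure) +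
  assumes conjugates: "a \<in> ob C \<Longrightarrow> \<exists>b R R'. conj_eqs C a b R R'"
    and direct_sums: "\<lbrakk>a \<in> ob C; b \<in> ob C\<rbrakk> \<Longrightarrow> \<exists>c\<in>ob C. binary_sum C a b c"
    and subobjects: "\<lbrakk>a \<in> ob C; is_projection C a e\<rbrakk>
      \<Longrightarrow> \<exists>b\<in>ob C. \<exists>v. is_isometry C b a v \<and> v \<cdot> str C v = e"
    and Hom_finite_dim: "\<lbrakk>a \<in> ob C; b \<in> ob C\<rbrakk> \<Longrightarrow> cfinite_dim (Hom C a b)"
    and unt_irred: "irred_obj C (unt C)"

locale BTC_star = TC_star C
  for C :: "('o, 'm::complex_vector, 'x) btcat_scheme" (structure) +
  assumes brd_unitary: "\<lbrakk>a \<in> ob C; b \<in> ob C\<rbrakk> \<Longrightarrow> is_unitary C (a \<odot> b) (b \<odot> a) (brd C a b)"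
    and brd_natural: "\<lbrakk>a \<in> ob C; b \<in> ob C; c \<in> ob C; d \<in> ob C; f \<in> Hom C a b; g \<in> Hom C c d\<rbrakk>
      \<Longrightarrow> brd C b d \<cdot> (f \<boxtimes> g) = (g \<boxtimes> f) \<cdot> brd C a c"
    and brd_tensor_right: "\<lbrakk>a \<in> ob C; b \<in> ob C; c \<in> ob C\<rbrakk>
      \<Longrightarrow> brd C a (b \<odot> c) = (idt C b \<boxtimes> brd C a c) \<cdot> (brd C a b \<boxtimes> idt C c)"
    and brd_tensor_left: "\<lbrakk>a \<in> ob C; b \<in> ob C; c \<in> ob C\<rbrakk>
      \<Longrightarrow> brd C (a \<odot> b) c = (brd C a c \<boxtimes> idt C b) \<cdot> (idt C a \<boxtimes> brd C b c)"

text \<open>A full subcategory is given by its set of objects.\<close>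

locale even_symmetric_subcategory =
  fixes C :: "('o, 'm::complex_vector, 'x) btcat_scheme" (structure) and S :: "'o set"
  assumes sub_ob: "S \<subseteq> ob C"
    and replete: "\<lbrakk>a \<in> S; b \<in> ob C; iso_obj C a b\<rbrakk> \<Longrightarrow> b \<in> S"
    and sub_unt: "unt C \<in> S"
    and sub_tob: "\<lbrakk>a \<in> S; b \<in> S\<rbrakk> \<Longrightarrow> a \<odot> b \<in> S"
    and sub_symmetric: "\<lbrakk>a \<in> S; b \<in> S\<rbrakk> \<Longrightarrow> brd C b a \<cdot> brd C a b = idt C (a \<odot> b)"
    and sub_conj: "\<lbrakk>a \<in> S; conj_eqs C a b R R'\<rbrakk> \<Longrightarrow> b \<in> S"
    and sub_sum: "\<lbrakk>a \<in> S; b \<in> S; c \<in> ob C; binary_sum C a b c\<rbrakk> \<Longrightarrow> c \<in> S"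
    and sub_subobject: "\<lbrakk>a \<in> S; b \<in> ob C; is_isometry C b a v\<rbrakk> \<Longrightarrow> b \<in> S"
    and sub_even: "\<lbrakk>a \<in> S; standard_solution C a b R R'\<rbrakk> \<Longrightarrow> twist C a b R = idt C a"


section \<open>The classes of irreducibles and their dual group\<close>

definition irr_classes :: "('o, 'm::complex_vector, 'x) scat_scheme \<Rightarrow> 'o set \<Rightarrow> 'o set set" where
  "irr_classes C S = iso_class C ` {a \<in> S. irred_obj C a}"

definition class_group ::
    "('o, 'm::complex_vector, 'x) tcat_scheme \<Rightarrow> 'o set \<Rightarrow> 'o set monoid" where
  "class_group C S =
    \<lparr>carrier = irr_classes C S,
     mult = (\<lambda>k l. {c \<in> ob C. \<exists>a\<in>k. \<exists>b\<in>l. iso_obj C (a \<odot>\<^bsub>C\<^esub> b) c}),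
     one = iso_class C (unt C)\<rparr>"

definition conj_class :: "('o, 'm::complex_vector, 'x) tcat_scheme \<Rightarrow> 'o set \<Rightarrow> 'o set" where
  "conj_class C k = {b \<in> ob C. \<exists>a\<in>k. \<exists>R R'. conj_eqs C a b R R'}"

definition circle_group :: "complex monoid" where
  "circle_group = \<lparr>carrier = sphere 0 1, mult = (*), one = 1\<rparr>"

text \<open>Characters of \<open>A\<close> are extensional on the carrier of \<open>A\<close>, so that they are determined by
  their values there. For discrete \<open>A\<close> the topology of pointwise convergence is the
  compact-open one.\<close>

definition char_group :: "('k, 'x) monoid_scheme \<Rightarrow> ('k \<Rightarrow> complex) monoid" where
  "char_group A =
    \<lparr>carrier = hom A circle_group \<inter> extensional (carrier A),
     mult = (\<lambda>\<xi> \<eta>. \<lambda>k\<in>carrier A. \<xi> k * \<eta> k),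
     one = (\<lambda>k\<in>carrier A. 1)\<rparr>"

definition char_topology :: "('k, 'x) monoid_scheme \<Rightarrow> ('k \<Rightarrow> complex) topology" where
  "char_topology A =
    subtopology (product_topology (\<lambda>_. top_of_set (sphere 0 1)) (carrier A))
      (carrier (char_group A))"


section \<open>Isomorphisms onto categories of representations\<close>

text \<open>
  The data of an isomorphism \<open>F\<close> from \<open>S\<close> onto a category \<open>U(G)\<close> of representations. As \<open>F\<close> is
  bijective on objects, the objects of \<open>U(G)\<close> are labelled by those of \<open>S\<close>: the representation
  space of \<open>F(a)\<close> is \<open>Sp F a\<close>, again a subspace of one ambient vector space, on which \<open>ip F\<close>
  is the inner product (antilinear in the first variable) and \<open>act F g\<close> the action of \<open>g\<close>.
  The linear map \<open>F(T)\<close> is \<open>fmap F T\<close>, and \<open>vtens F\<close> is the tensor product of vectors.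
\<close>

record ('o, 'm, 'h, 'g) fibre =
  Sp :: "'o \<Rightarrow> 'h set"
  ip :: "'h \<Rightarrow> 'h \<Rightarrow> complex"
  act :: "'g \<Rightarrow> 'h \<Rightarrow> 'h"
  fmap :: "'m \<Rightarrow> 'h \<Rightarrow> 'h"
  vtens :: "'h \<Rightarrow> 'h \<Rightarrow> 'h"
  vac :: 'h

text \<open>A continuous unitary matrix representation is irreducible if only the scalar matrices
  commute with it.\<close>

definition irred_matrix_rep ::
    "('g, 'x) monoid_scheme \<Rightarrow> 'g topology \<Rightarrow> nat \<Rightarrow> ('g \<Rightarrow> nat \<Rightarrow> nat \<Rightarrow> complex) \<Rightarrow> bool" where
  "irred_matrix_rep G TG n u \<longleftrightarrow> 0 < n \<and>
    (\<forall>i<n. \<forall>j<n. u \<one>\<^bsub>G\<^esub> i j = (if i = j then 1 else 0)) \<and>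
    (\<forall>g\<in>carrier G. \<forall>h\<in>carrier G. \<forall>i<n. \<forall>j<n.
      u (g \<otimes>\<^bsub>G\<^esub> h) i j = (\<Sum>l<n. u g i l * u h l j)) \<and>
    (\<forall>g\<in>carrier G. \<forall>i<n. \<forall>j<n. (\<Sum>l<n. cnj (u g l i) * u g l j) = (if i = j then 1 else 0)) \<and>
    (\<forall>i<n. \<forall>j<n. continuous_map TG euclidean (\<lambda>g. u g i j)) \<and>
    (\<forall>A::nat \<Rightarrow> nat \<Rightarrow> complex.
      (\<forall>g\<in>carrier G. \<forall>i<n. \<forall>j<n. (\<Sum>l<n. A i l * u g l j) = (\<Sum>l<n. u g i l * A l j)) \<longrightarrow>
      (\<exists>z. \<forall>i<n. \<forall>j<n. A i j = (if i = j then z else 0)))"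

locale representation_isomorphism =
  fixes C :: "('o, 'm::complex_vector, 'x) btcat_scheme" (structure)
    and S :: "'o set"
    and G :: "('g, 'y) monoid_scheme"
    and TG :: "'g topology"
    and F :: "('o, 'm, 'h::complex_vector, 'g) fibre"
  assumes Sp_subspace: "a \<in> S \<Longrightarrow> csubspace (Sp F a)"
    and Sp_finite_dim: "a \<in> S \<Longrightarrow> cfinite_dim (Sp F a)"
    and ip_add: "\<lbrakk>a \<in> S; x \<in> Sp F a; y \<in> Sp F a; z \<in> Sp F a\<rbrakk>
      \<Longrightarrow> ip F x (y + z) = ip F x y + ip F x z"
    and ip_scaleC: "\<lbrakk>a \<in> S; x \<in> Sp F a; y \<in> Sp F a\<rbrakk> \<Longrightarrow> ip F x (s *\<^sub>C y) = s * ip F x y"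
    and ip_cnj: "\<lbrakk>a \<in> S; x \<in> Sp F a; y \<in> Sp F a\<rbrakk> \<Longrightarrow> ip F y x = cnj (ip F x y)"
    and ip_positive: "\<lbrakk>a \<in> S; x \<in> Sp F a; x \<noteq> 0\<rbrakk> \<Longrightarrow> 0 < Re (ip F x x)"
    and act_in: "\<lbrakk>a \<in> S; g \<in> carrier G; x \<in> Sp F a\<rbrakk> \<Longrightarrow> act F g x \<in> Sp F a"
    and act_linear: "\<lbrakk>a \<in> S; g \<in> carrier G\<rbrakk> \<Longrightarrow> clinear_on (Sp F a) (act F g)"
    and act_one: "\<lbrakk>a \<in> S; x \<in> Sp F a\<rbrakk> \<Longrightarrow> act F \<one>\<^bsub>G\<^esub> x = x"
    and act_mult: "\<lbrakk>a \<in> S; g \<in> carrier G; h \<in> carrier G; x \<in> Sp F a\<rbrakk>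
      \<Longrightarrow> act F (g \<otimes>\<^bsub>G\<^esub> h) x = act F g (act F h x)"
    and act_unitary: "\<lbrakk>a \<in> S; g \<in> carrier G; x \<in> Sp F a; y \<in> Sp F a\<rbrakk>
      \<Longrightarrow> ip F (act F g x) (act F g y) = ip F x y"
    and act_continuous: "\<lbrakk>a \<in> S; x \<in> Sp F a; y \<in> Sp F a\<rbrakk>
      \<Longrightarrow> continuous_map TG euclidean (\<lambda>g. ip F x (act F g y))"
    and fmap_in: "\<lbrakk>a \<in> S; b \<in> S; T \<in> Hom C a b; x \<in> Sp F a\<rbrakk> \<Longrightarrow> fmap F T x \<in> Sp F b"
    and fmap_linear: "\<lbrakk>a \<in> S; b \<in> S; T \<in> Hom C a b\<rbrakk> \<Longrightarrow> clinear_on (Sp F a) (fmap F T)"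
    and fmap_linear_arrow: "\<lbrakk>a \<in> S; b \<in> S; x \<in> Sp F a\<rbrakk>
      \<Longrightarrow> clinear_on (Hom C a b) (\<lambda>T. fmap F T x)"
    and fmap_act: "\<lbrakk>a \<in> S; b \<in> S; T \<in> Hom C a b; g \<in> carrier G; x \<in> Sp F a\<rbrakk>
      \<Longrightarrow> fmap F T (act F g x) = act F g (fmap F T x)"
    and fmap_idt: "\<lbrakk>a \<in> S; x \<in> Sp F a\<rbrakk> \<Longrightarrow> fmap F (idt C a) x = x"
    and fmap_cmp: "\<lbrakk>a \<in> S; b \<in> S; c \<in> S; T' \<in> Hom C b c; T \<in> Hom C a b; x \<in> Sp F a\<rbrakk>
      \<Longrightarrow> fmap F (T' \<cdot> T) x = fmap F T' (fmap F T x)"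
    and fmap_str: "\<lbrakk>a \<in> S; b \<in> S; T \<in> Hom C a b; x \<in> Sp F a; y \<in> Sp F b\<rbrakk>
      \<Longrightarrow> ip F (fmap F (str C T) y) x = ip F y (fmap F T x)"
    and fmap_faithful: "\<lbrakk>a \<in> S; b \<in> S; T \<in> Hom C a b; \<And>x. x \<in> Sp F a \<Longrightarrow> fmap F T x = 0\<rbrakk>
      \<Longrightarrow> T = 0"
    and fmap_full: "\<lbrakk>a \<in> S; b \<in> S; clinear_on (Sp F a) t; \<And>x. x \<in> Sp F a \<Longrightarrow> t x \<in> Sp F b;
        \<And>g x. \<lbrakk>g \<in> carrier G; x \<in> Sp F a\<rbrakk> \<Longrightarrow> t (act F g x) = act F g (t x)\<rbrakk>
      \<Longrightarrow> \<exists>T\<in>Hom C a b. \<forall>x\<in>Sp F a. fmap F T x = t x"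
    and vtens_in: "\<lbrakk>a \<in> S; b \<in> S; x \<in> Sp F a; y \<in> Sp F b\<rbrakk> \<Longrightarrow> vtens F x y \<in> Sp F (a \<odot> b)"
    and vtens_linear_left: "\<lbrakk>a \<in> S; b \<in> S; y \<in> Sp F b\<rbrakk>
      \<Longrightarrow> clinear_on (Sp F a) (\<lambda>x. vtens F x y)"
    and vtens_linear_right: "\<lbrakk>a \<in> S; b \<in> S; x \<in> Sp F a\<rbrakk>
      \<Longrightarrow> clinear_on (Sp F b) (\<lambda>y. vtens F x y)"
    and vtens_ip: "\<lbrakk>a \<in> S; b \<in> S; x \<in> Sp F a; x' \<in> Sp F a; y \<in> Sp F b; y' \<in> Sp F b\<rbrakk>
      \<Longrightarrow> ip F (vtens F x y) (vtens F x' y') = ip F x x' * ip F y y'"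
    and vtens_span: "\<lbrakk>a \<in> S; b \<in> S\<rbrakk>
      \<Longrightarrow> Sp F (a \<odot> b) = cspan {vtens F x y |x y. x \<in> Sp F a \<and> y \<in> Sp F b}"
    and vtens_assoc: "\<lbrakk>a \<in> S; b \<in> S; c \<in> S; x \<in> Sp F a; y \<in> Sp F b; z \<in> Sp F c\<rbrakk>
      \<Longrightarrow> vtens F (vtens F x y) z = vtens F x (vtens F y z)"
    and vtens_act: "\<lbrakk>a \<in> S; b \<in> S; g \<in> carrier G; x \<in> Sp F a; y \<in> Sp F b\<rbrakk>
      \<Longrightarrow> act F g (vtens F x y) = vtens F (act F g x) (act F g y)"
    and vac_Sp: "Sp F (unt C) = cspan {vac F}"
    and vac_unit: "ip F (vac F) (vac F) = 1"
    and vac_act: "g \<in> carrier G \<Longrightarrow> act F g (vac F) = vac F"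
    and vtens_vac_left: "\<lbrakk>a \<in> S; x \<in> Sp F a\<rbrakk> \<Longrightarrow> vtens F (vac F) x = x"
    and vtens_vac_right: "\<lbrakk>a \<in> S; x \<in> Sp F a\<rbrakk> \<Longrightarrow> vtens F x (vac F) = x"
    and fmap_tar: "\<lbrakk>a \<in> S; b \<in> S; c \<in> S; d \<in> S; T \<in> Hom C a b; T' \<in> Hom C c d;
        x \<in> Sp F a; y \<in> Sp F c\<rbrakk>
      \<Longrightarrow> fmap F (T \<boxtimes> T') (vtens F x y) = vtens F (fmap F T x) (fmap F T' y)"
    and fmap_brd: "\<lbrakk>a \<in> S; b \<in> S; x \<in> Sp F a; y \<in> Sp F b\<rbrakk>
      \<Longrightarrow> fmap F (brd C a b) (vtens F x y) = vtens F y x"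
    \<comment> \<open>every irreducible representation of \<open>G\<close> is equivalent to some \<open>F(a)\<close>\<close>
    and all_irreducibles: "irred_matrix_rep G TG n u
      \<Longrightarrow> \<exists>a\<in>S. \<exists>e. Sp F a = cspan (e ` {..<n}) \<and>
        (\<forall>i<n. \<forall>j<n. ip F (e i) (e j) = (if i = j then 1 else 0)) \<and>
        (\<forall>g\<in>carrier G. \<forall>j<n. act F g (e j) = (\<Sum>i<n. u g i j *\<^sub>C e i))"


section \<open>The crossed product\<close>

text \<open>Representatives \<open>rep Z k\<close> of the classes \<open>k\<close>, orthonormal bases \<open>bas Z k l m\<close> of the
  Hom-spaces from \<open>rep Z m\<close> to the tensor product of \<open>rep Z k\<close> and \<open>rep Z l\<close>, and solutions
  \<open>Rs Z k\<close>, \<open>Rs' Z k\<close> of the conjugate equations for \<open>rep Z k\<close>.\<close>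

record ('o, 'm) cp_choice =
  rep :: "'o set \<Rightarrow> 'o"
  bas :: "'o set \<Rightarrow> 'o set \<Rightarrow> 'o set \<Rightarrow> 'm set"
  Rs :: "'o set \<Rightarrow> 'm"
  Rs' :: "'o set \<Rightarrow> 'm"

locale crossed_product_choice =
  fixes C :: "('o, 'm::complex_vector, 'x) tcat_scheme" (structure)
    and S :: "'o set"
    and Z :: "('o, 'm) cp_choice"
  assumes rep_in: "k \<in> irr_classes C S \<Longrightarrow> rep Z k \<in> k"
    and rep_unt: "rep Z (iso_class C (unt C)) = unt C"
    and bas_finite: "\<lbrakk>k \<in> irr_classes C S; l \<in> irr_classes C S; m \<in> irr_classes C S\<rbrakk>
      \<Longrightarrow> finite (bas Z k l m)"
    and bas_orthonormal: "\<lbrakk>k \<in> irr_classes C S; l \<in> irr_classes C S; m \<in> irr_classes C S;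
        v \<in> bas Z k l m; w \<in> bas Z k l m\<rbrakk>
      \<Longrightarrow> str C v \<cdot> w = (if v = w then idt C (rep Z m) else 0)"
    and bas_span: "\<lbrakk>k \<in> irr_classes C S; l \<in> irr_classes C S; m \<in> irr_classes C S\<rbrakk>
      \<Longrightarrow> cspan (bas Z k l m) = Hom C (rep Z m) (rep Z k \<odot> rep Z l)"
    and Rs_solution: "k \<in> irr_classes C S
      \<Longrightarrow> \<exists>d. normalized_conj C (rep Z k) (rep Z (conj_class C k)) (Rs Z k) (Rs' Z k) d"
    and Rs_conj: "\<lbrakk>k \<in> irr_classes C S; conj_class C k \<noteq> k\<rbrakk>
      \<Longrightarrow> Rs Z (conj_class C k) = Rs' Z k \<and> Rs' Z (conj_class C k) = Rs Z k"
    and Rs_self_conj: "\<lbrakk>k \<in> irr_classes C S; conj_class C k = k\<rbrakk>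
      \<Longrightarrow> Rs' Z k = Rs Z k \<or> Rs' Z k = - Rs Z k"

text \<open>
  An element of the tensor product of a Hom-space with the Hilbert space \<open>Sp F (rep Z k)\<close> is
  represented by an antilinear map from the latter to the former, \<open>T \<otimes> \<psi>\<close> being the map
  sending \<open>x\<close> to \<open>\<langle>x, \<psi>\<rangle> T\<close>. An arrow of the crossed product is thus a function of \<open>k\<close> and
  \<open>x\<close>. It is stored together with its source and target: an arrow from \<open>a\<close> to \<open>b\<close> is a
  matrix indexed by pairs of objects whose only nonzero entry is at \<open>a\<close>, \<open>b\<close>.
\<close>

type_synonym ('o, 'm, 'h) cp_arrow = "'o \<Rightarrow> 'o \<Rightarrow> 'o set \<Rightarrow> 'h \<Rightarrow> 'm"

context
  fixes C :: "('o, 'm::complex_vector, 'x) btcat_scheme" (structure)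
    and S :: "'o set"
    and F :: "('o, 'm, 'h::complex_vector, 'g) fibre"
    and Z :: "('o, 'm) cp_choice"
begin

definition elem :: "'o \<Rightarrow> 'o \<Rightarrow> 'o set \<Rightarrow> 'm \<Rightarrow> 'h \<Rightarrow> ('o, 'm, 'h) cp_arrow" where
  "elem a b k T \<psi> = (\<lambda>a' b' k' x.
    if a' = a \<and> b' = b \<and> k' = k \<and> x \<in> Sp F (rep Z k) then ip F x \<psi> *\<^sub>C T else 0)"

definition cp_Hom :: "'o \<Rightarrow> 'o \<Rightarrow> ('o, 'm, 'h) cp_arrow set" where
  "cp_Hom a b = cspan {elem a b k T \<psi> |k T \<psi>.
    k \<in> irr_classes C S \<and> T \<in> Hom C (rep Z k \<odot> a) b \<and> \<psi> \<in> Sp F (rep Z k)}"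

definition onb :: "'o set \<Rightarrow> 'h set" where
  "onb k = (SOME B. finite B \<and> cspan B = Sp F (rep Z k) \<and>
    (\<forall>x\<in>B. \<forall>y\<in>B. ip F x y = (if x = y then 1 else 0)))"

text \<open>Every arrow \<open>X\<close> is the sum of \<open>elem a b k (X a b k e) e\<close> over all \<open>(a, b, k, e)\<close> in
  \<open>terms X\<close>. The operations are the (anti)linear extensions of their values on elementary
  tensors.\<close>

definition terms :: "('o, 'm, 'h) cp_arrow \<Rightarrow> ('o \<times> 'o \<times> 'o set \<times> 'h) set" where
  "terms X = {(a, b, k, e). X a b k \<noteq> 0 \<and> e \<in> onb k}"

text \<open>The classes contained in the product of \<open>k\<close> and \<open>l\<close>; there are finitely many.\<close>

definition product_classes :: "'o set \<Rightarrow> 'o set \<Rightarrow> 'o set set" where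
  "product_classes k l = {m \<in> irr_classes C S. bas Z k l m \<noteq> {}}"

definition cmp_elem ::
    "'o \<Rightarrow> 'o \<Rightarrow> 'o set \<Rightarrow> 'm \<Rightarrow> 'h \<Rightarrow> 'o set \<Rightarrow> 'm \<Rightarrow> 'h \<Rightarrow> ('o, 'm, 'h) cp_arrow" where
  "cmp_elem a c k T \<psi> l T' \<psi>' = (\<Sum>m\<in>product_classes k l. \<Sum>v\<in>bas Z k l m.
    elem a c m (T \<cdot> (idt C (rep Z k) \<boxtimes> T') \<cdot> (v \<boxtimes> idt C a)) (fmap F (str C v) (vtens F \<psi> \<psi>')))"

definition tar_elem ::
    "'o \<Rightarrow> 'o \<Rightarrow> 'o \<Rightarrow> 'o \<Rightarrow> 'o set \<Rightarrow> 'm \<Rightarrow> 'h \<Rightarrow> 'o set \<Rightarrow> 'm \<Rightarrow> 'h \<Rightarrow> ('o, 'm, 'h) cp_arrow" where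
  "tar_elem a b a' b' k T \<psi> l T' \<psi>' = (\<Sum>m\<in>product_classes k l. \<Sum>v\<in>bas Z k l m.
    elem (a \<odot> a') (b \<odot> b') m
      ((T \<boxtimes> T') \<cdot> (idt C (rep Z k) \<boxtimes> brd C (rep Z l) a \<boxtimes> idt C a') \<cdot> (v \<boxtimes> idt C (a \<odot> a')))
      (fmap F (str C v) (vtens F \<psi> \<psi>')))"

definition vbar :: "'o set \<Rightarrow> 'h \<Rightarrow> 'h" where
  "vbar k \<psi> = (THE \<psi>'. \<psi>' \<in> Sp F (rep Z (conj_class C k)) \<and>
    (\<forall>x\<in>Sp F (rep Z (conj_class C k)). ip F x \<psi>' = ip F (vtens F \<psi> x) (fmap F (Rs' Z k) (vac F))))"

definition str_elem :: "'o \<Rightarrow> 'o \<Rightarrow> 'o set \<Rightarrow> 'm \<Rightarrow> 'h \<Rightarrow> ('o, 'm, 'h) cp_arrow" where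
  "str_elem a b k T \<psi> = elem b a (conj_class C k)
    ((str C (Rs Z k) \<boxtimes> idt C a) \<cdot> (idt C (rep Z (conj_class C k)) \<boxtimes> str C T)) (vbar k \<psi>)"

definition cp_cmp ::
    "('o, 'm, 'h) cp_arrow \<Rightarrow> ('o, 'm, 'h) cp_arrow \<Rightarrow> ('o, 'm, 'h) cp_arrow" where
  "cp_cmp Y X = (\<Sum>(b', c, k, e)\<in>terms Y. \<Sum>(a, b, l, e')\<in>terms X.
    if b = b' then cmp_elem a c k (Y b' c k e) e l (X a b l e') e' else 0)"

definition cp_tar ::
    "('o, 'm, 'h) cp_arrow \<Rightarrow> ('o, 'm, 'h) cp_arrow \<Rightarrow> ('o, 'm, 'h) cp_arrow" where
  "cp_tar X Y = (\<Sum>(a, b, k, e)\<in>terms X. \<Sum>(a', b', l, e')\<in>terms Y.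
    tar_elem a b a' b' k (X a b k e) e l (Y a' b' l e') e')"

definition cp_str :: "('o, 'm, 'h) cp_arrow \<Rightarrow> ('o, 'm, 'h) cp_arrow" where
  "cp_str X = (\<Sum>(a, b, k, e)\<in>terms X. str_elem a b k (X a b k e) e)"

definition crossed_product0 :: "('o, ('o, 'm, 'h) cp_arrow) tcat" where
  "crossed_product0 =
    \<lparr>ob = ob C, Hom = cp_Hom, idt = (\<lambda>a. elem a a (iso_class C (unt C)) (idt C a) (vac F)),
     cmp = cp_cmp, str = cp_str, tob = tob C, tar = cp_tar, unt = unt C\<rparr>"

end

definition subobject_closure :: "('o, 'm::complex_vector) tcat \<Rightarrow> ('o \<times> 'm, 'm) tcat" where
  "subobject_closure D =
    \<lparr>ob = {(a, E). a \<in> ob D \<and> is_projection D a E},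
     Hom = (\<lambda>(a, E) (b, E'). {E' \<cdot>\<^bsub>D\<^esub> X \<cdot>\<^bsub>D\<^esub> E |X. X \<in> Hom D a b}),
     idt = snd, cmp = cmp D, str = str D,
     tob = (\<lambda>(a, E) (b, E'). (a \<odot>\<^bsub>D\<^esub> b, E \<boxtimes>\<^bsub>D\<^esub> E')), tar = tar D,
     unt = (unt D, idt D (unt D))\<rparr>"

definition crossed_product ::
    "('o, 'm::complex_vector, 'x) btcat_scheme \<Rightarrow> 'o set \<Rightarrow>
      ('o, 'm, 'h::complex_vector, 'g) fibre \<Rightarrow> ('o, 'm) cp_choice \<Rightarrow>
      ('o \<times> ('o, 'm, 'h) cp_arrow, ('o, 'm, 'h) cp_arrow) tcat" where
  "crossed_product C S F Z = subobject_closure (crossed_product0 C S F Z)"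

definition cp_embed ::
    "('o, 'm::complex_vector, 'x) btcat_scheme \<Rightarrow> 'o set \<Rightarrow>
      ('o, 'm, 'h::complex_vector, 'g) fibre \<Rightarrow> ('o, 'm) cp_choice \<Rightarrow>
      'o \<Rightarrow> 'o \<times> ('o, 'm, 'h) cp_arrow" where
  "cp_embed C S F Z a = (a, idt (crossed_product0 C S F Z) a)"

definition cp_act ::
    "('o, 'm::complex_vector, 'h::complex_vector, 'g) fibre \<Rightarrow> ('o, 'm) cp_choice \<Rightarrow>
      ('o set \<Rightarrow> complex) \<Rightarrow> ('o, 'm, 'h) cp_arrow \<Rightarrow> ('o, 'm, 'h) cp_arrow" where
  "cp_act F Z g X = (\<Sum>(a, b, k, e)\<in>terms F Z X. elem F Z a b k (X a b k e) (g k *\<^sub>C e))"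

definition cp_act_ob ::
    "('o, 'm::complex_vector, 'h::complex_vector, 'g) fibre \<Rightarrow> ('o, 'm) cp_choice \<Rightarrow>
      ('o set \<Rightarrow> complex) \<Rightarrow> 'o \<times> ('o, 'm, 'h) cp_arrow \<Rightarrow> 'o \<times> ('o, 'm, 'h) cp_arrow" where
  "cp_act_ob F Z g = (\<lambda>(a, E). (a, cp_act F Z g E))"


section \<open>The groups attached to an irreducible object\<close>

definition K_of ::
    "('o, 'm::complex_vector, 'x) tcat_scheme \<Rightarrow> 'o set \<Rightarrow> ('o, 'm) cp_choice \<Rightarrow> 'o \<Rightarrow> 'o set set" where
  "K_of C S Z \<rho> = {k \<in> irr_classes C S. iso_obj C (rep Z k \<odot>\<^bsub>C\<^esub> \<rho>) \<rho>}"

definition unitary_choice ::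
    "('o, 'm::complex_vector, 'x) tcat_scheme \<Rightarrow> 'o set \<Rightarrow>
      ('o, 'm, 'h::complex_vector, 'g) fibre \<Rightarrow> ('o, 'm) cp_choice \<Rightarrow> 'o \<Rightarrow>
      ('o set \<Rightarrow> 'm) \<Rightarrow> ('o set \<Rightarrow> 'h) \<Rightarrow> bool" where
  "unitary_choice C S F Z \<rho> T \<psi> \<longleftrightarrow>
    (\<forall>k\<in>K_of C S Z \<rho>. is_unitary C (rep Z k \<odot>\<^bsub>C\<^esub> \<rho>) \<rho> (T k) \<and>
      \<psi> k \<in> Sp F (rep Z k) \<and> ip F (\<psi> k) (\<psi> k) = 1) \<and>
    T (iso_class C (unt C)) = idt C \<rho>"

definition cocycle ::
    "('o, 'm::complex_vector, 'x) btcat_scheme \<Rightarrow> 'o set \<Rightarrow>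
      ('o, 'm, 'h::complex_vector, 'g) fibre \<Rightarrow> ('o, 'm) cp_choice \<Rightarrow> 'o \<Rightarrow>
      ('o set \<Rightarrow> 'm) \<Rightarrow> ('o set \<Rightarrow> 'h) \<Rightarrow> 'o set \<Rightarrow> 'o set \<Rightarrow> complex" where
  "cocycle C S F Z \<rho> T \<psi> k l =
    (let U = (\<lambda>k. elem F Z \<rho> \<rho> k (T k) (\<psi> k))
     in THE c. U k \<cdot>\<^bsub>crossed_product C S F Z\<^esub> U l = c *\<^sub>C U (k \<otimes>\<^bsub>class_group C S\<^esub> l))"

definition L_of ::
    "('o, 'm::complex_vector, 'x) btcat_scheme \<Rightarrow> 'o set \<Rightarrow>
      ('o, 'm, 'h::complex_vector, 'g) fibre \<Rightarrow> ('o, 'm) cp_choice \<Rightarrow> 'o \<Rightarrow>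
      ('o set \<Rightarrow> 'm) \<Rightarrow> ('o set \<Rightarrow> 'h) \<Rightarrow> 'o set set" where
  "L_of C S F Z \<rho> T \<psi> = {k \<in> K_of C S Z \<rho>.
    \<forall>l\<in>K_of C S Z \<rho>. cocycle C S F Z \<rho> T \<psi> k l = cocycle C S F Z \<rho> T \<psi> l k}"

end

theory Submission
  imports Defs "HOL-Algebra.Coset" "HOL-Algebra.FiniteProduct"
begin

text \<open>
  By Schur's lemma the endomorphisms of \<open>\<rho>\<close> in the crossed product are spanned by the unitaries
  \<open>U\<^sub>k = T\<^sub>k \<otimes> \<psi>\<^sub>k\<close>, \<open>k \<in> K\<^sub>\<rho>\<close>: they form the group algebra of the finite abelian group \<open>K\<^sub>\<rho>\<close>, twisted by
  the cocycle \<open>c\<close>. The theorem is the structure theory of such an algebra.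

  Write \<open>U\<^sub>k U\<^sub>l = b(k, l) U\<^sub>l U\<^sub>k\<close> with the bicharacter \<open>b(k, l) = c(k, l) / c(l, k)\<close>, whose radical is
  \<open>L = L\<^sub>\<rho>\<close>, and let \<open>M\<close> be a maximal isotropic subgroup, so that \<open>M\<close> is its own orthogonal complement
  (\<open>exists_lagrangian\<close>). The algebra spanned by the \<open>U\<^sub>m\<close>, \<open>m \<in> M\<close>, is commutative, and the projections
  \<open>p\<^sub>\<phi>\<close> of its characters \<open>\<phi>\<close> add up to the identity (\<open>sum_proj\<close>). Conjugation with \<open>U\<^sub>k\<close> multiplies
  \<open>\<phi>\<close> by the conjugate of \<open>b(k, \<sqdot>)\<close>, which is trivial on \<open>M\<close> only if \<open>k \<in> M\<close>. Hence the projections are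
  minimal (\<open>corner\<close>), two of them are equivalent if and only if their characters agree on \<open>L\<close>
  (\<open>chars_shift\<close>, \<open>proj_iso\<close>, \<open>proj_not_iso\<close>), and an equivalence class is an orbit of \<open>K\<^sub>\<rho> / M\<close>. The
  characters on \<open>L\<close> form a torsor for the character group of \<open>L\<close>; the multiplicity is
  \<open>N = [K\<^sub>\<rho> : M] = [M : L]\<close>, and therefore \<open>N\<^sup>2 = [K\<^sub>\<rho> : L]\<close>. The action of \<open>g\<close> multiplies \<open>U\<^sub>k\<close> by \<open>g(k)\<close> and so
  translates the torsor by the restriction of \<open>g\<close> to \<open>L\<close> (\<open>decomposition\<close>).

  That the crossed product has an endomorphism algebra of this kind rests on the fact that the
  representation spaces of the objects \<open>\<gamma>\<^sub>k\<close> are one-dimensional: the dual group acts on them by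
  scalars, so every linear endomorphism comes from an endomorphism of \<open>\<gamma>\<^sub>k\<close> (\<open>line_rep\<close>). An
  arrow between such objects is a complex number, tensor products of such objects are
  irreducible, and the sums in the definition of the composition have one term each. It remains
  to see that the phases which depend on choices cancel in the associative law
  (\<open>cocycle_identity\<close>) and in \<open>U\<^sub>k\<^sup>* U\<^sub>k = 1\<close> (\<open>adj_U\<close>). The group \<open>K\<^sub>\<rho>\<close> is finite because every \<open>\<gamma>\<^sub>k\<close>
  with \<open>k \<in> K\<^sub>\<rho>\<close> occurs in \<open>\<rho>\<close> tensored with a conjugate (\<open>K\<rho>_finite\<close>).
\<close>


section \<open>Linear algebra\<close>

lemma clinear_on_add: "clinear_on A f \<Longrightarrow> x \<in> A \<Longrightarrow> y \<in> A \<Longrightarrow> f (x + y) = f x + f y"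
  unfolding clinear_on_def by blast

lemma clinear_on_scaleC: "clinear_on A f \<Longrightarrow> x \<in> A \<Longrightarrow> f (z *\<^sub>C x) = z *\<^sub>C f x"
  unfolding clinear_on_def by blast

lemma clinear_on_zero: "clinear_on A f \<Longrightarrow> csubspace A \<Longrightarrow> f 0 = 0"
  using clinear_on_scaleC[of A f 0 0] complex_vector.subspace_0[of A] by simp

lemma clinear_on_diff:
  assumes "clinear_on A f" "csubspace A" "x \<in> A" "y \<in> A"
  shows "f (x - y) = f x - f y"
proof -
  have "f x = f ((x - y) + y)" by simp
  also have "\<dots> = f (x - y) + f y"
    using assms complex_vector.subspace_diff by (intro clinear_on_add) auto
  finally show ?thesis by simp
qed

lemma clinear_on_sum:
  assumes "clinear_on A f" "csubspace A" "\<And>i. i \<in> I \<Longrightarrow> x i \<in> A"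
  shows "f (\<Sum>i\<in>I. x i) = (\<Sum>i\<in>I. f (x i))"
  using assms(3)
proof (induction I rule: infinite_finite_induct)
  case (insert i I)
  then show ?case
    using clinear_on_add[OF assms(1), of "x i" "\<Sum>i\<in>I. x i"]
      complex_vector.subspace_sum[OF assms(2), of I x] by auto
qed (use clinear_on_zero[OF assms(1,2)] in auto)

text \<open>Vectors that are separated by linear maps are linearly independent, so a space of finite
  dimension contains only finitely many of them.\<close>

lemma finite_if_separated:
  fixes p :: "'i \<Rightarrow> 'a::complex_vector" and f :: "'i \<Rightarrow> 'a \<Rightarrow> 'b::complex_vector"
  assumes B: "finite B" and p: "\<And>i. i \<in> I \<Longrightarrow> p i \<in> cspan B"
    and lin: "\<And>i. i \<in> I \<Longrightarrow> clinear_on (cspan B) (f i)"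
    and zero: "\<And>i j. i \<in> I \<Longrightarrow> j \<in> I \<Longrightarrow> i \<noteq> j \<Longrightarrow> f i (p j) = 0"
    and nz: "\<And>i. i \<in> I \<Longrightarrow> f i (p i) \<noteq> 0"
  shows "finite I"
proof -
  have inj: "inj_on p I"
    by (rule inj_onI) (metis zero nz)
  have "\<not> complex_vector.dependent (p ` I)"
  proof
    assume "complex_vector.dependent (p ` I)"
    then obtain t u v where t: "finite t" "t \<subseteq> p ` I" "(\<Sum>v\<in>t. u v *\<^sub>C v) = 0" "v \<in> t" "u v \<noteq> 0"
      unfolding complex_vector.dependent_explicit by blast
    then obtain i where i: "i \<in> I" "v = p i" by blast
    have "0 = f i (\<Sum>v\<in>t. u v *\<^sub>C v)"
      using t(3) clinear_on_zero[OF lin[OF i(1)]] complex_vector.subspace_span by simp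
    also have "\<dots> = (\<Sum>v\<in>t. f i (u v *\<^sub>C v))"
      using t(2) p complex_vector.subspace_span
      by (intro clinear_on_sum[OF lin[OF i(1)]] complex_vector.span_scale) auto
    also have "\<dots> = (\<Sum>w\<in>t. if w = v then u v *\<^sub>C f i v else 0)"
    proof (intro sum.cong refl)
      fix w assume w: "w \<in> t"
      then obtain j where j: "j \<in> I" "w = p j" using t(2) by blast
      have "f i (u w *\<^sub>C w) = u w *\<^sub>C f i w"
        using clinear_on_scaleC[OF lin[OF i(1)]] p j by simp
      then show "f i (u w *\<^sub>C w) = (if w = v then u v *\<^sub>C f i v else 0)"
        using zero[OF i(1) j(1)] i j by auto
    qed
    also have "\<dots> = u v *\<^sub>C f i v" using t(1,4) by simp
    finally show False using nz i t(5) by simp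
  qed
  then have "finite (p ` I)"
    using complex_vector.independent_span_bound[OF B] p by blast
  then show ?thesis using finite_imageD inj by blast
qed

lemma root_of_unity_sum:
  assumes "0 < n" "i < n"
  shows "(\<Sum>j<n. (cis (2 * pi / real n) ^ j) ^ i) = (if i = 0 then of_nat n else 0)"
proof (cases "i = 0")
  case False
  let ?w = "cis (2 * pi / real n) ^ i"
  have "?w = cis (2 * pi * real i / real n)" by (simp add: Complex.DeMoivre mult_ac)
  moreover have "cis (2 * pi * real i / real n) \<noteq> 1"
  proof
    assume "cis (2 * pi * real i / real n) = 1"
    then have "cos (2 * pi * real i / real n) = 1" by (simp add: complex_eq_iff)
    then obtain m :: int where "2 * pi * real i / real n = real_of_int m * 2 * pi"
      using cos_one_2pi_int by blast
    then have "real i = real_of_int m * real n" using assms by (simp add: field_simps)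
    then have eq: "int i = m * int n" by (metis of_int_eq_iff of_int_mult of_int_of_nat_eq)
    with False assms have "m > 0" by (metis nat_less_le not_gr_zero of_nat_0_less_iff zero_less_mult_pos2)
    then have "int n \<le> m * int n" using assms by simp
    with eq assms show False by linarith
  qed
  ultimately have ne: "?w \<noteq> 1" by simp
  have "?w ^ n = (cis (2 * pi / real n) ^ n) ^ i" by (metis power_mult mult.commute)
  also have "cis (2 * pi / real n) ^ n = 1" using assms by (simp add: Complex.DeMoivre)
  finally have one: "?w ^ n = 1" by simp
  have "(\<Sum>j<n. (cis (2 * pi / real n) ^ j) ^ i) = (\<Sum>j<n. ?w ^ j)"
    by (intro sum.cong refl) (metis power_mult mult.commute)
  also have "\<dots> = 0" using ne one by (simp add: geometric_sum)
  finally show ?thesis using False by simp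
qed simp

text \<open>An operator \<open>f\<close> with \<open>f\<^sup>n = s\<close> decomposes every vector into its eigenvectors
  \<open>\<Sum>i<n. t\<^sup>-\<^sup>i f\<^sup>i v\<close> with \<open>t\<^sup>n = s\<close> (up to the factor \<open>n\<close>), so one of these is nonzero. It is
  again an eigenvector of every operator which commutes with \<open>f\<close> and has \<open>v\<close> as an eigenvector,
  so operators may be treated one after the other.\<close>

lemma common_eigenvector:
  fixes f :: "'i \<Rightarrow> 'a::complex_vector \<Rightarrow> 'a"
  assumes fin: "finite I" and V: "csubspace V" "v0 \<in> V" "v0 \<noteq> 0"
    and lin: "\<And>i. i \<in> I \<Longrightarrow> clinear_on V (f i)"
    and inV: "\<And>i v. i \<in> I \<Longrightarrow> v \<in> V \<Longrightarrow> f i v \<in> V"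
    and comm: "\<And>i j v. i \<in> I \<Longrightarrow> j \<in> I \<Longrightarrow> v \<in> V \<Longrightarrow> f i (f j v) = f j (f i v)"
    and n: "0 < n" and s: "\<And>i. i \<in> I \<Longrightarrow> \<exists>s. s \<noteq> 0 \<and> (\<forall>v\<in>V. (f i ^^ n) v = s *\<^sub>C v)"
  shows "\<exists>v\<in>V. v \<noteq> 0 \<and> (\<forall>i\<in>I. \<exists>z. f i v = z *\<^sub>C v)"
  using fin subset_refl[of I]
proof (induction I rule: finite_subset_induct')
  case empty
  then show ?case using V by blast
next
  case (insert i J)
  then obtain v where v: "v \<in> V" "v \<noteq> 0" "\<forall>j\<in>J. \<exists>z. f j v = z *\<^sub>C v" by blast
  obtain s where s: "s \<noteq> 0" "(f i ^^ n) v = s *\<^sub>C v" using s insert v by blast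
  obtain a where a: "a ^ n = s" "a \<noteq> 0"
    using n s(1) exists_complex_root[of n s] by (metis not_gr_zero power_0_left)
  define t where "t j = a * cis (2 * pi / real n) ^ j" for j
  define u where "u j = (\<Sum>k<n. inverse (t j) ^ k *\<^sub>C (f i ^^ k) v)" for j
  have t0: "t j \<noteq> 0" for j using a(2) by (simp add: t_def)
  have tn: "t j ^ n = s" for j
  proof -
    have "cis (2 * pi / real n) ^ n = 1" using n by (simp add: Complex.DeMoivre)
    then show ?thesis
      by (metis a(1) mult.right_neutral power_mult_distrib power_one t_def power_mult mult.commute)
  qed
  have pow: "(f i ^^ k) v \<in> V" for k
    by (induction k) (use v inV insert in auto)
  have uV: "u j \<in> V" for j
    unfolding u_def using V(1) pow
    by (intro complex_vector.subspace_sum complex_vector.subspace_scale) auto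
  have eig: "f i (u j) = t j *\<^sub>C u j" for j
  proof -
    let ?g = "\<lambda>k. inverse (t j) ^ k *\<^sub>C (f i ^^ k) v"
    have "f i (u j) = (\<Sum>k<n. f i (?g k))"
      unfolding u_def using insert pow V(1)
      by (intro clinear_on_sum[OF lin]) (auto intro: complex_vector.subspace_scale)
    also have "\<dots> = (\<Sum>k<n. t j *\<^sub>C ?g (Suc k))"
    proof (intro sum.cong refl)
      fix k
      have "f i (?g k) = inverse (t j) ^ k *\<^sub>C f i ((f i ^^ k) v)"
        using clinear_on_scaleC[OF lin pow] insert by blast
      moreover have "t j *\<^sub>C ?g (Suc k) = (t j * inverse (t j) ^ Suc k) *\<^sub>C f i ((f i ^^ k) v)"
        by (simp only: scaleC_scaleC funpow.simps comp_apply)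
      moreover have "t j * inverse (t j) ^ Suc k = inverse (t j) ^ k" using t0 by simp
      ultimately show "f i (?g k) = t j *\<^sub>C ?g (Suc k)" by simp
    qed
    also have "\<dots> = t j *\<^sub>C (\<Sum>k<n. ?g (Suc k))"
      by (simp add: complex_vector.scale_sum_right)
    also have "(\<Sum>k<n. ?g (Suc k)) = (\<Sum>k<n. ?g k) + ?g n - ?g 0"
      using sum.lessThan_Suc_shift[of ?g n] sum.lessThan_Suc[of ?g n]
      by (simp only: eq_diff_eq add.commute)
    also have "?g n = v"
      using s tn t0 by (simp add: scaleC_scaleC power_inverse scaleC_one)
    finally show ?thesis by (simp add: u_def scaleC_one)
  qed
  have "\<exists>j<n. u j \<noteq> 0"
  proof (rule ccontr)
    assume "\<not> (\<exists>j<n. u j \<noteq> 0)"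
    then have "0 = (\<Sum>j<n. u j)" by simp
    also have "\<dots> = (\<Sum>k<n. (\<Sum>j<n. inverse (t j) ^ k) *\<^sub>C (f i ^^ k) v)"
      unfolding u_def by (subst sum.swap) (simp add: complex_vector.scale_sum_left)
    also have "\<dots> = (\<Sum>k<n. (if k = 0 then of_nat n else 0) *\<^sub>C (f i ^^ k) v)"
    proof (intro sum.cong refl)
      fix k assume k: "k \<in> {..<n}"
      let ?w = "cis (2 * pi / real n)"
      have "(\<Sum>j<n. inverse (t j) ^ k) = inverse a ^ k * cnj (\<Sum>j<n. (?w ^ j) ^ k)"
      proof -
        have "inverse (?w ^ j) = cnj (?w ^ j)" for j
          by (simp only: complex_cnj_power cis_cnj power_inverse[symmetric] cis_inverse)
        then show ?thesis
          by (simp add: t_def power_mult_distrib sum_distrib_left)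
      qed
      also have "(\<Sum>j<n. (?w ^ j) ^ k) = (if k = 0 then of_nat n else 0)"
        using k n by (intro root_of_unity_sum) auto
      finally show "(\<Sum>j<n. inverse (t j) ^ k) *\<^sub>C (f i ^^ k) v
          = (if k = 0 then of_nat n else 0) *\<^sub>C (f i ^^ k) v" by simp
    qed
    also have "\<dots> = (\<Sum>k<n. if k = 0 then of_nat n *\<^sub>C v else 0)"
      by (intro sum.cong refl) auto
    also have "\<dots> = of_nat n *\<^sub>C v" using n by simp
    finally show False using n v(2) by simp
  qed
  then obtain j where j: "u j \<noteq> 0" by blast
  have "\<exists>z. f k (u j) = z *\<^sub>C u j" if k: "k \<in> J" for k
  proof -
    obtain z where z: "f k v = z *\<^sub>C v" using v k by blast
    have kI: "k \<in> I" "i \<in> I" using insert k by auto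
    have "f k ((f i ^^ l) v) = z *\<^sub>C (f i ^^ l) v" for l
    proof (induction l)
      case (Suc l)
      then show ?case
        using comm[OF kI pow[of l]] clinear_on_scaleC[OF lin[OF kI(2)] pow[of l]] by simp
    qed (use z in simp)
    then have "f k (inverse (t j) ^ l *\<^sub>C (f i ^^ l) v) = z *\<^sub>C inverse (t j) ^ l *\<^sub>C (f i ^^ l) v" for l
      using clinear_on_scaleC[OF lin[OF kI(1)] pow[of l]] by (simp add: scaleC_scaleC mult.commute)
    moreover have "f k (u j) = (\<Sum>l<n. f k (inverse (t j) ^ l *\<^sub>C (f i ^^ l) v))"
      unfolding u_def using kI pow V(1)
      by (intro clinear_on_sum[OF lin]) (auto intro: complex_vector.subspace_scale)
    ultimately show ?thesis by (auto simp: u_def complex_vector.scale_sum_right)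
  qed
  then show ?case using j uV eig by blast
qed

lemma norm_1_cnj: "norm (z::complex) = 1 \<longleftrightarrow> cnj z * z = 1"
proof -
  have "cnj z * z = of_real ((norm z)\<^sup>2)" by (simp only: complex_norm_square mult.commute)
  moreover have "of_real ((norm z)\<^sup>2) = (1::complex) \<longleftrightarrow> (norm z)\<^sup>2 = 1" by (rule of_real_eq_1_iff)
  moreover have "(norm z)\<^sup>2 = 1 \<longleftrightarrow> norm z = 1"
    using norm_ge_zero[of z] unfolding power2_eq_1_iff by linarith
  ultimately show ?thesis by simp
qed

lemma unit_cnj: "norm (z::complex) = 1 \<Longrightarrow> z * cnj z = 1"
  by (simp add: complex_norm_square[symmetric])

lemma unit_cnj': "norm (z::complex) = 1 \<Longrightarrow> cnj z * z = 1"
  by (subst mult.commute) (rule unit_cnj)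


section \<open>Twisted group algebras\<close>

text \<open>The endomorphism algebra of an object \<open>a\<close> has a basis of unitaries \<open>U k\<close>, indexed by a finite abelian
  group, which multiply up to the phases \<open>c k l\<close>. Nothing is assumed about \<open>D\<close> away from \<open>a\<close>, since
  the subobjects of \<open>a\<close> and their arrows live in this algebra. The axioms describe the operations on
  linear combinations of the basis; bilinearity, associativity and the laws of the involution are
  consequences. The factor in the identity occurs because \<open>U \<one>\<close> is only a multiple of it.\<close>

locale twisted_group_algebra =
  fixes D :: "('o, 'v::complex_vector) tcat" (structure)
    and a :: 'o
    and Q :: "('k, 'z) monoid_scheme"
    and U :: "'k \<Rightarrow> 'v"
    and c :: "'k \<Rightarrow> 'k \<Rightarrow> complex"
  assumes Q_group: "comm_group Q" and Q_finite: "finite (carrier Q)"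
    and ob_a: "a \<in> ob D"
    and Hom_eq: "Hom D a a = range (\<lambda>x. \<Sum>k\<in>carrier Q. x k *\<^sub>C U k)"
    and independent: "\<lbrakk>(\<Sum>k\<in>carrier Q. x k *\<^sub>C U k) = 0; l \<in> carrier Q\<rbrakk> \<Longrightarrow> x l = 0"
    and cmp_sum: "(\<Sum>k\<in>carrier Q. x k *\<^sub>C U k) \<cdot> (\<Sum>l\<in>carrier Q. y l *\<^sub>C U l)
      = (\<Sum>k\<in>carrier Q. \<Sum>l\<in>carrier Q. (x k * y l * c k l) *\<^sub>C U (k \<otimes>\<^bsub>Q\<^esub> l))"
    and norm_c: "\<lbrakk>k \<in> carrier Q; l \<in> carrier Q\<rbrakk> \<Longrightarrow> norm (c k l) = 1"
    and cocycle: "\<lbrakk>k \<in> carrier Q; l \<in> carrier Q; m \<in> carrier Q\<rbrakk>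
      \<Longrightarrow> c k l * c (k \<otimes>\<^bsub>Q\<^esub> l) m = c l m * c k (l \<otimes>\<^bsub>Q\<^esub> m)"
    and idt_eq: "idt D a = cnj (c \<one>\<^bsub>Q\<^esub> \<one>\<^bsub>Q\<^esub>) *\<^sub>C U \<one>\<^bsub>Q\<^esub>"
    and str_sum: "str D (\<Sum>k\<in>carrier Q. x k *\<^sub>C U k) = (\<Sum>k\<in>carrier Q. cnj (x k) *\<^sub>C str D (U k))"
    and str_U_in: "k \<in> carrier Q \<Longrightarrow> str D (U k) \<in> Hom D a a"
    and str_U_U: "k \<in> carrier Q \<Longrightarrow> str D (U k) \<cdot> U k = idt D a"
begin

sublocale Q: comm_group Q by (rule Q_group)

abbreviation A :: "'v set" where "A \<equiv> Hom D a a"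

abbreviation I :: 'v where "I \<equiv> idt D a"

abbreviation lin :: "('k \<Rightarrow> complex) \<Rightarrow> 'v" where
  "lin x \<equiv> \<Sum>k\<in>carrier Q. x k *\<^sub>C U k"

lemma lin_in [simp]: "lin x \<in> A"
  unfolding Hom_eq by blast

lemma A_cases: "b \<in> A \<Longrightarrow> (\<And>x. b = lin x \<Longrightarrow> P) \<Longrightarrow> P"
  unfolding Hom_eq by blast

lemma lin_add: "lin x + lin y = lin (\<lambda>k. x k + y k)"
  by (simp add: scaleC_add_left sum.distrib)

lemma lin_scale: "z *\<^sub>C lin x = lin (\<lambda>k. z * x k)"
  by (simp add: complex_vector.scale_sum_right scaleC_scaleC)

lemma A_subspace: "csubspace A"
proof (rule complex_vector.subspaceI)
  show "0 \<in> A" using lin_in[of "\<lambda>_. 0"] by simp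
  show "x + y \<in> A" if "x \<in> A" "y \<in> A" for x y
    using that by (elim A_cases) (simp only: lin_add lin_in)
  show "z *\<^sub>C x \<in> A" if "x \<in> A" for x z
    using that by (elim A_cases) (simp only: lin_scale lin_in)
qed

lemma U_eq_lin: "k \<in> carrier Q \<Longrightarrow> U k = lin (\<lambda>l. if l = k then 1 else 0)"
  using Q_finite by (simp add: if_distrib[of "\<lambda>z. z *\<^sub>C _"] scaleC_one cong: if_cong)

lemma U_in [simp]: "k \<in> carrier Q \<Longrightarrow> U k \<in> A"
  by (subst U_eq_lin) auto

lemma I_in [simp]: "I \<in> A"
  unfolding idt_eq using A_subspace by (auto intro: complex_vector.subspace_scale)

lemma scale_in [simp]: "b \<in> A \<Longrightarrow> z *\<^sub>C b \<in> A"
  using A_subspace by (rule complex_vector.subspace_scale)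

lemma sum_in [simp]: "(\<And>i. i \<in> J \<Longrightarrow> b i \<in> A) \<Longrightarrow> sum b J \<in> A"
  using A_subspace by (rule complex_vector.subspace_sum)

lemma U_nonzero: "k \<in> carrier Q \<Longrightarrow> U k \<noteq> 0"
  using independent[of "\<lambda>l. if l = k then 1 else 0" k] U_eq_lin[of k] by auto

lemma lin_eqD: "lin x = lin y \<Longrightarrow> k \<in> carrier Q \<Longrightarrow> x k = y k"
  using independent[of "\<lambda>k. x k - y k" k]
  by (simp add: complex_vector.scale_left_diff_distrib sum_subtractf)

lemma cmp_in_A [simp]: "b \<in> A \<Longrightarrow> d \<in> A \<Longrightarrow> b \<cdot> d \<in> A"
  by (elim A_cases) (simp add: cmp_sum Q_group comm_group.axioms)

lemma cmp_linear_left: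
  assumes "d \<in> A"
  shows "clinear_on A (\<lambda>b. b \<cdot> d)"
proof -
  obtain y where d: "d = lin y" using assms by (rule A_cases)
  have 1: "(lin x + lin x') \<cdot> d = lin x \<cdot> d + lin x' \<cdot> d" for x x'
    unfolding d lin_add cmp_sum
    by (simp add: algebra_simps scaleC_add_left sum.distrib)
  have 2: "(z *\<^sub>C lin x) \<cdot> d = z *\<^sub>C (lin x \<cdot> d)" for z x
    unfolding d lin_scale cmp_sum
    by (simp add: mult.assoc complex_vector.scale_sum_right scaleC_scaleC)
  show ?thesis
    unfolding clinear_on_def using 1 2 by (auto simp: Hom_eq)
qed

lemma cmp_linear_right:
  assumes "d \<in> A"
  shows "clinear_on A (\<lambda>b. d \<cdot> b)"
proof -
  obtain y where d: "d = lin y" using assms by (rule A_cases)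
  have 1: "d \<cdot> (lin x + lin x') = d \<cdot> lin x + d \<cdot> lin x'" for x x'
    unfolding d lin_add cmp_sum
    by (simp add: algebra_simps scaleC_add_left sum.distrib)
  have 2: "d \<cdot> (z *\<^sub>C lin x) = z *\<^sub>C (d \<cdot> lin x)" for z x
    unfolding d lin_scale cmp_sum
    by (simp add: mult.left_commute mult.assoc complex_vector.scale_sum_right scaleC_scaleC)
  show ?thesis
    unfolding clinear_on_def using 1 2 by (auto simp: Hom_eq)
qed

lemmas scale_cmp [simp] = clinear_on_scaleC[OF cmp_linear_left]
lemmas cmp_scale [simp] = clinear_on_scaleC[OF cmp_linear_right]
lemmas add_cmp = clinear_on_add[OF cmp_linear_left]
lemmas cmp_add = clinear_on_add[OF cmp_linear_right]
lemmas cmp_diff = clinear_on_diff[OF cmp_linear_right A_subspace]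
lemmas sum_cmp = clinear_on_sum[OF cmp_linear_left A_subspace]
lemmas cmp_sum_right = clinear_on_sum[OF cmp_linear_right A_subspace]
lemmas zero_cmp [simp] = clinear_on_zero[OF cmp_linear_left A_subspace]
lemmas cmp_zero [simp] = clinear_on_zero[OF cmp_linear_right A_subspace]

lemma clinear_ext:
  assumes "clinear_on A f" "clinear_on A g" "\<And>k. k \<in> carrier Q \<Longrightarrow> f (U k) = g (U k)" "b \<in> A"
  shows "f b = g b"
proof -
  obtain x where b: "b = lin x" using assms(4) by (rule A_cases)
  have "f b = (\<Sum>k\<in>carrier Q. f (x k *\<^sub>C U k))"
    unfolding b by (rule clinear_on_sum[OF assms(1) A_subspace]) simp
  also have "\<dots> = (\<Sum>k\<in>carrier Q. g (x k *\<^sub>C U k))"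
    using clinear_on_scaleC[OF assms(1)] clinear_on_scaleC[OF assms(2)] assms(3) by simp
  also have "\<dots> = g b"
    unfolding b by (rule clinear_on_sum[OF assms(2) A_subspace, symmetric]) simp
  finally show ?thesis .
qed

lemma clinear_comp: "clinear_on A f \<Longrightarrow> (\<And>b. b \<in> A \<Longrightarrow> f b \<in> A) \<Longrightarrow> clinear_on A g \<Longrightarrow> clinear_on A (\<lambda>b. g (f b))"
  unfolding clinear_on_def by simp

lemma cmp_U: "k \<in> carrier Q \<Longrightarrow> l \<in> carrier Q \<Longrightarrow> U k \<cdot> U l = c k l *\<^sub>C U (k \<otimes>\<^bsub>Q\<^esub> l)"
proof -
  assume k: "k \<in> carrier Q" and l: "l \<in> carrier Q"
  have "(\<Sum>k'\<in>carrier Q. \<Sum>l'\<in>carrier Q.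
      ((if k' = k then 1 else 0) * (if l' = l then 1 else 0) * c k' l') *\<^sub>C U (k' \<otimes>\<^bsub>Q\<^esub> l'))
    = (\<Sum>k'\<in>carrier Q. \<Sum>l'\<in>carrier Q. if l' = l then if k' = k then c k l *\<^sub>C U (k \<otimes>\<^bsub>Q\<^esub> l) else 0 else 0)"
    by (intro sum.cong refl) auto
  also have "\<dots> = c k l *\<^sub>C U (k \<otimes>\<^bsub>Q\<^esub> l)" using k l Q_finite by simp
  finally have "lin (\<lambda>k'. if k' = k then 1 else 0) \<cdot> lin (\<lambda>l'. if l' = l then 1 else 0)
      = c k l *\<^sub>C U (k \<otimes>\<^bsub>Q\<^esub> l)"
    by (simp only: cmp_sum)
  then show ?thesis by (simp only: U_eq_lin[OF k, symmetric] U_eq_lin[OF l, symmetric])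
qed

lemma c_nonzero: "k \<in> carrier Q \<Longrightarrow> l \<in> carrier Q \<Longrightarrow> c k l \<noteq> 0"
  using norm_c by fastforce

lemma c_cnj: "k \<in> carrier Q \<Longrightarrow> l \<in> carrier Q \<Longrightarrow> c k l * cnj (c k l) = 1"
  using norm_c[of k l] by (simp add: complex_norm_square[symmetric])

lemma cmp_assoc: "b \<in> A \<Longrightarrow> d \<in> A \<Longrightarrow> e \<in> A \<Longrightarrow> (b \<cdot> d) \<cdot> e = b \<cdot> (d \<cdot> e)"
proof -
  have 1: "(U k \<cdot> U l) \<cdot> U m = U k \<cdot> (U l \<cdot> U m)"
    if "k \<in> carrier Q" "l \<in> carrier Q" "m \<in> carrier Q" for k l m
    using that cocycle[OF that] by (simp add: cmp_U scaleC_scaleC Q.m_assoc)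
  have 2: "(U k \<cdot> U l) \<cdot> e = U k \<cdot> (U l \<cdot> e)"
    if "k \<in> carrier Q" "l \<in> carrier Q" "e \<in> A" for k l e
  proof (rule clinear_ext[of "\<lambda>e. (U k \<cdot> U l) \<cdot> e" "\<lambda>e. U k \<cdot> (U l \<cdot> e)"])
    show "clinear_on A (\<lambda>e. U k \<cdot> U l \<cdot> e)" using that by (intro cmp_linear_right) simp
    show "clinear_on A (\<lambda>e. U k \<cdot> (U l \<cdot> e))"
      by (rule clinear_comp[of "\<lambda>e. U l \<cdot> e" "\<lambda>e. U k \<cdot> e"]) (use that in \<open>auto intro: cmp_linear_right\<close>)
  qed (use that 1 in simp_all)
  have 3: "(U k \<cdot> d) \<cdot> e = U k \<cdot> (d \<cdot> e)"
    if "k \<in> carrier Q" "d \<in> A" "e \<in> A" for k d e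
  proof (rule clinear_ext[of "\<lambda>d. (U k \<cdot> d) \<cdot> e" "\<lambda>d. U k \<cdot> (d \<cdot> e)"])
    show "clinear_on A (\<lambda>d. U k \<cdot> d \<cdot> e)"
      by (rule clinear_comp[of "\<lambda>d. U k \<cdot> d" "\<lambda>d. d \<cdot> e"])
        (use that in \<open>auto intro: cmp_linear_left cmp_linear_right\<close>)
    show "clinear_on A (\<lambda>d. U k \<cdot> (d \<cdot> e))"
      by (rule clinear_comp[of "\<lambda>d. d \<cdot> e" "\<lambda>d. U k \<cdot> d"])
        (use that in \<open>auto intro: cmp_linear_left cmp_linear_right\<close>)
  qed (use that 2 in simp_all)
  show "(b \<cdot> d) \<cdot> e = b \<cdot> (d \<cdot> e)" if "b \<in> A" "d \<in> A" "e \<in> A"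
  proof (rule clinear_ext[of "\<lambda>b. (b \<cdot> d) \<cdot> e" "\<lambda>b. b \<cdot> (d \<cdot> e)"])
    show "clinear_on A (\<lambda>b. b \<cdot> d \<cdot> e)"
      by (rule clinear_comp[of "\<lambda>b. b \<cdot> d" "\<lambda>b. b \<cdot> e"]) (use that in \<open>auto intro: cmp_linear_left\<close>)
    show "clinear_on A (\<lambda>b. b \<cdot> (d \<cdot> e))" using that by (intro cmp_linear_left) simp
  qed (use that 3 in simp_all)
qed

lemma c_one_left: "k \<in> carrier Q \<Longrightarrow> c \<one>\<^bsub>Q\<^esub> k = c \<one>\<^bsub>Q\<^esub> \<one>\<^bsub>Q\<^esub>"
  using cocycle[of "\<one>\<^bsub>Q\<^esub>" "\<one>\<^bsub>Q\<^esub>" k] c_nonzero[of "\<one>\<^bsub>Q\<^esub>" k] by simp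

lemma c_one_right: "k \<in> carrier Q \<Longrightarrow> c k \<one>\<^bsub>Q\<^esub> = c \<one>\<^bsub>Q\<^esub> \<one>\<^bsub>Q\<^esub>"
  using cocycle[of k "\<one>\<^bsub>Q\<^esub>" "\<one>\<^bsub>Q\<^esub>"] c_nonzero[of k "\<one>\<^bsub>Q\<^esub>"] by simp

lemma I_cmp [simp]: "b \<in> A \<Longrightarrow> I \<cdot> b = b"
proof -
  have "I \<cdot> U k = U k" if "k \<in> carrier Q" for k
    using that c_cnj[of "\<one>\<^bsub>Q\<^esub>" "\<one>\<^bsub>Q\<^esub>"]
    by (simp add: idt_eq cmp_U c_one_left[OF that] scaleC_scaleC mult.commute)
  then show "I \<cdot> b = b" if "b \<in> A"
    using that clinear_ext[of "\<lambda>b. I \<cdot> b" "\<lambda>b. b" b] cmp_linear_right[of I]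
    by (simp add: clinear_on_def)
qed

lemma cmp_I [simp]: "b \<in> A \<Longrightarrow> b \<cdot> I = b"
proof -
  have "U k \<cdot> I = U k" if "k \<in> carrier Q" for k
    using that c_cnj[of "\<one>\<^bsub>Q\<^esub>" "\<one>\<^bsub>Q\<^esub>"]
    by (simp add: idt_eq cmp_U c_one_right[OF that] scaleC_scaleC mult.commute)
  then show "b \<cdot> I = b" if "b \<in> A"
    using that clinear_ext[of "\<lambda>b. b \<cdot> I" "\<lambda>b. b" b] cmp_linear_left[of I]
    by (simp add: clinear_on_def)
qed

subsection \<open>The involution\<close>

text \<open>The adjoint of a basis element is a left inverse, hence the inverse and a multiple of modulus one
  of a basis element. This makes the antilinear map \<^term>\<open>str D\<close> an involutive antihomomorphism.\<close>

lemma U_inverse: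
  assumes k: "k \<in> carrier Q"
  obtains s where "norm s = 1" "str D (U k) = s *\<^sub>C U (inv\<^bsub>Q\<^esub> k)" "U k \<cdot> str D (U k) = I"
proof -
  let ?s = "cnj (c \<one>\<^bsub>Q\<^esub> \<one>\<^bsub>Q\<^esub>) * cnj (c k (inv\<^bsub>Q\<^esub> k))"
  have n: "norm ?s = 1" using k norm_c by (simp add: norm_mult)
  have *: "U k \<cdot> (?s *\<^sub>C U (inv\<^bsub>Q\<^esub> k)) = I"
    using k c_cnj[of k "inv\<^bsub>Q\<^esub> k"] by (simp add: cmp_U scaleC_scaleC idt_eq mult_ac)
  have "str D (U k) = str D (U k) \<cdot> (U k \<cdot> (?s *\<^sub>C U (inv\<^bsub>Q\<^esub> k)))"
    using * k str_U_in by (metis cmp_I)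
  also have "\<dots> = (str D (U k) \<cdot> U k) \<cdot> (?s *\<^sub>C U (inv\<^bsub>Q\<^esub> k))"
    using k str_U_in by (subst cmp_assoc) auto
  also have "\<dots> = ?s *\<^sub>C U (inv\<^bsub>Q\<^esub> k)" using k str_U_U[OF k] by simp
  finally show ?thesis using that n * by metis
qed

lemma str_in_A [simp]:
  assumes "b \<in> A"
  shows "str D b \<in> A"
proof -
  obtain x where b: "b = lin x" using assms by (rule A_cases)
  show ?thesis unfolding b str_sum by (intro sum_in scale_in str_U_in)
qed

lemma str_add:
  assumes "b \<in> A" "d \<in> A"
  shows "str D (b + d) = str D b + str D d"
proof -
  obtain x y where b: "b = lin x" and d: "d = lin y" using assms by (elim A_cases)
  show ?thesis unfolding b d lin_add str_sum by (simp add: scaleC_add_left sum.distrib)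
qed

lemma str_scale [simp]:
  assumes "b \<in> A"
  shows "str D (z *\<^sub>C b) = cnj z *\<^sub>C str D b"
proof -
  obtain x where b: "b = lin x" using assms by (rule A_cases)
  show ?thesis
    unfolding b lin_scale str_sum by (simp add: complex_vector.scale_sum_right scaleC_scaleC)
qed

lemma U_str_U: "k \<in> carrier Q \<Longrightarrow> U k \<cdot> str D (U k) = I"
  using U_inverse by metis

lemma left_inverse_unique:
  assumes "b \<in> A" "d \<in> A" "e \<in> A" "b \<cdot> d = I" "d \<cdot> e = I"
  shows "b = e"
  using assms cmp_assoc[of b d e] by simp

lemma str_str_A [simp]: "b \<in> A \<Longrightarrow> str D (str D b) = b"
proof -
  have 1: "str D (str D (U k)) = U k" if k: "k \<in> carrier Q" for k
  proof -
    obtain s where s: "norm s = 1" "str D (U k) = s *\<^sub>C U (inv\<^bsub>Q\<^esub> k)"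
      using U_inverse[OF k] by metis
    have ss: "cnj s * s = 1" using s(1) by (metis complex_norm_square mult.commute of_real_1 power_one)
    let ?l = "inv\<^bsub>Q\<^esub> k"
    have e: "str D (str D (U k)) = cnj s *\<^sub>C str D (U ?l)" using s k by simp
    have "(cnj s *\<^sub>C str D (U ?l)) \<cdot> (s *\<^sub>C U ?l) = I"
      using k ss str_U_U[of ?l] by (simp add: scaleC_scaleC mult.commute[of s])
    moreover have "(s *\<^sub>C U ?l) \<cdot> U k = I" using s str_U_U[OF k] by simp
    ultimately show ?thesis
      unfolding e using k left_inverse_unique[of _ "s *\<^sub>C U ?l"] by simp
  qed
  show "str D (str D b) = b" if b: "b \<in> A"
  proof (rule clinear_ext[OF _ _ _ b, of "\<lambda>b. str D (str D b)" "\<lambda>b. b"])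
    show "clinear_on A (\<lambda>b. str D (str D b))" by (simp add: clinear_on_def str_add)
  qed (use 1 in \<open>simp_all add: clinear_on_def\<close>)
qed

text \<open>For basis elements both sides are inverses of the same element. The general case follows by
  linearity from the form \<open>b \<cdot> d = (d\<^sup>* \<cdot> b\<^sup>*)\<^sup>*\<close>, in which both sides are linear in \<open>b\<close> and \<open>d\<close>.\<close>

lemma str_cmp_A: "b \<in> A \<Longrightarrow> d \<in> A \<Longrightarrow> str D (b \<cdot> d) = str D d \<cdot> str D b"
proof -
  have 1: "str D (U k \<cdot> U l) = str D (U l) \<cdot> str D (U k)"
    if k: "k \<in> carrier Q" and l: "l \<in> carrier Q" for k l
  proof (rule sym, rule left_inverse_unique[of _ "U k \<cdot> U l"])
    have "(str D (U l) \<cdot> str D (U k)) \<cdot> (U k \<cdot> U l) = str D (U l) \<cdot> ((str D (U k) \<cdot> U k) \<cdot> U l)"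
      using k l by (simp add: cmp_assoc)
    also have "\<dots> = I" using k l by (simp add: str_U_U)
    finally show "(str D (U l) \<cdot> str D (U k)) \<cdot> (U k \<cdot> U l) = I" .
    show "U k \<cdot> U l \<cdot> str D (U k \<cdot> U l) = I"
      using k l c_cnj[of k l] U_str_U[of "k \<otimes>\<^bsub>Q\<^esub> l"] by (simp add: cmp_U scaleC_scaleC mult.commute)
  qed (use k l in auto)
  have c: "str D d \<cdot> str D b = str D (str D (str D d \<cdot> str D b))" if "b \<in> A" "d \<in> A" for b d
    using that by simp
  have lin1: "clinear_on A (\<lambda>d. str D (str D d \<cdot> e))" if "e \<in> A" for e
    using that by (simp add: clinear_on_def str_add add_cmp)
  have lin2: "clinear_on A (\<lambda>d. str D (e \<cdot> str D d))" if "e \<in> A" for e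
    using that by (simp add: clinear_on_def str_add cmp_add)
  have 2: "U k \<cdot> d = str D (str D d \<cdot> str D (U k))" if k: "k \<in> carrier Q" and d: "d \<in> A" for k d
  proof (rule clinear_ext[of "\<lambda>d. U k \<cdot> d" "\<lambda>d. str D (str D d \<cdot> str D (U k))", OF _ lin1 _ d])
    show "clinear_on A (\<lambda>d. U k \<cdot> d)" using k by (intro cmp_linear_right) simp
    show "U k \<cdot> U l = str D (str D (U l) \<cdot> str D (U k))" if "l \<in> carrier Q" for l
      using k that str_str_A[of "U k \<cdot> U l"] by (simp add: 1)
  qed (use k in simp)
  have 3: "b \<cdot> d = str D (str D d \<cdot> str D b)" if b: "b \<in> A" and d: "d \<in> A" for b d
  proof (rule clinear_ext[of "\<lambda>b. b \<cdot> d" "\<lambda>b. str D (str D d \<cdot> str D b)", OF _ lin2 _ b])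
    show "clinear_on A (\<lambda>b. b \<cdot> d)" using d by (rule cmp_linear_left)
  qed (use d 2 in simp_all)
  show "str D (b \<cdot> d) = str D d \<cdot> str D b" if "b \<in> A" "d \<in> A"
    using 3[OF that] that by simp
qed

subsection \<open>Characters of isotropic subgroups\<close>

definition isotropic :: "'k set \<Rightarrow> bool" where
  "isotropic H \<longleftrightarrow> (\<forall>h\<in>H. \<forall>h'\<in>H. c h h' = c h' h)"

text \<open>The functions \<open>\<phi>\<close> for which \<open>U h \<mapsto> \<phi> h\<close> defines a unitary character of the algebra spanned by the
  \<open>U h\<close>, \<open>h \<in> H\<close>. They are the characters of the group \<open>H\<close> twisted by the cocycle, and \<open>proj H \<phi>\<close> is the
  projection onto the part on which this algebra acts by \<open>\<phi>\<close>.\<close>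

definition chars :: "'k set \<Rightarrow> ('k \<Rightarrow> complex) set" where
  "chars H = {\<phi> \<in> extensional H. (\<forall>h\<in>H. norm (\<phi> h) = 1) \<and>
    (\<forall>h\<in>H. \<forall>h'\<in>H. \<phi> h * \<phi> h' = c h h' * \<phi> (h \<otimes>\<^bsub>Q\<^esub> h'))}"

definition proj :: "'k set \<Rightarrow> ('k \<Rightarrow> complex) \<Rightarrow> 'v" where
  "proj H \<phi> = (1 / of_nat (card H)) *\<^sub>C (\<Sum>h\<in>H. cnj (\<phi> h) *\<^sub>C U h)"

context
  fixes H assumes H: "subgroup H Q"
begin

lemma H_carrier [simp]: "h \<in> H \<Longrightarrow> h \<in> carrier Q"
  by (rule subgroup.mem_carrier[OF H])

lemma H_finite [simp]: "finite H"
  by (rule finite_subset[OF subgroup.subset[OF H] Q_finite])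

lemma H_card [simp]: "card H > 0"
  using H_finite subgroup.one_closed[OF H] by (auto simp: card_gt_0_iff)

lemma H_nonempty [simp]: "H \<noteq> {}"
  using subgroup.one_closed[OF H] by blast

lemma H_mult [simp]: "h \<in> H \<Longrightarrow> h' \<in> H \<Longrightarrow> h \<otimes>\<^bsub>Q\<^esub> h' \<in> H"
  by (rule subgroup.m_closed[OF H])

lemma proj_in [simp]: "proj H \<phi> \<in> A"
  unfolding proj_def by (intro scale_in sum_in) auto

lemma H_shift:
  assumes h: "h \<in> H"
  shows "(\<Sum>x\<in>H. f (h \<otimes>\<^bsub>Q\<^esub> x)) = (\<Sum>x\<in>H. f x)"
proof (rule sum.reindex_bij_witness[of _ "\<lambda>x. inv\<^bsub>Q\<^esub> h \<otimes>\<^bsub>Q\<^esub> x" "\<lambda>x. h \<otimes>\<^bsub>Q\<^esub> x"])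
qed (use h subgroup.m_inv_closed[OF H h] in \<open>auto simp: Q.m_assoc[symmetric]\<close>)

text \<open>For values of modulus one, \<open>\<phi>(h) \<phi>(x) = c(h, x) \<phi>(hx)\<close> is the same as
  \<open>c(h, x) \<phi>(x)\<^sup>* = \<phi>(h) \<phi>(hx)\<^sup>*\<close>, and so left multiplication by \<open>U h\<close> permutes the terms of
  the projection and produces the factor \<open>\<phi>(h)\<close>.\<close>

lemma chars_cnj:
  assumes "\<phi> \<in> chars H" "h \<in> H" "x \<in> H"
  shows "cnj (\<phi> x) * c h x = \<phi> h * cnj (\<phi> (h \<otimes>\<^bsub>Q\<^esub> x))"
proof -
  have n: "\<phi> x * cnj (\<phi> x) = 1" "\<phi> (h \<otimes>\<^bsub>Q\<^esub> x) * cnj (\<phi> (h \<otimes>\<^bsub>Q\<^esub> x)) = 1"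
    using assms unit_cnj by (auto simp: chars_def)
  have e: "\<phi> h * \<phi> x = c h x * \<phi> (h \<otimes>\<^bsub>Q\<^esub> x)" using assms by (simp add: chars_def)
  have "cnj (\<phi> x) * c h x = cnj (\<phi> x) * (c h x * \<phi> (h \<otimes>\<^bsub>Q\<^esub> x)) * cnj (\<phi> (h \<otimes>\<^bsub>Q\<^esub> x))"
    using n(2) by (simp add: mult.assoc)
  also have "\<dots> = \<phi> h * (\<phi> x * cnj (\<phi> x)) * cnj (\<phi> (h \<otimes>\<^bsub>Q\<^esub> x))"
    unfolding e[symmetric] by (simp add: mult_ac)
  finally show ?thesis using n by simp
qed

lemma chars_commute: "\<phi> \<in> chars H \<Longrightarrow> isotropic H"
  unfolding isotropic_def
proof (intro ballI)
  fix h h' assume \<phi>: "\<phi> \<in> chars H" and h: "h \<in> H" "h' \<in> H"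
  have "c h h' * \<phi> (h \<otimes>\<^bsub>Q\<^esub> h') = c h' h * \<phi> (h' \<otimes>\<^bsub>Q\<^esub> h)"
    using \<phi> h by (simp add: chars_def) (metis mult.commute)
  moreover have "\<phi> (h \<otimes>\<^bsub>Q\<^esub> h') \<noteq> 0" using \<phi> h by (force simp: chars_def)
  ultimately show "c h h' = c h' h" using h by (simp add: Q.m_comm)
qed

lemma U_proj:
  assumes \<phi>: "\<phi> \<in> chars H" and h: "h \<in> H"
  shows "U h \<cdot> proj H \<phi> = \<phi> h *\<^sub>C proj H \<phi>"
proof -
  have "U h \<cdot> proj H \<phi> = (1 / of_nat (card H)) *\<^sub>C (\<Sum>x\<in>H. U h \<cdot> (cnj (\<phi> x) *\<^sub>C U x))"
    unfolding proj_def using h by (subst cmp_scale, simp_all add: cmp_sum_right)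
  also have "(\<Sum>x\<in>H. U h \<cdot> (cnj (\<phi> x) *\<^sub>C U x))
      = (\<Sum>x\<in>H. \<phi> h *\<^sub>C cnj (\<phi> (h \<otimes>\<^bsub>Q\<^esub> x)) *\<^sub>C U (h \<otimes>\<^bsub>Q\<^esub> x))"
    using h chars_cnj[OF \<phi> h] by (intro sum.cong refl) (simp add: cmp_U scaleC_scaleC)
  also have "\<dots> = (\<Sum>x\<in>H. \<phi> h *\<^sub>C cnj (\<phi> x) *\<^sub>C U x)"
    using h by (rule H_shift)
  finally show ?thesis
    by (simp add: proj_def complex_vector.scale_sum_right scaleC_scaleC mult_ac)
qed

lemma proj_U:
  assumes \<phi>: "\<phi> \<in> chars H" and h: "h \<in> H"
  shows "proj H \<phi> \<cdot> U h = \<phi> h *\<^sub>C proj H \<phi>"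
proof -
  have comm: "U x \<cdot> U h = U h \<cdot> U x" if "x \<in> H" for x
    using that h chars_commute[OF \<phi>] by (simp add: cmp_U isotropic_def Q.m_comm)
  have "proj H \<phi> \<cdot> U h = U h \<cdot> proj H \<phi>"
    unfolding proj_def using h comm
    by (subst cmp_scale, simp, simp, subst scale_cmp) (simp_all add: cmp_sum_right sum_cmp)
  then show ?thesis using U_proj[OF assms] by simp
qed

lemma chars_eqI:
  assumes "\<phi> \<in> chars H" "\<phi>' \<in> chars H" "\<And>h. h \<in> H \<Longrightarrow> \<phi> h = \<phi>' h"
  shows "\<phi> = \<phi>'"
  using assms by (auto simp: chars_def intro: extensionalityI)

lemma proj_cmp_eigen:
  assumes "v \<in> A" "\<And>h. h \<in> H \<Longrightarrow> U h \<cdot> v = \<phi> h *\<^sub>C v" "\<phi> \<in> chars H"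
  shows "proj H \<phi> \<cdot> v = v"
proof -
  have "proj H \<phi> \<cdot> v = (1 / of_nat (card H)) *\<^sub>C (\<Sum>h\<in>H. (cnj (\<phi> h) *\<^sub>C U h) \<cdot> v)"
    unfolding proj_def using assms(1) by (subst scale_cmp) (simp_all add: sum_cmp)
  also have "(\<Sum>h\<in>H. (cnj (\<phi> h) *\<^sub>C U h) \<cdot> v) = (\<Sum>h\<in>H. v)"
    using assms unit_cnj' by (intro sum.cong refl) (simp add: scaleC_scaleC chars_def)
  also have "\<dots> = of_nat (card H) *\<^sub>C v"
    by (simp add: complex_vector.sum_constant_scale)
  finally show ?thesis using H_card by (simp add: scaleC_scaleC)
qed

lemma proj_idem: "\<phi> \<in> chars H \<Longrightarrow> proj H \<phi> \<cdot> proj H \<phi> = proj H \<phi>"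
  by (rule proj_cmp_eigen) (auto simp: U_proj)

lemma proj_orthogonal:
  assumes "\<phi> \<in> chars H" "\<phi>' \<in> chars H" "\<phi> \<noteq> \<phi>'"
  shows "proj H \<phi> \<cdot> proj H \<phi>' = 0"
proof -
  obtain h where h: "h \<in> H" "\<phi> h \<noteq> \<phi>' h" using chars_eqI assms by blast
  have "(proj H \<phi> \<cdot> U h) \<cdot> proj H \<phi>' = proj H \<phi> \<cdot> (U h \<cdot> proj H \<phi>')"
    using h by (intro cmp_assoc) auto
  then have "\<phi> h *\<^sub>C (proj H \<phi> \<cdot> proj H \<phi>') = \<phi>' h *\<^sub>C (proj H \<phi> \<cdot> proj H \<phi>')"
    using assms h by (simp add: U_proj proj_U)
  then show ?thesis using h(2) complex_vector.scale_right_imp_eq by blast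
qed

text \<open>Both \<open>proj H \<phi>\<close> and its adjoint are multiplied by \<open>\<phi> h\<close> when multiplied with \<open>U h\<close>, so the product
  \<open>str (proj H \<phi>) \<cdot> proj H \<phi>\<close>, which is self-adjoint, equals the adjoint of the projection.\<close>

lemma str_proj:
  assumes \<phi>: "\<phi> \<in> chars H"
  shows "str D (proj H \<phi>) = proj H \<phi>"
proof -
  let ?q = "proj H \<phi>"
  have "str D ?q \<cdot> U h = \<phi> h *\<^sub>C str D ?q" if h: "h \<in> H" for h
  proof -
    have n: "norm (\<phi> h) = 1" using \<phi> h by (simp add: chars_def)
    have "str D (U h) \<cdot> ?q = cnj (\<phi> h) *\<^sub>C (str D (U h) \<cdot> (U h \<cdot> ?q))"
      using h unit_cnj'[OF n] \<phi> by (simp add: U_proj scaleC_scaleC)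
    also have "str D (U h) \<cdot> (U h \<cdot> ?q) = ?q"
      using h by (subst cmp_assoc[symmetric]) (simp_all add: str_U_U)
    finally have "str D (str D (U h) \<cdot> ?q) = str D (cnj (\<phi> h) *\<^sub>C ?q)" by simp
    then show ?thesis using h by (simp add: str_cmp_A)
  qed
  then have "str D ?q \<cdot> (cnj (\<phi> h) *\<^sub>C U h) = str D ?q" if "h \<in> H" for h
    using that \<phi> unit_cnj' by (simp add: scaleC_scaleC chars_def)
  then have "str D ?q \<cdot> ?q = (1 / of_nat (card H)) *\<^sub>C (\<Sum>h\<in>H. str D ?q)"
    by (subst (2) proj_def) (subst cmp_scale, simp_all add: cmp_sum_right)
  also have "\<dots> = str D ?q"
    using H_card by (simp add: scaleC_scaleC complex_vector.sum_constant_scale)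
  finally have e: "str D ?q \<cdot> ?q = str D ?q" .
  have "str D (str D ?q \<cdot> ?q) = str D ?q \<cdot> ?q" by (simp add: str_cmp_A)
  then have "str D (str D ?q) = str D ?q" by (simp only: e)
  then show ?thesis by simp
qed

lemma proj_eq_lin: "proj H \<phi> = lin (\<lambda>k. if k \<in> H then cnj (\<phi> k) / of_nat (card H) else 0)"
proof -
  have "lin (\<lambda>k. if k \<in> H then cnj (\<phi> k) / of_nat (card H) else 0)
    = (\<Sum>k\<in>H. (if k \<in> H then cnj (\<phi> k) / of_nat (card H) else 0) *\<^sub>C U k)"
    using Q_finite by (intro sum.mono_neutral_right) auto
  also have "\<dots> = (\<Sum>k\<in>H. (1 / of_nat (card H)) *\<^sub>C cnj (\<phi> k) *\<^sub>C U k)"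
    by (intro sum.cong refl) (simp add: scaleC_scaleC)
  finally show ?thesis by (simp add: proj_def complex_vector.scale_sum_right)
qed

lemma proj_nonzero:
  assumes "\<phi> \<in> chars H"
  shows "proj H \<phi> \<noteq> 0"
proof
  assume "proj H \<phi> = 0"
  then have "(if \<one>\<^bsub>Q\<^esub> \<in> H then cnj (\<phi> \<one>\<^bsub>Q\<^esub>) / of_nat (card H) else 0) = (0::complex)"
    unfolding proj_eq_lin by (rule independent) simp
  moreover have "\<one>\<^bsub>Q\<^esub> \<in> H" using H by (rule subgroup.one_closed)
  ultimately show False using assms by (auto simp: chars_def)
qed

end

text \<open>As a simplification rule for arbitrary \<open>H\<close> it would not terminate.\<close>

declare H_carrier [simp del]

lemma U_power:
  assumes h: "h \<in> carrier Q"
  shows "\<exists>s. norm s = 1 \<and> (\<forall>v\<in>A. ((\<lambda>v. U h \<cdot> v) ^^ i) v = s *\<^sub>C (U (h [^]\<^bsub>Q\<^esub> i) \<cdot> v))"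
proof (induction i)
  case 0
  let ?c = "c \<one>\<^bsub>Q\<^esub> \<one>\<^bsub>Q\<^esub>"
  have "v = cnj ?c *\<^sub>C (U \<one>\<^bsub>Q\<^esub> \<cdot> v)" if "v \<in> A" for v
    using that I_cmp[OF that] by (simp add: idt_eq)
  then show ?case using norm_c[of "\<one>\<^bsub>Q\<^esub>" "\<one>\<^bsub>Q\<^esub>"] by (intro exI[of _ "cnj ?c"]) auto
next
  case (Suc i)
  then obtain s where s: "norm s = 1" "\<forall>v\<in>A. ((\<lambda>v. U h \<cdot> v) ^^ i) v = s *\<^sub>C (U (h [^]\<^bsub>Q\<^esub> i) \<cdot> v)"
    by blast
  let ?s = "s * c h (h [^]\<^bsub>Q\<^esub> i)"
  have "((\<lambda>v. U h \<cdot> v) ^^ Suc i) v = ?s *\<^sub>C (U (h [^]\<^bsub>Q\<^esub> Suc i) \<cdot> v)" if v: "v \<in> A" for v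
  proof -
    have "((\<lambda>v. U h \<cdot> v) ^^ Suc i) v = s *\<^sub>C (U h \<cdot> (U (h [^]\<^bsub>Q\<^esub> i) \<cdot> v))" using s v h by simp
    also have "U h \<cdot> (U (h [^]\<^bsub>Q\<^esub> i) \<cdot> v) = (U h \<cdot> U (h [^]\<^bsub>Q\<^esub> i)) \<cdot> v"
      using h v by (subst cmp_assoc) auto
    also have "h \<otimes>\<^bsub>Q\<^esub> h [^]\<^bsub>Q\<^esub> i = h [^]\<^bsub>Q\<^esub> Suc i" using h by (simp add: Q.nat_pow_comm Q.m_comm)
    then have "U h \<cdot> U (h [^]\<^bsub>Q\<^esub> i) = c h (h [^]\<^bsub>Q\<^esub> i) *\<^sub>C U (h [^]\<^bsub>Q\<^esub> Suc i)"
      using h by (simp add: cmp_U)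
    finally show ?thesis using h v by (simp add: scaleC_scaleC)
  qed
  moreover have "norm ?s = 1" using s h norm_c by (simp add: norm_mult)
  ultimately show ?case by blast
qed

text \<open>The operators \<open>U h\<close>, \<open>h \<in> H\<close>, commute, and the \<open>n\<close>-th power of each is a scalar for the order \<open>n\<close> of
  the group, so that they have a common eigenvector. Its eigenvalues form a twisted character.\<close>

lemma joint_eigenvector:
  assumes H: "subgroup H Q" and iso: "isotropic H"
    and V: "csubspace V" "V \<subseteq> A" "v0 \<in> V" "v0 \<noteq> 0"
    and stable: "\<And>h v. h \<in> H \<Longrightarrow> v \<in> V \<Longrightarrow> U h \<cdot> v \<in> V"
  obtains \<phi> v where "\<phi> \<in> chars H" "v \<in> V" "v \<noteq> 0" "\<And>h. h \<in> H \<Longrightarrow> U h \<cdot> v = \<phi> h *\<^sub>C v"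
proof -
  note [simp] = H_carrier[OF H] H_finite[OF H] H_mult[OF H]
  let ?n = "card (carrier Q)"
  have n: "?n > 0" using Q_finite Q.one_closed card_gt_0_iff by blast
  have assoc: "U h \<cdot> (U h' \<cdot> v) = c h h' *\<^sub>C (U (h \<otimes>\<^bsub>Q\<^esub> h') \<cdot> v)"
    if "h \<in> H" "h' \<in> H" "v \<in> A" for h h' v
    using that by (subst cmp_assoc[symmetric]) (simp_all add: cmp_U)
  have period: "\<exists>s. norm s = 1 \<and> (\<forall>v\<in>A. ((\<lambda>v. U h \<cdot> v) ^^ ?n) v = s *\<^sub>C v)" if h: "h \<in> H" for h
  proof -
    obtain s where s: "norm s = 1" "\<forall>v\<in>A. ((\<lambda>v. U h \<cdot> v) ^^ ?n) v = s *\<^sub>C (U (h [^]\<^bsub>Q\<^esub> ?n) \<cdot> v)"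
      using U_power[of h ?n] h by auto
    obtain t where t: "norm t = 1" "\<forall>v\<in>A. v = t *\<^sub>C (U \<one>\<^bsub>Q\<^esub> \<cdot> v)"
      using U_power[of h 0] h by auto
    have "h [^]\<^bsub>Q\<^esub> ?n = \<one>\<^bsub>Q\<^esub>"
      using Q.power_order_eq_one[OF Q_finite] h by simp
    then have "((\<lambda>v. U h \<cdot> v) ^^ ?n) v = (s * cnj t) *\<^sub>C v" if v: "v \<in> A" for v
    proof -
      have "U \<one>\<^bsub>Q\<^esub> \<cdot> v = cnj t *\<^sub>C (t *\<^sub>C (U \<one>\<^bsub>Q\<^esub> \<cdot> v))"
        using unit_cnj'[OF t(1)] by (simp add: scaleC_scaleC)
      also have "\<dots> = cnj t *\<^sub>C v" using t(2) v by simp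
      finally show ?thesis using s(2) v \<open>h [^]\<^bsub>Q\<^esub> ?n = \<one>\<^bsub>Q\<^esub>\<close> by (simp add: scaleC_scaleC)
    qed
    then show ?thesis using s(1) t(1) by (intro exI[of _ "s * cnj t"]) (simp add: norm_mult)
  qed
  have "\<exists>v\<in>V. v \<noteq> 0 \<and> (\<forall>h\<in>H. \<exists>z. U h \<cdot> v = z *\<^sub>C v)"
  proof (rule common_eigenvector[where f = "\<lambda>h v. U h \<cdot> v" and n = ?n and ?v0.0 = v0])
    show "clinear_on V (\<lambda>v. U h \<cdot> v)" if "h \<in> H" for h
      using cmp_linear_right[of "U h"] that V(2) by (auto simp: clinear_on_def)
    show "U i \<cdot> (U j \<cdot> v) = U j \<cdot> (U i \<cdot> v)" if "i \<in> H" "j \<in> H" "v \<in> V" for i j v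
      using that V(2) iso by (simp add: assoc subsetD isotropic_def Q.m_comm)
    show "\<exists>s. s \<noteq> 0 \<and> (\<forall>v\<in>V. ((\<lambda>v. U i \<cdot> v) ^^ ?n) v = s *\<^sub>C v)" if "i \<in> H" for i
    proof -
      obtain s where "norm s = 1" "\<forall>v\<in>A. ((\<lambda>v. U i \<cdot> v) ^^ ?n) v = s *\<^sub>C v"
        using period[OF \<open>i \<in> H\<close>] by blast
      then show ?thesis using V(2) by (intro exI[of _ s]) auto
    qed
  qed (use V stable n in auto)
  then obtain v z where v: "v \<in> V" "v \<noteq> 0" and z: "\<And>h. h \<in> H \<Longrightarrow> U h \<cdot> v = z h *\<^sub>C v"
    by metis
  have vA: "v \<in> A" using v V by blast
  have "norm (z h) = 1" if h: "h \<in> H" for h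
  proof -
    obtain s where s: "norm s = 1" "((\<lambda>v. U h \<cdot> v) ^^ ?n) v = s *\<^sub>C v"
      using period[OF h] vA by blast
    have "((\<lambda>v. U h \<cdot> v) ^^ i) v = z h ^ i *\<^sub>C v" for i
      by (induction i) (use h vA z in \<open>auto simp: scaleC_scaleC mult.commute\<close>)
    then have "z h ^ ?n = s" using s v(2) complex_vector.scale_right_imp_eq by metis
    then have "norm (z h) ^ ?n = 1 ^ ?n" using s by (simp flip: norm_power)
    then show ?thesis using n power_eq_iff_eq_base[of ?n "norm (z h)" 1] by simp
  qed
  moreover have "z h * z h' = c h h' * z (h \<otimes>\<^bsub>Q\<^esub> h')" if h: "h \<in> H" "h' \<in> H" for h h'
  proof -
    have "(z h * z h') *\<^sub>C v = U h \<cdot> (U h' \<cdot> v)"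
      using h vA by (simp add: z scaleC_scaleC mult.commute[of "z h"])
    also have "\<dots> = c h h' *\<^sub>C (U (h \<otimes>\<^bsub>Q\<^esub> h') \<cdot> v)" using h vA by (rule assoc)
    also have "\<dots> = (c h h' * z (h \<otimes>\<^bsub>Q\<^esub> h')) *\<^sub>C v"
      using h by (simp add: z scaleC_scaleC)
    finally show ?thesis using v(2) complex_vector.scale_right_imp_eq by blast
  qed
  ultimately have "restrict z H \<in> chars H" by (simp add: chars_def)
  then show ?thesis using that[of "restrict z H" v] v z by simp
qed

text \<open>The eigenvectors of \<open>H\<close> with character \<open>\<phi>\<close> form a space which is stable under the
  commuting operators \<open>U m\<close>, \<open>m \<in> M\<close>.\<close>

lemma chars_extend:
  assumes H: "subgroup H Q" and M: "subgroup M Q" "isotropic M" and HM: "H \<subseteq> M"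
    and \<phi>: "\<phi> \<in> chars H"
  shows "\<exists>\<phi>'\<in>chars M. \<forall>h\<in>H. \<phi>' h = \<phi> h"
proof -
  note [simp] = H_carrier[OF M(1)]
  let ?V = "{v \<in> A. \<forall>h\<in>H. U h \<cdot> v = \<phi> h *\<^sub>C v}"
  have hM: "h \<in> H \<Longrightarrow> h \<in> M" for h using HM by blast
  have V1: "csubspace ?V"
  proof (rule complex_vector.subspaceI)
    show "0 \<in> ?V" using complex_vector.subspace_0[OF A_subspace] hM by simp
    show "x + y \<in> ?V" if "x \<in> ?V" "y \<in> ?V" for x y
      using that complex_vector.subspace_add[OF A_subspace] hM by (simp add: cmp_add scaleC_add_right)
    show "z *\<^sub>C x \<in> ?V" if "x \<in> ?V" for z x
      using that hM by (simp add: scaleC_scaleC mult.commute)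
  qed
  have V2: "U m \<cdot> v \<in> ?V" if m: "m \<in> M" and v: "v \<in> ?V" for m v
  proof -
    have "U h \<cdot> (U m \<cdot> v) = \<phi> h *\<^sub>C (U m \<cdot> v)" if h: "h \<in> H" for h
    proof -
      have "U h \<cdot> (U m \<cdot> v) = (U h \<cdot> U m) \<cdot> v" using m v h hM by (subst cmp_assoc) auto
      also have "U h \<cdot> U m = U m \<cdot> U h"
        using m h hM M(2) by (simp add: cmp_U isotropic_def Q.m_comm)
      also have "(U m \<cdot> U h) \<cdot> v = U m \<cdot> (U h \<cdot> v)" using m v h hM by (subst cmp_assoc) auto
      finally show ?thesis using v h m by simp
    qed
    then show ?thesis using m v by simp
  qed
  have V3: "proj H \<phi> \<in> ?V" using H \<phi> by (simp add: U_proj proj_in)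
  have V4: "?V \<subseteq> A" by blast
  obtain \<phi>' v where v: "\<phi>' \<in> chars M" "v \<in> ?V" "v \<noteq> 0"
    "\<And>m. m \<in> M \<Longrightarrow> U m \<cdot> v = \<phi>' m *\<^sub>C v"
    using joint_eigenvector[OF M V1 V4 V3 proj_nonzero[OF H \<phi>] V2] by blast
  have "\<phi>' h = \<phi> h" if h: "h \<in> H" for h
  proof -
    have "\<phi>' h *\<^sub>C v = \<phi> h *\<^sub>C v" using v(2,4) h hM by force
    then show ?thesis using v(3) complex_vector.scale_right_imp_eq by blast
  qed
  then show ?thesis using v(1) by blast
qed

lemma A_span: "cspan (U ` carrier Q) = A"
proof
  show "cspan (U ` carrier Q) \<subseteq> A"
    using A_subspace by (intro complex_vector.span_minimal) auto
  have "lin x \<in> cspan (U ` carrier Q)" for x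
    by (intro complex_vector.span_sum complex_vector.span_scale complex_vector.span_base) simp
  then show "A \<subseteq> cspan (U ` carrier Q)" unfolding Hom_eq by blast
qed

lemma finite_chars:
  assumes H: "subgroup H Q"
  shows "finite (chars H)"
proof (rule finite_if_separated[of "U ` carrier Q" _ "proj H" "\<lambda>\<phi> v. proj H \<phi> \<cdot> v"])
  show "finite (U ` carrier Q)" using Q_finite by simp
  show "clinear_on (cspan (U ` carrier Q)) (\<lambda>v. proj H \<phi> \<cdot> v)" for \<phi>
    unfolding A_span using H by (intro cmp_linear_right) simp
qed (use H in \<open>simp_all add: A_span proj_orthogonal proj_idem proj_nonzero\<close>)

text \<open>Otherwise the elements annihilated by the sum of the projections form a nonzero stable space,
  which contains a joint eigenvector; but this is fixed by the projection of its character.\<close>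

lemma sum_proj:
  assumes H: "subgroup H Q" and iso: "isotropic H"
  shows "(\<Sum>\<phi>\<in>chars H. proj H \<phi>) = I"
proof (rule ccontr)
  note [simp] = H_carrier[OF H] proj_in[OF H]
  let ?P = "\<Sum>\<phi>\<in>chars H. proj H \<phi>"
  let ?V = "{v \<in> A. ?P \<cdot> v = 0}"
  have PA [simp]: "?P \<in> A" by simp
  assume "?P \<noteq> I"
  then have nz: "I - ?P \<noteq> 0" unfolding right_minus_eq by (rule not_sym)
  have V1: "csubspace ?V"
  proof (rule complex_vector.subspaceI)
    show "0 \<in> ?V" using complex_vector.subspace_0[OF A_subspace] by simp
    show "x + y \<in> ?V" if "x \<in> ?V" "y \<in> ?V" for x y
      using that complex_vector.subspace_add[OF A_subspace] by (simp add: cmp_add)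
    show "z *\<^sub>C x \<in> ?V" if "x \<in> ?V" for z x
      using that by simp
  qed
  have PP: "?P \<cdot> proj H \<phi> = proj H \<phi>" if \<phi>: "\<phi> \<in> chars H" for \<phi>
  proof -
    have "?P \<cdot> proj H \<phi> = (\<Sum>\<phi>'\<in>chars H. proj H \<phi>' \<cdot> proj H \<phi>)" by (simp add: sum_cmp)
    also have "\<dots> = (\<Sum>\<phi>'\<in>chars H. if \<phi>' = \<phi> then proj H \<phi> else 0)"
      using \<phi> by (intro sum.cong refl) (simp add: proj_idem[OF H] proj_orthogonal[OF H])
    finally show ?thesis using \<phi> finite_chars[OF H] by simp
  qed
  then have "?P \<cdot> ?P = ?P" by (simp add: cmp_sum_right)
  then have V3: "I - ?P \<in> ?V"
    using complex_vector.subspace_diff[OF A_subspace, of I ?P] by (simp add: cmp_diff)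
  have V2: "U h \<cdot> v \<in> ?V" if h: "h \<in> H" and v: "v \<in> ?V" for h v
  proof -
    have "?P \<cdot> U h = U h \<cdot> ?P"
      using h by (simp add: sum_cmp cmp_sum_right U_proj[OF H] proj_U[OF H])
    then have "?P \<cdot> (U h \<cdot> v) = U h \<cdot> (?P \<cdot> v)"
      using h v PA cmp_assoc[of ?P "U h" v] cmp_assoc[of "U h" ?P v] by simp
    then show ?thesis using h v by simp
  qed
  have V4: "?V \<subseteq> A" by blast
  obtain \<phi> v where v: "\<phi> \<in> chars H" "v \<in> ?V" "v \<noteq> 0"
    "\<And>h. h \<in> H \<Longrightarrow> U h \<cdot> v = \<phi> h *\<^sub>C v"
    using joint_eigenvector[OF H iso V1 V4 V3 nz V2] by blast
  have "proj H \<phi> \<cdot> v = v" using v H by (intro proj_cmp_eigen) auto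
  moreover have "?P \<cdot> (proj H \<phi> \<cdot> v) = (?P \<cdot> proj H \<phi>) \<cdot> v"
    using v by (intro cmp_assoc[symmetric]) auto
  ultimately show False using v PP[OF v(1)] by simp
qed

text \<open>Compare the coefficients of the unit in \<open>sum_proj\<close>.\<close>

lemma card_chars:
  assumes H: "subgroup H Q" and iso: "isotropic H"
  shows "card (chars H) = card H"
proof -
  let ?c = "c \<one>\<^bsub>Q\<^esub> \<one>\<^bsub>Q\<^esub>" and ?n = "of_nat (card H) :: complex"
  have 1: "\<one>\<^bsub>Q\<^esub> \<in> H" using H by (rule subgroup.one_closed)
  have \<phi>1: "\<phi> \<one>\<^bsub>Q\<^esub> = ?c" if "\<phi> \<in> chars H" for \<phi>
  proof -
    have "\<phi> \<one>\<^bsub>Q\<^esub> * \<phi> \<one>\<^bsub>Q\<^esub> = ?c * \<phi> (\<one>\<^bsub>Q\<^esub> \<otimes>\<^bsub>Q\<^esub> \<one>\<^bsub>Q\<^esub>)" "norm (\<phi> \<one>\<^bsub>Q\<^esub>) = 1"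
      using that 1 unfolding chars_def by blast+
    then show ?thesis by auto
  qed
  have "(\<Sum>\<phi>\<in>chars H. proj H \<phi>)
      = lin (\<lambda>k. \<Sum>\<phi>\<in>chars H. if k \<in> H then cnj (\<phi> k) / ?n else 0)"
    unfolding proj_eq_lin[OF H]
    by (subst sum.swap) (simp add: complex_vector.scale_sum_left)
  also have "(\<Sum>\<phi>\<in>chars H. proj H \<phi>) = lin (\<lambda>k. if k = \<one>\<^bsub>Q\<^esub> then cnj ?c else 0)"
    unfolding sum_proj[OF assms] idt_eq using Q_finite
    by (simp add: if_distrib[of "\<lambda>z. z *\<^sub>C _"] cong: if_cong)
  finally have "cnj ?c = (\<Sum>\<phi>\<in>chars H. cnj (\<phi> \<one>\<^bsub>Q\<^esub>) / ?n)"
    using 1 by (drule_tac k = "\<one>\<^bsub>Q\<^esub>" in lin_eqD) auto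
  also have "\<dots> = (\<Sum>\<phi>\<in>chars H. cnj ?c / ?n)"
  proof (intro sum.cong refl)
    fix \<phi> assume "\<phi> \<in> chars H"
    then have "\<phi> \<one>\<^bsub>Q\<^esub> = ?c" by (rule \<phi>1)
    then show "cnj (\<phi> \<one>\<^bsub>Q\<^esub>) / ?n = cnj ?c / ?n" by simp
  qed
  also have "\<dots> = of_nat (card (chars H)) * cnj ?c / ?n" by simp
  finally show ?thesis
    using c_nonzero[of "\<one>\<^bsub>Q\<^esub>" "\<one>\<^bsub>Q\<^esub>"] H_card[OF H] by (simp add: field_simps)
qed

subsection \<open>The commutator bicharacter\<close>

text \<open>The phases by which the basis elements fail to commute. They depend bimultiplicatively on the
  two group elements, in contrast to the cocycle itself.\<close>

definition comm :: "'k \<Rightarrow> 'k \<Rightarrow> complex" where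
  "comm k l = c k l * cnj (c l k)"

definition perp :: "'k set \<Rightarrow> 'k set" where
  "perp H = {k \<in> carrier Q. \<forall>h\<in>H. comm k h = 1}"

lemma norm_comm: "k \<in> carrier Q \<Longrightarrow> l \<in> carrier Q \<Longrightarrow> norm (comm k l) = 1"
  by (simp add: comm_def norm_mult norm_c)

lemma comm_same: "k \<in> carrier Q \<Longrightarrow> comm k k = 1"
  by (simp add: comm_def c_cnj)

lemma comm_cnj: "comm l k = cnj (comm k l)"
  by (simp add: comm_def mult.commute)

lemma comm_eq_1: "k \<in> carrier Q \<Longrightarrow> l \<in> carrier Q \<Longrightarrow> comm k l = 1 \<longleftrightarrow> c k l = c l k"
proof -
  assume k: "k \<in> carrier Q" and l: "l \<in> carrier Q"
  have "comm k l * c l k = c k l"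
    using unit_cnj'[OF norm_c[OF l k]] by (simp add: comm_def mult.assoc)
  then show ?thesis using c_nonzero[OF l k] by auto
qed

lemma U_commute: 
  assumes "k \<in> carrier Q" "l \<in> carrier Q"
  shows "U k \<cdot> U l = comm k l *\<^sub>C (U l \<cdot> U k)"
proof -
  have "comm k l * c l k = c k l"
    using unit_cnj'[OF norm_c[OF assms(2,1)]] by (simp add: comm_def mult.assoc)
  then show ?thesis using assms by (simp add: cmp_U scaleC_scaleC Q.m_comm)
qed

text \<open>Move \<open>U k\<close> through \<open>U l \<cdot> U m\<close> at once or in two steps.\<close>

lemma comm_mult_right:
  assumes k: "k \<in> carrier Q" and l: "l \<in> carrier Q" and m: "m \<in> carrier Q"
  shows "comm k (l \<otimes>\<^bsub>Q\<^esub> m) = comm k l * comm k m"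
proof -
  let ?w = "U l \<cdot> U m \<cdot> U k"
  have "?w = (c l m * c (l \<otimes>\<^bsub>Q\<^esub> m) k) *\<^sub>C U (l \<otimes>\<^bsub>Q\<^esub> m \<otimes>\<^bsub>Q\<^esub> k)"
    using assms by (simp add: cmp_U scaleC_scaleC)
  then have w: "?w \<noteq> 0" using assms c_nonzero U_nonzero by simp
  have "U k \<cdot> (U l \<cdot> U m) = c l m *\<^sub>C (U k \<cdot> U (l \<otimes>\<^bsub>Q\<^esub> m))"
    using assms by (simp add: cmp_U[of l m])
  also have "\<dots> = comm k (l \<otimes>\<^bsub>Q\<^esub> m) *\<^sub>C ?w"
    using assms by (simp add: U_commute[of k "l \<otimes>\<^bsub>Q\<^esub> m"] cmp_U[of l m] scaleC_scaleC mult.commute)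
  finally have 1: "U k \<cdot> (U l \<cdot> U m) = comm k (l \<otimes>\<^bsub>Q\<^esub> m) *\<^sub>C ?w" .
  have "U k \<cdot> (U l \<cdot> U m) = (U k \<cdot> U l) \<cdot> U m" using assms by (simp add: cmp_assoc)
  also have "\<dots> = comm k l *\<^sub>C (U l \<cdot> (U k \<cdot> U m))"
    using assms by (simp add: U_commute[of k l] cmp_assoc)
  also have "\<dots> = (comm k l * comm k m) *\<^sub>C ?w"
    using assms by (simp add: U_commute[of k m] cmp_assoc scaleC_scaleC)
  finally show ?thesis using 1 w complex_vector.scale_right_imp_eq by metis
qed

lemma comm_mult_left:
  assumes "k \<in> carrier Q" "l \<in> carrier Q" "m \<in> carrier Q"
  shows "comm (k \<otimes>\<^bsub>Q\<^esub> l) m = comm k m * comm l m"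
proof -
  have "cnj (comm (k \<otimes>\<^bsub>Q\<^esub> l) m) = cnj (comm k m * comm l m)"
    using comm_mult_right[of m k l] assms comm_cnj[of m] by simp
  then show ?thesis by (simp only: complex_cnj_cancel_iff)
qed

lemma comm_one [simp]: "k \<in> carrier Q \<Longrightarrow> comm k \<one>\<^bsub>Q\<^esub> = 1" "k \<in> carrier Q \<Longrightarrow> comm \<one>\<^bsub>Q\<^esub> k = 1"
  using c_one_left[of k] c_one_right[of k] c_nonzero[of k "\<one>\<^bsub>Q\<^esub>"]
  by (simp_all add: comm_eq_1)

lemma comm_inv_left:
  assumes "k \<in> carrier Q" "l \<in> carrier Q"
  shows "comm (inv\<^bsub>Q\<^esub> k) l = cnj (comm k l)"
proof -
  have "comm k l * comm (inv\<^bsub>Q\<^esub> k) l = 1"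
    using comm_mult_left[of k "inv\<^bsub>Q\<^esub> k" l] assms by simp
  then have "cnj (comm k l) * (comm k l * comm (inv\<^bsub>Q\<^esub> k) l) = cnj (comm k l)" by simp
  then show ?thesis
    using unit_cnj'[OF norm_comm[OF assms]] by (simp add: mult.assoc[symmetric])
qed

lemma perp_subgroup: "H \<subseteq> carrier Q \<Longrightarrow> subgroup (perp H) Q"
  by (intro Q.subgroupI)
    (auto simp: perp_def comm_mult_left comm_inv_left subset_iff intro!: exI[of _ "\<one>\<^bsub>Q\<^esub>"])

lemma perp_isotropic: "M = perp M \<Longrightarrow> isotropic M"
  unfolding isotropic_def
proof (intro ballI)
  fix h h' assume M: "M = perp M" and h: "h \<in> M" "h' \<in> M"
  have "h \<in> perp M" "h' \<in> perp M" using h M by auto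
  then show "c h h' = c h' h" using comm_eq_1[of h h'] h(2) by (simp add: perp_def)
qed

text \<open>A maximal isotropic subset \<open>M\<close> equals \<open>perp M\<close>: an element of \<open>perp M\<close> also commutes with
  itself, so it may be added to \<open>M\<close>.\<close>

lemma exists_lagrangian: "\<exists>M. M = perp M"
proof -
  let ?F = "{M. M \<subseteq> perp M}"
  have "?F \<subseteq> Pow (carrier Q)" by (auto simp: perp_def)
  then have "finite ?F" using Q_finite finite_subset by blast
  moreover have "{} \<in> ?F" by simp
  ultimately obtain M where M: "M \<subseteq> perp M" and max: "\<And>M'. M' \<subseteq> perp M' \<Longrightarrow> M \<subseteq> M' \<Longrightarrow> M = M'"
    using finite_has_maximal2[of ?F "{}"] by auto
  have "perp M \<subseteq> M"
  proof
    fix k assume k: "k \<in> perp M"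
    have "comm m k = 1" if "m \<in> M" for m
      using k that by (subst comm_cnj) (simp add: perp_def)
    then have "insert k M \<subseteq> perp (insert k M)"
      using M k comm_same by (auto simp: perp_def subset_iff)
    then show "k \<in> M" using max[of "insert k M"] by blast
  qed
  with M show ?thesis by blast
qed

text \<open>A nontrivial character sums to zero because the sum is invariant under the shift by an
  element at which the character is not one.\<close>

lemma character_sum:
  assumes H: "subgroup H Q" and mult: "\<And>x y. x \<in> H \<Longrightarrow> y \<in> H \<Longrightarrow> f (x \<otimes>\<^bsub>Q\<^esub> y) = f x * f y"
    and h: "h \<in> H" "f h \<noteq> (1::complex)"
  shows "(\<Sum>x\<in>H. f x) = 0"
proof -
  have "(\<Sum>x\<in>H. f x) = (\<Sum>x\<in>H. f (h \<otimes>\<^bsub>Q\<^esub> x))" using H_shift[OF H h(1)] by metis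
  also have "\<dots> = f h * (\<Sum>x\<in>H. f x)" using h(1) mult by (simp add: sum_distrib_left)
  finally show ?thesis using h(2) by simp
qed

text \<open>Conjugation with \<open>U k\<close> maps the projection of \<open>\<phi>\<close> to that of \<open>shift M k \<phi>\<close>.\<close>

definition shift :: "'k set \<Rightarrow> 'k \<Rightarrow> ('k \<Rightarrow> complex) \<Rightarrow> 'k \<Rightarrow> complex" where
  "shift M k \<phi> = (\<lambda>m\<in>M. \<phi> m * cnj (comm k m))"

context
  fixes M assumes M: "M = perp M"
begin

lemma M_subgroup: "subgroup M Q"
  using M perp_subgroup[of M] by (auto simp: perp_def)

lemma M_isotropic: "isotropic M"
  using M by (rule perp_isotropic)

lemma M_carrier [simp]: "m \<in> M \<Longrightarrow> m \<in> carrier Q"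
  using M by (auto simp: perp_def)

lemma in_MI: "k \<in> carrier Q \<Longrightarrow> (\<And>m. m \<in> M \<Longrightarrow> comm k m = 1) \<Longrightarrow> k \<in> M"
  by (subst M) (simp add: perp_def)

lemma comm_M [simp]: "k \<in> M \<Longrightarrow> m \<in> M \<Longrightarrow> comm k m = 1"
  using M by (auto simp: perp_def)

lemma radical_subset: "perp (carrier Q) \<subseteq> M"
  by (auto simp: perp_def intro: in_MI)

lemma shift_in:
  assumes "k \<in> carrier Q" "\<phi> \<in> chars M"
  shows "shift M k \<phi> \<in> chars M"
proof -
  note [simp] = H_mult[OF M_subgroup]
  have "shift M k \<phi> m * shift M k \<phi> m' = c m m' * shift M k \<phi> (m \<otimes>\<^bsub>Q\<^esub> m')"
    if m: "m \<in> M" "m' \<in> M" for m m'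
  proof -
    have "shift M k \<phi> m * shift M k \<phi> m' = (\<phi> m * \<phi> m') * (cnj (comm k m) * cnj (comm k m'))"
      using m by (simp add: shift_def mult_ac)
    then show ?thesis using m assms by (simp add: shift_def chars_def comm_mult_right)
  qed
  then show ?thesis using assms norm_comm by (simp add: chars_def shift_def norm_mult)
qed

lemma U_shift:
  assumes k: "k \<in> carrier Q"
  shows "U k \<cdot> proj M \<phi> = proj M (shift M k \<phi>) \<cdot> U k"
proof -
  note [simp] = proj_in[OF M_subgroup]
  have "U k \<cdot> proj M \<phi> = (1 / of_nat (card M)) *\<^sub>C (\<Sum>m\<in>M. U k \<cdot> (cnj (\<phi> m) *\<^sub>C U m))"
    unfolding proj_def using k by (subst cmp_scale, simp_all add: cmp_sum_right)
  also have "(\<Sum>m\<in>M. U k \<cdot> (cnj (\<phi> m) *\<^sub>C U m)) = (\<Sum>m\<in>M. (cnj (shift M k \<phi> m) *\<^sub>C U m) \<cdot> U k)"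
    using k by (intro sum.cong refl) (simp add: shift_def U_commute[of k] scaleC_scaleC)
  also have "(1 / of_nat (card M)) *\<^sub>C \<dots> = proj M (shift M k \<phi>) \<cdot> U k"
    unfolding proj_def using k by (subst scale_cmp, simp_all add: sum_cmp)
  finally show ?thesis .
qed

lemma U_conj_proj:
  assumes k: "k \<in> carrier Q"
  shows "(U k \<cdot> proj M \<phi>) \<cdot> str D (U k) = proj M (shift M k \<phi>)"
proof -
  note [simp] = proj_in[OF M_subgroup]
  have "(U k \<cdot> proj M \<phi>) \<cdot> str D (U k) = proj M (shift M k \<phi>) \<cdot> (U k \<cdot> str D (U k))"
    unfolding U_shift[OF k] using k by (intro cmp_assoc) auto
  then show ?thesis using k by (simp add: U_str_U)
qed

lemma shift_eq_iff:
  assumes k: "k \<in> carrier Q" "k' \<in> carrier Q" and \<phi>: "\<phi> \<in> chars M"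
  shows "shift M k \<phi> = shift M k' \<phi> \<longleftrightarrow> inv\<^bsub>Q\<^esub> k' \<otimes>\<^bsub>Q\<^esub> k \<in> M"
proof -
  have "shift M k \<phi> = shift M k' \<phi> \<longleftrightarrow> (\<forall>m\<in>M. comm k m = comm k' m)"
  proof
    assume e: "shift M k \<phi> = shift M k' \<phi>"
    show "\<forall>m\<in>M. comm k m = comm k' m"
    proof
      fix m assume m: "m \<in> M"
      have "\<phi> m \<noteq> 0" using \<phi> m by (force simp: chars_def)
      then show "comm k m = comm k' m" using fun_cong[OF e, of m] m by (simp add: shift_def)
    qed
  qed (auto simp: shift_def)
  also have "\<dots> \<longleftrightarrow> (\<forall>m\<in>M. comm (inv\<^bsub>Q\<^esub> k' \<otimes>\<^bsub>Q\<^esub> k) m = 1)"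
  proof (intro ball_cong refl)
    fix m assume m: "m \<in> M"
    have e: "comm k' m * cnj (comm k' m) = 1" using k m norm_comm by (intro unit_cnj) auto
    have "comm (inv\<^bsub>Q\<^esub> k' \<otimes>\<^bsub>Q\<^esub> k) m = cnj (comm k' m) * comm k m"
      using k m by (simp add: comm_mult_left comm_inv_left)
    moreover have "comm k m = comm k' m * (cnj (comm k' m) * comm k m)"
      using e by (simp add: mult.assoc[symmetric])
    ultimately show "comm k m = comm k' m \<longleftrightarrow> comm (inv\<^bsub>Q\<^esub> k' \<otimes>\<^bsub>Q\<^esub> k) m = 1"
      using e by (metis mult.commute mult.right_neutral)
  qed
  also have "\<dots> \<longleftrightarrow> inv\<^bsub>Q\<^esub> k' \<otimes>\<^bsub>Q\<^esub> k \<in> M"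
    using k in_MI[of "inv\<^bsub>Q\<^esub> k' \<otimes>\<^bsub>Q\<^esub> k"] by auto
  finally show ?thesis .
qed

lemma corner_U:
  assumes k: "k \<in> carrier Q" and \<phi>: "\<phi> \<in> chars M" and \<phi>': "\<phi>' \<in> chars M"
  shows "proj M \<phi>' \<cdot> (U k \<cdot> proj M \<phi>)
    = (if \<phi>' = shift M k \<phi> then U k \<cdot> proj M \<phi> else 0)"
proof -
  note [simp] = proj_in[OF M_subgroup]
  have "proj M \<phi>' \<cdot> (U k \<cdot> proj M \<phi>) = (proj M \<phi>' \<cdot> proj M (shift M k \<phi>)) \<cdot> U k"
    unfolding U_shift[OF k] using k by (subst cmp_assoc) auto
  then show ?thesis
    using k \<phi> \<phi>' shift_in
    by (simp add: proj_idem[OF M_subgroup] proj_orthogonal[OF M_subgroup] U_shift)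
qed

text \<open>An element \<open>U k\<close> with \<open>k \<in> M\<close> multiplies the projection by a scalar, and one with \<open>k \<notin> M\<close> moves it
  to an orthogonal projection, because \<open>M\<close> is its own orthogonal complement.\<close>

lemma corner:
  assumes \<phi>: "\<phi> \<in> chars M" and v: "v \<in> A"
  shows "\<exists>z. proj M \<phi> \<cdot> v \<cdot> proj M \<phi> = z *\<^sub>C proj M \<phi>"
proof -
  note [simp] = proj_in[OF M_subgroup]
  obtain x where x: "v = lin x" using v by (rule A_cases)
  have "\<exists>z. proj M \<phi> \<cdot> (U k \<cdot> proj M \<phi>) = z *\<^sub>C proj M \<phi>" if k: "k \<in> carrier Q" for k
  proof (cases "k \<in> M")
    case True
    then have "U k \<cdot> proj M \<phi> = \<phi> k *\<^sub>C proj M \<phi>" using \<phi> M_subgroup by (intro U_proj)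
    then show ?thesis using \<phi> by (auto simp: proj_idem[OF M_subgroup])
  next
    case False
    have "\<phi> = shift M \<one>\<^bsub>Q\<^esub> \<phi>"
      using \<phi> by (auto simp: shift_def chars_def intro: extensionalityI)
    then have "\<phi> \<noteq> shift M k \<phi>" using shift_eq_iff[OF k _ \<phi>, of "\<one>\<^bsub>Q\<^esub>"] k False by auto
    then have "proj M \<phi> \<cdot> (U k \<cdot> proj M \<phi>) = 0 *\<^sub>C proj M \<phi>"
      using corner_U[OF k \<phi> \<phi>] by simp
    then show ?thesis by blast
  qed
  then obtain z where z: "\<And>k. k \<in> carrier Q \<Longrightarrow> proj M \<phi> \<cdot> (U k \<cdot> proj M \<phi>) = z k *\<^sub>C proj M \<phi>"
    by metis
  have "proj M \<phi> \<cdot> v \<cdot> proj M \<phi> = proj M \<phi> \<cdot> (v \<cdot> proj M \<phi>)" using v by (simp add: cmp_assoc)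
  also have "\<dots> = (\<Sum>k\<in>carrier Q. x k *\<^sub>C z k *\<^sub>C proj M \<phi>)"
    unfolding x by (simp add: sum_cmp cmp_sum_right z)
  also have "\<dots> = (\<Sum>k\<in>carrier Q. x k * z k) *\<^sub>C proj M \<phi>"
    by (simp add: scaleC_scaleC complex_vector.scale_sum_left)
  finally show ?thesis by blast
qed

text \<open>Characters of \<open>M\<close> which agree on the radical differ by a character \<open>\<eta>\<close> of \<open>M\<close> that is trivial
  on the radical. In \<open>\<Sum>k. \<Sum>m\<in>M. \<eta> m * comm k m\<close> the sum over \<open>k\<close> first leaves the terms with
  \<open>m\<close> in the radical, so the double sum is positive; hence for some \<open>k\<close> the character
  \<open>\<lambda>m. \<eta> m * comm k m\<close> has nonzero sum and is trivial.\<close>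

lemma chars_shift:
  assumes \<phi>: "\<phi> \<in> chars M" "\<phi>' \<in> chars M" and agree: "\<And>l. l \<in> perp (carrier Q) \<Longrightarrow> \<phi> l = \<phi>' l"
  shows "\<exists>k\<in>carrier Q. \<phi>' = shift M k \<phi>"
proof -
  note [simp] = H_mult[OF M_subgroup] H_finite[OF M_subgroup]
  let ?L = "perp (carrier Q)"
  define \<eta> where "\<eta> m = \<phi>' m * cnj (\<phi> m)" for m
  have mult: "\<eta> (m \<otimes>\<^bsub>Q\<^esub> m') = \<eta> m * \<eta> m'" if m: "m \<in> M" "m' \<in> M" for m m'
  proof -
    have "\<eta> m * \<eta> m' = (\<phi>' m * \<phi>' m') * cnj (\<phi> m * \<phi> m')" by (simp add: \<eta>_def mult_ac)
    also have "\<phi>' m * \<phi>' m' = c m m' * \<phi>' (m \<otimes>\<^bsub>Q\<^esub> m')"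
      using \<phi>(2) m by (simp add: chars_def)
    also have "\<phi> m * \<phi> m' = c m m' * \<phi> (m \<otimes>\<^bsub>Q\<^esub> m')"
      using \<phi>(1) m by (simp add: chars_def)
    also have "c m m' * \<phi>' (m \<otimes>\<^bsub>Q\<^esub> m') * cnj (c m m' * \<phi> (m \<otimes>\<^bsub>Q\<^esub> m'))
        = (c m m' * cnj (c m m')) * \<eta> (m \<otimes>\<^bsub>Q\<^esub> m')"
      unfolding \<eta>_def by (simp add: ac_simps)
    finally show ?thesis using m by (simp add: c_cnj)
  qed
  have L: "\<eta> l = 1" if "l \<in> ?L" for l
    using that radical_subset agree[OF that] \<phi> unit_cnj by (auto simp: \<eta>_def chars_def)
  have "(\<Sum>k\<in>carrier Q. comm k m) = (if m \<in> ?L then of_nat (card (carrier Q)) else 0)"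
    if m: "m \<in> M" for m
  proof (cases "m \<in> ?L")
    case True
    then have "comm k m = 1" if "k \<in> carrier Q" for k
      using that comm_cnj[of k m] by (simp add: perp_def)
    then show ?thesis using True by simp
  next
    case False
    then obtain k where k: "k \<in> carrier Q" "comm m k \<noteq> 1"
      using m by (auto simp: perp_def)
    have "comm k m \<noteq> 1" using k(2) by (subst comm_cnj) simp
    with k(1) have "(\<Sum>k\<in>carrier Q. comm k m) = 0"
      using m comm_mult_left by (intro character_sum[OF Q.subgroup_self]) auto
    then show ?thesis using False by simp
  qed
  then have "(\<Sum>k\<in>carrier Q. \<Sum>m\<in>M. \<eta> m * comm k m)
      = (\<Sum>m\<in>M. \<eta> m * (if m \<in> ?L then of_nat (card (carrier Q)) else 0))"
    by (subst sum.swap) (simp add: sum_distrib_left[symmetric])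
  also have "\<dots> = (\<Sum>m\<in>?L. \<eta> m * (if m \<in> ?L then of_nat (card (carrier Q)) else 0))"
    using radical_subset by (intro sum.mono_neutral_right) auto
  also have "\<dots> = of_nat (card ?L * card (carrier Q))" using L by simp
  also have "\<dots> \<noteq> 0"
    using H_card[OF perp_subgroup] H_card[OF Q.subgroup_self] by simp
  finally obtain k where k: "k \<in> carrier Q" "(\<Sum>m\<in>M. \<eta> m * comm k m) \<noteq> 0"
    by (metis (no_types, lifting) sum.neutral)
  have triv: "\<eta> m * comm k m = 1" if m: "m \<in> M" for m
  proof (rule ccontr)
    assume "\<eta> m * comm k m \<noteq> 1"
    then have "(\<Sum>m\<in>M. \<eta> m * comm k m) = 0"
      using k(1) m mult by (intro character_sum[OF M_subgroup]) (auto simp: comm_mult_right)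
    with k(2) show False by simp
  qed
  have "\<phi>' m = \<phi> m * cnj (comm k m)" if m: "m \<in> M" for m
  proof -
    have 1: "\<phi> m * cnj (\<phi> m) = 1" "comm k m * cnj (comm k m) = 1"
      using \<phi> m k norm_comm by (auto simp: chars_def intro: unit_cnj)
    have "\<phi>' m = \<phi>' m * (\<phi> m * cnj (\<phi> m)) * (comm k m * cnj (comm k m))" using 1 by simp
    also have "\<dots> = (\<eta> m * comm k m) * (\<phi> m * cnj (comm k m))" by (simp add: \<eta>_def mult_ac)
    finally show ?thesis using triv[OF m] by simp
  qed
  then have "\<phi>' = shift M k \<phi>"
    using \<phi> by (auto simp: shift_def chars_def intro: extensionalityI)
  then show ?thesis using k(1) by blast
qed

end

text \<open>These rules would not terminate for arbitrary \<open>M\<close> either.\<close>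

declare M_carrier [simp del] comm_M [simp del]

subsection \<open>The decomposition\<close>

lemma coset_representatives:
  assumes M: "subgroup M Q"
  obtains N :: nat and \<kappa> where "N * card M = card (carrier Q)" "\<And>i. i < N \<Longrightarrow> \<kappa> i \<in> carrier Q"
    "\<And>k. k \<in> carrier Q \<Longrightarrow> \<exists>i<N. inv\<^bsub>Q\<^esub> (\<kappa> i) \<otimes>\<^bsub>Q\<^esub> k \<in> M"
    "\<And>i j. i < N \<Longrightarrow> j < N \<Longrightarrow> inv\<^bsub>Q\<^esub> (\<kappa> j) \<otimes>\<^bsub>Q\<^esub> \<kappa> i \<in> M \<Longrightarrow> i = j"
proof -
  let ?N = "card (rcosets\<^bsub>Q\<^esub> M)"
  have sub: "M \<subseteq> carrier Q" using M by (rule subgroup.subset)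
  have lag: "?N * card M = card (carrier Q)"
    using Q.lagrange[OF M] by (simp add: order_def mult.commute)
  have "finite (rcosets\<^bsub>Q\<^esub> M)" using Q_finite by (simp add: RCOSETS_def)
  then obtain h where h: "bij_betw h {0..<?N} (rcosets\<^bsub>Q\<^esub> M)" using ex_bij_betw_nat_finite by blast
  have "\<exists>x\<in>carrier Q. h i = M #>\<^bsub>Q\<^esub> x" if "i < ?N" for i
    using bij_betwE[OF h] that by (auto simp: RCOSETS_def)
  then obtain \<kappa> where \<kappa>: "\<And>i. i < ?N \<Longrightarrow> \<kappa> i \<in> carrier Q" "\<And>i. i < ?N \<Longrightarrow> h i = M #>\<^bsub>Q\<^esub> \<kappa> i"
    by metis
  show ?thesis
  proof (rule that[OF lag \<kappa>(1)])
    fix k assume k: "k \<in> carrier Q"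
    then have "M #>\<^bsub>Q\<^esub> k \<in> rcosets\<^bsub>Q\<^esub> M" by (auto simp: RCOSETS_def)
    then have "M #>\<^bsub>Q\<^esub> k \<in> h ` {0..<?N}" using bij_betw_imp_surj_on[OF h] by simp
    then obtain i where "M #>\<^bsub>Q\<^esub> k = h i" "i \<in> {0..<?N}" by (rule imageE)
    then have i: "i < ?N" "h i = M #>\<^bsub>Q\<^esub> k" by auto
    have "k \<in> M #>\<^bsub>Q\<^esub> k" using k M by (rule Q.rcos_self)
    then obtain m where m: "m \<in> M" "k = m \<otimes>\<^bsub>Q\<^esub> \<kappa> i"
      using i \<kappa>(2)[OF i(1)] by (auto simp: r_coset_def)
    have "m \<in> carrier Q" using m sub by blast
    then have "inv\<^bsub>Q\<^esub> (\<kappa> i) \<otimes>\<^bsub>Q\<^esub> k = m"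
      unfolding m(2) using \<kappa>(1)[OF i(1)] by (simp add: Q.m_comm[of m] Q.m_assoc[symmetric])
    then show "\<exists>i<?N. inv\<^bsub>Q\<^esub> (\<kappa> i) \<otimes>\<^bsub>Q\<^esub> k \<in> M" using i m by blast
  next
    fix i j assume ij: "i < ?N" "j < ?N" and m: "inv\<^bsub>Q\<^esub> (\<kappa> j) \<otimes>\<^bsub>Q\<^esub> \<kappa> i \<in> M"
    let ?m = "inv\<^bsub>Q\<^esub> (\<kappa> j) \<otimes>\<^bsub>Q\<^esub> \<kappa> i"
    have "\<kappa> j \<otimes>\<^bsub>Q\<^esub> ?m = \<kappa> i" using \<kappa>(1) ij by (simp add: Q.m_assoc[symmetric])
    then have "\<kappa> i = ?m \<otimes>\<^bsub>Q\<^esub> \<kappa> j" using Q.m_comm[of ?m "\<kappa> j"] \<kappa>(1) ij by simp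
    then have "\<kappa> i \<in> M #>\<^bsub>Q\<^esub> \<kappa> j" using m by (auto simp: r_coset_def)
    then have "M #>\<^bsub>Q\<^esub> \<kappa> j = M #>\<^bsub>Q\<^esub> \<kappa> i"
      using \<kappa>(1) ij M by (intro Q.repr_independence)
    then have "h i = h j" using \<kappa>(2) ij by simp
    then show "i = j" using h ij by (auto simp: bij_betw_def inj_on_def)
  qed
qed

lemma radical_central:
  assumes l: "l \<in> perp (carrier Q)" and v: "v \<in> A"
  shows "U l \<cdot> v = v \<cdot> U l"
proof -
  have l': "U l \<in> A" "l \<in> carrier Q" using l by (simp_all add: perp_def)
  have "U l \<cdot> U k = U k \<cdot> U l" if k: "k \<in> carrier Q" for k
  proof -
    have "comm l k = 1" using l k by (simp add: perp_def)
    then show ?thesis using U_commute[OF l'(2) k] by simp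
  qed
  then show ?thesis
    by (rule clinear_ext[OF cmp_linear_right[OF l'(1)] cmp_linear_left[OF l'(1)] _ v])
qed

abbreviation CS :: "('o \<times> 'v, 'v) tcat" where
  "CS \<equiv> subobject_closure D"

lemma CS_simps [simp]:
  "cmp CS = cmp D" "str CS = str D" "idt CS = snd"
  "Hom CS (b, E) (b', E') = {E' \<cdot> X \<cdot> E |X. X \<in> Hom D b b'}"
  "(b, E) \<in> ob CS \<longleftrightarrow> b \<in> ob D \<and> is_projection D b E"
  by (simp_all add: subobject_closure_def)

context
  fixes M assumes M: "M = perp M"
begin

lemmas MS = M_subgroup[OF M]

lemma proj_A [simp]: "proj M \<phi> \<in> A"
  by (rule proj_in[OF MS])

lemma proj_ob: "\<phi> \<in> chars M \<Longrightarrow> (a, proj M \<phi>) \<in> ob CS"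
  using MS ob_a by (simp add: is_projection_def proj_idem str_proj)

lemma proj_irred:
  assumes \<phi>: "\<phi> \<in> chars M"
  shows "irred_obj CS (a, proj M \<phi>)"
proof -
  let ?q = "proj M \<phi>"
  have "{?q \<cdot> X \<cdot> ?q |X. X \<in> A} = range (\<lambda>z. z *\<^sub>C ?q)"
  proof
    show "{?q \<cdot> X \<cdot> ?q |X. X \<in> A} \<subseteq> range (\<lambda>z. z *\<^sub>C ?q)"
      using corner[OF M \<phi>] by blast
    have "z *\<^sub>C ?q = ?q \<cdot> (z *\<^sub>C ?q) \<cdot> ?q" for z
      using \<phi> MS by (simp add: proj_idem)
    then show "range (\<lambda>z. z *\<^sub>C ?q) \<subseteq> {?q \<cdot> X \<cdot> ?q |X. X \<in> A}"
      using scale_in[OF proj_A] by blast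
  qed
  then show ?thesis using proj_nonzero[OF MS \<phi>] by (simp add: irred_obj_def)
qed

lemma proj_iso:
  assumes \<phi>: "\<phi> \<in> chars M" "\<phi>' \<in> chars M" and agree: "\<And>l. l \<in> perp (carrier Q) \<Longrightarrow> \<phi> l = \<phi>' l"
  shows "iso_obj CS (a, proj M \<phi>) (a, proj M \<phi>')"
proof -
  obtain k where k: "k \<in> carrier Q" "\<phi>' = shift M k \<phi>"
    using chars_shift[OF M \<phi> agree] by blast
  let ?f = "U k \<cdot> proj M \<phi>"
  have f: "?f = proj M \<phi>' \<cdot> U k \<cdot> proj M \<phi>"
    using corner_U[OF M k(1) \<phi>] k by (simp add: cmp_assoc)
  have sf: "str D ?f = proj M \<phi> \<cdot> str D (U k)"
    using k \<phi> by (simp add: str_cmp_A str_proj[OF MS])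
  then have sf': "str D ?f = proj M \<phi> \<cdot> str D (U k) \<cdot> proj M \<phi>'"
    by (subst f) (use k \<phi> in \<open>simp add: str_cmp_A str_proj[OF MS] cmp_assoc\<close>)
  have "str D ?f \<cdot> ?f = proj M \<phi> \<cdot> ((str D (U k) \<cdot> U k) \<cdot> proj M \<phi>)"
    unfolding sf using k by (simp add: cmp_assoc)
  then have 1: "str D ?f \<cdot> ?f = proj M \<phi>"
    using k \<phi> by (simp add: str_U_U proj_idem[OF MS])
  have "?f \<cdot> str D ?f = (U k \<cdot> (proj M \<phi> \<cdot> proj M \<phi>)) \<cdot> str D (U k)"
    unfolding sf using k by (simp add: cmp_assoc)
  then have 2: "?f \<cdot> str D ?f = proj M \<phi>'"
    using k \<phi> U_conj_proj[OF M k(1)] by (simp add: proj_idem[OF MS])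
  have "?f \<in> Hom CS (a, proj M \<phi>) (a, proj M \<phi>')" using f k by auto
  moreover have "str D ?f \<in> Hom CS (a, proj M \<phi>') (a, proj M \<phi>)"
    using sf' str_in_A[OF U_in[OF k(1)]] by auto
  ultimately show ?thesis unfolding iso_obj_def using 1 2 by auto
qed

text \<open>An element \<open>U l\<close> with \<open>l\<close> in the radical is central and acts on the two objects by the scalars
  \<open>\<phi> l\<close> and \<open>\<phi>' l\<close>, so that there are no nonzero arrows between them.\<close>

lemma proj_not_iso:
  assumes \<phi>: "\<phi> \<in> chars M" "\<phi>' \<in> chars M" and l: "l \<in> perp (carrier Q)" "\<phi> l \<noteq> \<phi>' l"
  shows "\<not> iso_obj CS (a, proj M \<phi>) (a, proj M \<phi>')"
proof
  assume "iso_obj CS (a, proj M \<phi>) (a, proj M \<phi>')"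
  then obtain X Y where X: "X \<in> A" and Y: "Y \<in> A"
    and e: "(proj M \<phi> \<cdot> Y \<cdot> proj M \<phi>') \<cdot> (proj M \<phi>' \<cdot> X \<cdot> proj M \<phi>) = proj M \<phi>"
    by (auto simp: iso_obj_def)
  have lM: "l \<in> M" using l radical_subset[OF M] by blast
  have lQ: "U l \<in> A" using l by (simp add: perp_def)
  let ?f = "proj M \<phi>' \<cdot> X \<cdot> proj M \<phi>"
  have "U l \<cdot> ?f = (U l \<cdot> proj M \<phi>') \<cdot> X \<cdot> proj M \<phi>" using lQ X by (simp add: cmp_assoc)
  then have 1: "U l \<cdot> ?f = \<phi>' l *\<^sub>C ?f" using lM \<phi> X by (simp add: U_proj[OF MS])
  have "?f \<cdot> U l = proj M \<phi>' \<cdot> X \<cdot> (proj M \<phi> \<cdot> U l)" using lQ X by (simp add: cmp_assoc)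
  then have 2: "?f \<cdot> U l = \<phi> l *\<^sub>C ?f" using lM \<phi> X by (simp add: proj_U[OF MS])
  have "?f \<in> A" using X by simp
  then have "\<phi>' l *\<^sub>C ?f = \<phi> l *\<^sub>C ?f" using 1 2 radical_central[OF l(1)] by metis
  then have "?f = 0" using l(2) complex_vector.scale_right_imp_eq by metis
  then have "proj M \<phi> = 0" using e Y by simp
  then show False using proj_nonzero[OF MS \<phi>(1)] by simp
qed

end

text \<open>The objects are given by projections of a maximal isotropic subgroup \<open>M\<close>, one for each
  character of the radical \<open>L\<close>, and the isometries are their translates by representatives of
  the cosets of \<open>M\<close>; these translates are all the projections of \<open>M\<close>. The characters in \<open>chars L\<close>
  form a torsor for the character group of \<open>L\<close>, and \<open>\<xi>\<close> is made to act on it by multiplication with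
  \<open>\<xi>\<^sup>-\<^sup>1\<close>, because the coefficients of a projection are the conjugates of the values of its
  character.\<close>

theorem decomposition:
  assumes L: "L = perp (carrier Q)"
  shows "\<exists>(N::nat) r w.
      real N = sqrt (real (card (carrier Q)) / real (card L)) \<and>
      (\<forall>\<xi>\<in>carrier (char_group (Q\<lparr>carrier := L\<rparr>)). r \<xi> \<in> ob CS \<and> irred_obj CS (r \<xi>)) \<and>
      (\<forall>\<xi>\<in>carrier (char_group (Q\<lparr>carrier := L\<rparr>)). \<forall>\<eta>\<in>carrier (char_group (Q\<lparr>carrier := L\<rparr>)).
        \<xi> \<noteq> \<eta> \<longrightarrow> \<not> iso_obj CS (r \<xi>) (r \<eta>)) \<and>
      direct_sum CS (carrier (char_group (Q\<lparr>carrier := L\<rparr>)) \<times> {..<N}) (\<lambda>(\<xi>, i). r \<xi>) w (a, I) \<and>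
      (\<forall>g act. g \<in> hom Q circle_group \<longrightarrow> (\<forall>x. act (lin x) = lin (\<lambda>k. g k * x k)) \<longrightarrow>
        (\<forall>\<xi>\<in>carrier (char_group (Q\<lparr>carrier := L\<rparr>)).
          iso_obj CS (map_prod id act (r \<xi>))
            (r (restrict g L \<otimes>\<^bsub>char_group (Q\<lparr>carrier := L\<rparr>)\<^esub> \<xi>))))"
proof -
  obtain M where M: "M = perp M" using exists_lagrangian ..
  note MS = M_subgroup[OF M] and MI = M_isotropic[OF M]
  have LS: "subgroup L Q" unfolding L by (rule perp_subgroup) simp
  have LM: "L \<subseteq> M" unfolding L by (rule radical_subset[OF M])
  have LI: "isotropic L" using MI LM by (auto simp: isotropic_def)
  note [simp] = H_mult[OF LS] H_carrier[OF LS]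
  let ?X = "carrier (char_group (Q\<lparr>carrier := L\<rparr>))"
  have X: "\<xi> \<in> ?X \<longleftrightarrow> \<xi> \<in> extensional L \<and> (\<forall>l\<in>L. norm (\<xi> l) = 1) \<and>
      (\<forall>l\<in>L. \<forall>l'\<in>L. \<xi> (l \<otimes>\<^bsub>Q\<^esub> l') = \<xi> l * \<xi> l')" for \<xi>
    by (auto simp: char_group_def hom_def circle_group_def)
  have "card (chars L) > 0" using card_chars[OF LS LI] H_card[OF LS] by simp
  then obtain \<phi>0 where \<phi>0: "\<phi>0 \<in> chars L" by (metis card.empty ex_in_conv less_irrefl)
  have n0: "\<phi>0 l * cnj (\<phi>0 l) = 1" if "l \<in> L" for l
    using that \<phi>0 by (intro unit_cnj) (simp add: chars_def)
  define base where "base \<xi> = (\<lambda>l\<in>L. \<phi>0 l * cnj (\<xi> l))" for \<xi>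
  have base_in: "base \<xi> \<in> chars L" if \<xi>: "\<xi> \<in> ?X" for \<xi>
  proof -
    have "base \<xi> l * base \<xi> l' = c l l' * base \<xi> (l \<otimes>\<^bsub>Q\<^esub> l')" if l: "l \<in> L" "l' \<in> L" for l l'
    proof -
      have "base \<xi> l * base \<xi> l' = (\<phi>0 l * \<phi>0 l') * cnj (\<xi> l * \<xi> l')"
        using l by (simp add: base_def ac_simps)
      also have "\<phi>0 l * \<phi>0 l' = c l l' * \<phi>0 (l \<otimes>\<^bsub>Q\<^esub> l')" using \<phi>0 l by (simp add: chars_def)
      finally show ?thesis using l \<xi> by (simp add: base_def X)
    qed
    then show ?thesis using \<xi> \<phi>0 by (simp add: chars_def base_def X norm_mult)
  qed
  define unbase where "unbase \<phi> = (\<lambda>l\<in>L. \<phi>0 l * cnj (\<phi> l))" for \<phi>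
  have unbase_in: "unbase \<phi> \<in> ?X" if \<phi>: "\<And>l. l \<in> L \<Longrightarrow> norm (\<phi> l) = 1"
    "\<And>l l'. l \<in> L \<Longrightarrow> l' \<in> L \<Longrightarrow> \<phi> l * \<phi> l' = c l l' * \<phi> (l \<otimes>\<^bsub>Q\<^esub> l')" for \<phi>
  proof -
    have "unbase \<phi> (l \<otimes>\<^bsub>Q\<^esub> l') = unbase \<phi> l * unbase \<phi> l'" if l: "l \<in> L" "l' \<in> L" for l l'
    proof -
      have "unbase \<phi> l * unbase \<phi> l' = (\<phi>0 l * \<phi>0 l') * cnj (\<phi> l * \<phi> l')"
        using l by (simp add: unbase_def ac_simps)
      also have "\<phi>0 l * \<phi>0 l' = c l l' * \<phi>0 (l \<otimes>\<^bsub>Q\<^esub> l')" using \<phi>0 l by (simp add: chars_def)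
      also have "\<phi> l * \<phi> l' = c l l' * \<phi> (l \<otimes>\<^bsub>Q\<^esub> l')" using \<phi> l by simp
      also have "c l l' * \<phi>0 (l \<otimes>\<^bsub>Q\<^esub> l') * cnj (c l l' * \<phi> (l \<otimes>\<^bsub>Q\<^esub> l'))
          = (c l l' * cnj (c l l')) * (\<phi>0 (l \<otimes>\<^bsub>Q\<^esub> l') * cnj (\<phi> (l \<otimes>\<^bsub>Q\<^esub> l')))"
        by (simp add: ac_simps)
      finally show ?thesis using l by (simp add: unbase_def c_cnj)
    qed
    then show ?thesis using \<phi>(1) \<phi>0 by (simp add: X unbase_def chars_def norm_mult)
  qed
  have base_unbase: "base (unbase \<phi>) l = \<phi> l" if l: "l \<in> L" for \<phi> l
  proof -
    have "base (unbase \<phi>) l = (\<phi>0 l * cnj (\<phi>0 l)) * \<phi> l"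
      using l by (simp add: base_def unbase_def mult.assoc)
    then show ?thesis using n0[OF l] by simp
  qed
  have base_inj: "\<xi> = \<eta>" if \<xi>: "\<xi> \<in> ?X" "\<eta> \<in> ?X" and e: "\<And>l. l \<in> L \<Longrightarrow> base \<xi> l = base \<eta> l" for \<xi> \<eta>
  proof (rule extensionalityI)
    show "\<xi> \<in> extensional L" "\<eta> \<in> extensional L" using \<xi> X by auto
    fix l assume l: "l \<in> L"
    have "\<phi>0 l \<noteq> 0" using \<phi>0 l by (force simp: chars_def)
    then show "\<xi> l = \<eta> l" using e[OF l] l by (simp add: base_def)
  qed
  have "bij_betw base ?X (chars L)"
  proof (rule bij_betw_imageI)
    show "inj_on base ?X" using base_inj by (intro inj_onI) metis
    have "\<phi> \<in> base ` ?X" if \<phi>: "\<phi> \<in> chars L" for \<phi>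
    proof (rule image_eqI)
      show "unbase \<phi> \<in> ?X" using \<phi> by (intro unbase_in) (auto simp: chars_def)
      then show "\<phi> = base (unbase \<phi>)"
        using base_in base_unbase \<phi> by (intro chars_eqI[OF LS]) auto
    qed
    then show "base ` ?X = chars L" using base_in by blast
  qed
  then have cardX: "card ?X = card L" using card_chars[OF LS LI] bij_betw_same_card by metis
  have "\<exists>\<phi>\<in>chars M. \<forall>l\<in>L. \<phi> l = base \<xi> l" if "\<xi> \<in> ?X" for \<xi>
    by (rule chars_extend[OF LS MS MI LM base_in[OF that]])
  then obtain ext where ext: "\<And>\<xi>. \<xi> \<in> ?X \<Longrightarrow> ext \<xi> \<in> chars M"
    "\<And>\<xi> l. \<xi> \<in> ?X \<Longrightarrow> l \<in> L \<Longrightarrow> ext \<xi> l = base \<xi> l"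
    by metis
  obtain N :: nat and \<kappa> where N: "N * card M = card (carrier Q)"
    and \<kappa>: "\<And>i. i < N \<Longrightarrow> \<kappa> i \<in> carrier Q"
    and \<kappa>_surj: "\<And>k. k \<in> carrier Q \<Longrightarrow> \<exists>i<N. inv\<^bsub>Q\<^esub> (\<kappa> i) \<otimes>\<^bsub>Q\<^esub> k \<in> M"
    and \<kappa>_inj: "\<And>i j. i < N \<Longrightarrow> j < N \<Longrightarrow> inv\<^bsub>Q\<^esub> (\<kappa> j) \<otimes>\<^bsub>Q\<^esub> \<kappa> i \<in> M \<Longrightarrow> i = j"
    using coset_representatives[OF MS] by blast
  define \<beta> where "\<beta> = (\<lambda>(\<xi>, i). shift M (\<kappa> i) (ext \<xi>))"
  have \<beta>: "\<beta> (\<xi>, i) = shift M (\<kappa> i) (ext \<xi>)" for \<xi> i by (simp add: \<beta>_def)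
  have shift_L: "shift M k \<phi> l = \<phi> l" if "k \<in> carrier Q" "l \<in> L" for k \<phi> l
  proof -
    have "comm l k = 1" using that unfolding L perp_def by simp
    then have "cnj (comm k l) = 1" by (simp only: comm_cnj[of l k])
    moreover have "l \<in> M" using that LM by blast
    ultimately show ?thesis by (simp add: shift_def)
  qed
  have \<beta>_bij: "bij_betw \<beta> (?X \<times> {..<N}) (chars M)"
  proof (rule bij_betw_imageI)
    show "inj_on \<beta> (?X \<times> {..<N})"
    proof (rule inj_onI, clarify)
      fix \<xi> \<eta> i j assume \<xi>: "\<xi> \<in> ?X" "\<eta> \<in> ?X" and i: "i < N" "j < N" and e: "\<beta> (\<xi>, i) = \<beta> (\<eta>, j)"
      have "base \<xi> l = base \<eta> l" if l: "l \<in> L" for l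
        using fun_cong[OF e, of l] \<xi> i l \<kappa> ext by (simp add: \<beta> shift_L)
      then have "\<xi> = \<eta>" using base_inj \<xi> by blast
      moreover from this have "inv\<^bsub>Q\<^esub> (\<kappa> j) \<otimes>\<^bsub>Q\<^esub> \<kappa> i \<in> M"
        using e shift_eq_iff[OF M \<kappa>[OF i(1)] \<kappa>[OF i(2)] ext(1)[OF \<xi>(1)]] by (simp add: \<beta>)
      ultimately show "\<xi> = \<eta> \<and> i = j" using \<kappa>_inj i by blast
    qed
    have "\<phi> \<in> \<beta> ` (?X \<times> {..<N})" if \<phi>: "\<phi> \<in> chars M" for \<phi>
    proof -
      have un: "unbase \<phi> \<in> ?X" using \<phi> LM by (intro unbase_in) (auto simp: chars_def subset_iff)
      then obtain k where k: "k \<in> carrier Q" "\<phi> = shift M k (ext (unbase \<phi>))"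
        using chars_shift[OF M ext(1)[OF un] \<phi>] ext(2)[OF un] base_unbase L by auto
      obtain i where i: "i < N" "inv\<^bsub>Q\<^esub> (\<kappa> i) \<otimes>\<^bsub>Q\<^esub> k \<in> M" using \<kappa>_surj[OF k(1)] by blast
      then have "\<phi> = \<beta> (unbase \<phi>, i)"
        using shift_eq_iff[OF M k(1) \<kappa>[OF i(1)] ext(1)[OF un]] k(2) by (simp add: \<beta>)
      then show ?thesis using un i by (intro image_eqI) auto
    qed
    moreover have "\<beta> (\<xi>, i) \<in> chars M" if "\<xi> \<in> ?X" "i < N" for \<xi> i
      using that \<kappa> ext shift_in[OF M] by (simp add: \<beta>)
    ultimately show "\<beta> ` (?X \<times> {..<N}) = chars M" by auto
  qed
  \<comment> \<open>With \<open>card M = N * card L\<close> and \<open>card (carrier Q) = N * card M\<close> the multiplicity is determined.\<close>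
  then have "card ?X * N = card M"
    using card_chars[OF MS MI] bij_betw_same_card[OF \<beta>_bij] by (simp add: card_cartesian_product)
  then have "N * (card L * N) = card (carrier Q)" using N cardX by simp
  then have "real N ^ 2 = real (card (carrier Q)) / real (card L)"
    using H_card[OF LS] by (simp add: field_simps power2_eq_square flip: of_nat_mult)
  then have N_eq: "real N = sqrt (real (card (carrier Q)) / real (card L))"
    by (metis of_nat_0_le_iff real_sqrt_unique)
  define r where "r \<xi> = (a, proj M (ext \<xi>))" for \<xi>
  define w where "w = (\<lambda>(\<xi>, i). U (\<kappa> i) \<cdot> proj M (ext \<xi>))"
  note [simp] = proj_A[OF M]
  have w_str: "str D (w (\<xi>, i)) = proj M (ext \<xi>) \<cdot> str D (U (\<kappa> i))" if "\<xi> \<in> ?X" "i < N" for \<xi> i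
    using that \<kappa> ext by (simp add: w_def str_cmp_A str_proj[OF MS])
  have w_iso: "is_isometry CS (r \<xi>) (a, I) (w (\<xi>, i))" if \<xi>: "\<xi> \<in> ?X" and i: "i < N" for \<xi> i
  proof -
    have "w (\<xi>, i) = I \<cdot> U (\<kappa> i) \<cdot> proj M (ext \<xi>)" using i \<kappa> by (simp add: w_def)
    then have "w (\<xi>, i) \<in> Hom CS (r \<xi>) (a, I)"
      unfolding r_def CS_simps using U_in[OF \<kappa>[OF i]] by blast
    moreover have "str D (w (\<xi>, i)) \<cdot> w (\<xi>, i)
        = proj M (ext \<xi>) \<cdot> ((str D (U (\<kappa> i)) \<cdot> U (\<kappa> i)) \<cdot> proj M (ext \<xi>))"
      unfolding w_str[OF that] using i \<kappa> by (simp add: w_def cmp_assoc)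
    then have "str D (w (\<xi>, i)) \<cdot> w (\<xi>, i) = proj M (ext \<xi>)"
      using i \<kappa> \<xi> ext by (simp add: str_U_U proj_idem[OF MS])
    ultimately show ?thesis by (simp add: is_isometry_def r_def)
  qed
  have w_range: "w (\<xi>, i) \<cdot> str D (w (\<xi>, i)) = proj M (\<beta> (\<xi>, i))" if \<xi>: "\<xi> \<in> ?X" and i: "i < N" for \<xi> i
  proof -
    have "w (\<xi>, i) \<cdot> str D (w (\<xi>, i))
        = (U (\<kappa> i) \<cdot> (proj M (ext \<xi>) \<cdot> proj M (ext \<xi>))) \<cdot> str D (U (\<kappa> i))"
      unfolding w_str[OF that] using i \<kappa> by (simp add: w_def cmp_assoc)
    then show ?thesis
      using i \<kappa> \<xi> ext by (simp add: proj_idem[OF MS] U_conj_proj[OF M] \<beta>)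
  qed
  have w_orth: "str D (w p) \<cdot> w p' = 0" if p: "p \<in> ?X \<times> {..<N}" "p' \<in> ?X \<times> {..<N}" "p \<noteq> p'" for p p'
  proof -
    obtain \<xi> i \<eta> j where e: "p = (\<xi>, i)" "p' = (\<eta>, j)" and \<xi>: "\<xi> \<in> ?X" "\<eta> \<in> ?X" and i: "i < N" "j < N"
      using p by auto
    have ch: "\<beta> p \<in> chars M" "\<beta> p' \<in> chars M" "\<beta> p \<noteq> \<beta> p'"
      using \<beta>_bij p by (auto simp: bij_betw_def inj_on_def)
    have 1: "w p = proj M (\<beta> p) \<cdot> U (\<kappa> i)" "w p' = proj M (\<beta> p') \<cdot> U (\<kappa> j)"
      using e i \<kappa> U_shift[OF M] by (auto simp: w_def \<beta>)
    have "str D (w p) = str D (U (\<kappa> i)) \<cdot> proj M (\<beta> p)"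
      using 1 i \<kappa> ch by (simp add: str_cmp_A str_proj[OF MS])
    then have "str D (w p) \<cdot> w p' = str D (U (\<kappa> i)) \<cdot> ((proj M (\<beta> p) \<cdot> proj M (\<beta> p')) \<cdot> U (\<kappa> j))"
      using 1 i \<kappa> by (simp add: cmp_assoc)
    then show ?thesis using ch i \<kappa> by (simp add: proj_orthogonal[OF MS])
  qed
  have w_sum: "(\<Sum>p\<in>?X \<times> {..<N}. w p \<cdot> str D (w p)) = I"
  proof -
    have "(\<Sum>p\<in>?X \<times> {..<N}. w p \<cdot> str D (w p)) = (\<Sum>p\<in>?X \<times> {..<N}. proj M (\<beta> p))"
      using w_range by (intro sum.cong refl) auto
    also have "\<dots> = (\<Sum>\<phi>\<in>chars M. proj M \<phi>)" using \<beta>_bij by (rule sum.reindex_bij_betw)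
    finally show ?thesis using sum_proj[OF MS MI] by simp
  qed
  have fin: "finite (?X \<times> {..<N})"
    using bij_betw_finite[OF \<beta>_bij] finite_chars[OF MS] by simp
  have r_ob: "r \<xi> \<in> ob CS" if "\<xi> \<in> ?X" for \<xi>
    unfolding r_def using that ext by (intro proj_ob[OF M])
  have "direct_sum CS (?X \<times> {..<N}) (\<lambda>(\<xi>, i). r \<xi>) w (a, I)"
    using fin r_ob w_iso w_orth w_sum unfolding direct_sum_def by auto
  moreover have "irred_obj CS (r \<xi>)" if "\<xi> \<in> ?X" for \<xi>
    unfolding r_def using that ext by (intro proj_irred[OF M])
  moreover have "\<not> iso_obj CS (r \<xi>) (r \<eta>)" if \<xi>: "\<xi> \<in> ?X" "\<eta> \<in> ?X" "\<xi> \<noteq> \<eta>" for \<xi> \<eta>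
  proof -
    obtain l where l: "l \<in> L" "base \<xi> l \<noteq> base \<eta> l" using base_inj \<xi> by blast
    then show ?thesis
      unfolding r_def using \<xi> ext L by (intro proj_not_iso[OF M, of _ _ l]) auto
  qed
  moreover have "iso_obj CS (map_prod id act (r \<xi>)) (r (restrict g L \<otimes>\<^bsub>char_group (Q\<lparr>carrier := L\<rparr>)\<^esub> \<xi>))"
    if g: "g \<in> hom Q circle_group" and act: "\<forall>x. act (lin x) = lin (\<lambda>k. g k * x k)" and \<xi>: "\<xi> \<in> ?X"
    for g act \<xi>
  proof -
    let ?g\<xi> = "restrict g L \<otimes>\<^bsub>char_group (Q\<lparr>carrier := L\<rparr>)\<^esub> \<xi>"
    have g1: "norm (g k) = 1" if "k \<in> carrier Q" for k
      using g that by (auto simp: hom_def circle_group_def Pi_iff)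
    have g2: "g (k \<otimes>\<^bsub>Q\<^esub> l) = g k * g l" if "k \<in> carrier Q" "l \<in> carrier Q" for k l
      using g that by (simp add: hom_def circle_group_def)
    have g\<xi>: "?g\<xi> = (\<lambda>l\<in>L. g l * \<xi> l)" by (auto simp: char_group_def)
    have g\<xi>_in: "?g\<xi> \<in> ?X" unfolding X g\<xi> using \<xi> g1 g2 by (auto simp: X norm_mult)
    let ?\<phi> = "\<lambda>m\<in>M. ext \<xi> m * cnj (g m)"
    note [simp] = H_mult[OF MS] H_carrier[OF MS]
    have "?\<phi> m * ?\<phi> m' = c m m' * ?\<phi> (m \<otimes>\<^bsub>Q\<^esub> m')" if m: "m \<in> M" "m' \<in> M" for m m'
    proof -
      have "?\<phi> m * ?\<phi> m' = (ext \<xi> m * ext \<xi> m') * cnj (g m * g m')"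
        using m by (simp add: ac_simps)
      also have "ext \<xi> m * ext \<xi> m' = c m m' * ext \<xi> (m \<otimes>\<^bsub>Q\<^esub> m')"
        using ext(1)[OF \<xi>] m by (simp add: chars_def)
      finally show ?thesis using m by (simp add: g2)
    qed
    then have \<phi>: "?\<phi> \<in> chars M" using ext(1)[OF \<xi>] g1 by (simp add: chars_def norm_mult)
    have "act (proj M (ext \<xi>)) = proj M ?\<phi>"
      unfolding proj_eq_lin[OF MS] act[rule_format] by (intro sum.cong refl) simp
    moreover have "iso_obj CS (a, proj M ?\<phi>) (a, proj M (ext ?g\<xi>))"
    proof (rule proj_iso[OF M \<phi> ext(1)[OF g\<xi>_in]])
      fix l assume "l \<in> perp (carrier Q)"
      then have l: "l \<in> L" "l \<in> M" using L LM by auto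
      show "?\<phi> l = ext ?g\<xi> l"
        using l ext(2)[OF \<xi> l(1)] ext(2)[OF g\<xi>_in l(1)] by (simp add: base_def g\<xi>)
    qed
    ultimately show ?thesis by (simp add: r_def)
  qed
  ultimately show ?thesis
    using N_eq r_ob by (intro exI[of _ N] exI[of _ r] exI[of _ w]) blast
qed

end


section \<open>Irreducible objects\<close>

context star_category
begin

lemma zero_in: "a \<in> ob C \<Longrightarrow> b \<in> ob C \<Longrightarrow> 0 \<in> Hom C a b"
  using Hom_subspace complex_vector.subspace_0 by blast

lemma scale_in: "a \<in> ob C \<Longrightarrow> b \<in> ob C \<Longrightarrow> f \<in> Hom C a b \<Longrightarrow> z *\<^sub>C f \<in> Hom C a b"
  using Hom_subspace complex_vector.subspace_scale by blast

lemma diff_in: "a \<in> ob C \<Longrightarrow> b \<in> ob C \<Longrightarrow> f \<in> Hom C a b \<Longrightarrow> g \<in> Hom C a b \<Longrightarrow> f - g \<in> Hom C a b"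
  using Hom_subspace complex_vector.subspace_diff by blast

lemma cmp_scale: "\<lbrakk>a \<in> ob C; b \<in> ob C; c \<in> ob C; g \<in> Hom C b c; f \<in> Hom C a b\<rbrakk>
    \<Longrightarrow> g \<cdot> (z *\<^sub>C f) = z *\<^sub>C (g \<cdot> f)"
  using clinear_on_scaleC[OF cmp_linear_right] by blast

lemma scale_cmp: "\<lbrakk>a \<in> ob C; b \<in> ob C; c \<in> ob C; g \<in> Hom C b c; f \<in> Hom C a b\<rbrakk>
    \<Longrightarrow> (z *\<^sub>C g) \<cdot> f = z *\<^sub>C (g \<cdot> f)"
  using clinear_on_scaleC[OF cmp_linear_left] by blast

lemma cmp_zero: "\<lbrakk>a \<in> ob C; b \<in> ob C; c \<in> ob C; g \<in> Hom C b c\<rbrakk> \<Longrightarrow> g \<cdot> 0 = 0"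
  using clinear_on_zero[OF cmp_linear_right Hom_subspace] by blast

lemma zero_cmp: "\<lbrakk>a \<in> ob C; b \<in> ob C; c \<in> ob C; f \<in> Hom C a b\<rbrakk> \<Longrightarrow> 0 \<cdot> f = 0"
  using clinear_on_zero[OF cmp_linear_left Hom_subspace] by blast

lemma str_idt:
  assumes a: "a \<in> ob C"
  shows "str C (idt C a) = idt C a"
proof -
  let ?s = "str C (idt C a)"
  have s: "?s \<in> Hom C a a" using str_in[OF a a idt_in[OF a]] .
  have "idt C a = str C (?s \<cdot> idt C a)"
    using cmp_idt_right[OF a a s] str_str[OF a a idt_in[OF a]] by simp
  also have "\<dots> = ?s \<cdot> str C ?s" using str_cmp[OF a a a s idt_in[OF a]] .
  also have "\<dots> = ?s" using str_str[OF a a idt_in[OF a]] cmp_idt_right[OF a a s] by simp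
  finally show ?thesis by (rule sym)
qed

lemma iso_refl: "a \<in> ob C \<Longrightarrow> iso_obj C a a"
  unfolding iso_obj_def using idt_in cmp_idt_left by blast

lemma iso_sym: "iso_obj C a b \<Longrightarrow> iso_obj C b a"
  unfolding iso_obj_def by blast

lemma iso_trans:
  assumes ob: "a \<in> ob C" "b \<in> ob C" "c \<in> ob C" and "iso_obj C a b" "iso_obj C b c"
  shows "iso_obj C a c"
proof -
  obtain f g where f: "f \<in> Hom C a b" "g \<in> Hom C b a" "g \<cdot> f = idt C a" "f \<cdot> g = idt C b"
    using assms unfolding iso_obj_def by blast
  obtain h k where h: "h \<in> Hom C b c" "k \<in> Hom C c b" "k \<cdot> h = idt C b" "h \<cdot> k = idt C c"
    using assms unfolding iso_obj_def by blast
  have hf: "h \<cdot> f \<in> Hom C a c" and gk: "g \<cdot> k \<in> Hom C c a"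
    using cmp_in[OF ob h(1) f(1)] cmp_in[OF ob(3,2,1) f(2) h(2)] by simp_all
  have "(g \<cdot> k) \<cdot> (h \<cdot> f) = g \<cdot> (k \<cdot> (h \<cdot> f))"
    using cmp_assoc[OF ob(1,3,2,1) f(2) h(2) hf] by simp
  also have "k \<cdot> (h \<cdot> f) = f"
    using cmp_assoc[OF ob(1,2,3,2) h(2) h(1) f(1)] h cmp_idt_left[OF ob(1,2) f(1)] by simp
  finally have 1: "(g \<cdot> k) \<cdot> (h \<cdot> f) = idt C a" using f by simp
  have "(h \<cdot> f) \<cdot> (g \<cdot> k) = h \<cdot> (f \<cdot> (g \<cdot> k))"
    using cmp_assoc[OF ob(3,1,2,3) h(1) f(1) gk] by simp
  also have "f \<cdot> (g \<cdot> k) = k"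
    using cmp_assoc[OF ob(3,2,1,2) f(1) f(2) h(2)] f cmp_idt_left[OF ob(3,2) h(2)] by simp
  finally have "(h \<cdot> f) \<cdot> (g \<cdot> k) = idt C c" using h by simp
  with 1 hf gk show ?thesis unfolding iso_obj_def by blast
qed

lemma iso_class_eq_iff:
  assumes "a \<in> ob C" "b \<in> ob C"
  shows "iso_class C a = iso_class C b \<longleftrightarrow> iso_obj C a b"
proof
  assume "iso_class C a = iso_class C b"
  moreover have "b \<in> iso_class C b" using assms iso_refl by (simp add: iso_class_def)
  ultimately show "iso_obj C a b" by (auto simp: iso_class_def)
next
  assume "iso_obj C a b"
  then show "iso_class C a = iso_class C b"
    using iso_trans[OF assms(2,1)] iso_trans[OF assms] iso_sym[of a b]
    unfolding iso_class_def by blast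
qed

lemma irred_scalar: "irred_obj C a \<Longrightarrow> f \<in> Hom C a a \<Longrightarrow> \<exists>z. f = z *\<^sub>C idt C a"
  by (auto simp: irred_obj_def)

lemma irred_iso:
  assumes ob: "a \<in> ob C" "b \<in> ob C" and a: "irred_obj C a" and iso: "iso_obj C a b"
  shows "irred_obj C b"
proof -
  obtain f g where f: "f \<in> Hom C a b" "g \<in> Hom C b a" "g \<cdot> f = idt C a" "f \<cdot> g = idt C b"
    using iso unfolding iso_obj_def by blast
  have "idt C b \<noteq> 0"
  proof
    assume "idt C b = 0"
    then have "f = 0" using cmp_idt_left[OF ob f(1)] zero_cmp[OF ob(1,2,2) f(1)] by simp
    then have "idt C a = 0" using f(3) cmp_zero[OF ob(1,2,1) f(2)] by simp
    with a show False by (simp add: irred_obj_def)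
  qed
  moreover have "\<exists>z. h = z *\<^sub>C idt C b" if h: "h \<in> Hom C b b" for h
  proof -
    have hf: "h \<cdot> f \<in> Hom C a b" using cmp_in[OF ob(1,2,2) h f(1)] .
    have "g \<cdot> (h \<cdot> f) \<in> Hom C a a" using cmp_in[OF ob(1,2,1) f(2) hf] .
    then obtain z where z: "g \<cdot> (h \<cdot> f) = z *\<^sub>C idt C a" using a irred_scalar by blast
    have "h \<cdot> f = f \<cdot> (g \<cdot> (h \<cdot> f))"
      using cmp_assoc[OF ob(1,2,1,2) f(1) f(2) hf] f(4) cmp_idt_left[OF ob hf] by simp
    also have "\<dots> = z *\<^sub>C f"
      unfolding z using ob f by (subst cmp_scale[of a a b]) (auto intro: idt_in simp: cmp_idt_right)
    finally have "(h \<cdot> f) \<cdot> g = z *\<^sub>C idt C b"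
      using ob f scale_cmp[of b a b f g z] by simp
    moreover have "(h \<cdot> f) \<cdot> g = h"
      using cmp_assoc[OF ob(2,1,2,2) h f(1) f(2)] f(4) cmp_idt_right[OF ob(2,2) h] by simp
    ultimately show ?thesis by auto
  qed
  moreover have "range (\<lambda>z. z *\<^sub>C idt C b) \<subseteq> Hom C b b" using ob idt_in scale_in by blast
  ultimately show ?thesis unfolding irred_obj_def by blast
qed

text \<open>For an arrow \<open>T \<noteq> 0\<close> between irreducible objects both \<open>T\<^sup>* T\<close> and \<open>T T\<^sup>*\<close> are scalars; as
  \<open>T T\<^sup>* T \<noteq> 0\<close> they are the same nonzero scalar.\<close>

lemma schur:
  assumes ob: "a \<in> ob C" "b \<in> ob C" and irr: "irred_obj C a" "irred_obj C b"
    and T: "T \<in> Hom C a b" "T \<noteq> 0"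
  obtains z where "z \<noteq> 0" "str C T \<cdot> T = z *\<^sub>C idt C a" "T \<cdot> str C T = z *\<^sub>C idt C b"
proof -
  have sT: "str C T \<in> Hom C b a" using ob T str_in by blast
  obtain z where z: "str C T \<cdot> T = z *\<^sub>C idt C a"
    using irred_scalar[OF irr(1) cmp_in[OF ob(1,2,1) sT T(1)]] by blast
  obtain y where y: "T \<cdot> str C T = y *\<^sub>C idt C b"
    using irred_scalar[OF irr(2) cmp_in[OF ob(2,1,2) T(1) sT]] by blast
  have "z \<noteq> 0"
  proof
    assume "z = 0"
    then have "str C T \<cdot> T = 0" using z by simp
    then show False using str_positive[OF ob T(1)] T(2) by blast
  qed
  have "z *\<^sub>C T = T \<cdot> (str C T \<cdot> T)"
    unfolding z using ob T by (subst cmp_scale[of a a b]) (auto intro: idt_in simp: cmp_idt_right)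
  also have "\<dots> = (T \<cdot> str C T) \<cdot> T" using cmp_assoc[OF ob(1,2,1,2) T(1) sT T(1)] .
  also have "\<dots> = y *\<^sub>C T"
    unfolding y using ob T by (subst scale_cmp[of a b b]) (auto intro: idt_in simp: cmp_idt_left)
  finally have "z = y" using T(2) complex_vector.scale_right_imp_eq by blast
  with that z y \<open>z \<noteq> 0\<close> show ?thesis by blast
qed

lemma iso_if_nonzero:
  assumes ob: "a \<in> ob C" "b \<in> ob C" and irr: "irred_obj C a" "irred_obj C b"
    and T: "T \<in> Hom C a b" "T \<noteq> 0"
  shows "iso_obj C a b"
proof -
  obtain z where z: "z \<noteq> 0" "str C T \<cdot> T = z *\<^sub>C idt C a" "T \<cdot> str C T = z *\<^sub>C idt C b"
    using schur[OF assms] .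
  let ?g = "(1 / z) *\<^sub>C str C T"
  have sT: "str C T \<in> Hom C b a" using ob T str_in by blast
  have "?g \<cdot> T = idt C a" "T \<cdot> ?g = idt C b"
    using z ob T sT scale_cmp[of a b a "str C T" T] cmp_scale[of b a b T "str C T"]
    by (simp_all add: scaleC_scaleC)
  moreover have "?g \<in> Hom C b a" using ob sT scale_in by blast
  ultimately show ?thesis using T unfolding iso_obj_def by blast
qed

lemma unitary_inv:
  assumes "a \<in> ob C" "b \<in> ob C" "is_unitary C a b u"
  shows "u \<in> Hom C a b" "str C u \<in> Hom C b a" "str C u \<cdot> u = idt C a" "u \<cdot> str C u = idt C b"
  using assms str_in unfolding is_unitary_def is_isometry_def by blast+

lemma unitary_iso: "a \<in> ob C \<Longrightarrow> b \<in> ob C \<Longrightarrow> is_unitary C a b u \<Longrightarrow> iso_obj C a b"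
  using unitary_inv unfolding iso_obj_def by blast

lemma unitary_cmp:
  assumes ob: "a \<in> ob C" "b \<in> ob C" "c \<in> ob C" and u: "is_unitary C a b u" "is_unitary C b c v"
  shows "is_unitary C a c (v \<cdot> u)"
proof -
  note U = unitary_inv[OF ob(1,2) u(1)] and V = unitary_inv[OF ob(2,3) u(2)]
  have s: "str C (v \<cdot> u) = str C u \<cdot> str C v" using str_cmp[OF ob V(1) U(1)] .
  have vu: "v \<cdot> u \<in> Hom C a c" and uv: "str C u \<cdot> str C v \<in> Hom C c a"
    using cmp_in[OF ob V(1) U(1)] cmp_in[OF ob(3,2,1) U(2) V(2)] by simp_all
  have "(str C u \<cdot> str C v) \<cdot> (v \<cdot> u) = str C u \<cdot> (str C v \<cdot> (v \<cdot> u))"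
    using cmp_assoc[OF ob(1,3,2,1) U(2) V(2) vu] by simp
  also have "str C v \<cdot> (v \<cdot> u) = u"
    using cmp_assoc[OF ob(1,2,3,2) V(2) V(1) U(1)] V cmp_idt_left[OF ob(1,2) U(1)] by simp
  finally have 1: "str C (v \<cdot> u) \<cdot> (v \<cdot> u) = idt C a" using s U by simp
  have "(v \<cdot> u) \<cdot> (str C u \<cdot> str C v) = v \<cdot> (u \<cdot> (str C u \<cdot> str C v))"
    using cmp_assoc[OF ob(3,1,2,3) V(1) U(1) uv] by simp
  also have "u \<cdot> (str C u \<cdot> str C v) = str C v"
    using cmp_assoc[OF ob(3,2,1,2) U(1) U(2) V(2)] U cmp_idt_left[OF ob(3,2) V(2)] by simp
  finally have "(v \<cdot> u) \<cdot> str C (v \<cdot> u) = idt C c" using s V by simp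
  with 1 vu show ?thesis by (simp add: is_unitary_def is_isometry_def)
qed

lemma unitary_idt: "a \<in> ob C \<Longrightarrow> is_unitary C a a (idt C a)"
  using idt_in str_idt cmp_idt_left by (simp add: is_unitary_def is_isometry_def)

lemma unitary_nonzero:
  assumes "a \<in> ob C" "b \<in> ob C" "is_unitary C a b u" "idt C a \<noteq> 0"
  shows "u \<noteq> 0"
  using unitary_inv[OF assms(1-3)] assms(4) cmp_zero[OF assms(1,2,1)] by auto

text \<open>The endomorphisms \<open>W i \<cdot> str (W i)\<close> of \<open>b\<close> are nonzero and orthogonal to each other, because there
  are no nonzero arrows between inequivalent irreducible objects.\<close>

lemma finite_subobjects:
  assumes b: "b \<in> ob C" and fin: "cfinite_dim (Hom C b b)"
    and g: "\<And>i. i \<in> J \<Longrightarrow> g i \<in> ob C" "\<And>i. i \<in> J \<Longrightarrow> irred_obj C (g i)"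
    and W: "\<And>i. i \<in> J \<Longrightarrow> W i \<in> Hom C (g i) b" "\<And>i. i \<in> J \<Longrightarrow> W i \<noteq> 0"
    and inequiv: "\<And>i j. i \<in> J \<Longrightarrow> j \<in> J \<Longrightarrow> i \<noteq> j \<Longrightarrow> \<not> iso_obj C (g i) (g j)"
  shows "finite J"
proof -
  obtain B where B: "finite B" "Hom C b b = cspan B" using fin unfolding cfinite_dim_def by blast
  define P where "P i = W i \<cdot> str C (W i)" for i
  have sW: "str C (W i) \<in> Hom C b (g i)" if "i \<in> J" for i using that b g W str_in by blast
  have P: "P i \<in> Hom C b b" if "i \<in> J" for i
    unfolding P_def using cmp_in[OF b g(1)[OF that] b W(1)[OF that] sW[OF that]] .
  have sP: "str C (P i) = P i" if "i \<in> J" for i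
    unfolding P_def
    using str_cmp[OF b g(1)[OF that] b W(1)[OF that] sW[OF that]]
      str_str[OF g(1)[OF that] b W(1)[OF that]] by simp
  show ?thesis
  proof (rule finite_if_separated[OF B(1), of J P "\<lambda>i v. P i \<cdot> v"])
    show "P i \<in> cspan B" if "i \<in> J" for i using P[OF that] B(2) by simp
    show "clinear_on (cspan B) (\<lambda>v. P i \<cdot> v)" if "i \<in> J" for i
      using cmp_linear_right[OF b b b P[OF that]] B(2) by simp
    show "P i \<cdot> P i \<noteq> 0" if i: "i \<in> J" for i
    proof
      assume "P i \<cdot> P i = 0"
      then have "P i = 0" using str_positive[OF b b P[OF i]] sP[OF i] by simp
      then have "str C (str C (W i)) \<cdot> str C (W i) = 0"
        using str_str[OF g(1)[OF i] b W(1)[OF i]] by (simp add: P_def)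
      then have "str C (W i) = 0" using str_positive[OF b g(1)[OF i] sW[OF i]] by blast
      then have "str C (W i) \<cdot> W i = 0" using zero_cmp[OF g(1)[OF i] b g(1)[OF i] W(1)[OF i]] by simp
      then show False using str_positive[OF g(1)[OF i] b W(1)[OF i]] W(2)[OF i] by blast
    qed
    show "P i \<cdot> P j = 0" if i: "i \<in> J" and j: "j \<in> J" and ij: "i \<noteq> j" for i j
    proof -
      note gi = g(1)[OF i] and gj = g(1)[OF j]
      have in1: "str C (W i) \<cdot> W j \<in> Hom C (g j) (g i)" using cmp_in[OF gj b gi sW[OF i] W(1)[OF j]] .
      have z: "str C (W i) \<cdot> W j = 0"
        using iso_if_nonzero[OF gj gi g(2)[OF j] g(2)[OF i] in1] inequiv[OF j i] ij by blast
      have "P i \<cdot> P j = W i \<cdot> (str C (W i) \<cdot> P j)"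
        unfolding P_def[of i] using cmp_assoc[OF b b gi b W(1)[OF i] sW[OF i] P[OF j]] by simp
      also have "str C (W i) \<cdot> P j = (str C (W i) \<cdot> W j) \<cdot> str C (W j)"
        unfolding P_def using cmp_assoc[OF b gj b gi sW[OF i] W(1)[OF j] sW[OF j]] .
      also have "\<dots> = 0" unfolding z using zero_cmp[OF b gj gi sW[OF j]] .
      finally show ?thesis using cmp_zero[OF b gi b W(1)[OF i]] by simp
    qed
  qed
qed

end

context tensor_star_category
begin

lemma unitary_tar:
  assumes ob: "a \<in> ob C" "b \<in> ob C" "c \<in> ob C" "d \<in> ob C"
    and u: "is_unitary C a b u" "is_unitary C c d v"
  shows "is_unitary C (a \<odot> c) (b \<odot> d) (u \<boxtimes> v)"
proof -
  note U = unitary_inv[OF ob(1,2) u(1)] and V = unitary_inv[OF ob(3,4) u(2)]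
  have s: "str C (u \<boxtimes> v) = str C u \<boxtimes> str C v" using str_tar[OF ob U(1) V(1)] .
  have "(str C u \<boxtimes> str C v) \<cdot> (u \<boxtimes> v) = (str C u \<cdot> u) \<boxtimes> (str C v \<cdot> v)"
    using tar_cmp[OF ob(1,2,1,3,4,3) U(2,1) V(2,1)] by simp
  moreover have "(u \<boxtimes> v) \<cdot> (str C u \<boxtimes> str C v) = (u \<cdot> str C u) \<boxtimes> (v \<cdot> str C v)"
    using tar_cmp[OF ob(2,1,2,4,3,4) U(1,2) V(1,2)] by simp
  moreover have "u \<boxtimes> v \<in> Hom C (a \<odot> c) (b \<odot> d)" using tar_in[OF ob U(1) V(1)] .
  ultimately show ?thesis
    using U V ob by (simp add: is_unitary_def is_isometry_def s tar_idt)
qed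

lemma iso_tob:
  assumes ob: "a \<in> ob C" "b \<in> ob C" "c \<in> ob C" "d \<in> ob C" and iso: "iso_obj C a b" "iso_obj C c d"
  shows "iso_obj C (a \<odot> c) (b \<odot> d)"
proof -
  obtain f f' where f: "f \<in> Hom C a b" "f' \<in> Hom C b a" "f' \<cdot> f = idt C a" "f \<cdot> f' = idt C b"
    using iso(1) unfolding iso_obj_def by blast
  obtain g g' where g: "g \<in> Hom C c d" "g' \<in> Hom C d c" "g' \<cdot> g = idt C c" "g \<cdot> g' = idt C d"
    using iso(2) unfolding iso_obj_def by blast
  have "(f' \<boxtimes> g') \<cdot> (f \<boxtimes> g) = idt C (a \<odot> c)"
    using tar_cmp[OF ob(1,2,1,3,4,3) f(2,1) g(2,1)] f g ob tar_idt by simp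
  moreover have "(f \<boxtimes> g) \<cdot> (f' \<boxtimes> g') = idt C (b \<odot> d)"
    using tar_cmp[OF ob(2,1,2,4,3,4) f(1,2) g(1,2)] f g ob tar_idt by simp
  ultimately show ?thesis
    using tar_in[OF ob f(1) g(1)] tar_in[OF ob(2,1,4,3) f(2) g(2)] unfolding iso_obj_def by blast
qed

lemma tar_scale: "\<lbrakk>a \<in> ob C; b \<in> ob C; c \<in> ob C; d \<in> ob C; f \<in> Hom C a b; g \<in> Hom C c d\<rbrakk>
    \<Longrightarrow> f \<boxtimes> (z *\<^sub>C g) = z *\<^sub>C (f \<boxtimes> g)"
  using clinear_on_scaleC[OF tar_linear_right] by blast

lemma scale_tar: "\<lbrakk>a \<in> ob C; b \<in> ob C; c \<in> ob C; d \<in> ob C; f \<in> Hom C a b; g \<in> Hom C c d\<rbrakk>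
    \<Longrightarrow> (z *\<^sub>C f) \<boxtimes> g = z *\<^sub>C (f \<boxtimes> g)"
  using clinear_on_scaleC[OF tar_linear_left] by blast

text \<open>Tensor from the left with \<open>b\<close> and conjugate with \<open>R\<close> to get \<open>f\<close> back.\<close>

lemma tensor_faithful:
  assumes ob: "a \<in> ob C" "b \<in> ob C" "c \<in> ob C" "d \<in> ob C"
    and R: "is_unitary C (unt C) (b \<odot> a) R"
    and f: "f \<in> Hom C c d" "f' \<in> Hom C c d" and e: "idt C a \<boxtimes> f = idt C a \<boxtimes> f'"
  shows "f = f'"
proof -
  have ba: "b \<odot> a \<in> ob C" using ob tob_in by blast
  note R' = unitary_inv[OF unt_in ba R]
  have key: "(str C R \<boxtimes> idt C d) \<cdot> ((idt C b \<boxtimes> (idt C a \<boxtimes> f)) \<cdot> (R \<boxtimes> idt C c)) = f"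
    if f: "f \<in> Hom C c d" for f
  proof -
    have "idt C b \<boxtimes> (idt C a \<boxtimes> f) = idt C (b \<odot> a) \<boxtimes> f"
      using tar_assoc[OF ob(2,2,1,1,3,4) idt_in[OF ob(2)] idt_in[OF ob(1)] f] ob tar_idt by simp
    then have "(idt C b \<boxtimes> (idt C a \<boxtimes> f)) \<cdot> (R \<boxtimes> idt C c) = R \<boxtimes> f"
      using tar_cmp[OF unt_in ba ba ob(3,3,4) idt_in[OF ba] R'(1) f idt_in[OF ob(3)]]
        cmp_idt_left[OF unt_in ba R'(1)] cmp_idt_right[OF ob(3,4) f] by simp
    moreover have "(str C R \<boxtimes> idt C d) \<cdot> (R \<boxtimes> f) = idt C (unt C) \<boxtimes> f"
      using tar_cmp[OF unt_in ba unt_in ob(3,4,4) R'(2,1) idt_in[OF ob(4)] f]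
        cmp_idt_left[OF ob(3,4) f] R'(3) by simp
    ultimately show ?thesis using tar_unt_left[OF ob(3,4) f] by simp
  qed
  show ?thesis using key[OF f(1)] unfolding e key[OF f(2)] by (rule sym)
qed

text \<open>As \<open>b \<odot> a \<odot> c\<close> is isomorphic to \<open>c\<close>, an endomorphism of \<open>a \<odot> c\<close> becomes a scalar after tensoring with
  \<open>b\<close>, and tensoring with \<open>b\<close> is faithful because of \<open>R'\<close>.\<close>

lemma invertible_tensor_irred:
  assumes ob: "a \<in> ob C" "b \<in> ob C" "c \<in> ob C"
    and R: "is_unitary C (unt C) (b \<odot> a) R" and R': "is_unitary C (unt C) (a \<odot> b) R'"
    and irr: "irred_obj C c"
  shows "irred_obj C (a \<odot> c)"
proof -
  have ac: "a \<odot> c \<in> ob C" and ba: "b \<odot> a \<in> ob C" and bac: "(b \<odot> a) \<odot> c \<in> ob C"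
    using ob tob_in by auto
  have assoc: "b \<odot> (a \<odot> c) = (b \<odot> a) \<odot> c" using ob tob_assoc by simp
  have "is_unitary C (unt C \<odot> c) ((b \<odot> a) \<odot> c) (R \<boxtimes> idt C c)"
    using unitary_tar[OF unt_in ba ob(3,3) R unitary_idt[OF ob(3)]] .
  then have u: "is_unitary C c ((b \<odot> a) \<odot> c) (R \<boxtimes> idt C c)" using ob tob_unt_left by simp
  have irr': "irred_obj C ((b \<odot> a) \<odot> c)"
    using irred_iso[OF ob(3) bac irr unitary_iso[OF ob(3) bac u]] .
  have "\<exists>z. f = z *\<^sub>C idt C (a \<odot> c)" if f: "f \<in> Hom C (a \<odot> c) (a \<odot> c)" for f
  proof -
    have "idt C b \<boxtimes> f \<in> Hom C ((b \<odot> a) \<odot> c) ((b \<odot> a) \<odot> c)"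
      using tar_in[OF ob(2,2) ac ac idt_in[OF ob(2)] f] assoc by simp
    then obtain z where z: "idt C b \<boxtimes> f = z *\<^sub>C idt C ((b \<odot> a) \<odot> c)" using irr' irred_scalar by blast
    also have "\<dots> = idt C b \<boxtimes> (z *\<^sub>C idt C (a \<odot> c))"
      using tar_scale[OF ob(2,2) ac ac idt_in[OF ob(2)] idt_in[OF ac]] tar_idt[OF ob(2) ac] assoc by simp
    finally have "f = z *\<^sub>C idt C (a \<odot> c)"
      using tensor_faithful[OF ob(2,1) ac ac R' f] scale_in[OF ac ac idt_in[OF ac]] by blast
    then show ?thesis by blast
  qed
  moreover have "range (\<lambda>z. z *\<^sub>C idt C (a \<odot> c)) \<subseteq> Hom C (a \<odot> c) (a \<odot> c)"
    using ac idt_in scale_in by blast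
  moreover have "idt C (a \<odot> c) \<noteq> 0"
  proof
    assume 0: "idt C (a \<odot> c) = 0"
    have "idt C ((b \<odot> a) \<odot> c) = idt C b \<boxtimes> (0 *\<^sub>C idt C (a \<odot> c))"
      using tar_idt[OF ob(2) ac] assoc 0 by simp
    also have "\<dots> = 0"
      using tar_scale[OF ob(2,2) ac ac idt_in[OF ob(2)] idt_in[OF ac], of 0] by simp
    finally show False using irr' by (simp add: irred_obj_def)
  qed
  ultimately show ?thesis unfolding irred_obj_def by blast
qed

text \<open>The adjoint of the first conjugate equation recovers \<open>T\<close> from the transposed arrow.\<close>

lemma transpose_nonzero:
  assumes ob: "a \<in> ob C" "c \<in> ob C" "d \<in> ob C" and eq: "conj_eqs C c c' R R'"
    and T: "T \<in> Hom C (a \<odot> c) d" "T \<noteq> 0"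
  shows "(T \<boxtimes> idt C c') \<cdot> (idt C a \<boxtimes> R') \<in> Hom C a (d \<odot> c')" "(T \<boxtimes> idt C c') \<cdot> (idt C a \<boxtimes> R') \<noteq> 0"
proof -
  let ?W = "(T \<boxtimes> idt C c') \<cdot> (idt C a \<boxtimes> R')"
  have c': "c' \<in> ob C" and R: "R \<in> Hom C (unt C) (c' \<odot> c)" and R': "R' \<in> Hom C (unt C) (c \<odot> c')"
    and e: "(str C R' \<boxtimes> idt C c) \<cdot> (idt C c \<boxtimes> R) = idt C c"
    using eq by (auto simp: conj_eqs_def)
  note i = idt_in[OF ob(1)] idt_in[OF ob(2)] idt_in[OF c'] idt_in[OF ob(3)]
  note [simp] = ob c' unt_in tob_in tob_assoc tob_unt_left tob_unt_right
  have s: "str C R \<in> Hom C (c' \<odot> c) (unt C)" "str C R' \<in> Hom C (c \<odot> c') (unt C)"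
    using R R' str_in by simp_all
  have T1: "T \<boxtimes> idt C c' \<in> Hom C (a \<odot> (c \<odot> c')) (d \<odot> c')"
    using tar_in[OF _ _ _ _ T(1) i(3)] by simp
  have R1: "idt C a \<boxtimes> R' \<in> Hom C a (a \<odot> (c \<odot> c'))"
    using tar_in[OF _ _ _ _ i(1) R'] by simp
  show W: "?W \<in> Hom C a (d \<odot> c')" using cmp_in[OF _ _ _ T1 R1] by simp
  have e': "(idt C c \<boxtimes> str C R) \<cdot> (R' \<boxtimes> idt C c) = idt C c"
  proof -
    have 1: "str C R' \<boxtimes> idt C c \<in> Hom C (c \<odot> (c' \<odot> c)) c" using tar_in[OF _ _ _ _ s(2) i(2)] by simp
    have 2: "idt C c \<boxtimes> R \<in> Hom C c (c \<odot> (c' \<odot> c))" using tar_in[OF _ _ _ _ i(2) R] by simp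
    have "str C (idt C c \<boxtimes> R) \<cdot> str C (str C R' \<boxtimes> idt C c) = str C (idt C c)"
      using str_cmp[OF _ _ _ 1 2] e by simp
    moreover have "str C (idt C c \<boxtimes> R) = idt C c \<boxtimes> str C R"
      using str_tar[OF _ _ _ _ i(2) R] str_idt by simp
    moreover have "str C (str C R' \<boxtimes> idt C c) = R' \<boxtimes> idt C c"
      using str_tar[OF _ _ _ _ s(2) i(2)] str_idt str_str[OF _ _ R'] by simp
    ultimately show ?thesis using str_idt by simp
  qed
  show "?W \<noteq> 0"
  proof
    assume 0: "?W = 0"
    have T2: "(T \<boxtimes> idt C c') \<boxtimes> idt C c = T \<boxtimes> idt C (c' \<odot> c)"
      using tar_assoc[OF _ _ _ _ _ _ T(1) i(3) i(2)] tar_idt[of c' c] by simp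
    have R2: "(idt C a \<boxtimes> R') \<boxtimes> idt C c = idt C a \<boxtimes> (R' \<boxtimes> idt C c)"
      using tar_assoc[OF _ _ _ _ _ _ i(1) R' i(2)] by simp
    have R3: "R' \<boxtimes> idt C c \<in> Hom C c (c \<odot> (c' \<odot> c))" using tar_in[OF _ _ _ _ R' i(2)] by simp
    have R4: "idt C c \<boxtimes> str C R \<in> Hom C (c \<odot> (c' \<odot> c)) c" using tar_in[OF _ _ _ _ i(2) s(1)] by simp
    have R5: "idt C a \<boxtimes> (R' \<boxtimes> idt C c) \<in> Hom C (a \<odot> c) (a \<odot> (c \<odot> (c' \<odot> c)))"
      using tar_in[OF _ _ _ _ i(1) R3] by simp
    have R6: "idt C a \<boxtimes> (idt C c \<boxtimes> str C R) \<in> Hom C (a \<odot> (c \<odot> (c' \<odot> c))) (a \<odot> c)"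
      using tar_in[OF _ _ _ _ i(1) R4] by simp
    have T3: "T \<boxtimes> idt C (c' \<odot> c) \<in> Hom C (a \<odot> (c \<odot> (c' \<odot> c))) (d \<odot> (c' \<odot> c))"
      using tar_in[OF _ _ _ _ T(1) idt_in[of "c' \<odot> c"]] by simp
    have s1: "idt C d \<boxtimes> str C R \<in> Hom C (d \<odot> (c' \<odot> c)) d" using tar_in[OF _ _ _ _ i(4) s(1)] by simp
    have "?W \<boxtimes> idt C c = ((T \<boxtimes> idt C c') \<boxtimes> idt C c) \<cdot> ((idt C a \<boxtimes> R') \<boxtimes> idt C c)"
      using tar_cmp[OF _ _ _ _ _ _ T1 R1 i(2) i(2)] cmp_idt_left[OF _ _ i(2)] by simp
    then have W1: "?W \<boxtimes> idt C c = (T \<boxtimes> idt C (c' \<odot> c)) \<cdot> (idt C a \<boxtimes> (R' \<boxtimes> idt C c))"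
      unfolding T2 R2 .
    have sw: "(idt C d \<boxtimes> str C R) \<cdot> (T \<boxtimes> idt C (c' \<odot> c)) = T \<cdot> (idt C a \<boxtimes> (idt C c \<boxtimes> str C R))"
    proof -
      have "(idt C d \<boxtimes> str C R) \<cdot> (T \<boxtimes> idt C (c' \<odot> c)) = T \<boxtimes> str C R"
        using tar_cmp[OF _ _ _ _ _ _ i(4) T(1) s(1) idt_in[of "c' \<odot> c"]]
          cmp_idt_left[OF _ _ T(1)] cmp_idt_right[OF _ _ s(1)] by simp
      also have "\<dots> = (T \<boxtimes> idt C (unt C)) \<cdot> (idt C (a \<odot> c) \<boxtimes> str C R)"
        using tar_cmp[OF _ _ _ _ _ _ T(1) idt_in[of "a \<odot> c"] idt_in[of "unt C"] s(1)]
          cmp_idt_right[OF _ _ T(1)] cmp_idt_left[OF _ _ s(1)] by simp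
      also have "T \<boxtimes> idt C (unt C) = T" using tar_unt_right[OF _ _ T(1)] by simp
      also have "idt C (a \<odot> c) \<boxtimes> str C R = idt C a \<boxtimes> (idt C c \<boxtimes> str C R)"
        using tar_assoc[OF _ _ _ _ _ _ i(1) i(2) s(1)] tar_idt[of a c] by simp
      finally show ?thesis .
    qed
    have "(idt C d \<boxtimes> str C R) \<cdot> (?W \<boxtimes> idt C c)
        = ((idt C d \<boxtimes> str C R) \<cdot> (T \<boxtimes> idt C (c' \<odot> c))) \<cdot> (idt C a \<boxtimes> (R' \<boxtimes> idt C c))"
      unfolding W1 using cmp_assoc[OF _ _ _ _ s1 T3 R5] by simp
    also have "\<dots> = T \<cdot> ((idt C a \<boxtimes> (idt C c \<boxtimes> str C R)) \<cdot> (idt C a \<boxtimes> (R' \<boxtimes> idt C c)))"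
      unfolding sw using cmp_assoc[OF _ _ _ _ T(1) R6 R5] by simp
    also have "(idt C a \<boxtimes> (idt C c \<boxtimes> str C R)) \<cdot> (idt C a \<boxtimes> (R' \<boxtimes> idt C c)) = idt C (a \<odot> c)"
      using tar_cmp[OF _ _ _ _ _ _ i(1) i(1) R4 R3] e' cmp_idt_left[OF _ _ i(1)] tar_idt[of a c] by simp
    also have "T \<cdot> idt C (a \<odot> c) = T" using cmp_idt_right[OF _ _ T(1)] by simp
    finally have "(idt C d \<boxtimes> str C R) \<cdot> (?W \<boxtimes> idt C c) = T" .
    moreover have "?W \<boxtimes> idt C c = 0"
      using clinear_on_zero[OF tar_linear_left[OF _ _ _ _ i(2)] Hom_subspace, of a "d \<odot> c'"] 0 by simp
    ultimately have "T = 0" using cmp_zero[OF _ _ _ s1, of "a \<odot> c"] by simp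
    then show False using T(2) by simp
  qed
qed

lemma tar_interchange:
  assumes ob: "a \<in> ob C" "b \<in> ob C" "c \<in> ob C" "d \<in> ob C" and f: "f \<in> Hom C a b" and g: "g \<in> Hom C c d"
  shows "(f \<boxtimes> idt C d) \<cdot> (idt C a \<boxtimes> g) = (idt C b \<boxtimes> g) \<cdot> (f \<boxtimes> idt C c)"
  using tar_cmp[OF ob(1,1,2,3,4,4) f idt_in[OF ob(1)] idt_in[OF ob(4)] g]
    tar_cmp[OF ob(1,2,2,3,3,4) idt_in[OF ob(2)] f g idt_in[OF ob(3)]]
    cmp_idt_right[OF ob(1,2) f] cmp_idt_left[OF ob(1,2) f]
    cmp_idt_right[OF ob(3,4) g] cmp_idt_left[OF ob(3,4) g] by simp

lemma cmp_tar_idt: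
  assumes ob: "a \<in> ob C" "b \<in> ob C" "c \<in> ob C" "x \<in> ob C" and f: "f \<in> Hom C a b" and g: "g \<in> Hom C b c"
  shows "(g \<cdot> f) \<boxtimes> idt C x = (g \<boxtimes> idt C x) \<cdot> (f \<boxtimes> idt C x)"
  using tar_cmp[OF ob(1,2,3,4,4,4) g f idt_in[OF ob(4)] idt_in[OF ob(4)]]
    cmp_idt_left[OF ob(4,4) idt_in[OF ob(4)]] by simp

lemma idt_tar_cmp:
  assumes ob: "a \<in> ob C" "b \<in> ob C" "c \<in> ob C" "x \<in> ob C" and f: "f \<in> Hom C a b" and g: "g \<in> Hom C b c"
  shows "idt C x \<boxtimes> (g \<cdot> f) = (idt C x \<boxtimes> g) \<cdot> (idt C x \<boxtimes> f)"
  using tar_cmp[OF ob(4,4,4,1,2,3) idt_in[OF ob(4)] idt_in[OF ob(4)] g f]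
    cmp_idt_left[OF ob(4,4) idt_in[OF ob(4)]] by simp

text \<open>The phase is that of the endomorphism \<open>v \<cdot> str u\<close> of an irreducible object.\<close>

lemma unitary_phase:
  assumes ob: "a \<in> ob C" "b \<in> ob C" and irr: "irred_obj C b" and u: "is_unitary C a b u" and v: "is_unitary C a b v"
  shows "\<exists>z. cnj z * z = 1 \<and> v = z *\<^sub>C u"
proof -
  note U = unitary_inv[OF ob u] and V = unitary_inv[OF ob v]
  obtain z where z: "v \<cdot> str C u = z *\<^sub>C idt C b"
    using irred_scalar[OF irr cmp_in[OF ob(2,1,2) V(1) U(2)]] by blast
  have "v = (v \<cdot> str C u) \<cdot> u"
    using cmp_assoc[OF ob(1,2,1,2) V(1) U(2) U(1)] U(3) cmp_idt_right[OF ob V(1)] by simp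
  then have vz: "v = z *\<^sub>C u"
    using z scale_cmp[OF ob(1,2,2) idt_in[OF ob(2)] U(1)] cmp_idt_left[OF ob U(1)] by simp
  have "idt C b = v \<cdot> str C v" using V(4) by simp
  also have "\<dots> = (cnj z * z) *\<^sub>C idt C b"
    using str_scaleC[OF ob U(1), of z] cmp_scale[OF ob(2,1,2) V(1) U(2), of "cnj z"] z vz
    by (simp add: scaleC_scaleC)
  finally have "(cnj z * z) *\<^sub>C idt C b = 1 *\<^sub>C idt C b" by simp
  moreover have "idt C b \<noteq> 0" using irr by (simp add: irred_obj_def)
  ultimately have "cnj z * z = 1" using complex_vector.scale_right_imp_eq by blast
  with vz show ?thesis by blast
qed

end


section \<open>Objects with one-dimensional representation space\<close>

text \<open>Throughout, the group acts on the representation spaces of the \<open>rep Z k\<close> by scalars. This makes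
  these spaces one-dimensional.\<close>

locale abelian_crossed_product =
  BTC_star C + even_symmetric_subcategory C S + crossed_product_choice C S Z +
  representation_isomorphism C S G TG F
  for C :: "('o, 'm::complex_vector) btcat" (structure)
    and S :: "'o set"
    and Z :: "('o, 'm) cp_choice"
    and G :: "('o set \<Rightarrow> complex) monoid"
    and TG :: "('o set \<Rightarrow> complex) topology"
    and F :: "('o, 'm, 'h::complex_vector, 'o set \<Rightarrow> complex) fibre" +
  assumes act_scalar: "\<lbrakk>g \<in> carrier G; k \<in> irr_classes C S; x \<in> Sp F (rep Z k)\<rbrakk>
    \<Longrightarrow> act F g x = g k *\<^sub>C x"
begin

lemma S_ob: "a \<in> S \<Longrightarrow> a \<in> ob C"
  using sub_ob by blast

lemma Sp_scale: "a \<in> S \<Longrightarrow> x \<in> Sp F a \<Longrightarrow> z *\<^sub>C x \<in> Sp F a"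
  using Sp_subspace complex_vector.subspace_scale by blast

lemma ip_scale_left:
  assumes "a \<in> S" "x \<in> Sp F a" "y \<in> Sp F a"
  shows "ip F (z *\<^sub>C x) y = cnj z * ip F x y"
proof -
  have "ip F (z *\<^sub>C x) y = cnj (ip F y (z *\<^sub>C x))"
    using ip_cnj[OF assms(1) assms(3) Sp_scale[OF assms(1,2)]] .
  also have "ip F y (z *\<^sub>C x) = z * ip F y x" using ip_scaleC[OF assms(1,3,2)] .
  finally show ?thesis using ip_cnj[OF assms(1,3,2)] by simp
qed

lemma fmap_scale: "\<lbrakk>a \<in> S; b \<in> S; T \<in> Hom C a b; x \<in> Sp F a\<rbrakk> \<Longrightarrow> fmap F T (z *\<^sub>C x) = z *\<^sub>C fmap F T x"
  using clinear_on_scaleC[OF fmap_linear] by blast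

lemma fmap_scale_arrow: "\<lbrakk>a \<in> S; b \<in> S; T \<in> Hom C a b; x \<in> Sp F a\<rbrakk> \<Longrightarrow> fmap F (z *\<^sub>C T) x = z *\<^sub>C fmap F T x"
  using clinear_on_scaleC[OF fmap_linear_arrow] by blast

lemma vtens_scale_left: "\<lbrakk>a \<in> S; b \<in> S; x \<in> Sp F a; y \<in> Sp F b\<rbrakk> \<Longrightarrow> vtens F (z *\<^sub>C x) y = z *\<^sub>C vtens F x y"
  using clinear_on_scaleC[OF vtens_linear_left] by blast

lemma vtens_scale_right: "\<lbrakk>a \<in> S; b \<in> S; x \<in> Sp F a; y \<in> Sp F b\<rbrakk> \<Longrightarrow> vtens F x (z *\<^sub>C y) = z *\<^sub>C vtens F x y"
  using clinear_on_scaleC[OF vtens_linear_right] by blast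

definition unit_vec :: "'o \<Rightarrow> 'h \<Rightarrow> bool" where
  "unit_vec a e \<longleftrightarrow> e \<in> Sp F a \<and> ip F e e = 1"

text \<open>An arrow between objects with one-dimensional representation space is determined by its effect on
  one vector. Identities between such arrows are therefore reduced to identities between complex
  numbers.\<close>

definition line :: "'o \<Rightarrow> bool" where
  "line a \<longleftrightarrow> a \<in> S \<and> (\<exists>e. unit_vec a e \<and> Sp F a = range (\<lambda>z. z *\<^sub>C e))"

lemma unit_vec_in: "unit_vec a e \<Longrightarrow> e \<in> Sp F a"
  by (simp add: unit_vec_def)

lemma line_S: "line a \<Longrightarrow> a \<in> S"
  by (simp add: line_def)

lemma line_ob: "line a \<Longrightarrow> a \<in> ob C"
  using line_S S_ob by blast

lemma ip_zero_right:
  assumes "a \<in> S" "x \<in> Sp F a"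
  shows "ip F x 0 = 0"
  using ip_scaleC[OF assms assms(2), of 0] by simp

lemma unit_vec_nonzero: "a \<in> S \<Longrightarrow> unit_vec a e \<Longrightarrow> e \<noteq> 0"
  using ip_zero_right by (fastforce simp: unit_vec_def)

lemma normalize:
  assumes a: "a \<in> S" and x: "x \<in> Sp F a" "x \<noteq> 0"
  shows "\<exists>r. r \<noteq> 0 \<and> unit_vec a (r *\<^sub>C x)"
proof -
  let ?n = "Re (ip F x x)"
  have n: "?n > 0" using ip_positive[OF a x] .
  have "ip F x x = cnj (ip F x x)" using ip_cnj[OF a x(1) x(1)] .
  then have real: "ip F x x = of_real ?n" by (simp add: complex_eq_iff)
  let ?r = "of_real (1 / sqrt ?n) :: complex"
  have "ip F (?r *\<^sub>C x) (?r *\<^sub>C x) = ?r * (cnj ?r * ip F x x)"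
    using ip_scaleC[OF a Sp_scale[OF a x(1)] x(1)] ip_scale_left[OF a x(1) x(1)] by simp
  also have "\<dots> = of_real (1 / sqrt ?n * (1 / sqrt ?n * ?n))"
    unfolding of_real_mult real[symmetric] by simp
  also have "1 / sqrt ?n * (1 / sqrt ?n * ?n) = 1" using n by (simp add: field_simps)
  finally show ?thesis using n Sp_scale[OF a x(1)] by (intro exI[of _ ?r]) (simp add: unit_vec_def)
qed

lemma lineI:
  assumes a: "a \<in> S" and x: "x \<in> Sp F a" "x \<noteq> 0" and span: "\<And>y. y \<in> Sp F a \<Longrightarrow> \<exists>z. y = z *\<^sub>C x"
  shows "line a"
proof -
  obtain r where r: "r \<noteq> 0" "unit_vec a (r *\<^sub>C x)" using normalize[OF a x] by blast
  have "Sp F a \<subseteq> range (\<lambda>z. z *\<^sub>C (r *\<^sub>C x))"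
  proof
    fix y assume "y \<in> Sp F a"
    then obtain z where "y = z *\<^sub>C x" using span by blast
    then have "y = (z / r) *\<^sub>C (r *\<^sub>C x)" using r by (simp add: scaleC_scaleC)
    then show "y \<in> range (\<lambda>z. z *\<^sub>C (r *\<^sub>C x))" by blast
  qed
  moreover have "range (\<lambda>z. z *\<^sub>C (r *\<^sub>C x)) \<subseteq> Sp F a"
    using r a Sp_scale unit_vec_in by blast
  ultimately show ?thesis using a r unfolding line_def by blast
qed

lemma line_unit_vec: "line a \<Longrightarrow> \<exists>e. unit_vec a e"
  unfolding line_def by blast

lemma line_expand:
  assumes a: "line a" and e: "unit_vec a e" and x: "x \<in> Sp F a"
  shows "x = ip F e x *\<^sub>C e"
proof -
  obtain e0 where e0: "unit_vec a e0" "Sp F a = range (\<lambda>z. z *\<^sub>C e0)" using a unfolding line_def by blast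
  note aS = line_S[OF a]
  obtain z where z: "e = z *\<^sub>C e0" using e e0 unfolding unit_vec_def by blast
  obtain y where y: "x = y *\<^sub>C e0" using x e0 by blast
  have ip: "ip F (u *\<^sub>C e0) (v *\<^sub>C e0) = cnj u * v" for u v
  proof -
    have e0in: "e0 \<in> Sp F a" "ip F e0 e0 = 1" using e0 by (simp_all add: unit_vec_def)
    show ?thesis
      using ip_scaleC[OF aS Sp_scale[OF aS e0in(1)] e0in(1)] ip_scale_left[OF aS e0in(1) e0in(1)] e0in(2)
      by simp
  qed
  have "cnj z * z = 1" using e ip[of z z] z by (simp add: unit_vec_def)
  moreover have "ip F e x = cnj z * y" using ip z y by simp
  ultimately show ?thesis using z y by (simp add: scaleC_scaleC mult_ac)
qed

lemma unit_vec_phase: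
  assumes a: "line a" and e: "unit_vec a e" "unit_vec a e'"
  shows "\<exists>z. norm z = 1 \<and> e' = z *\<^sub>C e"
proof -
  let ?z = "ip F e e'"
  note aS = line_S[OF a]
  have ein: "e \<in> Sp F a" "e' \<in> Sp F a" using e by (simp_all add: unit_vec_def)
  have e': "e' = ?z *\<^sub>C e" using line_expand[OF a e(1) ein(2)] .
  have "1 = ip F e' e'" using e by (simp add: unit_vec_def)
  also have "\<dots> = ?z * ip F e' e" using ip_scaleC[OF aS ein(2,1), of ?z] e' by simp
  also have "ip F e' e = cnj ?z" using ip_cnj[OF aS ein] .
  finally have "complex_of_real ((norm ?z)\<^sup>2) = 1" by (simp only: complex_norm_square)
  then have "(norm ?z)\<^sup>2 = 1" by (simp only: of_real_eq_1_iff)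
  then have "norm ?z = 1" by (simp add: power2_eq_1_iff) (use norm_ge_zero[of ?z] in linarith)
  then show ?thesis using e' by blast
qed

lemma line_arrow_eqI:
  assumes a: "line a" "b \<in> S" and e: "unit_vec a e" and T: "T \<in> Hom C a b" "T' \<in> Hom C a b"
    and eq: "fmap F T e = fmap F T' e"
  shows "T = T'"
proof -
  note aS = line_S[OF a(1)]
  have ein: "e \<in> Sp F a" using e by (rule unit_vec_in)
  have "fmap F (T - T') x = 0" if x: "x \<in> Sp F a" for x
  proof -
    have "fmap F (T - T') x = fmap F T x - fmap F T' x"
      using clinear_on_diff[OF fmap_linear_arrow[OF aS a(2) x] Hom_subspace T] aS a(2) S_ob by blast
    also have "\<dots> = 0"
      using fmap_scale[OF aS a(2) T(1) ein] fmap_scale[OF aS a(2) T(2) ein] eq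
      by (subst (1 2) line_expand[OF a(1) e x]) simp
    finally show ?thesis .
  qed
  then have "T - T' = 0"
    using fmap_faithful[OF aS a(2), of "T - T'"] diff_in[OF _ _ T] aS a(2) S_ob by blast
  then show ?thesis by simp
qed

lemma line_arrow_zero:
  assumes a: "line a" "b \<in> S" and e: "unit_vec a e" and T: "T \<in> Hom C a b" "fmap F T e = 0"
  shows "T = 0"
proof (rule line_arrow_eqI[OF a e T(1)])
  have ob: "a \<in> ob C" "b \<in> ob C" using a line_ob S_ob by auto
  show "0 \<in> Hom C a b" using zero_in ob by blast
  have "fmap F (0 *\<^sub>C T) e = 0 *\<^sub>C fmap F T e"
    using fmap_scale_arrow[OF line_S[OF a(1)] a(2) T(1) unit_vec_in[OF e]] .
  then show "fmap F T e = fmap F 0 e" using T(2) by simp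
qed

lemma line_irred:
  assumes a: "line a"
  shows "irred_obj C a"
proof -
  obtain e where e: "unit_vec a e" using line_unit_vec[OF a] by blast
  note aS = line_S[OF a] and ob = line_ob[OF a]
  have ein: "e \<in> Sp F a" using e by (rule unit_vec_in)
  note i = idt_in[OF ob]
  have "\<exists>z. f = z *\<^sub>C idt C a" if f: "f \<in> Hom C a a" for f
  proof
    let ?z = "ip F e (fmap F f e)"
    show "f = ?z *\<^sub>C idt C a"
    proof (rule line_arrow_eqI[OF a aS e f scale_in[OF ob ob i]])
      have "fmap F (?z *\<^sub>C idt C a) e = ?z *\<^sub>C e"
        using fmap_scale_arrow[OF aS aS i ein] fmap_idt[OF aS ein] by simp
      then show "fmap F f e = fmap F (?z *\<^sub>C idt C a) e"
        using line_expand[OF a e fmap_in[OF aS aS f ein]] by simp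
    qed
  qed
  moreover have "idt C a \<noteq> 0"
  proof
    assume "idt C a = 0"
    then have "fmap F (0 *\<^sub>C idt C a) e = e" using fmap_idt[OF aS ein] by simp
    then show False using fmap_scale_arrow[OF aS aS i ein, of 0] unit_vec_nonzero[OF aS e] by simp
  qed
  ultimately show ?thesis using scale_in[OF ob ob i] unfolding irred_obj_def by blast
qed

lemma rep_irr:
  assumes k: "k \<in> irr_classes C S"
  shows "rep Z k \<in> S" "irred_obj C (rep Z k)" "iso_class C (rep Z k) = k"
proof -
  obtain a where a: "a \<in> S" "irred_obj C a" "k = iso_class C a" using k unfolding irr_classes_def by blast
  have r: "rep Z k \<in> ob C" "iso_obj C a (rep Z k)" using rep_in[OF k] a(3) by (auto simp: iso_class_def)
  show "rep Z k \<in> S" using replete[OF a(1) r] .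
  show "irred_obj C (rep Z k)" using irred_iso[OF S_ob[OF a(1)] r(1) a(2) r(2)] .
  show "iso_class C (rep Z k) = k"
    using a(3) iso_class_eq_iff[OF S_ob[OF a(1)] r(1)] r(2) by simp
qed

text \<open>As the group acts on the representation space by scalars, every linear endomorphism of the
  space is an intertwiner; by irreducibility it is a scalar.\<close>

lemma line_rep:
  assumes k: "k \<in> irr_classes C S"
  shows "line (rep Z k)"
proof -
  let ?a = "rep Z k"
  note aS = rep_irr(1)[OF k] and irr = rep_irr(2)[OF k]
  note ob = S_ob[OF aS]
  note i = idt_in[OF ob]
  have "\<exists>x. x \<in> Sp F ?a \<and> x \<noteq> 0"
  proof (rule ccontr)
    assume "\<not> ?thesis"
    then have "idt C ?a = 0" using fmap_idt[OF aS] fmap_faithful[OF aS aS i] by blast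
    then show False using irr by (simp add: irred_obj_def)
  qed
  then obtain x0 where "x0 \<in> Sp F ?a" "x0 \<noteq> 0" by blast
  then obtain e where e: "unit_vec ?a e" using normalize[OF aS] by blast
  have ein: "e \<in> Sp F ?a" using e by (rule unit_vec_in)
  have "\<exists>z. y = z *\<^sub>C e" if y: "y \<in> Sp F ?a" for y
  proof -
    define t where "t v = ip F e v *\<^sub>C y" for v
    have tin: "t v \<in> Sp F ?a" for v unfolding t_def using Sp_scale[OF aS y] .
    have tl: "clinear_on (Sp F ?a) t"
      unfolding clinear_on_def t_def
      using ip_add[OF aS ein] ip_scaleC[OF aS ein] by (simp add: scaleC_add_left scaleC_scaleC)
    have "t (act F g v) = act F g (t v)" if "g \<in> carrier G" "v \<in> Sp F ?a" for g v
      using act_scalar[OF that(1) k that(2)] act_scalar[OF that(1) k tin]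
        clinear_on_scaleC[OF tl that(2)] by simp
    then obtain T where T: "T \<in> Hom C ?a ?a" "\<And>v. v \<in> Sp F ?a \<Longrightarrow> fmap F T v = t v"
      using fmap_full[OF aS aS tl tin] by blast
    obtain z where "T = z *\<^sub>C idt C ?a" using irred_scalar[OF irr T(1)] by blast
    then have "t e = z *\<^sub>C e"
      using T(2)[OF ein] fmap_scale_arrow[OF aS aS i ein] fmap_idt[OF aS ein] by simp
    then show ?thesis using e by (auto simp: t_def unit_vec_def)
  qed
  then show ?thesis by (rule lineI[OF aS ein unit_vec_nonzero[OF aS e]])
qed

lemma line_tob:
  assumes a: "line a" and b: "line b" and e: "unit_vec a e" "unit_vec b f"
  shows "line (a \<odot> b)" "unit_vec (a \<odot> b) (vtens F e f)"
proof -
  note aS = line_S[OF a] and bS = line_S[OF b]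
  have ein: "e \<in> Sp F a" "f \<in> Sp F b" using e by (simp_all add: unit_vec_in)
  have v: "vtens F e f \<in> Sp F (a \<odot> b)" using vtens_in[OF aS bS ein] .
  show u: "unit_vec (a \<odot> b) (vtens F e f)"
    using vtens_ip[OF aS bS ein(1,1,2,2)] e v by (simp add: unit_vec_def)
  have ab: "a \<odot> b \<in> S" using sub_tob[OF aS bS] .
  show "line (a \<odot> b)"
  proof (rule lineI[OF ab v unit_vec_nonzero[OF ab u]])
    fix y assume y: "y \<in> Sp F (a \<odot> b)"
    have "{vtens F x y |x y. x \<in> Sp F a \<and> y \<in> Sp F b} \<subseteq> cspan {vtens F e f}"
    proof clarify
      fix x y assume x: "x \<in> Sp F a" and y: "y \<in> Sp F b"
      have "vtens F x y = vtens F (ip F e x *\<^sub>C e) (ip F f y *\<^sub>C f)"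
        using line_expand[OF a e(1) x] line_expand[OF b e(2) y] by simp
      also have "\<dots> = ip F e x *\<^sub>C ip F f y *\<^sub>C vtens F e f"
        using vtens_scale_left[OF aS bS ein(1) Sp_scale[OF bS ein(2)]] vtens_scale_right[OF aS bS ein]
        by simp
      finally show "vtens F x y \<in> cspan {vtens F e f}"
        by (simp add: complex_vector.span_scale complex_vector.span_base)
    qed
    then have "Sp F (a \<odot> b) \<subseteq> cspan {vtens F e f}"
      unfolding vtens_span[OF aS bS]
      by (intro complex_vector.span_minimal complex_vector.subspace_span)
    then have "y \<in> cspan {vtens F e f}" using y by blast
    then show "\<exists>z. y = z *\<^sub>C vtens F e f" by (auto simp: complex_vector.span_singleton)
  qed
qed

lemma line_unt: "line (unt C)" "unit_vec (unt C) (vac F)"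
proof -
  have u: "vac F \<in> Sp F (unt C)" using vac_Sp complex_vector.span_base by blast
  then show v: "unit_vec (unt C) (vac F)" using vac_unit by (simp add: unit_vec_def)
  show "line (unt C)"
  proof (rule lineI[OF sub_unt u unit_vec_nonzero[OF sub_unt v]])
    show "\<exists>z. y = z *\<^sub>C vac F" if "y \<in> Sp F (unt C)" for y
      using that vac_Sp by (auto simp: complex_vector.span_singleton)
  qed
qed

lemma line_iso:
  assumes a: "line a" and b: "b \<in> ob C" and iso: "iso_obj C a b"
  shows "line b"
proof -
  note aS = line_S[OF a] and aob = line_ob[OF a]
  have bS: "b \<in> S" using replete[OF aS b iso] .
  obtain f g where f: "f \<in> Hom C a b" "g \<in> Hom C b a" "g \<cdot> f = idt C a" "f \<cdot> g = idt C b"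
    using iso unfolding iso_obj_def by blast
  obtain e where e: "unit_vec a e" using line_unit_vec[OF a] by blast
  have ein: "e \<in> Sp F a" using e by (rule unit_vec_in)
  show ?thesis
  proof (rule lineI[OF bS fmap_in[OF aS bS f(1) ein]])
    show "fmap F f e \<noteq> 0"
    proof
      assume "fmap F f e = 0"
      then have "f = 0" by (rule line_arrow_zero[OF a bS e f(1)])
      then have "idt C a = 0" using f(3) cmp_zero[OF aob b aob f(2)] by simp
      then show False using line_irred[OF a] by (simp add: irred_obj_def)
    qed
    fix y assume y: "y \<in> Sp F b"
    have gy: "fmap F g y \<in> Sp F a" using fmap_in[OF bS aS f(2) y] .
    have "y = fmap F f (fmap F g y)"
      using fmap_cmp[OF bS aS bS f(1,2) y] f(4) fmap_idt[OF bS y] by simp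
    also have "fmap F g y = ip F e (fmap F g y) *\<^sub>C e" using line_expand[OF a e gy] .
    also have "fmap F f (ip F e (fmap F g y) *\<^sub>C e) = ip F e (fmap F g y) *\<^sub>C fmap F f e"
      using fmap_scale[OF aS bS f(1) ein] .
    finally show "\<exists>z. y = z *\<^sub>C fmap F f e" by blast
  qed
qed


section \<open>The group of classes\<close>

lemma line_class: "line a \<Longrightarrow> iso_class C a \<in> irr_classes C S"
  using line_S line_irred unfolding irr_classes_def by blast

lemma rep_class_iso:
  assumes a: "line a"
  shows "iso_obj C (rep Z (iso_class C a)) a"
proof -
  note k = line_class[OF a]
  show ?thesis
    using rep_irr(3)[OF k] iso_class_eq_iff[OF line_ob[OF line_rep[OF k]] line_ob[OF a]] by simp
qed

lemma tob_line: "line a \<Longrightarrow> line b \<Longrightarrow> line (a \<odot> b)"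
  using line_tob(1) line_unit_vec by blast

lemma class_mult:
  assumes a: "line a" and b: "line b"
  shows "iso_class C a \<otimes>\<^bsub>class_group C S\<^esub> iso_class C b = iso_class C (a \<odot> b)"
proof -
  note ob = line_ob[OF a] line_ob[OF b] line_ob[OF tob_line[OF a b]]
  have "iso_obj C (a \<odot> b) c" if c: "c \<in> ob C" and a': "a' \<in> iso_class C a" and b': "b' \<in> iso_class C b"
    and i: "iso_obj C (a' \<odot> b') c" for a' b' c
  proof -
    have o': "a' \<in> ob C" "b' \<in> ob C" "iso_obj C a a'" "iso_obj C b b'" using a' b' by (auto simp: iso_class_def)
    show ?thesis
      using iso_trans[OF ob(3) tob_in[OF o'(1,2)] c iso_tob[OF ob(1) o'(1) ob(2) o'(2) o'(3,4)] i] .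
  qed
  moreover have "a \<in> iso_class C a" "b \<in> iso_class C b" using ob iso_refl by (auto simp: iso_class_def)
  ultimately show ?thesis by (auto simp: class_group_def iso_class_def[of _ "a \<odot> b"])
qed

lemma class_group_simps [simp]:
  "carrier (class_group C S) = irr_classes C S"
  "\<one>\<^bsub>class_group C S\<^esub> = iso_class C (unt C)"
  by (simp_all add: class_group_def)

lemma classes_mult:
  assumes k: "k \<in> irr_classes C S" and l: "l \<in> irr_classes C S"
  shows "k \<otimes>\<^bsub>class_group C S\<^esub> l = iso_class C (rep Z k \<odot> rep Z l)"
  using class_mult[OF line_rep[OF k] line_rep[OF l]] rep_irr(3)[OF k] rep_irr(3)[OF l] by simp

text \<open>Evaluated on \<open>e\<close> and on \<open>f\<close>, the two conjugate equations become the same equation between the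
  coefficients \<open>r\<close> and \<open>r'\<close>, up to complex conjugation.\<close>

lemma line_conj_eqs_iff:
  assumes a: "line a" and b: "line b" and e: "unit_vec a e" and f: "unit_vec b f"
    and R: "R \<in> Hom C (unt C) (b \<odot> a)" "fmap F R (vac F) = r *\<^sub>C vtens F f e"
    and R': "R' \<in> Hom C (unt C) (a \<odot> b)" "fmap F R' (vac F) = r' *\<^sub>C vtens F e f"
  shows "conj_eqs C a b R R' \<longleftrightarrow> cnj r' * r = 1"
proof -
  \<comment> \<open>The second equation is the first one with \<open>a\<close> and \<open>b\<close> exchanged.\<close>
  have half: "(str C R' \<boxtimes> idt C a) \<cdot> (idt C a \<boxtimes> R) = idt C a \<longleftrightarrow> cnj r' * r = 1"
    if a: "line a" and b: "line b" and e: "unit_vec a e" and f: "unit_vec b f"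
    and R: "R \<in> Hom C (unt C) (b \<odot> a)" "fmap F R (vac F) = r *\<^sub>C vtens F f e"
    and R': "R' \<in> Hom C (unt C) (a \<odot> b)" "fmap F R' (vac F) = r' *\<^sub>C vtens F e f"
    for a b e f R R' r r'
  proof -
    note aS = line_S[OF a] and bS = line_S[OF b] and uS = sub_unt
    note abS = sub_tob[OF aS bS] and baS = sub_tob[OF bS aS]
    note ob = line_ob[OF a] line_ob[OF b] unt_in S_ob[OF abS] S_ob[OF baS]
    have ein: "e \<in> Sp F a" and fin: "f \<in> Sp F b" using e f by (auto simp: unit_vec_in)
    have vin: "vac F \<in> Sp F (unt C)" using line_unt(2) by (rule unit_vec_in)
    have efin: "vtens F e f \<in> Sp F (a \<odot> b)" and fein: "vtens F f e \<in> Sp F (b \<odot> a)"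
      using vtens_in aS bS ein fin by auto
    note ia = idt_in[OF ob(1)]
    have aba: "a \<odot> (b \<odot> a) = (a \<odot> b) \<odot> a" using tob_assoc ob by simp
    have 1: "idt C a \<boxtimes> R \<in> Hom C a ((a \<odot> b) \<odot> a)"
      using tar_in[OF ob(1,1,3,5) ia R(1)] aba tob_unt_right[OF ob(1)] by simp
    have sR': "str C R' \<in> Hom C (a \<odot> b) (unt C)" using str_in[OF ob(3,4) R'(1)] .
    have 2: "str C R' \<boxtimes> idt C a \<in> Hom C ((a \<odot> b) \<odot> a) a"
      using tar_in[OF ob(4,3,1,1) sR' ia] tob_unt_left[OF ob(1)] by simp
    have abaS: "(a \<odot> b) \<odot> a \<in> S" using sub_tob[OF abS aS] .
    have in3: "(str C R' \<boxtimes> idt C a) \<cdot> (idt C a \<boxtimes> R) \<in> Hom C a a"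
      using cmp_in[OF ob(1) S_ob[OF abaS] ob(1) 2 1] .
    have "fmap F (idt C a \<boxtimes> R) e = fmap F (idt C a \<boxtimes> R) (vtens F e (vac F))"
      using vtens_vac_right[OF aS ein] by simp
    also have "\<dots> = vtens F e (r *\<^sub>C vtens F f e)"
      using fmap_tar[OF aS aS uS baS ia R(1) ein vin] fmap_idt[OF aS ein] R(2) by simp
    also have "\<dots> = r *\<^sub>C vtens F (vtens F e f) e"
      using vtens_scale_right[OF aS baS ein fein] vtens_assoc[OF aS bS aS ein fin ein] by simp
    finally have 4: "fmap F (idt C a \<boxtimes> R) e = r *\<^sub>C vtens F (vtens F e f) e" .
    have sin: "fmap F (str C R') (vtens F e f) \<in> Sp F (unt C)" using fmap_in[OF abS uS sR' efin] .
    have "ip F (fmap F (str C R') (vtens F e f)) (vac F) = ip F (vtens F e f) (fmap F R' (vac F))"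
      using fmap_str[OF uS abS R'(1) vin efin] .
    also have "\<dots> = r'"
      using ip_scaleC[OF abS efin efin] line_tob(2)[OF a b e f] R'(2) by (simp add: unit_vec_def)
    finally have "ip F (vac F) (fmap F (str C R') (vtens F e f)) = cnj r'"
      using ip_cnj[OF uS sin vin] by simp
    then have 5: "fmap F (str C R') (vtens F e f) = cnj r' *\<^sub>C vac F"
      using line_expand[OF line_unt sin] by simp
    have efein: "vtens F (vtens F e f) e \<in> Sp F ((a \<odot> b) \<odot> a)" using vtens_in[OF abS aS efin ein] .
    have "fmap F (str C R' \<boxtimes> idt C a) (vtens F (vtens F e f) e) = vtens F (cnj r' *\<^sub>C vac F) e"
      using fmap_tar[OF abS uS aS aS sR' ia efin ein] fmap_idt[OF aS ein] 5 by simp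
    also have "\<dots> = cnj r' *\<^sub>C e"
      using vtens_scale_left[OF uS aS vin ein] vtens_vac_left[OF aS ein] by simp
    finally have "fmap F ((str C R' \<boxtimes> idt C a) \<cdot> (idt C a \<boxtimes> R)) e = r *\<^sub>C cnj r' *\<^sub>C e"
      using fmap_cmp[OF aS abaS aS 2 1 ein] 4 fmap_scale[OF abaS aS 2 efein] by simp
    then have 6: "fmap F ((str C R' \<boxtimes> idt C a) \<cdot> (idt C a \<boxtimes> R)) e = (cnj r' * r) *\<^sub>C e"
      by (simp add: scaleC_scaleC mult.commute)
    show ?thesis
    proof
      assume "(str C R' \<boxtimes> idt C a) \<cdot> (idt C a \<boxtimes> R) = idt C a"
      then have "(cnj r' * r) *\<^sub>C e = 1 *\<^sub>C e" using 6 fmap_idt[OF aS ein] by simp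
      then show "cnj r' * r = 1"
        using unit_vec_nonzero[OF aS e] complex_vector.scale_right_imp_eq by blast
    next
      assume "cnj r' * r = 1"
      then show "(str C R' \<boxtimes> idt C a) \<cdot> (idt C a \<boxtimes> R) = idt C a"
        using 6 fmap_idt[OF aS ein] by (intro line_arrow_eqI[OF a aS e in3 ia]) simp
    qed
  qed
  have "cnj r * r' = 1 \<longleftrightarrow> cnj r' * r = 1"
  proof -
    have "cnj (cnj r * r') = cnj r' * r" by simp
    then show ?thesis by (metis complex_cnj_one complex_cnj_cnj)
  qed
  then show ?thesis
    using half[OF a b e f R R'] half[OF b a f e R' R] R R' line_ob[OF a] line_ob[OF b]
    by (auto simp: conj_eqs_def)
qed

lemma line_tob_factor_right:
  assumes a: "line a" and bS: "b \<in> S" and e: "unit_vec a e" and y: "y \<in> Sp F (b \<odot> a)"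
  shows "\<exists>x\<in>Sp F b. y = vtens F x e"
proof -
  note aS = line_S[OF a]
  have ein: "e \<in> Sp F a" using e by (rule unit_vec_in)
  let ?V = "(\<lambda>x. vtens F x e) ` Sp F b"
  have lin: "clinear_on (Sp F b) (\<lambda>x. vtens F x e)" using vtens_linear_left[OF bS aS ein] .
  have sub: "csubspace ?V"
  proof (rule complex_vector.subspaceI)
    show "0 \<in> ?V"
      using clinear_on_zero[OF lin Sp_subspace[OF bS]] complex_vector.subspace_0[OF Sp_subspace[OF bS]]
      by force
    show "u + v \<in> ?V" if "u \<in> ?V" "v \<in> ?V" for u v
      using that clinear_on_add[OF lin] complex_vector.subspace_add[OF Sp_subspace[OF bS]] by force
    show "z *\<^sub>C u \<in> ?V" if "u \<in> ?V" for z u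
    proof -
      obtain x where x: "x \<in> Sp F b" "u = vtens F x e" using \<open>u \<in> ?V\<close> by blast
      then have "z *\<^sub>C u = vtens F (z *\<^sub>C x) e" using clinear_on_scaleC[OF lin] by simp
      then show ?thesis using Sp_scale[OF bS x(1)] by blast
    qed
  qed
  have "{vtens F x y |x y. x \<in> Sp F b \<and> y \<in> Sp F a} \<subseteq> ?V"
  proof clarify
    fix x y assume x: "x \<in> Sp F b" and y: "y \<in> Sp F a"
    have "vtens F x y = vtens F x (ip F e y *\<^sub>C e)" using line_expand[OF a e y] by simp
    also have "\<dots> = vtens F (ip F e y *\<^sub>C x) e"
      using vtens_scale_right[OF bS aS x ein] vtens_scale_left[OF bS aS x ein] by simp
    finally show "vtens F x y \<in> ?V" using Sp_scale[OF bS x] by blast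
  qed
  then have "Sp F (b \<odot> a) \<subseteq> ?V"
    unfolding vtens_span[OF bS aS] using sub by (rule complex_vector.span_minimal)
  then show ?thesis using y by blast
qed

lemma line_tob_factor_left:
  assumes a: "line a" and bS: "b \<in> S" and e: "unit_vec a e" and y: "y \<in> Sp F (a \<odot> b)"
  shows "\<exists>x\<in>Sp F b. y = vtens F e x"
proof -
  note aS = line_S[OF a]
  note obs = S_ob[OF sub_tob[OF aS bS]] S_ob[OF sub_tob[OF bS aS]]
  have ein: "e \<in> Sp F a" using e by (rule unit_vec_in)
  have br: "brd C a b \<in> Hom C (a \<odot> b) (b \<odot> a)" "brd C b a \<in> Hom C (b \<odot> a) (a \<odot> b)"
    using brd_unitary S_ob[OF aS] S_ob[OF bS] by (auto simp: is_unitary_def is_isometry_def)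
  note abS = sub_tob[OF aS bS] and baS = sub_tob[OF bS aS]
  obtain x where x: "x \<in> Sp F b" "fmap F (brd C a b) y = vtens F x e"
    using line_tob_factor_right[OF a bS e fmap_in[OF abS baS br(1) y]] by blast
  have "y = fmap F (brd C b a \<cdot> brd C a b) y"
    using sub_symmetric[OF aS bS] fmap_idt[OF abS y] by simp
  also have "\<dots> = fmap F (brd C b a) (vtens F x e)"
    using fmap_cmp[OF abS baS abS br(2,1) y] x(2) by simp
  also have "\<dots> = vtens F e x" using fmap_brd[OF bS aS x(1) ein] .
  finally show ?thesis using x(1) by blast
qed

text \<open>If \<open>e\<close> spans the space of \<open>a\<close>, the vector of \<open>R'\<close> is of the form \<open>e \<otimes> x'\<close>, and the second conjugate
  equation expresses every vector of the space of \<open>b\<close> as a multiple of \<open>x'\<close>.\<close>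

lemma conj_line:
  assumes a: "line a" and eq: "conj_eqs C a b R R'"
  shows "line b"
proof -
  note aS = line_S[OF a] and uS = sub_unt
  have bS: "b \<in> S" using sub_conj[OF aS eq] .
  note abS = sub_tob[OF aS bS] and baS = sub_tob[OF bS aS]
  note ob = S_ob[OF aS] S_ob[OF bS] unt_in S_ob[OF abS] S_ob[OF baS]
  have R: "R \<in> Hom C (unt C) (b \<odot> a)" and R': "R' \<in> Hom C (unt C) (a \<odot> b)"
    and e1: "(str C R' \<boxtimes> idt C a) \<cdot> (idt C a \<boxtimes> R) = idt C a"
    and e2: "(str C R \<boxtimes> idt C b) \<cdot> (idt C b \<boxtimes> R') = idt C b"
    using eq by (auto simp: conj_eqs_def)
  obtain e where e: "unit_vec a e" using line_unit_vec[OF a] by blast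
  have ein: "e \<in> Sp F a" using e by (rule unit_vec_in)
  have vin: "vac F \<in> Sp F (unt C)" using line_unt(2) by (rule unit_vec_in)
  obtain x' where x': "x' \<in> Sp F b" "fmap F R' (vac F) = vtens F e x'"
    using line_tob_factor_left[OF a bS e fmap_in[OF uS abS R' vin]] by blast
  note ia = idt_in[OF ob(1)] and ib = idt_in[OF ob(2)]
  have sR: "str C R \<in> Hom C (b \<odot> a) (unt C)" using str_in[OF ob(3,5) R] .
  have bab: "b \<odot> (a \<odot> b) = (b \<odot> a) \<odot> b" using tob_assoc ob by simp
  have 1: "idt C b \<boxtimes> R' \<in> Hom C b ((b \<odot> a) \<odot> b)"
    using tar_in[OF ob(2,2,3,4) ib R'] bab tob_unt_right[OF ob(2)] by simp
  have 2: "str C R \<boxtimes> idt C b \<in> Hom C ((b \<odot> a) \<odot> b) b"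
    using tar_in[OF ob(5,3,2,2) sR ib] tob_unt_left[OF ob(2)] by simp
  have babS: "(b \<odot> a) \<odot> b \<in> S" using sub_tob[OF baS bS] .
  have span: "\<exists>z. y = z *\<^sub>C x'" if y: "y \<in> Sp F b" for y
  proof -
    have yein: "vtens F y e \<in> Sp F (b \<odot> a)" using vtens_in[OF bS aS y ein] .
    let ?s = "fmap F (str C R) (vtens F y e)"
    have sin: "?s \<in> Sp F (unt C)" using fmap_in[OF baS uS sR yein] .
    have "fmap F (idt C b \<boxtimes> R') y = fmap F (idt C b \<boxtimes> R') (vtens F y (vac F))"
      using vtens_vac_right[OF bS y] by simp
    also have "\<dots> = vtens F y (vtens F e x')"
      using fmap_tar[OF bS bS uS abS ib R' y vin] fmap_idt[OF bS y] x'(2) by simp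
    also have "\<dots> = vtens F (vtens F y e) x'" using vtens_assoc[OF bS aS bS y ein x'(1)] by simp
    finally have 3: "fmap F (idt C b \<boxtimes> R') y = vtens F (vtens F y e) x'" .
    have "y = fmap F ((str C R \<boxtimes> idt C b) \<cdot> (idt C b \<boxtimes> R')) y" using e2 fmap_idt[OF bS y] by simp
    also have "\<dots> = fmap F (str C R \<boxtimes> idt C b) (vtens F (vtens F y e) x')"
      using fmap_cmp[OF bS babS bS 2 1 y] 3 by simp
    also have "\<dots> = vtens F ?s x'"
      using fmap_tar[OF baS uS bS bS sR ib yein x'(1)] fmap_idt[OF bS x'(1)] by simp
    also have "?s = ip F (vac F) ?s *\<^sub>C vac F" using line_expand[OF line_unt sin] .
    also have "vtens F (ip F (vac F) ?s *\<^sub>C vac F) x' = ip F (vac F) ?s *\<^sub>C x'"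
      using vtens_scale_left[OF uS bS vin x'(1)] vtens_vac_left[OF bS x'(1)] by simp
    finally show ?thesis by blast
  qed
  have "x' \<noteq> 0"
  proof
    assume "x' = 0"
    then have "fmap F R' (vac F) = 0"
      using x'(2) clinear_on_zero[OF vtens_linear_right[OF aS bS ein] Sp_subspace[OF bS]] by simp
    then have "R' = 0" by (rule line_arrow_zero[OF line_unt(1) abS line_unt(2) R'])
    then have "str C R' = 0" using str_scaleC[OF ob(3,4) R', of 0] by simp
    then have "str C R' \<boxtimes> idt C a = 0"
      using clinear_on_zero[OF tar_linear_left[OF ob(4,3,1,1) ia] Hom_subspace[OF ob(4,3)]] by simp
    moreover have "idt C a \<boxtimes> R \<in> Hom C a (a \<odot> (b \<odot> a))"
      using tar_in[OF ob(1,1,3,5) ia R] tob_unt_right[OF ob(1)] by simp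
    ultimately have "idt C a = 0"
      using e1 zero_cmp[OF ob(1) tob_in[OF ob(1,5)] ob(1)] by simp
    then show False using line_irred[OF a] by (simp add: irred_obj_def)
  qed
  then show ?thesis using lineI[OF bS x'(1) _ span] by blast
qed

lemma conj_iso_unt:
  assumes a: "line a" and eq: "conj_eqs C a b R R'"
  shows "iso_obj C (b \<odot> a) (unt C)" "iso_obj C (a \<odot> b) (unt C)"
proof -
  have b: "line b" using conj_line[OF assms] .
  obtain e f where e: "unit_vec a e" and f: "unit_vec b f" using line_unit_vec a b by blast
  have vin: "vac F \<in> Sp F (unt C)" using line_unt(2) by (rule unit_vec_in)
  note ba = line_tob[OF b a f e] and ab = line_tob[OF a b e f]
  have R: "R \<in> Hom C (unt C) (b \<odot> a)" and R': "R' \<in> Hom C (unt C) (a \<odot> b)"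
    using eq by (auto simp: conj_eqs_def)
  let ?r = "ip F (vtens F f e) (fmap F R (vac F))" and ?r' = "ip F (vtens F e f) (fmap F R' (vac F))"
  have r: "fmap F R (vac F) = ?r *\<^sub>C vtens F f e"
    using line_expand[OF ba fmap_in[OF sub_unt line_S[OF ba(1)] R vin]] .
  have r': "fmap F R' (vac F) = ?r' *\<^sub>C vtens F e f"
    using line_expand[OF ab fmap_in[OF sub_unt line_S[OF ab(1)] R' vin]] .
  have "cnj ?r' * ?r = 1" using line_conj_eqs_iff[OF a b e f R r R' r'] eq by simp
  then have nz: "?r \<noteq> 0" "?r' \<noteq> 0" by auto
  have "fmap F (0 *\<^sub>C X) (vac F) = 0" if "X \<in> Hom C (unt C) x" "x \<in> S" for X x
    using fmap_scale_arrow[OF sub_unt that(2,1) vin, of 0] by simp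
  then have "R \<noteq> 0" "R' \<noteq> 0"
    using nz r r' R R' line_S[OF ba(1)] line_S[OF ab(1)]
      unit_vec_nonzero[OF line_S[OF ba(1)] ba(2)] unit_vec_nonzero[OF line_S[OF ab(1)] ab(2)]
    by (metis complex_vector.scale_eq_0_iff complex_vector.scale_zero_right)+
  then show "iso_obj C (b \<odot> a) (unt C)" "iso_obj C (a \<odot> b) (unt C)"
    using iso_sym iso_if_nonzero[OF unt_in line_ob[OF ba(1)] unt_irred line_irred[OF ba(1)] R]
      iso_sym iso_if_nonzero[OF unt_in line_ob[OF ab(1)] unt_irred line_irred[OF ab(1)] R'] by blast+
qed


text \<open>A conjugate of \<open>rep Z k\<close> is an inverse up to isomorphism and so is unique up to isomorphism.
  Conversely, from an object \<open>b2\<close> isomorphic to a conjugate one gets an arrow \<open>R2\<close> from the unit to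
  \<open>b2 \<odot> rep Z k\<close>; composed with the braiding and rescaled it gives the second arrow of a solution.\<close>

lemma conj_class_eq:
  assumes k: "k \<in> irr_classes C S" and b: "conj_eqs C (rep Z k) b R R'"
  shows "conj_class C k = iso_class C b"
proof
  let ?a = "rep Z k"
  note a = line_rep[OF k]
  note bl = conj_line[OF a b]
  note ob = line_ob[OF a] line_ob[OF bl]
  note ab = conj_iso_unt[OF a b]
  show "conj_class C k \<subseteq> iso_class C b"
  proof
    fix b2 assume "b2 \<in> conj_class C k"
    then obtain a2 Q Q' where b2: "b2 \<in> ob C" "a2 \<in> k" "conj_eqs C a2 b2 Q Q'"
      by (auto simp: conj_class_def)
    have a2: "a2 \<in> ob C" "iso_obj C ?a a2" using b2(2) rep_irr(3)[OF k] by (auto simp: iso_class_def)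
    have a2l: "line a2" using line_iso[OF a a2] .
    have 1: "iso_obj C (b2 \<odot> a2) (unt C)" using conj_iso_unt(1)[OF a2l b2(3)] .
    have 2: "iso_obj C (b2 \<odot> ?a) (b2 \<odot> a2)"
      using iso_tob[OF b2(1) b2(1) ob(1) a2(1) iso_refl[OF b2(1)] a2(2)] .
    have 3: "iso_obj C (b2 \<odot> ?a) (unt C)"
      using iso_trans[OF tob_in[OF b2(1) ob(1)] tob_in[OF b2(1) a2(1)] unt_in 2 1] .
    have 4: "iso_obj C ((b2 \<odot> ?a) \<odot> b) (unt C \<odot> b)"
      using iso_tob[OF tob_in[OF b2(1) ob(1)] unt_in ob(2,2) 3 iso_refl[OF ob(2)]] .
    have 5: "iso_obj C (b2 \<odot> (?a \<odot> b)) (b2 \<odot> unt C)"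
      using iso_tob[OF b2(1) b2(1) tob_in[OF ob] unt_in iso_refl[OF b2(1)] ab(2)] .
    have "iso_obj C (b2 \<odot> (?a \<odot> b)) b" using 4 tob_assoc[OF b2(1) ob] tob_unt_left[OF ob(2)] by simp
    moreover have "iso_obj C b2 (b2 \<odot> (?a \<odot> b))" using iso_sym[OF 5] tob_unt_right[OF b2(1)] by simp
    ultimately have "iso_obj C b2 b"
      using iso_trans[OF b2(1) tob_in[OF b2(1) tob_in[OF ob]] ob(2)] by blast
    then show "b2 \<in> iso_class C b" using b2(1) iso_sym by (simp add: iso_class_def)
  qed
  show "iso_class C b \<subseteq> conj_class C k"
  proof
    fix b2 assume "b2 \<in> iso_class C b"
    then have b2: "b2 \<in> ob C" "iso_obj C b b2" by (auto simp: iso_class_def)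
    have b2l: "line b2" using line_iso[OF bl b2] .
    have 1: "iso_obj C (b \<odot> ?a) (b2 \<odot> ?a)"
      using iso_tob[OF ob(2) b2(1) ob(1,1) b2(2) iso_refl[OF ob(1)]] .
    have "iso_obj C (unt C) (b2 \<odot> ?a)"
      using iso_trans[OF unt_in tob_in[OF ob(2,1)] tob_in[OF b2(1) ob(1)] iso_sym[OF ab(1)] 1] .
    then obtain R2 R3 where R2: "R2 \<in> Hom C (unt C) (b2 \<odot> ?a)" "R3 \<in> Hom C (b2 \<odot> ?a) (unt C)"
      "R3 \<cdot> R2 = idt C (unt C)"
      unfolding iso_obj_def by blast
    obtain e f where e: "unit_vec ?a e" and f: "unit_vec b2 f" using line_unit_vec a b2l by blast
    have ein: "e \<in> Sp F ?a" "f \<in> Sp F b2" "vac F \<in> Sp F (unt C)"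
      using e f line_unt(2) by (auto simp: unit_vec_in)
    note b2a = line_tob[OF b2l a f e] and ab2 = line_tob[OF a b2l e f]
    let ?r = "ip F (vtens F f e) (fmap F R2 (vac F))"
    have r: "fmap F R2 (vac F) = ?r *\<^sub>C vtens F f e"
      using line_expand[OF b2a fmap_in[OF sub_unt line_S[OF b2a(1)] R2(1) ein(3)]] .
    have "?r \<noteq> 0"
    proof
      assume "?r = 0"
      then have "R2 = 0"
        using r by (intro line_arrow_zero[OF line_unt(1) line_S[OF b2a(1)] line_unt(2) R2(1)]) simp
      then have "idt C (unt C) = 0"
        using R2(3) cmp_zero[OF unt_in line_ob[OF b2a(1)] unt_in R2(2)] by simp
      then show False using unt_irred by (simp add: irred_obj_def)
    qed
    note b2S = line_S[OF b2l] and aS = line_S[OF a]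
    have br: "brd C b2 ?a \<in> Hom C (b2 \<odot> ?a) (?a \<odot> b2)"
      using brd_unitary[OF b2(1) ob(1)] by (auto simp: is_unitary_def is_isometry_def)
    let ?s = "inverse (?r * cnj ?r)"
    let ?R' = "?s *\<^sub>C (brd C b2 ?a \<cdot> R2)"
    have bR: "brd C b2 ?a \<cdot> R2 \<in> Hom C (unt C) (?a \<odot> b2)"
      using cmp_in[OF unt_in line_ob[OF b2a(1)] line_ob[OF ab2(1)] br R2(1)] .
    have R': "?R' \<in> Hom C (unt C) (?a \<odot> b2)" using scale_in[OF unt_in line_ob[OF ab2(1)] bR] .
    have "fmap F (brd C b2 ?a \<cdot> R2) (vac F) = fmap F (brd C b2 ?a) (?r *\<^sub>C vtens F f e)"
      using fmap_cmp[OF sub_unt line_S[OF b2a(1)] line_S[OF ab2(1)] br R2(1) ein(3)] r by simp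
    also have "\<dots> = ?r *\<^sub>C vtens F e f"
      using fmap_scale[OF line_S[OF b2a(1)] line_S[OF ab2(1)] br unit_vec_in[OF b2a(2)]]
        fmap_brd[OF b2S aS ein(2,1)] by simp
    finally have r': "fmap F ?R' (vac F) = (?s * ?r) *\<^sub>C vtens F e f"
      using fmap_scale_arrow[OF sub_unt line_S[OF ab2(1)] bR ein(3)] by (simp add: scaleC_scaleC)
    have "cnj (?s * ?r) * ?r = 1" using \<open>?r \<noteq> 0\<close> by (simp add: field_simps)
    then have "conj_eqs C ?a b2 R2 ?R'"
      using line_conj_eqs_iff[OF a b2l e f R2(1) r R' r'] by simp
    moreover have "?a \<in> k" using rep_in[OF k] .
    ultimately show "b2 \<in> conj_class C k" using b2(1) by (auto simp: conj_class_def)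
  qed
qed

lemma conj_class_inverse:
  assumes k: "k \<in> irr_classes C S"
  shows "conj_class C k \<in> irr_classes C S"
    "conj_class C k \<otimes>\<^bsub>class_group C S\<^esub> k = iso_class C (unt C)"
proof -
  note a = line_rep[OF k]
  obtain b R R' where b: "conj_eqs C (rep Z k) b R R'" using conjugates[OF line_ob[OF a]] by blast
  note bl = conj_line[OF a b]
  have e: "conj_class C k = iso_class C b" using conj_class_eq[OF k b] .
  show "conj_class C k \<in> irr_classes C S" unfolding e by (rule line_class[OF bl])
  have "conj_class C k \<otimes>\<^bsub>class_group C S\<^esub> k = iso_class C (b \<odot> rep Z k)"
    using class_mult[OF bl a] rep_irr(3)[OF k] e by simp
  also have "\<dots> = iso_class C (unt C)"
    using iso_class_eq_iff[OF line_ob[OF tob_line[OF bl a]] unt_in] conj_iso_unt(1)[OF a b] by simp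
  finally show "conj_class C k \<otimes>\<^bsub>class_group C S\<^esub> k = iso_class C (unt C)" .
qed

lemma class_group: "comm_group (class_group C S)"
proof (rule comm_groupI)
  let ?K = "class_group C S"
  show "x \<otimes>\<^bsub>?K\<^esub> y \<in> carrier ?K" if "x \<in> carrier ?K" "y \<in> carrier ?K" for x y
    using that line_class[OF tob_line[OF line_rep line_rep]] by (simp add: classes_mult)
  show "x \<otimes>\<^bsub>?K\<^esub> y \<otimes>\<^bsub>?K\<^esub> z = x \<otimes>\<^bsub>?K\<^esub> (y \<otimes>\<^bsub>?K\<^esub> z)"
    if "x \<in> carrier ?K" "y \<in> carrier ?K" "z \<in> carrier ?K" for x y z
  proof -
    have k: "x \<in> irr_classes C S" "y \<in> irr_classes C S" "z \<in> irr_classes C S" using that by simp_all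
    note l = k[THEN line_rep] and e = k[THEN rep_irr(3)]
    have "x \<otimes>\<^bsub>?K\<^esub> y \<otimes>\<^bsub>?K\<^esub> z = iso_class C ((rep Z x \<odot> rep Z y) \<odot> rep Z z)"
      using class_mult[OF l(1,2)] class_mult[OF tob_line[OF l(1,2)] l(3)] e by simp
    moreover have "x \<otimes>\<^bsub>?K\<^esub> (y \<otimes>\<^bsub>?K\<^esub> z) = iso_class C (rep Z x \<odot> (rep Z y \<odot> rep Z z))"
      using class_mult[OF l(2,3)] class_mult[OF l(1) tob_line[OF l(2,3)]] e by simp
    ultimately show ?thesis
      using tob_assoc[OF l[THEN line_ob]] by (simp only:)
  qed
  show "x \<otimes>\<^bsub>?K\<^esub> y = y \<otimes>\<^bsub>?K\<^esub> x" if "x \<in> carrier ?K" "y \<in> carrier ?K" for x y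
  proof -
    have k: "x \<in> irr_classes C S" "y \<in> irr_classes C S" using that by simp_all
    note l = k[THEN line_rep]
    note ob = line_ob[OF tob_line[OF l(1,2)]] line_ob[OF tob_line[OF l(2,1)]]
    have "iso_obj C (rep Z x \<odot> rep Z y) (rep Z y \<odot> rep Z x)"
      using unitary_iso[OF ob brd_unitary[OF l[THEN line_ob]]] .
    then show ?thesis
      using classes_mult[OF k(1,2)] classes_mult[OF k(2,1)] iso_class_eq_iff[OF ob] by simp
  qed
  show "\<one>\<^bsub>?K\<^esub> \<in> carrier ?K" using line_class[OF line_unt(1)] by simp
  show "\<one>\<^bsub>?K\<^esub> \<otimes>\<^bsub>?K\<^esub> x = x" if "x \<in> carrier ?K" for x
  proof -
    have k: "x \<in> irr_classes C S" using that by simp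
    show ?thesis
      using class_mult[OF line_unt(1) line_rep[OF k]] rep_irr(3)[OF k]
        tob_unt_left[OF line_ob[OF line_rep[OF k]]] by simp
  qed
  show "\<exists>y\<in>carrier ?K. y \<otimes>\<^bsub>?K\<^esub> x = \<one>\<^bsub>?K\<^esub>" if "x \<in> carrier ?K" for x
    using conj_class_inverse[of x] that by auto
qed

sublocale K: comm_group "class_group C S"
  by (rule class_group)

abbreviation mult_K (infixl "\<star>" 70) where
  "k \<star> l \<equiv> k \<otimes>\<^bsub>class_group C S\<^esub> l"

text \<open>The product of \<open>rep Z k\<close> and \<open>rep Z l\<close> is irreducible, so by Schur's lemma only arrows from the
  representative of its class are nonzero, and they form a line. The sums over classes and bases
  in the definition of the composition thus have a single term.\<close>

lemma bas_product:
  assumes k: "k \<in> irr_classes C S" and l: "l \<in> irr_classes C S"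
  shows "product_classes C S Z k l = {k \<star> l}"
    "\<exists>v. bas Z k l (k \<star> l) = {v} \<and> is_unitary C (rep Z (k \<star> l)) (rep Z k \<odot> rep Z l) v"
proof -
  note kl = tob_line[OF line_rep[OF k] line_rep[OF l]]
  note klob = line_ob[OF kl]
  have klS: "k \<star> l \<in> irr_classes C S" using classes_mult[OF k l] line_class[OF kl] by simp
  have vin: "v \<in> Hom C (rep Z m) (rep Z k \<odot> rep Z l)" "str C v \<cdot> v = idt C (rep Z m)" "v \<noteq> 0"
    if m: "m \<in> irr_classes C S" and v: "v \<in> bas Z k l m" for m v
  proof -
    note mob = line_ob[OF line_rep[OF m]]
    show 1: "v \<in> Hom C (rep Z m) (rep Z k \<odot> rep Z l)"
      using bas_span[OF k l m] v complex_vector.span_base by blast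
    show 2: "str C v \<cdot> v = idt C (rep Z m)" using bas_orthonormal[OF k l m v v] by simp
    show "v \<noteq> 0"
    proof
      assume "v = 0"
      then have "idt C (rep Z m) = 0" using 2 cmp_zero[OF mob klob mob str_in[OF mob klob 1]] by simp
      then show False using rep_irr(2)[OF m] by (simp add: irred_obj_def)
    qed
  qed
  have only: "m = k \<star> l" if m: "m \<in> irr_classes C S" and v: "v \<in> bas Z k l m" for m v
  proof -
    have "iso_obj C (rep Z m) (rep Z k \<odot> rep Z l)"
      using iso_if_nonzero[OF line_ob[OF line_rep[OF m]] klob rep_irr(2)[OF m] line_irred[OF kl]]
        vin(1,3)[OF m v] by blast
    then show ?thesis
      using iso_class_eq_iff[OF line_ob[OF line_rep[OF m]] klob] rep_irr(3)[OF m] classes_mult[OF k l] by simp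
  qed
  let ?m = "k \<star> l"
  note mob = line_ob[OF line_rep[OF klS]]
  have iso: "iso_obj C (rep Z ?m) (rep Z k \<odot> rep Z l)"
    using rep_class_iso[OF kl] classes_mult[OF k l] by simp
  have nonempty: "bas Z k l ?m \<noteq> {}"
  proof
    assume "bas Z k l ?m = {}"
    then have z: "Hom C (rep Z ?m) (rep Z k \<odot> rep Z l) = {0}" using bas_span[OF k l klS] by simp
    obtain f g where f: "f \<in> Hom C (rep Z ?m) (rep Z k \<odot> rep Z l)" "g \<in> Hom C (rep Z k \<odot> rep Z l) (rep Z ?m)"
      "g \<cdot> f = idt C (rep Z ?m)"
      using iso unfolding iso_obj_def by blast
    then have "idt C (rep Z ?m) = 0" using z cmp_zero[OF mob klob mob f(2)] by simp
    then show False using rep_irr(2)[OF klS] by (simp add: irred_obj_def)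
  qed
  then obtain v where v: "v \<in> bas Z k l ?m" by blast
  note vv = vin[OF klS v]
  have sv: "str C v \<in> Hom C (rep Z k \<odot> rep Z l) (rep Z ?m)" using str_in[OF mob klob vv(1)] .
  obtain z where z: "z \<noteq> 0" "str C v \<cdot> v = z *\<^sub>C idt C (rep Z ?m)" "v \<cdot> str C v = z *\<^sub>C idt C (rep Z k \<odot> rep Z l)"
    using schur[OF mob klob rep_irr(2)[OF klS] line_irred[OF kl] vv(1,3)] .
  have "z *\<^sub>C idt C (rep Z ?m) = 1 *\<^sub>C idt C (rep Z ?m)" using z(2) vv(2) by simp
  moreover have "idt C (rep Z ?m) \<noteq> 0" using rep_irr(2)[OF klS] by (simp add: irred_obj_def)
  ultimately have "z = 1" using complex_vector.scale_right_imp_eq by blast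
  then have vu: "v \<cdot> str C v = idt C (rep Z k \<odot> rep Z l)" using z(3) by simp
  have "w = v" if w: "w \<in> bas Z k l ?m" for w
  proof (rule ccontr)
    assume "w \<noteq> v"
    then have "str C v \<cdot> w = 0" using bas_orthonormal[OF k l klS v w] by simp
    moreover have "w = (v \<cdot> str C v) \<cdot> w"
      using vu cmp_idt_left[OF mob klob vin(1)[OF klS w]] by simp
    ultimately have "w = 0"
      using cmp_assoc[OF mob klob mob klob vv(1) sv vin(1)[OF klS w]] cmp_zero[OF mob mob klob vv(1)] by simp
    then show False using vin(3)[OF klS w] by simp
  qed
  then have bas_eq: "bas Z k l ?m = {v}" using v by blast
  moreover have "is_unitary C (rep Z ?m) (rep Z k \<odot> rep Z l) v"
    using vv vu by (simp add: is_unitary_def is_isometry_def)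
  ultimately show "\<exists>v. bas Z k l (k \<star> l) = {v} \<and> is_unitary C (rep Z (k \<star> l)) (rep Z k \<odot> rep Z l) v"
    by blast
  show "product_classes C S Z k l = {k \<star> l}"
    unfolding product_classes_def using only klS bas_eq by blast
qed

end


section \<open>The stabilizer of an irreducible object\<close>

locale irreducible_in_crossed_product = abelian_crossed_product C S Z G TG F
  for C :: "('o, 'm::complex_vector) btcat" (structure)
    and S :: "'o set"
    and Z :: "('o, 'm) cp_choice"
    and G :: "('o set \<Rightarrow> complex) monoid"
    and TG :: "('o set \<Rightarrow> complex) topology"
    and F :: "('o, 'm, 'h::complex_vector, 'o set \<Rightarrow> complex) fibre" +
  fixes \<rho> :: 'o and T :: "'o set \<Rightarrow> 'm" and \<psi> :: "'o set \<Rightarrow> 'h"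
  assumes \<rho>_ob: "\<rho> \<in> ob C" and \<rho>_irred: "irred_obj C \<rho>"
    and choice: "unitary_choice C S F Z \<rho> T \<psi>"
begin

abbreviation irr :: "'o set set" where "irr \<equiv> irr_classes C S"
abbreviation \<gamma> :: "'o set \<Rightarrow> 'o" where "\<gamma> \<equiv> rep Z"
abbreviation K\<rho> :: "'o set set" where "K\<rho> \<equiv> K_of C S Z \<rho>"
abbreviation one_class :: "'o set" ("\<e>") where "\<e> \<equiv> iso_class C (unt C)"

lemma \<gamma>_ob: "k \<in> irr \<Longrightarrow> \<gamma> k \<in> ob C"
  using line_ob line_rep by blast

lemma \<gamma>\<rho>_ob: "k \<in> irr \<Longrightarrow> \<gamma> k \<odot> \<rho> \<in> ob C"
  using \<gamma>_ob tob_in \<rho>_ob by blast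

lemma irr_mult: "k \<in> irr \<Longrightarrow> l \<in> irr \<Longrightarrow> k \<star> l \<in> irr"
  using K.m_closed[of k l] by simp

lemma e_irr: "\<e> \<in> irr"
  using line_class[OF line_unt(1)] .

lemma conj_inv: "k \<in> irr \<Longrightarrow> conj_class C k = inv\<^bsub>class_group C S\<^esub> k"
  using K.inv_equality[of "conj_class C k" k] conj_class_inverse[of k] by simp

lemma dual_unitary:
  assumes k: "k \<in> irr"
  shows "\<exists>R. is_unitary C (unt C) (\<gamma> (conj_class C k) \<odot> \<gamma> k) R"
    "\<exists>R. is_unitary C (unt C) (\<gamma> k \<odot> \<gamma> (conj_class C k)) R"
proof -
  note kb = conj_class_inverse[OF k]
  have "k \<star> conj_class C k = \<e>" using kb k K.m_comm[of k "conj_class C k"] by simp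
  then show "\<exists>R. is_unitary C (unt C) (\<gamma> (conj_class C k) \<odot> \<gamma> k) R"
    "\<exists>R. is_unitary C (unt C) (\<gamma> k \<odot> \<gamma> (conj_class C k)) R"
    using bas_product(2)[OF kb(1) k] bas_product(2)[OF k kb(1)] kb(2) rep_unt by auto
qed

lemma \<gamma>\<rho>_irred:
  assumes k: "k \<in> irr"
  shows "irred_obj C (\<gamma> k \<odot> \<rho>)"
proof -
  obtain R where R: "is_unitary C (unt C) (\<gamma> (conj_class C k) \<odot> \<gamma> k) R" using dual_unitary[OF k] by blast
  obtain R' where R': "is_unitary C (unt C) (\<gamma> k \<odot> \<gamma> (conj_class C k)) R'" using dual_unitary[OF k] by blast
  show ?thesis
    using invertible_tensor_irred[OF \<gamma>_ob[OF k] \<gamma>_ob[OF conj_class_inverse(1)[OF k]] \<rho>_ob R R' \<rho>_irred] .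
qed

lemma K\<rho>_irr: "k \<in> K\<rho> \<Longrightarrow> k \<in> irr"
  by (simp add: K_of_def)

lemma T_unitary: "k \<in> K\<rho> \<Longrightarrow> is_unitary C (\<gamma> k \<odot> \<rho>) \<rho> (T k)"
  using choice by (simp add: unitary_choice_def)

lemma T_e: "T \<e> = idt C \<rho>"
  using choice by (simp add: unitary_choice_def)

lemma \<psi>_unit: "k \<in> K\<rho> \<Longrightarrow> unit_vec (\<gamma> k) (\<psi> k)"
  using choice by (simp add: unitary_choice_def unit_vec_def)

lemma T_in: "k \<in> K\<rho> \<Longrightarrow> T k \<in> Hom C (\<gamma> k \<odot> \<rho>) \<rho>"
  using T_unitary by (simp add: is_unitary_def is_isometry_def)

lemma \<psi>_in: "k \<in> K\<rho> \<Longrightarrow> \<psi> k \<in> Sp F (\<gamma> k)"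
  using \<psi>_unit unit_vec_in by blast

lemma T_nonzero:
  assumes k: "k \<in> K\<rho>"
  shows "T k \<noteq> 0"
  using unitary_nonzero[OF \<gamma>\<rho>_ob[OF K\<rho>_irr[OF k]] \<rho>_ob T_unitary[OF k]] \<gamma>\<rho>_irred[OF K\<rho>_irr[OF k]]
  by (simp add: irred_obj_def)

lemma Hom_K\<rho>:
  assumes k: "k \<in> K\<rho>" and X: "X \<in> Hom C (\<gamma> k \<odot> \<rho>) \<rho>"
  shows "\<exists>z. X = z *\<^sub>C T k"
proof -
  note ob = \<gamma>\<rho>_ob[OF K\<rho>_irr[OF k]]
  note t = unitary_inv[OF ob \<rho>_ob T_unitary[OF k]]
  obtain z where z: "X \<cdot> str C (T k) = z *\<^sub>C idt C \<rho>"
    using irred_scalar[OF \<rho>_irred cmp_in[OF \<rho>_ob ob \<rho>_ob X t(2)]] by blast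
  have "X = X \<cdot> (str C (T k) \<cdot> T k)" using cmp_idt_right[OF ob \<rho>_ob X] t by simp
  also have "\<dots> = (X \<cdot> str C (T k)) \<cdot> T k" using cmp_assoc[OF ob \<rho>_ob ob \<rho>_ob X t(2) t(1)] .
  also have "\<dots> = z *\<^sub>C T k"
    unfolding z using scale_cmp[OF ob \<rho>_ob \<rho>_ob idt_in[OF \<rho>_ob] t(1)] cmp_idt_left[OF ob \<rho>_ob t(1)] by simp
  finally show ?thesis by blast
qed

lemma Hom_not_K\<rho>:
  assumes k: "k \<in> irr" "k \<notin> K\<rho>" and X: "X \<in> Hom C (\<gamma> k \<odot> \<rho>) \<rho>"
  shows "X = 0"
  using iso_if_nonzero[OF \<gamma>\<rho>_ob[OF k(1)] \<rho>_ob \<gamma>\<rho>_irred[OF k(1)] \<rho>_irred X] k by (auto simp: K_of_def)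

lemma K\<rho>_subgroup: "subgroup K\<rho> (class_group C S)"
proof (rule K.subgroupI)
  show "K\<rho> \<subseteq> carrier (class_group C S)" using K\<rho>_irr by auto
  have "\<e> \<in> K\<rho>"
    using e_irr rep_unt tob_unt_left[OF \<rho>_ob] iso_refl[OF \<rho>_ob] by (simp add: K_of_def)
  then show "K\<rho> \<noteq> {}" by blast
  have iso: "k \<in> K\<rho> \<Longrightarrow> iso_obj C (\<gamma> k \<odot> \<rho>) \<rho>" for k by (simp add: K_of_def)
  show "inv\<^bsub>class_group C S\<^esub> k \<in> K\<rho>" if k: "k \<in> K\<rho>" for k
  proof -
    note ki = K\<rho>_irr[OF k]
    let ?kb = "conj_class C k"
    note kb = conj_class_inverse(1)[OF ki]
    obtain R where R: "is_unitary C (unt C) (\<gamma> ?kb \<odot> \<gamma> k) R" using dual_unitary[OF ki] by blast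
    note ob = \<gamma>_ob[OF kb] \<gamma>_ob[OF ki] \<rho>_ob \<gamma>\<rho>_ob[OF ki]
    have 1: "iso_obj C (\<gamma> ?kb \<odot> \<rho>) (\<gamma> ?kb \<odot> (\<gamma> k \<odot> \<rho>))"
      using iso_tob[OF ob(1,1,3,4) iso_refl[OF ob(1)] iso_sym[OF iso[OF k]]] .
    have 2: "iso_obj C ((\<gamma> ?kb \<odot> \<gamma> k) \<odot> \<rho>) (unt C \<odot> \<rho>)"
      using iso_tob[OF tob_in[OF ob(1,2)] unt_in ob(3,3)
          iso_sym[OF unitary_iso[OF unt_in tob_in[OF ob(1,2)] R]] iso_refl[OF ob(3)]] .
    then have "iso_obj C (\<gamma> ?kb \<odot> (\<gamma> k \<odot> \<rho>)) \<rho>" using tob_assoc[OF ob(1,2,3)] tob_unt_left[OF ob(3)] by simp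
    then have "iso_obj C (\<gamma> ?kb \<odot> \<rho>) \<rho>"
      using iso_trans[OF tob_in[OF ob(1,3)] tob_in[OF ob(1,4)] ob(3) 1] by blast
    then show ?thesis using kb conj_inv[OF ki] by (simp add: K_of_def)
  qed
  show "k \<star> l \<in> K\<rho>" if k: "k \<in> K\<rho>" and l: "l \<in> K\<rho>" for k l
  proof -
    note ki = K\<rho>_irr[OF k] and li = K\<rho>_irr[OF l]
    note kl = tob_line[OF line_rep[OF ki] line_rep[OF li]]
    note ob = \<gamma>_ob[OF irr_mult[OF ki li]] \<gamma>_ob[OF ki] \<gamma>_ob[OF li] \<rho>_ob line_ob[OF kl]
    have 1: "iso_obj C (\<gamma> (k \<star> l) \<odot> \<rho>) ((\<gamma> k \<odot> \<gamma> l) \<odot> \<rho>)"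
      using iso_tob[OF ob(1,5,4,4) rep_class_iso[OF kl, folded classes_mult[OF ki li]] iso_refl[OF ob(4)]] .
    have 2: "iso_obj C (\<gamma> k \<odot> (\<gamma> l \<odot> \<rho>)) (\<gamma> k \<odot> \<rho>)"
      using iso_tob[OF ob(2,2) \<gamma>\<rho>_ob[OF li] ob(4) iso_refl[OF ob(2)] iso[OF l]] .
    have 3: "iso_obj C ((\<gamma> k \<odot> \<gamma> l) \<odot> \<rho>) \<rho>"
      using iso_trans[OF tob_in[OF ob(2) \<gamma>\<rho>_ob[OF li]] \<gamma>\<rho>_ob[OF ki] ob(4) 2 iso[OF k]]
        tob_assoc[OF ob(2,3,4)] by simp
    have "iso_obj C (\<gamma> (k \<star> l) \<odot> \<rho>) \<rho>"
      using iso_trans[OF tob_in[OF ob(1,4)] tob_in[OF ob(5,4)] ob(4) 1 3] .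
    then show ?thesis using irr_mult[OF ki li] by (simp add: K_of_def)
  qed
qed

text \<open>Every \<open>\<gamma> k\<close> with \<open>k \<in> K\<rho>\<close> is contained in the tensor product of \<open>\<rho>\<close> and its conjugate.\<close>

lemma K\<rho>_finite: "finite K\<rho>"
proof -
  obtain c R R' where c: "conj_eqs C \<rho> c R R'" using conjugates[OF \<rho>_ob] by blast
  have cob: "c \<in> ob C" using c by (simp add: conj_eqs_def)
  note b = tob_in[OF \<rho>_ob cob]
  define W where "W k = (T k \<boxtimes> idt C c) \<cdot> (idt C (\<gamma> k) \<boxtimes> R')" for k
  have W: "W k \<in> Hom C (\<gamma> k) (\<rho> \<odot> c)" "W k \<noteq> 0" if k: "k \<in> K\<rho>" for k
    unfolding W_def
    using transpose_nonzero[OF \<gamma>_ob[OF K\<rho>_irr[OF k]] \<rho>_ob \<rho>_ob c T_in[OF k] T_nonzero[OF k]] by blast+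
  show ?thesis
  proof (rule finite_subobjects[OF b Hom_finite_dim[OF b b], of K\<rho> \<gamma> W])
    fix k l assume k: "k \<in> K\<rho>" "l \<in> K\<rho>" "k \<noteq> l"
    note i = K\<rho>_irr[OF k(1)] K\<rho>_irr[OF k(2)]
    show "\<not> iso_obj C (\<gamma> k) (\<gamma> l)"
      using iso_class_eq_iff[OF \<gamma>_ob[OF i(1)] \<gamma>_ob[OF i(2)]] rep_irr(3)[OF i(1)] rep_irr(3)[OF i(2)] k(3)
      by simp
  qed (use K\<rho>_irr \<gamma>_ob rep_irr(2) W in auto)
qed


section \<open>The endomorphisms of the object in the crossed product\<close>

definition Q :: "'o set monoid" where
  "Q = (class_group C S)\<lparr>carrier := K\<rho>\<rparr>"

lemma Q_simps [simp]: "carrier Q = K\<rho>" "k \<otimes>\<^bsub>Q\<^esub> l = k \<star> l" "\<one>\<^bsub>Q\<^esub> = \<e>"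
  by (simp_all add: Q_def)

lemma Q_comm_group: "comm_group Q"
  unfolding Q_def
  by (rule group.group_comm_groupI[OF K.subgroup_imp_group[OF K\<rho>_subgroup]])
    (use K.m_comm K\<rho>_irr in auto)

lemma K\<rho>_mult: "k \<in> K\<rho> \<Longrightarrow> l \<in> K\<rho> \<Longrightarrow> k \<star> l \<in> K\<rho>"
  using subgroup.m_closed[OF K\<rho>_subgroup] .

lemma e_K\<rho>: "\<e> \<in> K\<rho>"
  using subgroup.one_closed[OF K\<rho>_subgroup] by simp

lemma conj_K\<rho>: "k \<in> K\<rho> \<Longrightarrow> conj_class C k \<in> K\<rho>"
  using subgroup.m_inv_closed[OF K\<rho>_subgroup] conj_inv K\<rho>_irr by simp

abbreviation el :: "'o set \<Rightarrow> 'm \<Rightarrow> 'h \<Rightarrow> ('o, 'm, 'h) cp_arrow" where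
  "el \<equiv> elem F Z \<rho> \<rho>"

definition U :: "'o set \<Rightarrow> ('o, 'm, 'h) cp_arrow" where
  "U k = el k (T k) (\<psi> k)"

abbreviation lin :: "('o set \<Rightarrow> complex) \<Rightarrow> ('o, 'm, 'h) cp_arrow" where
  "lin x \<equiv> \<Sum>k\<in>K\<rho>. x k *\<^sub>C U k"

lemma elem_scale_arrow: "elem F Z a b k (z *\<^sub>C X) \<phi> = z *\<^sub>C elem F Z a b k X \<phi>"
  by (simp add: elem_def scaleC_fun_def fun_eq_iff scaleC_scaleC mult.commute)

lemma elem_scale_vec:
  assumes k: "k \<in> irr" and \<phi>: "\<phi> \<in> Sp F (\<gamma> k)"
  shows "elem F Z a b k X (z *\<^sub>C \<phi>) = z *\<^sub>C elem F Z a b k X \<phi>"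
  using ip_scaleC[OF rep_irr(1)[OF k] _ \<phi>]
  by (simp add: elem_def scaleC_fun_def fun_eq_iff scaleC_scaleC)

lemma elem_zero: "elem F Z a b k 0 \<phi> = 0"
  by (simp add: elem_def fun_eq_iff)

lemma sum_fun4: "(\<Sum>i\<in>I. f i) a b k x = (\<Sum>i\<in>I. (f i :: ('o, 'm, 'h) cp_arrow) a b k x)"
  by (induction I rule: infinite_finite_induct) simp_all

lemma lin_apply:
  "lin x a b k y = (if a = \<rho> \<and> b = \<rho> \<and> k \<in> K\<rho> \<and> y \<in> Sp F (\<gamma> k) then (x k * ip F y (\<psi> k)) *\<^sub>C T k else 0)"
proof -
  have "lin x a b k y = (\<Sum>l\<in>K\<rho>. if l = k then (if a = \<rho> \<and> b = \<rho> \<and> y \<in> Sp F (\<gamma> k)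
      then (x k * ip F y (\<psi> k)) *\<^sub>C T k else 0) else 0)"
    unfolding sum_fun4
    by (intro sum.cong refl) (auto simp: U_def elem_def scaleC_fun_def scaleC_scaleC)
  then show ?thesis using K\<rho>_finite by simp
qed

lemma lin_independent:
  assumes "lin x = 0" and k: "k \<in> K\<rho>"
  shows "x k = 0"
proof -
  have "(x k * ip F (\<psi> k) (\<psi> k)) *\<^sub>C T k = 0"
    using fun_cong[OF fun_cong[OF fun_cong[OF fun_cong[OF assms(1), of \<rho>], of \<rho>], of k], of "\<psi> k"]
      k \<psi>_in[OF k] by (simp add: lin_apply)
  then show ?thesis using T_nonzero[OF k] \<psi>_unit[OF k] by (simp add: unit_vec_def)
qed

lemma lin_single: "k \<in> K\<rho> \<Longrightarrow> lin (\<lambda>l. if l = k then z else 0) = z *\<^sub>C U k"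
  using K\<rho>_finite by (simp add: if_distrib[of "\<lambda>z. z *\<^sub>C _"] cong: if_cong)

lemma el_expand:
  assumes k: "k \<in> K\<rho>" and X: "X \<in> Hom C (\<gamma> k \<odot> \<rho>) \<rho>" and \<phi>: "\<phi> \<in> Sp F (\<gamma> k)"
  obtains x y where "X = x *\<^sub>C T k" "\<phi> = y *\<^sub>C \<psi> k" "el k X \<phi> = (x * y) *\<^sub>C U k"
proof -
  obtain x where x: "X = x *\<^sub>C T k" using Hom_K\<rho>[OF k X] by blast
  have y: "\<phi> = ip F (\<psi> k) \<phi> *\<^sub>C \<psi> k" using line_expand[OF line_rep[OF K\<rho>_irr[OF k]] \<psi>_unit[OF k] \<phi>] .
  have "el k X \<phi> = (x * ip F (\<psi> k) \<phi>) *\<^sub>C U k"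
    unfolding x U_def
    by (subst y) (simp add: elem_scale_arrow elem_scale_vec[OF K\<rho>_irr[OF k] \<psi>_in[OF k]] scaleC_scaleC)
  with x y that show ?thesis by blast
qed

text \<open>By Schur's lemma there are no nonzero arrows from \<open>\<gamma> k \<odot> \<rho>\<close> to \<open>\<rho>\<close> for \<open>k\<close> outside \<open>K\<rho>\<close>; for \<open>k\<close> in
  \<open>K\<rho>\<close> both factors of the elementary tensors range over lines.\<close>

lemma endomorphisms: "cp_Hom C S F Z \<rho> \<rho> = range lin"
proof
  have sub: "csubspace (range lin)"
  proof (rule complex_vector.subspaceI)
    show "0 \<in> range lin" using rangeI[of "\<lambda>x. lin x" "\<lambda>_. 0"] by simp
    show "u + v \<in> range lin" if uv: "u \<in> range lin" "v \<in> range lin" for u v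
    proof -
      obtain x where u: "u = lin x" using uv(1) by (rule rangeE)
      obtain y where v: "v = lin y" using uv(2) by (rule rangeE)
      have "u + v = lin (\<lambda>k. x k + y k)" unfolding u v by (simp add: scaleC_add_left sum.distrib)
      then show ?thesis using range_eqI[of "u + v" "\<lambda>x. lin x" "\<lambda>k. x k + y k"] by simp
    qed
    show "z *\<^sub>C u \<in> range lin" if ur: "u \<in> range lin" for z u
    proof -
      obtain x where u: "u = lin x" using ur by (rule rangeE)
      have "z *\<^sub>C u = lin (\<lambda>k. z * x k)"
        unfolding u by (simp add: complex_vector.scale_sum_right scaleC_scaleC)
      then show ?thesis using range_eqI[of "z *\<^sub>C u" "\<lambda>x. lin x" "\<lambda>k. z * x k"] by simp
    qed
  qed
  have "el k X \<phi> \<in> range lin" if k: "k \<in> irr" and X: "X \<in> Hom C (\<gamma> k \<odot> \<rho>) \<rho>" and \<phi>: "\<phi> \<in> Sp F (\<gamma> k)" for k X \<phi>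
  proof (cases "k \<in> K\<rho>")
    case True
    obtain x y where "el k X \<phi> = (x * y) *\<^sub>C U k" using el_expand[OF True X \<phi>] by blast
    then show ?thesis
      using rangeI[of "\<lambda>x'. lin x'" "\<lambda>l. if l = k then x * y else 0"]
      by (simp only: lin_single[OF True, of "x * y"])
  next
    case False
    then have "el k X \<phi> = 0" using Hom_not_K\<rho>[OF k _ X] elem_zero by simp
    then show ?thesis using complex_vector.subspace_0[OF sub] by simp
  qed
  then show "cp_Hom C S F Z \<rho> \<rho> \<subseteq> range lin"
    unfolding cp_Hom_def using sub by (intro complex_vector.span_minimal) auto
  have "U k \<in> cp_Hom C S F Z \<rho> \<rho>" if k: "k \<in> K\<rho>" for k
    unfolding cp_Hom_def U_def
    using K\<rho>_irr[OF k] T_in[OF k] \<psi>_in[OF k] by (intro complex_vector.span_base) blast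
  then have "lin x \<in> cp_Hom C S F Z \<rho> \<rho>" for x
    unfolding cp_Hom_def by (intro complex_vector.span_sum complex_vector.span_scale)
  then show "range lin \<subseteq> cp_Hom C S F Z \<rho> \<rho>" by blast
qed

subsection \<open>Expansion into elementary tensors\<close>

text \<open>The operations of the crossed product are defined by expansion with respect to the vectors
  \<open>onv k\<close>, which differ from the given \<open>\<psi> k\<close> by the phases \<open>\<nu> k\<close>.\<close>

definition onv :: "'o set \<Rightarrow> 'h" where
  "onv k = the_elem (onb F Z k)"

lemma onb_singleton:
  assumes k: "k \<in> irr"
  shows "onb F Z k = {onv k}" "unit_vec (\<gamma> k) (onv k)"
proof -
  let ?P = "\<lambda>B. finite B \<and> cspan B = Sp F (\<gamma> k) \<and> (\<forall>x\<in>B. \<forall>y\<in>B. ip F x y = (if x = y then 1 else 0))"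
  note l = line_rep[OF k]
  obtain e where e: "unit_vec (\<gamma> k) e" using line_unit_vec[OF l] by blast
  have "cspan {e} = Sp F (\<gamma> k)"
  proof
    show "cspan {e} \<subseteq> Sp F (\<gamma> k)"
      using Sp_subspace[OF line_S[OF l]] unit_vec_in[OF e] by (intro complex_vector.span_minimal) auto
    show "Sp F (\<gamma> k) \<subseteq> cspan {e}"
      using line_expand[OF l e] by (auto simp: complex_vector.span_singleton)
  qed
  then have "?P {e}" using e by (simp add: unit_vec_def)
  then have B: "?P (onb F Z k)" unfolding onb_def by (rule someI)
  have unit: "unit_vec (\<gamma> k) x" if "x \<in> onb F Z k" for x
    using B that complex_vector.span_base unfolding unit_vec_def by auto
  have eq: "x = y" if x: "x \<in> onb F Z k" and y: "y \<in> onb F Z k" for x y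
  proof (rule ccontr)
    assume "x \<noteq> y"
    then have "ip F x y = 0" using B x y by simp
    then have "y = 0" using line_expand[OF l unit[OF x] unit_vec_in[OF unit[OF y]]] by simp
    then show False using unit_vec_nonzero[OF line_S[OF l] unit[OF y]] by simp
  qed
  have "onb F Z k \<noteq> {}"
  proof
    assume "onb F Z k = {}"
    then have "Sp F (\<gamma> k) = {0}" using B by simp
    then show False using unit_vec_in[OF e] unit_vec_nonzero[OF line_S[OF l] e] by simp
  qed
  then obtain x where "x \<in> onb F Z k" by blast
  then have x: "onb F Z k = {x}" using eq by blast
  then show 1: "onb F Z k = {onv k}" by (simp add: onv_def)
  then show "unit_vec (\<gamma> k) (onv k)" using unit by simp
qed

definition \<nu> :: "'o set \<Rightarrow> complex" where
  "\<nu> k = ip F (onv k) (\<psi> k)"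

lemma \<psi>_onv: "k \<in> K\<rho> \<Longrightarrow> \<psi> k = \<nu> k *\<^sub>C onv k"
  unfolding \<nu>_def
  by (rule line_expand[OF line_rep[OF K\<rho>_irr] onb_singleton(2)[OF K\<rho>_irr] \<psi>_in])

lemma \<nu>_norm:
  assumes k: "k \<in> K\<rho>"
  shows "cnj (\<nu> k) * \<nu> k = 1"
proof -
  note i = K\<rho>_irr[OF k]
  note l = line_rep[OF i] and u = onb_singleton(2)[OF i]
  obtain z where z: "norm z = 1" "\<psi> k = z *\<^sub>C onv k" using unit_vec_phase[OF l u \<psi>_unit[OF k]] by blast
  have "z = \<nu> k"
    using z(2) \<psi>_onv[OF k] unit_vec_nonzero[OF line_S[OF l] u] complex_vector.scale_right_imp_eq by metis
  then show ?thesis using z(1) by (metis complex_norm_square mult.commute of_real_1 power_one)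
qed

lemma lin_onv:
  assumes k: "k \<in> K\<rho>"
  shows "lin x \<rho> \<rho> k (onv k) = (x k * \<nu> k) *\<^sub>C T k"
  using k unit_vec_in[OF onb_singleton(2)[OF K\<rho>_irr[OF k]]] by (simp add: lin_apply \<nu>_def)

lemma terms_lin: "terms F Z (lin x) = (\<lambda>k. (\<rho>, \<rho>, k, onv k)) ` {k \<in> K\<rho>. x k \<noteq> 0}"
proof -
  have "lin x a b k \<noteq> 0 \<longleftrightarrow> a = \<rho> \<and> b = \<rho> \<and> k \<in> K\<rho> \<and> x k \<noteq> 0" for a b k
  proof
    assume "lin x a b k \<noteq> 0"
    then obtain y where "lin x a b k y \<noteq> 0" by (auto simp: fun_eq_iff)
    then show "a = \<rho> \<and> b = \<rho> \<and> k \<in> K\<rho> \<and> x k \<noteq> 0" by (auto simp: lin_apply split: if_splits)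
  next
    assume k: "a = \<rho> \<and> b = \<rho> \<and> k \<in> K\<rho> \<and> x k \<noteq> 0"
    then have "lin x a b k (onv k) \<noteq> 0"
      using lin_onv[of k x] T_nonzero[of k] \<nu>_norm[of k] by auto
    then show "lin x a b k \<noteq> 0" by auto
  qed
  then have "terms F Z (lin x) = {(a, b, k, e). a = \<rho> \<and> b = \<rho> \<and> k \<in> K\<rho> \<and> x k \<noteq> 0 \<and> e \<in> onb F Z k}"
    unfolding terms_def by auto
  also have "\<dots> = (\<lambda>k. (\<rho>, \<rho>, k, onv k)) ` {k \<in> K\<rho>. x k \<noteq> 0}"
    using onb_singleton(1)[OF K\<rho>_irr] by auto
  finally show ?thesis .
qed

text \<open>This evaluates the definitions of composition and action: a summand which is homogeneous in the
  coefficient need only be computed on the basis, and may be added where the coefficient is zero.\<close>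

lemma sum_terms:
  assumes "\<And>k. k \<in> K\<rho> \<Longrightarrow> h \<rho> \<rho> k (onv k) = x k *\<^sub>C (f k :: 'a::complex_vector)"
  shows "(\<Sum>(a, b, k, e)\<in>terms F Z (lin x). h a b k e) = (\<Sum>k\<in>K\<rho>. x k *\<^sub>C f k)"
proof -
  have "(\<Sum>(a, b, k, e)\<in>terms F Z (lin x). h a b k e) = (\<Sum>k\<in>{k \<in> K\<rho>. x k \<noteq> 0}. h \<rho> \<rho> k (onv k))"
    unfolding terms_lin by (subst sum.reindex) (auto simp: inj_on_def)
  also have "\<dots> = (\<Sum>k\<in>{k \<in> K\<rho>. x k \<noteq> 0}. x k *\<^sub>C f k)" using assms by (intro sum.cong refl) auto
  also have "\<dots> = (\<Sum>k\<in>K\<rho>. x k *\<^sub>C f k)" using K\<rho>_finite by (intro sum.mono_neutral_left) auto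
  finally show ?thesis .
qed

subsection \<open>Composition\<close>

text \<open>With the only element \<open>bv k l\<close> of the relevant basis, the composition of two elementary tensors is
  the elementary tensor of \<open>arrow_part\<close> and \<open>vector_part\<close>.\<close>

definition bv :: "'o set \<Rightarrow> 'o set \<Rightarrow> 'm" where
  "bv k l = the_elem (bas Z k l (k \<star> l))"

definition arrow_part :: "'o set \<Rightarrow> 'm \<Rightarrow> 'o set \<Rightarrow> 'm \<Rightarrow> 'm" where
  "arrow_part k X l Y = X \<cdot> (idt C (\<gamma> k) \<boxtimes> Y) \<cdot> (bv k l \<boxtimes> idt C \<rho>)"

definition vector_part :: "'o set \<Rightarrow> 'h \<Rightarrow> 'o set \<Rightarrow> 'h \<Rightarrow> 'h" where
  "vector_part k \<phi> l \<phi>' = fmap F (str C (bv k l)) (vtens F \<phi> \<phi>')"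

lemma bv:
  assumes "k \<in> irr" "l \<in> irr"
  shows "bas Z k l (k \<star> l) = {bv k l}" "is_unitary C (\<gamma> (k \<star> l)) (\<gamma> k \<odot> \<gamma> l) (bv k l)"
proof -
  obtain v where v: "bas Z k l (k \<star> l) = {v}" "is_unitary C (\<gamma> (k \<star> l)) (\<gamma> k \<odot> \<gamma> l) v"
    using bas_product(2)[OF assms] by blast
  have "bv k l = v" by (simp add: bv_def v(1))
  then show "bas Z k l (k \<star> l) = {bv k l}" "is_unitary C (\<gamma> (k \<star> l)) (\<gamma> k \<odot> \<gamma> l) (bv k l)"
    using v by simp_all
qed

lemma \<gamma>\<gamma>_ob: "k \<in> irr \<Longrightarrow> l \<in> irr \<Longrightarrow> \<gamma> k \<odot> \<gamma> l \<in> ob C"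
  using \<gamma>_ob tob_in by blast

lemma bv_in:
  assumes "k \<in> irr" "l \<in> irr"
  shows "bv k l \<in> Hom C (\<gamma> (k \<star> l)) (\<gamma> k \<odot> \<gamma> l)" "str C (bv k l) \<in> Hom C (\<gamma> k \<odot> \<gamma> l) (\<gamma> (k \<star> l))"
  using unitary_inv[OF \<gamma>_ob[OF irr_mult[OF assms]] \<gamma>\<gamma>_ob[OF assms] bv(2)[OF assms]] by blast+

lemma cmp_elem_eq:
  assumes "k \<in> irr" "l \<in> irr"
  shows "cmp_elem C S F Z \<rho> \<rho> k X \<phi> l Y \<phi>' = el (k \<star> l) (arrow_part k X l Y) (vector_part k \<phi> l \<phi>')"
  using bas_product(1)[OF assms] bv(1)[OF assms]
  by (simp add: cmp_elem_def arrow_part_def vector_part_def)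

lemma idt_tar_in:
  assumes k: "k \<in> irr" and l: "l \<in> irr" and Y: "Y \<in> Hom C (\<gamma> l \<odot> \<rho>) \<rho>"
  shows "idt C (\<gamma> k) \<boxtimes> Y \<in> Hom C ((\<gamma> k \<odot> \<gamma> l) \<odot> \<rho>) (\<gamma> k \<odot> \<rho>)"
  using tar_in[OF \<gamma>_ob[OF k] \<gamma>_ob[OF k] \<gamma>\<rho>_ob[OF l] \<rho>_ob idt_in[OF \<gamma>_ob[OF k]] Y]
    tob_assoc[OF \<gamma>_ob[OF k] \<gamma>_ob[OF l] \<rho>_ob] by simp

lemma bv_tar_in:
  assumes k: "k \<in> irr" and l: "l \<in> irr"
  shows "bv k l \<boxtimes> idt C \<rho> \<in> Hom C (\<gamma> (k \<star> l) \<odot> \<rho>) ((\<gamma> k \<odot> \<gamma> l) \<odot> \<rho>)"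
  using tar_in[OF \<gamma>_ob[OF irr_mult[OF k l]] \<gamma>\<gamma>_ob[OF k l] \<rho>_ob \<rho>_ob bv_in(1)[OF k l] idt_in[OF \<rho>_ob]] .

lemma arrow_part_scale:
  assumes k: "k \<in> irr" and l: "l \<in> irr" and X: "X \<in> Hom C (\<gamma> k \<odot> \<rho>) \<rho>" and Y: "Y \<in> Hom C (\<gamma> l \<odot> \<rho>) \<rho>"
  shows "arrow_part k (x *\<^sub>C X) l (y *\<^sub>C Y) = (x * y) *\<^sub>C arrow_part k X l Y"
proof -
  note ob = \<gamma>\<rho>_ob[OF irr_mult[OF k l]] tob_in[OF \<gamma>\<gamma>_ob[OF k l] \<rho>_ob] \<gamma>\<rho>_ob[OF k]
  note Y' = idt_tar_in[OF k l Y]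
  have 1: "idt C (\<gamma> k) \<boxtimes> (y *\<^sub>C Y) = y *\<^sub>C (idt C (\<gamma> k) \<boxtimes> Y)"
    using tar_scale[OF \<gamma>_ob[OF k] \<gamma>_ob[OF k] \<gamma>\<rho>_ob[OF l] \<rho>_ob idt_in[OF \<gamma>_ob[OF k]] Y] .
  have "(x *\<^sub>C X) \<cdot> (y *\<^sub>C (idt C (\<gamma> k) \<boxtimes> Y)) = (x * y) *\<^sub>C (X \<cdot> (idt C (\<gamma> k) \<boxtimes> Y))"
    using scale_cmp[OF ob(2,3) \<rho>_ob X scale_in[OF ob(2,3) Y'], of x y]
      cmp_scale[OF ob(2,3) \<rho>_ob X Y', of y] by (simp add: scaleC_scaleC)
  then show ?thesis
    unfolding arrow_part_def 1
    using scale_cmp[OF ob(1,2) \<rho>_ob cmp_in[OF ob(2,3) \<rho>_ob X Y'] bv_tar_in[OF k l]] by simp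
qed

lemma vector_part_scale:
  assumes k: "k \<in> irr" and l: "l \<in> irr" and \<phi>: "\<phi> \<in> Sp F (\<gamma> k)" "\<phi>' \<in> Sp F (\<gamma> l)"
  shows "vector_part k (x *\<^sub>C \<phi>) l (y *\<^sub>C \<phi>') = (x * y) *\<^sub>C vector_part k \<phi> l \<phi>'"
proof -
  note S = rep_irr(1)[OF k] rep_irr(1)[OF l] rep_irr(1)[OF irr_mult[OF k l]]
  have "vtens F (x *\<^sub>C \<phi>) (y *\<^sub>C \<phi>') = (x * y) *\<^sub>C vtens F \<phi> \<phi>'"
    using vtens_scale_left[OF S(1,2) \<phi>(1) Sp_scale[OF S(2) \<phi>(2)]] vtens_scale_right[OF S(1,2) \<phi>]
    by (simp add: scaleC_scaleC)
  then show ?thesis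
    unfolding vector_part_def
    using fmap_scale[OF sub_tob[OF S(1,2)] S(3) bv_in(2)[OF k l] vtens_in[OF S(1,2) \<phi>]] by simp
qed

lemma vector_part_unit:
  assumes k: "k \<in> irr" and l: "l \<in> irr" and \<phi>: "unit_vec (\<gamma> k) \<phi>" "unit_vec (\<gamma> l) \<phi>'"
  shows "unit_vec (\<gamma> (k \<star> l)) (vector_part k \<phi> l \<phi>')"
proof -
  let ?v = "bv k l" and ?x = "vtens F \<phi> \<phi>'"
  note S = rep_irr(1)[OF k] rep_irr(1)[OF l] rep_irr(1)[OF irr_mult[OF k l]]
  note klS = sub_tob[OF S(1,2)]
  note v = unitary_inv[OF \<gamma>_ob[OF irr_mult[OF k l]] \<gamma>\<gamma>_ob[OF k l] bv(2)[OF k l]]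
  have x: "unit_vec (\<gamma> k \<odot> \<gamma> l) ?x" using line_tob(2)[OF line_rep[OF k] line_rep[OF l] \<phi>] .
  note xin = unit_vec_in[OF x]
  have yin: "fmap F (str C ?v) ?x \<in> Sp F (\<gamma> (k \<star> l))" using fmap_in[OF klS S(3) v(2) xin] .
  have "ip F (fmap F (str C ?v) ?x) (fmap F (str C ?v) ?x) = ip F ?x (fmap F ?v (fmap F (str C ?v) ?x))"
    using fmap_str[OF S(3) klS v(1) yin xin] .
  also have "fmap F ?v (fmap F (str C ?v) ?x) = ?x"
    using fmap_cmp[OF klS S(3) klS v(1,2) xin] v(4) fmap_idt[OF klS xin] by simp
  finally show ?thesis using x yin by (simp add: unit_vec_def vector_part_def)
qed

lemma vector_part_in:
  assumes k: "k \<in> irr" and l: "l \<in> irr" and \<phi>: "\<phi> \<in> Sp F (\<gamma> k)" "\<phi>' \<in> Sp F (\<gamma> l)"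
  shows "vector_part k \<phi> l \<phi>' \<in> Sp F (\<gamma> (k \<star> l))"
  unfolding vector_part_def
  using fmap_in[OF sub_tob[OF rep_irr(1)[OF k] rep_irr(1)[OF l]] rep_irr(1)[OF irr_mult[OF k l]]
      bv_in(2)[OF k l] vtens_in[OF rep_irr(1)[OF k] rep_irr(1)[OF l] \<phi>]] .

lemma cmp_elem_scale:
  assumes k: "k \<in> irr" and l: "l \<in> irr" and X: "X \<in> Hom C (\<gamma> k \<odot> \<rho>) \<rho>" and Y: "Y \<in> Hom C (\<gamma> l \<odot> \<rho>) \<rho>"
    and \<phi>: "\<phi> \<in> Sp F (\<gamma> k)" "\<phi>' \<in> Sp F (\<gamma> l)"
  shows "cmp_elem C S F Z \<rho> \<rho> k (x *\<^sub>C X) (x' *\<^sub>C \<phi>) l (y *\<^sub>C Y) (y' *\<^sub>C \<phi>')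
    = (x * x' * y * y') *\<^sub>C cmp_elem C S F Z \<rho> \<rho> k X \<phi> l Y \<phi>'"
  unfolding cmp_elem_eq[OF k l] arrow_part_scale[OF k l X Y] vector_part_scale[OF k l \<phi>]
  by (simp add: elem_scale_arrow elem_scale_vec[OF irr_mult[OF k l] vector_part_in[OF k l \<phi>]]
      scaleC_scaleC mult_ac)

text \<open>The two factors of the composition of \<open>U k\<close> and \<open>U l\<close> are unitary and of norm one, so they are
  the factors of \<open>U (k \<star> l)\<close> up to phases, and the cocycle is the product of the phases.\<close>

definition p :: "'o set \<Rightarrow> 'o set \<Rightarrow> complex" where
  "p k l = (SOME z. cnj z * z = 1 \<and> arrow_part k (T k) l (T l) = z *\<^sub>C T (k \<star> l))"

definition q :: "'o set \<Rightarrow> 'o set \<Rightarrow> complex" where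
  "q k l = (SOME z. cnj z * z = 1 \<and> vector_part k (\<psi> k) l (\<psi> l) = z *\<^sub>C \<psi> (k \<star> l))"

lemma p:
  assumes k: "k \<in> K\<rho>" and l: "l \<in> K\<rho>"
  shows "cnj (p k l) * p k l = 1" "arrow_part k (T k) l (T l) = p k l *\<^sub>C T (k \<star> l)"
proof -
  note i = K\<rho>_irr[OF k] K\<rho>_irr[OF l]
  note ob = \<gamma>_ob[OF i(1)] \<gamma>_ob[OF i(2)] \<rho>_ob \<gamma>_ob[OF irr_mult[OF i]] \<gamma>\<gamma>_ob[OF i]
    \<gamma>\<rho>_ob[OF i(1)] \<gamma>\<rho>_ob[OF i(2)]
  have "is_unitary C ((\<gamma> k \<odot> \<gamma> l) \<odot> \<rho>) (\<gamma> k \<odot> \<rho>) (idt C (\<gamma> k) \<boxtimes> T l)"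
    using unitary_tar[OF ob(1,1,7,3) unitary_idt[OF ob(1)] T_unitary[OF l]] tob_assoc[OF ob(1,2,3)] by simp
  then have "is_unitary C ((\<gamma> k \<odot> \<gamma> l) \<odot> \<rho>) \<rho> (T k \<cdot> (idt C (\<gamma> k) \<boxtimes> T l))"
    using unitary_cmp[OF tob_in[OF ob(5,3)] ob(6,3) _ T_unitary[OF k]] by blast
  moreover have "is_unitary C (\<gamma> (k \<star> l) \<odot> \<rho>) ((\<gamma> k \<odot> \<gamma> l) \<odot> \<rho>) (bv k l \<boxtimes> idt C \<rho>)"
    using unitary_tar[OF ob(4,5,3,3) bv(2)[OF i] unitary_idt[OF ob(3)]] .
  ultimately have "is_unitary C (\<gamma> (k \<star> l) \<odot> \<rho>) \<rho> (arrow_part k (T k) l (T l))"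
    unfolding arrow_part_def using unitary_cmp[OF tob_in[OF ob(4,3)] tob_in[OF ob(5,3)] ob(3)] by blast
  then have "\<exists>z. cnj z * z = 1 \<and> arrow_part k (T k) l (T l) = z *\<^sub>C T (k \<star> l)"
    by (rule unitary_phase[OF tob_in[OF ob(4,3)] ob(3) \<rho>_irred T_unitary[OF K\<rho>_mult[OF k l]]])
  then have "cnj (p k l) * p k l = 1 \<and> arrow_part k (T k) l (T l) = p k l *\<^sub>C T (k \<star> l)"
    unfolding p_def by (rule someI_ex)
  then show "cnj (p k l) * p k l = 1" "arrow_part k (T k) l (T l) = p k l *\<^sub>C T (k \<star> l)" by blast+
qed

lemma q:
  assumes k: "k \<in> K\<rho>" and l: "l \<in> K\<rho>"
  shows "cnj (q k l) * q k l = 1" "vector_part k (\<psi> k) l (\<psi> l) = q k l *\<^sub>C \<psi> (k \<star> l)"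
proof -
  note i = K\<rho>_irr[OF k] K\<rho>_irr[OF l]
  have "\<exists>z. norm z = 1 \<and> vector_part k (\<psi> k) l (\<psi> l) = z *\<^sub>C \<psi> (k \<star> l)"
    by (rule unit_vec_phase[OF line_rep[OF irr_mult[OF i]] \<psi>_unit[OF K\<rho>_mult[OF k l]]
        vector_part_unit[OF i \<psi>_unit[OF k] \<psi>_unit[OF l]]])
  then have "\<exists>z. cnj z * z = 1 \<and> vector_part k (\<psi> k) l (\<psi> l) = z *\<^sub>C \<psi> (k \<star> l)"
    by (simp only: norm_1_cnj)
  then have "cnj (q k l) * q k l = 1 \<and> vector_part k (\<psi> k) l (\<psi> l) = q k l *\<^sub>C \<psi> (k \<star> l)"
    unfolding q_def by (rule someI_ex)
  then show "cnj (q k l) * q k l = 1" "vector_part k (\<psi> k) l (\<psi> l) = q k l *\<^sub>C \<psi> (k \<star> l)" by blast+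
qed

definition c :: "'o set \<Rightarrow> 'o set \<Rightarrow> complex" where
  "c k l = p k l * q k l"

lemma norm_c: "k \<in> K\<rho> \<Longrightarrow> l \<in> K\<rho> \<Longrightarrow> norm (c k l) = 1"
  using p(1)[of k l] q(1)[of k l] by (simp only: c_def norm_mult flip: norm_1_cnj)

lemma cmp_elem_U:
  assumes k: "k \<in> K\<rho>" and l: "l \<in> K\<rho>"
  shows "cmp_elem C S F Z \<rho> \<rho> k (T k) (\<psi> k) l (T l) (\<psi> l) = c k l *\<^sub>C U (k \<star> l)"
proof -
  note i = K\<rho>_irr[OF k] K\<rho>_irr[OF l] and kl = K\<rho>_mult[OF k l]
  show ?thesis
    unfolding cmp_elem_eq[OF i] p(2)[OF k l] q(2)[OF k l]
    by (simp add: elem_scale_arrow elem_scale_vec[OF K\<rho>_irr[OF kl] \<psi>_in[OF kl]] scaleC_scaleC U_def c_def)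
qed

lemma cmp_lin:
  "cp_cmp C S F Z (lin x) (lin y) = (\<Sum>k\<in>K\<rho>. \<Sum>l\<in>K\<rho>. (x k * y l * c k l) *\<^sub>C U (k \<star> l))"
proof -
  have in': "onv k \<in> Sp F (\<gamma> k)" if "k \<in> K\<rho>" for k
    using unit_vec_in[OF onb_singleton(2)[OF K\<rho>_irr[OF that]]] .
  have elem: "cmp_elem C S F Z \<rho> \<rho> k (lin x \<rho> \<rho> k (onv k)) (onv k) l (lin y \<rho> \<rho> l (onv l)) (onv l)
      = y l *\<^sub>C ((x k * c k l) *\<^sub>C U (k \<star> l))" if k: "k \<in> K\<rho>" and l: "l \<in> K\<rho>" for k l
  proof -
    note i = K\<rho>_irr[OF k] K\<rho>_irr[OF l]
    let ?m = "cmp_elem C S F Z \<rho> \<rho> k (T k) (onv k) l (T l) (onv l)"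
    have "cmp_elem C S F Z \<rho> \<rho> k (1 *\<^sub>C T k) (\<nu> k *\<^sub>C onv k) l (1 *\<^sub>C T l) (\<nu> l *\<^sub>C onv l)
        = (1 * \<nu> k * 1 * \<nu> l) *\<^sub>C ?m"
      by (rule cmp_elem_scale[OF i T_in[OF k] T_in[OF l] in'[OF k] in'[OF l]])
    then have 1: "c k l *\<^sub>C U (k \<star> l) = (\<nu> k * \<nu> l) *\<^sub>C ?m"
      using \<psi>_onv[OF k] \<psi>_onv[OF l] cmp_elem_U[OF k l] by simp
    have "cmp_elem C S F Z \<rho> \<rho> k (lin x \<rho> \<rho> k (onv k)) (1 *\<^sub>C onv k) l (lin y \<rho> \<rho> l (onv l)) (1 *\<^sub>C onv l)
        = (x k * \<nu> k * 1 * (y l * \<nu> l) * 1) *\<^sub>C ?m"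
      unfolding lin_onv[OF k] lin_onv[OF l]
      by (rule cmp_elem_scale[OF i T_in[OF k] T_in[OF l] in'[OF k] in'[OF l]])
    also have "\<dots> = (x k * y l) *\<^sub>C (\<nu> k * \<nu> l) *\<^sub>C ?m" by (simp add: scaleC_scaleC mult_ac)
    also have "\<dots> = (x k * y l) *\<^sub>C c k l *\<^sub>C U (k \<star> l)" unfolding 1 ..
    finally show ?thesis by (simp add: scaleC_scaleC mult_ac)
  qed
  have inner: "(\<Sum>(a, b, l, e')\<in>terms F Z (lin y). if b = \<rho> then
        cmp_elem C S F Z a \<rho> k (lin x \<rho> \<rho> k (onv k)) (onv k) l (lin y a b l e') e' else 0)
      = x k *\<^sub>C (\<Sum>l\<in>K\<rho>. (y l * c k l) *\<^sub>C U (k \<star> l))" if k: "k \<in> K\<rho>" for k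
  proof -
    have "(\<Sum>(a, b, l, e')\<in>terms F Z (lin y). if b = \<rho> then
        cmp_elem C S F Z a \<rho> k (lin x \<rho> \<rho> k (onv k)) (onv k) l (lin y a b l e') e' else 0)
      = (\<Sum>l\<in>K\<rho>. y l *\<^sub>C ((x k * c k l) *\<^sub>C U (k \<star> l)))"
      using elem[OF k] by (intro sum_terms) simp
    then show ?thesis
      by (simp add: scaleC_scaleC complex_vector.scale_sum_right mult_ac)
  qed
  have "cp_cmp C S F Z (lin x) (lin y) = (\<Sum>k\<in>K\<rho>. x k *\<^sub>C (\<Sum>l\<in>K\<rho>. (y l * c k l) *\<^sub>C U (k \<star> l)))"
    unfolding cp_cmp_def using inner by (intro sum_terms)
  then show ?thesis by (simp add: complex_vector.scale_sum_right scaleC_scaleC mult.assoc)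
qed

lemma cmp_el:
  assumes k: "k \<in> K\<rho>" and l: "l \<in> K\<rho>" and X: "X \<in> Hom C (\<gamma> k \<odot> \<rho>) \<rho>" and Y: "Y \<in> Hom C (\<gamma> l \<odot> \<rho>) \<rho>"
    and \<phi>: "\<phi> \<in> Sp F (\<gamma> k)" "\<phi>' \<in> Sp F (\<gamma> l)"
  shows "cp_cmp C S F Z (z *\<^sub>C el k X \<phi>) (el l Y \<phi>') = z *\<^sub>C el (k \<star> l) (arrow_part k X l Y) (vector_part k \<phi> l \<phi>')"
proof -
  note i = K\<rho>_irr[OF k] K\<rho>_irr[OF l]
  obtain x x' where x: "X = x *\<^sub>C T k" "\<phi> = x' *\<^sub>C \<psi> k" "el k X \<phi> = (x * x') *\<^sub>C U k"
    using el_expand[OF k X \<phi>(1)] .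
  obtain y y' where y: "Y = y *\<^sub>C T l" "\<phi>' = y' *\<^sub>C \<psi> l" "el l Y \<phi>' = (y * y') *\<^sub>C U l"
    using el_expand[OF l Y \<phi>(2)] .
  have e: "z *\<^sub>C el k X \<phi> = lin (\<lambda>m. if m = k then z * (x * x') else 0)"
    "el l Y \<phi>' = lin (\<lambda>m. if m = l then y * y' else 0)"
    using lin_single[OF k] lin_single[OF l] x(3) y(3) by (simp_all add: scaleC_scaleC)
  have "cp_cmp C S F Z (z *\<^sub>C el k X \<phi>) (el l Y \<phi>')
      = (\<Sum>k'\<in>K\<rho>. \<Sum>l'\<in>K\<rho>. if l' = l then if k' = k then (z * (x * x') * (y * y') * c k l) *\<^sub>C U (k \<star> l) else 0 else 0)"
    unfolding e cmp_lin by (intro sum.cong refl) auto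
  also have "\<dots> = (z * (x * x') * (y * y') * c k l) *\<^sub>C U (k \<star> l)" using K\<rho>_finite k l by simp
  also have "\<dots> = (z * (x * x' * y * y')) *\<^sub>C cmp_elem C S F Z \<rho> \<rho> k (T k) (\<psi> k) l (T l) (\<psi> l)"
    unfolding cmp_elem_U[OF k l] by (simp add: scaleC_scaleC mult_ac)
  also have "\<dots> = z *\<^sub>C cmp_elem C S F Z \<rho> \<rho> k X \<phi> l Y \<phi>'"
    unfolding x(1,2) y(1,2) cmp_elem_scale[OF i T_in[OF k] T_in[OF l] \<psi>_in[OF k] \<psi>_in[OF l]]
    by (simp add: scaleC_scaleC)
  finally show ?thesis unfolding cmp_elem_eq[OF i] .
qed

subsection \<open>The cocycle identity\<close>

text \<open>Both ways of multiplying three elementary tensors lead to \<open>\<Theta> (w \<times> id)\<close> in the first factor and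
  to \<open>F(w)\<^sup>*\<close> of the product vector in the second factor, with two unitaries \<open>w\<close> from
  \<open>\<gamma> (k \<star> l \<star> m)\<close> to the triple product. These differ by a phase, and the phase cancels in the
  tensor product.\<close>

lemma cocycle_identity:
  assumes k: "k \<in> K\<rho>" and l: "l \<in> K\<rho>" and m: "m \<in> K\<rho>"
  shows "c k l * c (k \<star> l) m = c l m * c k (l \<star> m)"
proof -
  note i = K\<rho>_irr[OF k] K\<rho>_irr[OF l] K\<rho>_irr[OF m]
  note kl = K\<rho>_mult[OF k l] and lm = K\<rho>_mult[OF l m]
  note ikl = K\<rho>_irr[OF kl] and ilm = K\<rho>_irr[OF lm]
  have assoc: "k \<star> l \<star> m = k \<star> (l \<star> m)" using K.m_assoc[of k l m] i by simp
  define n where "n = k \<star> l \<star> m"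
  have n': "k \<star> (l \<star> m) = n" using assoc n_def by simp
  have nK: "n \<in> K\<rho>" unfolding n_def using K\<rho>_mult[OF kl m] .
  note inn = K\<rho>_irr[OF nK]
  note gk = \<gamma>_ob[OF i(1)] and gl = \<gamma>_ob[OF i(2)] and gm = \<gamma>_ob[OF i(3)] and gn = \<gamma>_ob[OF inn]
  note gkl = \<gamma>_ob[OF ikl] and glm = \<gamma>_ob[OF ilm]
  note r = \<rho>_ob
  let ?kl = "\<gamma> k \<odot> \<gamma> l" and ?lm = "\<gamma> l \<odot> \<gamma> m" and ?klm = "(\<gamma> k \<odot> \<gamma> l) \<odot> \<gamma> m"
  note okl = tob_in[OF gk gl] and olm = tob_in[OF gl gm]
  note oklm = tob_in[OF okl gm]
  have as1: "\<gamma> k \<odot> ?lm = ?klm" using tob_assoc[OF gk gl gm] by simp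
  note ik = idt_in[OF gk] and il = idt_in[OF gl] and im = idt_in[OF gm] and ir = idt_in[OF r]
  note ikl' = idt_in[OF okl]
  let ?v1 = "bv k l" and ?v2 = "bv (k \<star> l) m" and ?v3 = "bv l m" and ?v4 = "bv k (l \<star> m)"
  have v1: "?v1 \<in> Hom C (\<gamma> (k \<star> l)) ?kl" and v2: "?v2 \<in> Hom C (\<gamma> n) (\<gamma> (k \<star> l) \<odot> \<gamma> m)"
    and v3: "?v3 \<in> Hom C (\<gamma> (l \<star> m)) ?lm" and v4: "?v4 \<in> Hom C (\<gamma> n) (\<gamma> k \<odot> \<gamma> (l \<star> m))"
    using bv_in(1)[OF i(1,2)] bv_in(1)[OF ikl i(3)] bv_in(1)[OF i(2,3)] bv_in(1)[OF i(1) ilm]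
    by (simp_all add: n_def assoc)
  note oklm' = tob_in[OF gkl gm] and oklm'' = tob_in[OF gk glm]
  let ?w1 = "(?v1 \<boxtimes> idt C (\<gamma> m)) \<cdot> ?v2" and ?w2 = "(idt C (\<gamma> k) \<boxtimes> ?v3) \<cdot> ?v4"
  have v1m: "?v1 \<boxtimes> idt C (\<gamma> m) \<in> Hom C (\<gamma> (k \<star> l) \<odot> \<gamma> m) ?klm"
    using tar_in[OF gkl okl gm gm v1 im] .
  have kv3: "idt C (\<gamma> k) \<boxtimes> ?v3 \<in> Hom C (\<gamma> k \<odot> \<gamma> (l \<star> m)) ?klm"
    using tar_in[OF gk gk glm olm ik v3] as1 by simp
  have u1: "is_unitary C (\<gamma> n) ?klm ?w1"
    using unitary_cmp[OF gn oklm' oklm bv(2)[OF ikl i(3), folded n_def]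
      unitary_tar[OF gkl okl gm gm bv(2)[OF i(1,2)] unitary_idt[OF gm]]] .
  have "is_unitary C (\<gamma> k \<odot> \<gamma> (l \<star> m)) ?klm (idt C (\<gamma> k) \<boxtimes> ?v3)"
    using unitary_tar[OF gk gk glm olm unitary_idt[OF gk] bv(2)[OF i(2,3)]] as1 by simp
  then have u2: "is_unitary C (\<gamma> n) ?klm ?w2"
    using unitary_cmp[OF gn oklm'' oklm] bv(2)[OF i(1) ilm] n' by simp
  have lklm: "line ?klm" using tob_line[OF tob_line[OF line_rep[OF i(1)] line_rep[OF i(2)]] line_rep[OF i(3)]] .
  obtain z where z: "cnj z * z = 1" "?w2 = z *\<^sub>C ?w1"
    using unitary_phase[OF gn oklm line_irred[OF lklm] u1 u2] by blast
  note W1 = unitary_inv(1)[OF gn oklm u1]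

  \<comment> \<open>the arrows\<close>
  let ?\<Theta> = "(T k \<cdot> (idt C (\<gamma> k) \<boxtimes> T l)) \<cdot> (idt C ?kl \<boxtimes> T m)"
  note Tk = T_in[OF k] and Tl = T_in[OF l] and Tm = T_in[OF m] and Tkl = T_in[OF kl] and Tlm = T_in[OF lm]
  note okr = tob_in[OF gk r] and olr = tob_in[OF gl r] and omr = tob_in[OF gm r]
  note oklr = tob_in[OF okl r] and oklmr = tob_in[OF oklm r]
  have kTl: "idt C (\<gamma> k) \<boxtimes> T l \<in> Hom C (?kl \<odot> \<rho>) (\<gamma> k \<odot> \<rho>)" using idt_tar_in[OF i(1,2) Tl] .
  have as2: "?kl \<odot> (\<gamma> m \<odot> \<rho>) = ?klm \<odot> \<rho>" using tob_assoc[OF okl gm r] by simp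
  have klTm: "idt C ?kl \<boxtimes> T m \<in> Hom C (?klm \<odot> \<rho>) (?kl \<odot> \<rho>)"
    using tar_in[OF okl okl omr r ikl' Tm] as2 by simp
  note TT = cmp_in[OF oklr okr r Tk kTl]
  note \<Theta> = cmp_in[OF oklmr oklr r TT klTm]
  have w1r: "?w1 \<boxtimes> idt C \<rho> \<in> Hom C (\<gamma> n \<odot> \<rho>) (?klm \<odot> \<rho>)" using tar_in[OF gn oklm r r W1 ir] .
  have as3: "\<gamma> (k \<star> l) \<odot> (\<gamma> m \<odot> \<rho>) = (\<gamma> (k \<star> l) \<odot> \<gamma> m) \<odot> \<rho>" using tob_assoc[OF gkl gm r] by simp
  note oklr' = tob_in[OF gkl r] and oklmr' = tob_in[OF oklm' r] and onr = tob_in[OF gn r]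
  have v1r: "?v1 \<boxtimes> idt C \<rho> \<in> Hom C (\<gamma> (k \<star> l) \<odot> \<rho>) (?kl \<odot> \<rho>)" using bv_tar_in[OF i(1,2)] .
  have klTm': "idt C (\<gamma> (k \<star> l)) \<boxtimes> T m \<in> Hom C ((\<gamma> (k \<star> l) \<odot> \<gamma> m) \<odot> \<rho>) (\<gamma> (k \<star> l) \<odot> \<rho>)"
    using idt_tar_in[OF ikl i(3) Tm] .
  have v2r: "?v2 \<boxtimes> idt C \<rho> \<in> Hom C (\<gamma> n \<odot> \<rho>) ((\<gamma> (k \<star> l) \<odot> \<gamma> m) \<odot> \<rho>)"
    using bv_tar_in[OF ikl i(3)] by (simp add: n_def)
  have v1mr: "?v1 \<boxtimes> idt C (\<gamma> m \<odot> \<rho>) = (?v1 \<boxtimes> idt C (\<gamma> m)) \<boxtimes> idt C \<rho>"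
    using tar_assoc[OF gkl okl gm gm r r v1 im ir] tar_idt[OF gm r] by simp
  have v1mr_in: "(?v1 \<boxtimes> idt C (\<gamma> m)) \<boxtimes> idt C \<rho> \<in> Hom C ((\<gamma> (k \<star> l) \<odot> \<gamma> m) \<odot> \<rho>) (?klm \<odot> \<rho>)"
    using tar_in[OF oklm' oklm r r v1m ir] .
  have "(p k l * p (k \<star> l) m) *\<^sub>C T n = p k l *\<^sub>C arrow_part (k \<star> l) (T (k \<star> l)) m (T m)"
    unfolding p(2)[OF kl m] by (simp add: scaleC_scaleC n_def)
  also have "\<dots> = arrow_part (k \<star> l) (p k l *\<^sub>C T (k \<star> l)) m (1 *\<^sub>C T m)"
    unfolding arrow_part_scale[OF ikl i(3) Tkl Tm] by simp
  also have "\<dots> = ((T k \<cdot> (idt C (\<gamma> k) \<boxtimes> T l)) \<cdot> (?v1 \<boxtimes> idt C \<rho>))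
      \<cdot> (idt C (\<gamma> (k \<star> l)) \<boxtimes> T m) \<cdot> (?v2 \<boxtimes> idt C \<rho>)"
    unfolding p(2)[OF k l, symmetric] by (simp add: arrow_part_def)
  also have "((T k \<cdot> (idt C (\<gamma> k) \<boxtimes> T l)) \<cdot> (?v1 \<boxtimes> idt C \<rho>)) \<cdot> (idt C (\<gamma> (k \<star> l)) \<boxtimes> T m)
      = (T k \<cdot> (idt C (\<gamma> k) \<boxtimes> T l)) \<cdot> ((?v1 \<boxtimes> idt C \<rho>) \<cdot> (idt C (\<gamma> (k \<star> l)) \<boxtimes> T m))"
    using cmp_assoc[OF oklmr' oklr' oklr r TT v1r klTm'] by simp
  also have "(?v1 \<boxtimes> idt C \<rho>) \<cdot> (idt C (\<gamma> (k \<star> l)) \<boxtimes> T m) = (idt C ?kl \<boxtimes> T m) \<cdot> ((?v1 \<boxtimes> idt C (\<gamma> m)) \<boxtimes> idt C \<rho>)"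
    using tar_interchange[OF gkl okl omr r v1 Tm] v1mr by simp
  also have "(T k \<cdot> (idt C (\<gamma> k) \<boxtimes> T l)) \<cdot> \<dots> = ?\<Theta> \<cdot> ((?v1 \<boxtimes> idt C (\<gamma> m)) \<boxtimes> idt C \<rho>)"
    using cmp_assoc[OF oklmr' oklmr oklr r TT klTm v1mr_in] .
  also have "?\<Theta> \<cdot> ((?v1 \<boxtimes> idt C (\<gamma> m)) \<boxtimes> idt C \<rho>) \<cdot> (?v2 \<boxtimes> idt C \<rho>)
      = ?\<Theta> \<cdot> (((?v1 \<boxtimes> idt C (\<gamma> m)) \<boxtimes> idt C \<rho>) \<cdot> (?v2 \<boxtimes> idt C \<rho>))"
    using cmp_assoc[OF onr oklmr' oklmr r \<Theta> v1mr_in v2r] by simp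
  also have "((?v1 \<boxtimes> idt C (\<gamma> m)) \<boxtimes> idt C \<rho>) \<cdot> (?v2 \<boxtimes> idt C \<rho>) = ?w1 \<boxtimes> idt C \<rho>"
    using cmp_tar_idt[OF gn oklm' oklm r v2 v1m] by simp
  finally have arrow1: "(p k l * p (k \<star> l) m) *\<^sub>C T n = ?\<Theta> \<cdot> (?w1 \<boxtimes> idt C \<rho>)" .

  note olmr = tob_in[OF olm r] and olmr' = tob_in[OF glm r] and oklmr'' = tob_in[OF oklm'' r]
  have lTm: "idt C (\<gamma> l) \<boxtimes> T m \<in> Hom C (?lm \<odot> \<rho>) (\<gamma> l \<odot> \<rho>)" using idt_tar_in[OF i(2,3) Tm] .
  have v3r: "?v3 \<boxtimes> idt C \<rho> \<in> Hom C (\<gamma> (l \<star> m) \<odot> \<rho>) (?lm \<odot> \<rho>)" using bv_tar_in[OF i(2,3)] .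
  have v4r: "?v4 \<boxtimes> idt C \<rho> \<in> Hom C (\<gamma> n \<odot> \<rho>) ((\<gamma> k \<odot> \<gamma> (l \<star> m)) \<odot> \<rho>)"
    using bv_tar_in[OF i(1) ilm] n' by simp
  have as4: "\<gamma> k \<odot> (?lm \<odot> \<rho>) = ?klm \<odot> \<rho>" using tob_assoc[OF gk olm r] as1 by simp
  have as5: "\<gamma> k \<odot> (\<gamma> (l \<star> m) \<odot> \<rho>) = (\<gamma> k \<odot> \<gamma> (l \<star> m)) \<odot> \<rho>" using tob_assoc[OF gk glm r] by simp
  have kv3r: "idt C (\<gamma> k) \<boxtimes> (?v3 \<boxtimes> idt C \<rho>) = (idt C (\<gamma> k) \<boxtimes> ?v3) \<boxtimes> idt C \<rho>"
    using tar_assoc[OF gk gk glm olm r r ik v3 ir] by simp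
  have kv3r_in: "(idt C (\<gamma> k) \<boxtimes> ?v3) \<boxtimes> idt C \<rho> \<in> Hom C ((\<gamma> k \<odot> \<gamma> (l \<star> m)) \<odot> \<rho>) (?klm \<odot> \<rho>)"
    using tar_in[OF oklm'' oklm r r kv3 ir] .
  have klTm2: "idt C (\<gamma> k) \<boxtimes> (idt C (\<gamma> l) \<boxtimes> T m) = idt C ?kl \<boxtimes> T m"
    using tar_assoc[OF gk gk gl gl omr r ik il Tm] tar_idt[OF gk gl] by simp
  have inner: "idt C (\<gamma> k) \<boxtimes> arrow_part l (T l) m (T m)
      = ((idt C (\<gamma> k) \<boxtimes> T l) \<cdot> (idt C ?kl \<boxtimes> T m)) \<cdot> ((idt C (\<gamma> k) \<boxtimes> ?v3) \<boxtimes> idt C \<rho>)"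
    unfolding arrow_part_def
    using idt_tar_cmp[OF olmr' olmr r gk v3r cmp_in[OF olmr olr r Tl lTm]]
      idt_tar_cmp[OF olmr olr r gk lTm Tl] klTm2 kv3r by simp
  have in2: "(idt C (\<gamma> k) \<boxtimes> T l) \<cdot> (idt C ?kl \<boxtimes> T m) \<in> Hom C (?klm \<odot> \<rho>) (\<gamma> k \<odot> \<rho>)"
    using cmp_in[OF oklmr oklr okr kTl klTm] .
  have "(p l m * p k (l \<star> m)) *\<^sub>C T n = p l m *\<^sub>C arrow_part k (T k) (l \<star> m) (T (l \<star> m))"
    unfolding p(2)[OF k lm] by (simp add: scaleC_scaleC n')
  also have "\<dots> = arrow_part k (1 *\<^sub>C T k) (l \<star> m) (p l m *\<^sub>C T (l \<star> m))"
    unfolding arrow_part_scale[OF i(1) ilm Tk Tlm] by simp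
  also have "\<dots> = T k \<cdot> (idt C (\<gamma> k) \<boxtimes> arrow_part l (T l) m (T m)) \<cdot> (?v4 \<boxtimes> idt C \<rho>)"
    unfolding p(2)[OF l m, symmetric] by (simp add: arrow_part_def[of k])
  also have "T k \<cdot> (idt C (\<gamma> k) \<boxtimes> arrow_part l (T l) m (T m))
      = (T k \<cdot> ((idt C (\<gamma> k) \<boxtimes> T l) \<cdot> (idt C ?kl \<boxtimes> T m))) \<cdot> ((idt C (\<gamma> k) \<boxtimes> ?v3) \<boxtimes> idt C \<rho>)"
    unfolding inner using cmp_assoc[OF oklmr'' oklmr okr r Tk in2 kv3r_in] .
  also have "T k \<cdot> ((idt C (\<gamma> k) \<boxtimes> T l) \<cdot> (idt C ?kl \<boxtimes> T m)) = ?\<Theta>"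
    using cmp_assoc[OF oklmr oklr okr r Tk kTl klTm] .
  also have "?\<Theta> \<cdot> ((idt C (\<gamma> k) \<boxtimes> ?v3) \<boxtimes> idt C \<rho>) \<cdot> (?v4 \<boxtimes> idt C \<rho>)
      = ?\<Theta> \<cdot> (((idt C (\<gamma> k) \<boxtimes> ?v3) \<boxtimes> idt C \<rho>) \<cdot> (?v4 \<boxtimes> idt C \<rho>))"
    using cmp_assoc[OF onr oklmr'' oklmr r \<Theta> kv3r_in v4r] by simp
  also have "((idt C (\<gamma> k) \<boxtimes> ?v3) \<boxtimes> idt C \<rho>) \<cdot> (?v4 \<boxtimes> idt C \<rho>) = ?w2 \<boxtimes> idt C \<rho>"
    using cmp_tar_idt[OF gn oklm'' oklm r v4 kv3] by simp
  also have "\<dots> = z *\<^sub>C (?w1 \<boxtimes> idt C \<rho>)"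
    unfolding z(2) using scale_tar[OF gn oklm r r W1 ir] .
  also have "?\<Theta> \<cdot> \<dots> = z *\<^sub>C (?\<Theta> \<cdot> (?w1 \<boxtimes> idt C \<rho>))" using cmp_scale[OF onr oklmr r \<Theta> w1r] .
  finally have "(p l m * p k (l \<star> m)) *\<^sub>C T n = (z * (p k l * p (k \<star> l) m)) *\<^sub>C T n"
    unfolding arrow1[symmetric] by (simp add: scaleC_scaleC)
  then have P: "p l m * p k (l \<star> m) = z * (p k l * p (k \<star> l) m)"
    using T_nonzero[OF nK] complex_vector.scale_right_imp_eq by blast

  \<comment> \<open>the vectors\<close>
  note S = rep_irr(1)[OF i(1)] rep_irr(1)[OF i(2)] rep_irr(1)[OF i(3)] rep_irr(1)[OF inn]
    rep_irr(1)[OF ikl] rep_irr(1)[OF ilm]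
  note Skl = sub_tob[OF S(1,2)] and Slm = sub_tob[OF S(2,3)]
  note Sklm = sub_tob[OF Skl S(3)] and Sklm' = sub_tob[OF S(5,3)] and Sklm'' = sub_tob[OF S(1,6)]
  note \<psi> = \<psi>_in[OF k] \<psi>_in[OF l] \<psi>_in[OF m]
  let ?\<Psi> = "vtens F (vtens F (\<psi> k) (\<psi> l)) (\<psi> m)"
  note \<psi>kl = vtens_in[OF S(1,2) \<psi>(1,2)] and \<psi>lm = vtens_in[OF S(2,3) \<psi>(2,3)]
  have \<Psi>: "?\<Psi> \<in> Sp F ?klm" using vtens_in[OF Skl S(3) \<psi>kl \<psi>(3)] .
  note sv1 = bv_in(2)[OF i(1,2)] and sv3 = bv_in(2)[OF i(2,3)]
  have sv2: "str C ?v2 \<in> Hom C (\<gamma> (k \<star> l) \<odot> \<gamma> m) (\<gamma> n)" using str_in[OF gn oklm' v2] .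
  have sv4: "str C ?v4 \<in> Hom C (\<gamma> k \<odot> \<gamma> (l \<star> m)) (\<gamma> n)" using str_in[OF gn oklm'' v4] .
  have sw1: "str C ?w1 = str C ?v2 \<cdot> (str C ?v1 \<boxtimes> idt C (\<gamma> m))"
    using str_cmp[OF gn oklm' oklm v1m v2] str_tar[OF gkl okl gm gm v1 im] str_idt[OF gm] by simp
  have sw2: "str C ?w2 = str C ?v4 \<cdot> (idt C (\<gamma> k) \<boxtimes> str C ?v3)"
    using str_cmp[OF gn oklm'' oklm kv3 v4] str_tar[OF gk gk glm olm ik v3] str_idt[OF gk] by simp
  have sv1m: "str C ?v1 \<boxtimes> idt C (\<gamma> m) \<in> Hom C ?klm (\<gamma> (k \<star> l) \<odot> \<gamma> m)"
    using tar_in[OF okl gkl gm gm sv1 im] .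
  have ksv3: "idt C (\<gamma> k) \<boxtimes> str C ?v3 \<in> Hom C ?klm (\<gamma> k \<odot> \<gamma> (l \<star> m))"
    using tar_in[OF gk gk olm glm ik sv3] as1 by simp
  have "(q k l * q (k \<star> l) m) *\<^sub>C \<psi> n = q k l *\<^sub>C vector_part (k \<star> l) (\<psi> (k \<star> l)) m (\<psi> m)"
    unfolding q(2)[OF kl m] by (simp add: scaleC_scaleC n_def)
  also have "\<dots> = vector_part (k \<star> l) (q k l *\<^sub>C \<psi> (k \<star> l)) m (1 *\<^sub>C \<psi> m)"
    unfolding vector_part_scale[OF ikl i(3) \<psi>_in[OF kl] \<psi>(3)] by simp
  also have "\<dots> = fmap F (str C ?v2) (vtens F (fmap F (str C ?v1) (vtens F (\<psi> k) (\<psi> l))) (\<psi> m))"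
    unfolding q(2)[OF k l, symmetric] by (simp add: vector_part_def)
  also have "vtens F (fmap F (str C ?v1) (vtens F (\<psi> k) (\<psi> l))) (\<psi> m) = fmap F (str C ?v1 \<boxtimes> idt C (\<gamma> m)) ?\<Psi>"
    using fmap_tar[OF Skl S(5) S(3) S(3) sv1 im \<psi>kl \<psi>(3)] fmap_idt[OF S(3) \<psi>(3)] by simp
  also have "fmap F (str C ?v2) \<dots> = fmap F (str C ?w1) ?\<Psi>"
    unfolding sw1 using fmap_cmp[OF Sklm Sklm' S(4) sv2 sv1m \<Psi>] by simp
  finally have vec1: "(q k l * q (k \<star> l) m) *\<^sub>C \<psi> n = fmap F (str C ?w1) ?\<Psi>" .
  have "(q l m * q k (l \<star> m)) *\<^sub>C \<psi> n = q l m *\<^sub>C vector_part k (\<psi> k) (l \<star> m) (\<psi> (l \<star> m))"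
    unfolding q(2)[OF k lm] by (simp add: scaleC_scaleC n')
  also have "\<dots> = vector_part k (1 *\<^sub>C \<psi> k) (l \<star> m) (q l m *\<^sub>C \<psi> (l \<star> m))"
    unfolding vector_part_scale[OF i(1) ilm \<psi>(1) \<psi>_in[OF lm]] by simp
  also have "\<dots> = fmap F (str C ?v4) (vtens F (\<psi> k) (fmap F (str C ?v3) (vtens F (\<psi> l) (\<psi> m))))"
    unfolding q(2)[OF l m, symmetric] by (simp add: vector_part_def)
  also have "vtens F (\<psi> k) (fmap F (str C ?v3) (vtens F (\<psi> l) (\<psi> m))) = fmap F (idt C (\<gamma> k) \<boxtimes> str C ?v3) ?\<Psi>"
    using fmap_tar[OF S(1) S(1) Slm S(6) ik sv3 \<psi>(1) \<psi>lm] fmap_idt[OF S(1) \<psi>(1)]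
      vtens_assoc[OF S(1,2,3) \<psi>] by simp
  also have "fmap F (str C ?v4) \<dots> = fmap F (str C ?w2) ?\<Psi>"
    unfolding sw2 using fmap_cmp[OF Sklm Sklm'' S(4) sv4 ksv3 \<Psi>] by simp
  also have "str C ?w2 = cnj z *\<^sub>C str C ?w1" unfolding z(2) using str_scaleC[OF gn oklm W1] .
  also have "fmap F \<dots> ?\<Psi> = cnj z *\<^sub>C fmap F (str C ?w1) ?\<Psi>"
    using fmap_scale_arrow[OF Sklm S(4) str_in[OF gn oklm W1] \<Psi>] .
  finally have "(q l m * q k (l \<star> m)) *\<^sub>C \<psi> n = (cnj z * (q k l * q (k \<star> l) m)) *\<^sub>C \<psi> n"
    unfolding vec1[symmetric] by (simp add: scaleC_scaleC)
  then have Qe: "q l m * q k (l \<star> m) = cnj z * (q k l * q (k \<star> l) m)"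
    using unit_vec_nonzero[OF S(4) \<psi>_unit[OF nK]] complex_vector.scale_right_imp_eq by blast
  have "c l m * c k (l \<star> m) = (p l m * p k (l \<star> m)) * (q l m * q k (l \<star> m))" by (simp add: c_def mult_ac)
  also have "\<dots> = (cnj z * z) * (c k l * c (k \<star> l) m)" unfolding P Qe by (simp add: c_def mult_ac)
  finally show ?thesis using z(1) by simp
qed

subsection \<open>The unit, the adjoint and the action\<close>

text \<open>The arrow \<open>T \<e>\<close> is the identity, but \<open>\<psi> \<e>\<close> is a multiple \<open>z\<close> of the vacuum vector, which makes
  \<open>c \<e> \<e> = z\<close>; the phase \<open>t\<close> of \<open>bv \<e> \<e>\<close> cancels between the two factors.\<close>

lemma unit_eq: "elem F Z \<rho> \<rho> \<e> (idt C \<rho>) (vac F) = cnj (c \<e> \<e>) *\<^sub>C U \<e>"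
proof -
  note e = e_K\<rho> and i = e_irr
  have \<gamma>e: "\<gamma> \<e> = unt C" by (rule rep_unt)
  have ee: "\<e> \<star> \<e> = \<e>" using K.r_one[of "\<e>"] i by simp
  have uu: "unt C \<odot> unt C = unt C" using tob_unt_left[OF unt_in] .
  have v: "is_unitary C (unt C) (unt C) (bv \<e> \<e>)" using bv(2)[OF i i] ee \<gamma>e uu by simp
  obtain t where t: "cnj t * t = 1" "bv \<e> \<e> = t *\<^sub>C idt C (unt C)"
    using unitary_phase[OF unt_in unt_in unt_irred unitary_idt[OF unt_in] v] by blast
  obtain z where z: "norm z = 1" "\<psi> \<e> = z *\<^sub>C vac F"
    using unit_vec_phase[OF line_unt] \<psi>_unit[OF e] \<gamma>e by auto
  have zz: "cnj z * z = 1" using z(1) norm_1_cnj by blast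
  note ir = idt_in[OF \<rho>_ob] and iu = idt_in[OF unt_in]
  have vin: "vac F \<in> Sp F (unt C)" using unit_vec_in[OF line_unt(2)] .
  have "arrow_part \<e> (T \<e>) \<e> (T \<e>) = t *\<^sub>C T \<e>"
  proof -
    have 1: "idt C (unt C) \<boxtimes> idt C \<rho> = idt C \<rho>" using tar_unt_left[OF \<rho>_ob \<rho>_ob ir] .
    have 2: "bv \<e> \<e> \<boxtimes> idt C \<rho> = t *\<^sub>C idt C \<rho>"
      unfolding t(2) using scale_tar[OF unt_in unt_in \<rho>_ob \<rho>_ob iu ir] 1 by simp
    have "arrow_part \<e> (T \<e>) \<e> (T \<e>) = idt C \<rho> \<cdot> idt C \<rho> \<cdot> (t *\<^sub>C idt C \<rho>)"
      unfolding arrow_part_def 2 T_e \<gamma>e 1 ..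
    then show ?thesis
      using cmp_scale[OF \<rho>_ob \<rho>_ob \<rho>_ob ir ir] cmp_idt_left[OF \<rho>_ob \<rho>_ob ir] by (simp add: T_e)
  qed
  then have pe: "p \<e> \<e> = t"
    using p(2)[OF e e] ee T_nonzero[OF e] complex_vector.scale_right_imp_eq by metis
  have "vector_part \<e> (\<psi> \<e>) \<e> (\<psi> \<e>) = (cnj t * z) *\<^sub>C \<psi> \<e>"
  proof -
    have "str C (bv \<e> \<e>) = cnj t *\<^sub>C idt C (unt C)"
      unfolding t(2) using str_scaleC[OF unt_in unt_in iu] str_idt[OF unt_in] by simp
    moreover have "vtens F (\<psi> \<e>) (\<psi> \<e>) = z *\<^sub>C \<psi> \<e>"
      using vtens_scale_left[OF sub_unt sub_unt vin, of "\<psi> \<e>" z] \<psi>_in[OF e] \<gamma>e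
        vtens_vac_left[OF sub_unt, of "\<psi> \<e>"] z(2) by simp
    ultimately show ?thesis
      unfolding vector_part_def
      using fmap_scale_arrow[OF sub_unt sub_unt iu Sp_scale[OF sub_unt]] fmap_idt[OF sub_unt Sp_scale[OF sub_unt]]
        \<psi>_in[OF e] \<gamma>e by (simp add: scaleC_scaleC)
  qed
  then have "q \<e> \<e> = cnj t * z"
    using q(2)[OF e e] ee unit_vec_nonzero[OF rep_irr(1)[OF i] \<psi>_unit[OF e]]
      complex_vector.scale_right_imp_eq by metis
  then have "c \<e> \<e> = (cnj t * t) * z" using pe by (simp add: c_def)
  then have c: "c \<e> \<e> = z" using t(1) by simp
  have "vac F = cnj z *\<^sub>C \<psi> \<e>" using zz z(2) by (simp add: scaleC_scaleC)
  then have "elem F Z \<rho> \<rho> \<e> (idt C \<rho>) (vac F) = elem F Z \<rho> \<rho> \<e> (T \<e>) (cnj z *\<^sub>C \<psi> \<e>)"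
    by (simp add: T_e)
  also have "\<dots> = cnj z *\<^sub>C U \<e>" unfolding elem_scale_vec[OF i \<psi>_in[OF e]] U_def ..
  finally show ?thesis unfolding c .
qed

text \<open>The adjoint of the elementary tensor of \<open>T k\<close> and \<open>onv k\<close>, from which that of \<open>U k\<close> differs by the phase
  of \<open>\<psi> k\<close>.\<close>

definition adj :: "'o set \<Rightarrow> ('o, 'm, 'h) cp_arrow" where
  "adj k = str_elem C F Z \<rho> \<rho> k (T k) (onv k)"

lemma adj_arrow_in:
  assumes k: "k \<in> irr" and X: "X \<in> Hom C (\<gamma> k \<odot> \<rho>) \<rho>"
  shows "str C (Rs Z k) \<boxtimes> idt C \<rho> \<in> Hom C ((\<gamma> (conj_class C k) \<odot> \<gamma> k) \<odot> \<rho>) \<rho>"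
    "idt C (\<gamma> (conj_class C k)) \<boxtimes> str C X \<in> Hom C (\<gamma> (conj_class C k) \<odot> \<rho>) ((\<gamma> (conj_class C k) \<odot> \<gamma> k) \<odot> \<rho>)"
proof -
  note kb = conj_class_inverse(1)[OF k]
  note ob = \<gamma>_ob[OF k] \<gamma>_ob[OF kb] \<rho>_ob \<gamma>\<gamma>_ob[OF kb k] \<gamma>\<rho>_ob[OF k]
  have R: "Rs Z k \<in> Hom C (unt C) (\<gamma> (conj_class C k) \<odot> \<gamma> k)"
    using Rs_solution[OF k] by (auto simp: normalized_conj_def conj_eqs_def)
  show "str C (Rs Z k) \<boxtimes> idt C \<rho> \<in> Hom C ((\<gamma> (conj_class C k) \<odot> \<gamma> k) \<odot> \<rho>) \<rho>"
    using tar_in[OF ob(4) unt_in ob(3,3) str_in[OF unt_in ob(4) R] idt_in[OF ob(3)]] tob_unt_left[OF ob(3)]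
    by simp
  show "idt C (\<gamma> (conj_class C k)) \<boxtimes> str C X \<in> Hom C (\<gamma> (conj_class C k) \<odot> \<rho>) ((\<gamma> (conj_class C k) \<odot> \<gamma> k) \<odot> \<rho>)"
    using tar_in[OF ob(2,2,3,5) idt_in[OF ob(2)] str_in[OF ob(5,3) X]] tob_assoc[OF ob(2,1,3)] by simp
qed

lemma str_elem_scale:
  assumes k: "k \<in> irr" and X: "X \<in> Hom C (\<gamma> k \<odot> \<rho>) \<rho>"
  shows "str_elem C F Z \<rho> \<rho> k (z *\<^sub>C X) \<phi> = cnj z *\<^sub>C str_elem C F Z \<rho> \<rho> k X \<phi>"
proof -
  note kb = conj_class_inverse(1)[OF k]
  note ob = \<gamma>_ob[OF k] \<gamma>_ob[OF kb] \<rho>_ob \<gamma>\<gamma>_ob[OF kb k] \<gamma>\<rho>_ob[OF k]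
  have "idt C (\<gamma> (conj_class C k)) \<boxtimes> str C (z *\<^sub>C X) = cnj z *\<^sub>C (idt C (\<gamma> (conj_class C k)) \<boxtimes> str C X)"
    using str_scaleC[OF ob(5,3) X] tar_scale[OF ob(2,2,3,5) idt_in[OF ob(2)] str_in[OF ob(5,3) X]] by simp
  then show ?thesis
    unfolding str_elem_def
    using cmp_scale[OF tob_in[OF ob(2,3)] tob_in[OF ob(4,3)] ob(3) adj_arrow_in[OF k X], of "cnj z"]
    by (simp add: elem_scale_arrow)
qed

lemma str_lin: "cp_str C F Z (lin x) = (\<Sum>k\<in>K\<rho>. cnj (x k) *\<^sub>C (cnj (\<nu> k) *\<^sub>C adj k))"
proof -
  have "cp_str C F Z (lin x) = (\<Sum>k\<in>{k \<in> K\<rho>. x k \<noteq> 0}. str_elem C F Z \<rho> \<rho> k (lin x \<rho> \<rho> k (onv k)) (onv k))"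
    unfolding cp_str_def terms_lin by (subst sum.reindex) (auto simp: inj_on_def)
  also have "\<dots> = (\<Sum>k\<in>{k \<in> K\<rho>. x k \<noteq> 0}. cnj (x k) *\<^sub>C (cnj (\<nu> k) *\<^sub>C adj k))"
  proof (intro sum.cong refl)
    fix k assume "k \<in> {k \<in> K\<rho>. x k \<noteq> 0}"
    then have k: "k \<in> K\<rho>" by simp
    show "str_elem C F Z \<rho> \<rho> k (lin x \<rho> \<rho> k (onv k)) (onv k) = cnj (x k) *\<^sub>C (cnj (\<nu> k) *\<^sub>C adj k)"
      unfolding lin_onv[OF k] str_elem_scale[OF K\<rho>_irr[OF k] T_in[OF k]] adj_def
      by (simp add: scaleC_scaleC)
  qed
  also have "\<dots> = (\<Sum>k\<in>K\<rho>. cnj (x k) *\<^sub>C (cnj (\<nu> k) *\<^sub>C adj k))"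
    using K\<rho>_finite by (intro sum.mono_neutral_left) auto
  finally show ?thesis .
qed

lemma str_U:
  assumes k: "k \<in> K\<rho>"
  shows "cp_str C F Z (U k) = cnj (\<nu> k) *\<^sub>C adj k"
proof -
  have "cp_str C F Z (U k) = cp_str C F Z (lin (\<lambda>l. if l = k then 1 else 0))"
    using lin_single[OF k, of 1] by simp
  also have "\<dots> = (\<Sum>l\<in>K\<rho>. if l = k then cnj (\<nu> k) *\<^sub>C adj k else 0)"
    unfolding str_lin by (intro sum.cong refl) auto
  finally show ?thesis using k K\<rho>_finite by simp
qed

text \<open>If \<open>F(R)\<close> and \<open>F(R')\<close> have the coefficients \<open>s\<close> and \<open>s'\<close>, the arrow factor of the product contributes
  the conjugate of \<open>s\<close> and the conjugate vector contributes \<open>s'\<close>, up to mutually inverse phases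
  from \<open>bv\<close>. By the conjugate equations these contributions multiply to one.\<close>

lemma adj_U:
  assumes k: "k \<in> K\<rho>"
  shows "\<exists>Y \<phi>. Y \<in> Hom C (\<gamma> (conj_class C k) \<odot> \<rho>) \<rho> \<and> \<phi> \<in> Sp F (\<gamma> (conj_class C k)) \<and>
      adj k = el (conj_class C k) Y \<phi>"
    "cp_cmp C S F Z (cnj (\<nu> k) *\<^sub>C adj k) (U k) = elem F Z \<rho> \<rho> \<e> (idt C \<rho>) (vac F)"
proof -
  note i = K\<rho>_irr[OF k]
  let ?kb = "conj_class C k"
  note kb = conj_class_inverse[OF i] and kbK = conj_K\<rho>[OF k]
  note gk = \<gamma>_ob[OF i] and gb = \<gamma>_ob[OF kb(1)] and r = \<rho>_ob
  note gbk = \<gamma>\<gamma>_ob[OF kb(1) i] and gkr = \<gamma>\<rho>_ob[OF i]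
  note lk = line_rep[OF i] and lb = line_rep[OF kb(1)]
  note Sk = line_S[OF lk] and Sb = line_S[OF lb]
  note Sbk = sub_tob[OF Sb Sk] and Skb = sub_tob[OF Sk Sb]
  obtain d where "normalized_conj C (\<gamma> k) (\<gamma> ?kb) (Rs Z k) (Rs' Z k) d" using Rs_solution[OF i] by blast
  then have eqs: "conj_eqs C (\<gamma> k) (\<gamma> ?kb) (Rs Z k) (Rs' Z k)"
    by (simp add: normalized_conj_def)
  let ?R = "Rs Z k" and ?R' = "Rs' Z k"
  have R: "?R \<in> Hom C (unt C) (\<gamma> ?kb \<odot> \<gamma> k)" and R': "?R' \<in> Hom C (unt C) (\<gamma> k \<odot> \<gamma> ?kb)"
    using eqs by (auto simp: conj_eqs_def)
  let ?e = "onv k"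
  note e = onb_singleton(2)[OF i]
  obtain f where f: "unit_vec (\<gamma> ?kb) f" using line_unit_vec[OF lb] by blast
  note ein = unit_vec_in[OF e] and fin = unit_vec_in[OF f] and vin = unit_vec_in[OF line_unt(2)]
  note lfe = line_tob[OF lb lk f e] and lef = line_tob[OF lk lb e f]
  note fein = unit_vec_in[OF lfe(2)] and efin = unit_vec_in[OF lef(2)]
  obtain s where s: "fmap F ?R (vac F) = s *\<^sub>C vtens F f ?e"
    using line_expand[OF lfe fmap_in[OF sub_unt Sbk R vin]] by blast
  obtain s' where s': "fmap F ?R' (vac F) = s' *\<^sub>C vtens F ?e f"
    using line_expand[OF lef fmap_in[OF sub_unt Skb R' vin]] by blast
  have ss: "cnj s' * s = 1" using line_conj_eqs_iff[OF lk lb e f R s R' s'] eqs by simp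

  \<comment> \<open>the conjugate vector\<close>
  have vbar: "vbar C F Z k ?e = s' *\<^sub>C f"
    unfolding vbar_def
  proof (rule the_equality)
    have "ip F x (s' *\<^sub>C f) = ip F (vtens F ?e x) (fmap F ?R' (vac F))" if x: "x \<in> Sp F (\<gamma> ?kb)" for x
    proof -
      have "ip F (vtens F ?e x) (fmap F ?R' (vac F)) = s' * ip F (vtens F ?e x) (vtens F ?e f)"
        unfolding s' using ip_scaleC[OF Skb vtens_in[OF Sk Sb ein x] efin] .
      also have "ip F (vtens F ?e x) (vtens F ?e f) = ip F x f"
        using vtens_ip[OF Sk Sb ein ein x fin] e by (simp add: unit_vec_def)
      finally show ?thesis using ip_scaleC[OF Sb x fin] by simp
    qed
    then show *: "s' *\<^sub>C f \<in> Sp F (\<gamma> ?kb) \<and>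
        (\<forall>x\<in>Sp F (\<gamma> ?kb). ip F x (s' *\<^sub>C f) = ip F (vtens F ?e x) (fmap F ?R' (vac F)))"
      using Sp_scale[OF Sb fin] by blast
    fix y assume y: "y \<in> Sp F (\<gamma> ?kb) \<and>
        (\<forall>x\<in>Sp F (\<gamma> ?kb). ip F x y = ip F (vtens F ?e x) (fmap F ?R' (vac F)))"
    have "y = ip F f y *\<^sub>C f" using line_expand[OF lb f] y by blast
    also have "ip F f y = ip F f (s' *\<^sub>C f)" using y * fin by simp
    also have "\<dots> = s'" using ip_scaleC[OF Sb fin fin] f by (simp add: unit_vec_def)
    finally show "y = s' *\<^sub>C f" .
  qed
  let ?Y = "(str C ?R \<boxtimes> idt C \<rho>) \<cdot> (idt C (\<gamma> ?kb) \<boxtimes> str C (T k))"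
  note Yin = adj_arrow_in[OF i T_in[OF k]]
  note gbkr = tob_in[OF gbk r] and gbr = \<gamma>\<rho>_ob[OF kb(1)]
  have Y: "?Y \<in> Hom C (\<gamma> ?kb \<odot> \<rho>) \<rho>" using cmp_in[OF gbr gbkr r Yin] .
  have adj: "adj k = el ?kb ?Y (s' *\<^sub>C f)" unfolding adj_def str_elem_def vbar ..
  show "\<exists>Y \<phi>. Y \<in> Hom C (\<gamma> ?kb \<odot> \<rho>) \<rho> \<and> \<phi> \<in> Sp F (\<gamma> ?kb) \<and> adj k = el ?kb Y \<phi>"
    using Y Sp_scale[OF Sb fin] adj by blast

  \<comment> \<open>the product\<close>
  let ?v = "bv ?kb k"
  have \<gamma>e: "\<gamma> \<e> = unt C" by (rule rep_unt)
  have v: "is_unitary C (unt C) (\<gamma> ?kb \<odot> \<gamma> k) ?v" using bv(2)[OF kb(1) i] kb(2) \<gamma>e by simp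
  note V = unitary_inv[OF unt_in gbk v]
  obtain n where n: "fmap F ?v (vac F) = n *\<^sub>C vtens F f ?e"
    using line_expand[OF lfe fmap_in[OF sub_unt Sbk V(1) vin]] by blast
  have str_fe: "fmap F (str C X) (vtens F f ?e) = cnj x *\<^sub>C vac F"
    if X: "X \<in> Hom C (unt C) (\<gamma> ?kb \<odot> \<gamma> k)" "fmap F X (vac F) = x *\<^sub>C vtens F f ?e" for X x
  proof -
    have sin: "fmap F (str C X) (vtens F f ?e) \<in> Sp F (unt C)"
      using fmap_in[OF Sbk sub_unt str_in[OF unt_in gbk X(1)] fein] .
    have "ip F (fmap F (str C X) (vtens F f ?e)) (vac F) = ip F (vtens F f ?e) (fmap F X (vac F))"
      using fmap_str[OF sub_unt Sbk X(1) vin fein] .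
    also have "\<dots> = x" using ip_scaleC[OF Sbk fein fein] lfe(2) X(2) by (simp add: unit_vec_def)
    finally have "ip F (vac F) (fmap F (str C X) (vtens F f ?e)) = cnj x"
      using ip_cnj[OF sub_unt sin vin] by simp
    then show ?thesis using line_expand[OF line_unt sin] by simp
  qed
  have nn: "cnj n * n = 1"
  proof -
    have "vac F = fmap F (str C ?v) (fmap F ?v (vac F))"
      using fmap_cmp[OF sub_unt Sbk sub_unt V(2,1) vin] V(3) fmap_idt[OF sub_unt vin] by simp
    also have "\<dots> = (n * cnj n) *\<^sub>C vac F"
      using n fmap_scale[OF Sbk sub_unt V(2) fein] str_fe[OF V(1) n] by (simp add: scaleC_scaleC)
    finally have "(n * cnj n) *\<^sub>C vac F = 1 *\<^sub>C vac F" by simp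
    then have "n * cnj n = 1"
      using unit_vec_nonzero[OF sub_unt line_unt(2)] complex_vector.scale_right_imp_eq by blast
    then show ?thesis by (simp only: mult.commute)
  qed
  have sR: "str C ?R \<in> Hom C (\<gamma> ?kb \<odot> \<gamma> k) (unt C)" using str_in[OF unt_in gbk R] .
  note iu = idt_in[OF unt_in]
  have Rv: "str C ?R \<cdot> ?v = (n * cnj s) *\<^sub>C idt C (unt C)"
  proof (rule line_arrow_eqI[OF line_unt(1) sub_unt line_unt(2) cmp_in[OF unt_in gbk unt_in sR V(1)]
        scale_in[OF unt_in unt_in iu]])
    have "fmap F (str C ?R \<cdot> ?v) (vac F) = (n * cnj s) *\<^sub>C vac F"
      using fmap_cmp[OF sub_unt Sbk sub_unt sR V(1) vin] n fmap_scale[OF Sbk sub_unt sR fein]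
        str_fe[OF R s] by (simp add: scaleC_scaleC)
    then show "fmap F (str C ?R \<cdot> ?v) (vac F) = fmap F ((n * cnj s) *\<^sub>C idt C (unt C)) (vac F)"
      using fmap_scale_arrow[OF sub_unt sub_unt iu vin] fmap_idt[OF sub_unt vin] by simp
  qed
  note ir = idt_in[OF r] and ib = idt_in[OF gb]
  note t = unitary_inv[OF gkr r T_unitary[OF k]]
  have as: "\<gamma> ?kb \<odot> (\<gamma> k \<odot> \<rho>) = (\<gamma> ?kb \<odot> \<gamma> k) \<odot> \<rho>" using tob_assoc[OF gb gk r] by simp
  have bT: "idt C (\<gamma> ?kb) \<boxtimes> T k \<in> Hom C ((\<gamma> ?kb \<odot> \<gamma> k) \<odot> \<rho>) (\<gamma> ?kb \<odot> \<rho>)"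
    using idt_tar_in[OF kb(1) i T_in[OF k]] .
  have "(idt C (\<gamma> ?kb) \<boxtimes> str C (T k)) \<cdot> (idt C (\<gamma> ?kb) \<boxtimes> T k) = idt C ((\<gamma> ?kb \<odot> \<gamma> k) \<odot> \<rho>)"
    using idt_tar_cmp[OF gkr r gkr gb t(1,2)] t(3) tar_idt[OF gb gkr] as by simp
  then have "?Y \<cdot> (idt C (\<gamma> ?kb) \<boxtimes> T k) = str C ?R \<boxtimes> idt C \<rho>"
    using cmp_assoc[OF gbkr gbr gbkr r Yin bT] cmp_idt_right[OF gbkr r Yin(1)] by simp
  then have "arrow_part ?kb ?Y k (T k) = (str C ?R \<boxtimes> idt C \<rho>) \<cdot> (?v \<boxtimes> idt C \<rho>)"
    by (simp add: arrow_part_def)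
  also have "\<dots> = (str C ?R \<cdot> ?v) \<boxtimes> idt C \<rho>" using cmp_tar_idt[OF unt_in gbk unt_in r V(1) sR] by simp
  also have "\<dots> = (n * cnj s) *\<^sub>C idt C \<rho>"
    unfolding Rv using scale_tar[OF unt_in unt_in r r iu ir] tar_unt_left[OF r r ir] by simp
  finally have arrow: "arrow_part ?kb ?Y k (T k) = (n * cnj s) *\<^sub>C idt C \<rho>" .
  have "vector_part ?kb (s' *\<^sub>C f) k (\<psi> k) = (s' * \<nu> k) *\<^sub>C vector_part ?kb f k ?e"
    using vector_part_scale[OF kb(1) i fin ein] \<psi>_onv[OF k] by simp
  also have "vector_part ?kb f k ?e = cnj n *\<^sub>C vac F"
    unfolding vector_part_def using str_fe[OF V(1) n] .
  finally have vec: "vector_part ?kb (s' *\<^sub>C f) k (\<psi> k) = (s' * \<nu> k * cnj n) *\<^sub>C vac F"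
    by (simp add: scaleC_scaleC)
  have vin': "vac F \<in> Sp F (\<gamma> \<e>)" using vin \<gamma>e by simp
  have "cp_cmp C S F Z (cnj (\<nu> k) *\<^sub>C adj k) (U k)
      = cnj (\<nu> k) *\<^sub>C el (?kb \<star> k) (arrow_part ?kb ?Y k (T k)) (vector_part ?kb (s' *\<^sub>C f) k (\<psi> k))"
    unfolding adj U_def
    by (rule cmp_el[OF kbK k Y T_in[OF k] Sp_scale[OF Sb fin] \<psi>_in[OF k]])
  also have "\<dots> = (cnj (\<nu> k) * (n * cnj s) * (s' * \<nu> k * cnj n)) *\<^sub>C el \<e> (idt C \<rho>) (vac F)"
    unfolding arrow vec kb(2) elem_scale_arrow elem_scale_vec[OF e_irr vin'] by (simp add: scaleC_scaleC)
  also have "cnj (\<nu> k) * (n * cnj s) * (s' * \<nu> k * cnj n)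
      = (cnj (\<nu> k) * \<nu> k) * (cnj n * n) * cnj (cnj s' * s)" by (simp add: mult_ac)
  also have "\<dots> = 1" using \<nu>_norm[OF k] nn ss by simp
  finally show "cp_cmp C S F Z (cnj (\<nu> k) *\<^sub>C adj k) (U k) = elem F Z \<rho> \<rho> \<e> (idt C \<rho>) (vac F)" by simp
qed

lemma act_lin: "cp_act F Z g (lin x) = lin (\<lambda>k. g k * x k)"
proof -
  have "cp_act F Z g (lin x) = (\<Sum>k\<in>K\<rho>. x k *\<^sub>C (g k *\<^sub>C U k))"
    unfolding cp_act_def
  proof (rule sum_terms)
    fix k assume k: "k \<in> K\<rho>"
    note i = K\<rho>_irr[OF k]
    note e = unit_vec_in[OF onb_singleton(2)[OF i]]
    have "U k = \<nu> k *\<^sub>C el k (T k) (onv k)"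
      unfolding U_def elem_scale_vec[OF i e, symmetric] \<psi>_onv[OF k, symmetric] ..
    then show "el k (lin x \<rho> \<rho> k (onv k)) (g k *\<^sub>C onv k) = x k *\<^sub>C (g k *\<^sub>C U k)"
      unfolding lin_onv[OF k] elem_scale_arrow elem_scale_vec[OF i e] by (simp add: scaleC_scaleC mult_ac)
  qed
  then show ?thesis by (simp add: scaleC_scaleC mult.commute)
qed

sublocale A: twisted_group_algebra "crossed_product0 C S F Z" \<rho> Q U c
proof (rule twisted_group_algebra.intro)
  note [simp] = crossed_product0_def
  show "comm_group Q" by (rule Q_comm_group)
  show "finite (carrier Q)" using K\<rho>_finite by simp
  show "\<rho> \<in> ob (crossed_product0 C S F Z)" using \<rho>_ob by simp
  show "Hom (crossed_product0 C S F Z) \<rho> \<rho> = range (\<lambda>x. \<Sum>k\<in>carrier Q. x k *\<^sub>C U k)"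
    using endomorphisms by simp
  show "x l = 0" if "(\<Sum>k\<in>carrier Q. x k *\<^sub>C U k) = 0" "l \<in> carrier Q" for x l
    using lin_independent that by simp
  show "(\<Sum>k\<in>carrier Q. x k *\<^sub>C U k) \<cdot>\<^bsub>crossed_product0 C S F Z\<^esub> (\<Sum>l\<in>carrier Q. y l *\<^sub>C U l)
      = (\<Sum>k\<in>carrier Q. \<Sum>l\<in>carrier Q. (x k * y l * c k l) *\<^sub>C U (k \<otimes>\<^bsub>Q\<^esub> l))" for x y
    using cmp_lin by simp
  show "norm (c k l) = 1" if "k \<in> carrier Q" "l \<in> carrier Q" for k l
    using norm_c that by simp
  show "c k l * c (k \<otimes>\<^bsub>Q\<^esub> l) m = c l m * c k (l \<otimes>\<^bsub>Q\<^esub> m)"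
    if "k \<in> carrier Q" "l \<in> carrier Q" "m \<in> carrier Q" for k l m
    using cocycle_identity that by simp
  show "idt (crossed_product0 C S F Z) \<rho> = cnj (c \<one>\<^bsub>Q\<^esub> \<one>\<^bsub>Q\<^esub>) *\<^sub>C U \<one>\<^bsub>Q\<^esub>"
    using unit_eq by simp
  show "str (crossed_product0 C S F Z) (\<Sum>k\<in>carrier Q. x k *\<^sub>C U k)
      = (\<Sum>k\<in>carrier Q. cnj (x k) *\<^sub>C str (crossed_product0 C S F Z) (U k))" for x
    using str_lin[of x] by (simp add: str_U)
  show "str (crossed_product0 C S F Z) (U k) \<in> Hom (crossed_product0 C S F Z) \<rho> \<rho>" if "k \<in> carrier Q" for k
  proof -
    have k: "k \<in> K\<rho>" using that by simp
    obtain Y \<phi> where Y: "Y \<in> Hom C (\<gamma> (conj_class C k) \<odot> \<rho>) \<rho>" "\<phi> \<in> Sp F (\<gamma> (conj_class C k))"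
      "adj k = el (conj_class C k) Y \<phi>"
      using adj_U(1)[OF k] by blast
    then have "adj k \<in> cp_Hom C S F Z \<rho> \<rho>"
      unfolding cp_Hom_def using conj_class_inverse(1)[OF K\<rho>_irr[OF k]]
      by (intro complex_vector.span_base) blast
    then have "cnj (\<nu> k) *\<^sub>C adj k \<in> cp_Hom C S F Z \<rho> \<rho>"
      unfolding cp_Hom_def by (rule complex_vector.span_scale)
    then show ?thesis using str_U[OF k] by simp
  qed
  show "str (crossed_product0 C S F Z) (U k) \<cdot>\<^bsub>crossed_product0 C S F Z\<^esub> U k = idt (crossed_product0 C S F Z) \<rho>"
    if "k \<in> carrier Q" for k
    using adj_U(2)[of k] str_U[of k] that by simp
qed

lemma L_eq: "L_of C S F Z \<rho> T \<psi> = A.perp (carrier Q)"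
proof -
  have coc: "cocycle C S F Z \<rho> T \<psi> k l = c k l" if k: "k \<in> K\<rho>" and l: "l \<in> K\<rho>" for k l
  proof -
    have *: "cmp (crossed_product C S F Z) (U k) (U l) = c k l *\<^sub>C U (k \<star> l)"
      using A.cmp_U[of k l] k l by (simp add: crossed_product_def subobject_closure_def)
    have "U (k \<star> l) \<noteq> 0" using A.U_nonzero K\<rho>_mult[OF k l] by simp
    then have "(THE z. cmp (crossed_product C S F Z) (U k) (U l) = z *\<^sub>C U (k \<star> l)) = c k l"
      unfolding * using complex_vector.scale_right_imp_eq by (intro the_equality) auto
    then show ?thesis by (simp add: cocycle_def Let_def U_def)
  qed
  have "k \<in> L_of C S F Z \<rho> T \<psi> \<longleftrightarrow> k \<in> A.perp (carrier Q)" for k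
    using coc A.comm_eq_1[of k] by (auto simp: L_of_def A.perp_def)
  then show ?thesis by blast
qed

end


section \<open>Decomposition in the crossed product\<close>

theorem proposition5p2:
  fixes C :: "('o, 'm::complex_vector) btcat"
    and S :: "'o set"
    and K :: "'o set monoid"
    and G :: "('o set \<Rightarrow> complex) monoid"
    and F :: "('o, 'm, 'h::complex_vector, 'o set \<Rightarrow> complex) fibre"
    and Z :: "('o, 'm) cp_choice"
    and CS :: "('o \<times> ('o, 'm, 'h) cp_arrow, ('o, 'm, 'h) cp_arrow) tcat"
    and \<rho> :: 'o
    and T :: "'o set \<Rightarrow> 'm"
    and \<psi> :: "'o set \<Rightarrow> 'h"
    and K\<rho> L\<rho> :: "'o set set"
    and L :: "'o set monoid"
  assumes "BTC_star C"
    and "even_symmetric_subcategory C S"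
    and "\<And>a. \<lbrakk>a \<in> S; irred_obj C a\<rbrakk> \<Longrightarrow> has_dimension C a 1"
    and K: "K = class_group C S"
    and G: "G = char_group K"
    and "crossed_product_choice C S Z"
    and "representation_isomorphism C S G (char_topology K) F"
    and "\<And>g k x. \<lbrakk>g \<in> carrier G; k \<in> carrier K; x \<in> Sp F (rep Z k)\<rbrakk> \<Longrightarrow> act F g x = g k *\<^sub>C x"
    and CS: "CS = crossed_product C S F Z"
    and "\<rho> \<in> ob C" and "irred_obj C \<rho>"
    and K\<rho>: "K\<rho> = K_of C S Z \<rho>"
    and "unitary_choice C S F Z \<rho> T \<psi>"
    and L\<rho>: "L\<rho> = L_of C S F Z \<rho> T \<psi>"
    and L: "L = K\<lparr>carrier := L\<rho>\<rparr>"
  shows "finite K\<rho> \<and>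
    (\<exists>(N::nat) r w.
      real N = sqrt (real (card K\<rho>) / real (card L\<rho>)) \<and>
      (\<forall>\<xi>\<in>carrier (char_group L). r \<xi> \<in> ob CS \<and> irred_obj CS (r \<xi>)) \<and>
      (\<forall>\<xi>\<in>carrier (char_group L). \<forall>\<eta>\<in>carrier (char_group L).
        \<xi> \<noteq> \<eta> \<longrightarrow> \<not> iso_obj CS (r \<xi>) (r \<eta>)) \<and>
      direct_sum CS (carrier (char_group L) \<times> {..<N}) (\<lambda>(\<xi>, i). r \<xi>) w (cp_embed C S F Z \<rho>) \<and>
      (\<forall>g\<in>carrier G. \<forall>\<xi>\<in>carrier (char_group L).
        iso_obj CS (cp_act_ob F Z g (r \<xi>)) (r (restrict g L\<rho> \<otimes>\<^bsub>char_group L\<^esub> \<xi>))))"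
proof -
  interpret irreducible_in_crossed_product C S Z G "char_topology K" F \<rho> T \<psi>
  proof -
    interpret BTC_star C by fact
    interpret even_symmetric_subcategory C S by fact
    interpret crossed_product_choice C S Z by fact
    interpret representation_isomorphism C S G "char_topology K" F by fact
    show "irreducible_in_crossed_product C S Z G (char_topology K) F \<rho> T \<psi>"
      by unfold_locales (use assms(8,10,11,13) in \<open>auto simp: K class_group_def\<close>)
  qed
  have L': "L = Q\<lparr>carrier := L\<rho>\<rparr>" by (simp add: L K Q_def)
  have CS': "CS = subobject_closure (crossed_product0 C S F Z)" by (simp add: CS crossed_product_def)
  have emb: "cp_embed C S F Z \<rho> = (\<rho>, idt (crossed_product0 C S F Z) \<rho>)" by (simp add: cp_embed_def)
  have act: "map_prod id (cp_act F Z g) = cp_act_ob F Z g" for g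
    by (auto simp: cp_act_ob_def fun_eq_iff)
  have hom: "g \<in> hom Q circle_group" if "g \<in> carrier G" for g
    using that K_of_def[of C S Z \<rho>] by (auto simp: G K char_group_def hom_def circle_group_def class_group_def Q_def)
  have card: "card (carrier Q) = card K\<rho>" by (simp add: K\<rho>)
  have lin: "cp_act F Z g (\<Sum>k\<in>carrier Q. x k *\<^sub>C U k) = (\<Sum>k\<in>carrier Q. (g k * x k) *\<^sub>C U k)" for g x
    using act_lin by simp
  note dec = A.decomposition[of L\<rho>, folded L' CS' emb, OF L\<rho>[unfolded L_eq]]
  obtain N :: nat and r w where N: "real N = sqrt (real (card (carrier Q)) / real (card L\<rho>))"
    and r: "\<forall>\<xi>\<in>carrier (char_group L). r \<xi> \<in> ob CS \<and> irred_obj CS (r \<xi>)"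
    "\<forall>\<xi>\<in>carrier (char_group L). \<forall>\<eta>\<in>carrier (char_group L). \<xi> \<noteq> \<eta> \<longrightarrow> \<not> iso_obj CS (r \<xi>) (r \<eta>)"
    "direct_sum CS (carrier (char_group L) \<times> {..<N}) (\<lambda>(\<xi>, i). r \<xi>) w (cp_embed C S F Z \<rho>)"
    and perm: "\<forall>g act. g \<in> hom Q circle_group \<longrightarrow>
      (\<forall>x. act (\<Sum>k\<in>carrier Q. x k *\<^sub>C U k) = (\<Sum>k\<in>carrier Q. (g k * x k) *\<^sub>C U k)) \<longrightarrow>
      (\<forall>\<xi>\<in>carrier (char_group L). iso_obj CS (map_prod id act (r \<xi>)) (r (restrict g L\<rho> \<otimes>\<^bsub>char_group L\<^esub> \<xi>)))"
    using dec by (elim exE conjE) (rule that; assumption)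
  have "\<forall>g\<in>carrier G. \<forall>\<xi>\<in>carrier (char_group L).
      iso_obj CS (cp_act_ob F Z g (r \<xi>)) (r (restrict g L\<rho> \<otimes>\<^bsub>char_group L\<^esub> \<xi>))"
  proof
    fix g assume "g \<in> carrier G"
    then show "\<forall>\<xi>\<in>carrier (char_group L).
        iso_obj CS (cp_act_ob F Z g (r \<xi>)) (r (restrict g L\<rho> \<otimes>\<^bsub>char_group L\<^esub> \<xi>))"
      using perm[rule_format, of g "cp_act F Z g", OF hom lin] unfolding act by blast
  qed
  then show ?thesis
    using K\<rho>_finite N r unfolding card K\<rho> by (intro conjI exI[of _ N] exI[of _ r] exI[of _ w]) simp_all
qed

end
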